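(* Let $N \geq 2$ and let $\mathbf{U}=\nabla u$ be a curl-free vector field with $u \in X$, possibly complex-valued. For $P=(\alpha,\tau,\mathbf{a},\mathbf{b},\beta) \in \mathbb{C}\times\mathbb{C}\times\mathbb{C}^{N}\times\mathbb{C}^{N_{2}}\times(0,\infty)$, set $$w_{0}(x;P):=\alpha e^{-\beta|x|^{2}},\qquad w_{1}(x;P):=w_{0}(x;P)+\Theta_{1}(x;\beta)\,\mathbf{a}\cdot x,$$ $$w_{2}(x;P):=w_{1}(x;P)+\Theta_{2}(x;\beta)\,|x|^{2}\,\mathbf{b}\cdot\mathbf{\Phi}_{2}(x),\qquad w_{3}(x;P):=w_{2}(x;P)+\tau\,\mathcal{L}(x;\beta).$$ Then $$\delta_{\mathrm{CF}}(\mathbf{U}) \geq \inf_{P}\Bigg[\frac{D_{1}}{2}\left\|\mathbf{U}-\nabla w_{0}\right\|_{2}^{2}+\frac{D_{2}-D_{1}}{2}\left\|\mathbf{U}-\nabla w_{1}\right\|_{2}^{2}+\frac{4-D_{2}}{2}\left\|\mathbf{U}-\nabla w_{2}\right\|_{2}^{2}+\frac{D_{3}-4}{2}\left\|\mathbf{U}-\nabla w_{3}\right\|_{2}^{2}\Bigg],$$ where $w_j=w_j(\cdot;P)$, and, if $\mathbf{U}$ is real-valued, the infimum can equivalently be taken over the real parameters (i.e. $\alpha,\tau\in\mathbb{R}$, $\mathbf{a}\in\mathbb{R}^N$, $\mathbf{b}\in\mathbb{R}^{N_2}$, $\beta>0$). In particular, for real-valued $\mathbf{U}$, $$\delta_{\mathrm{CF}}(\mathbf{U})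 \geq\frac{D_{1}}{2}\inf_{\mathbf{U}^{*}\in E_{\mathrm{CF}}}\|\mathbf{U}-\mathbf{U}^{*}\|_{2}^{2},$$ and this constant is sharp.
   Context: $X$ is the completion of $C_0^\infty(\mathbb{R}^N)$ under the seminorm $\left(\int_{\mathbb{R}^{N}}|\Delta u|^{2}dx+\int_{\mathbb{R}^{N}}|x|^{2}|\nabla u|^{2}dx\right)^{1/2}$. The deficit is $$\delta_{\mathrm{CF}}(\mathbf{U}):=\left(\int_{\mathbb{R}^{N}} |\nabla \mathbf{U}|^{2}\,dx\right)^{\frac{1}{2}}\left(\int_{\mathbb{R}^{N}} |x|^{2} |\mathbf{U}|^{2}\,dx\right)^{\frac{1}{2}}-\frac{N+2}{2}\int_{\mathbb{R}^{N}} |\mathbf{U}|^{2}\,dx,$$ and $E_{\mathrm{CF}}:=\left\{\alpha e^{-\beta|x|^{2}}x:\alpha \in \mathbb{R},\ \beta>0\right\}$. $D_k:=\sqrt{N^2+4k(N+k-2)}-N$, so $D_1=\sqrt{N^2+4N-4}-N$, $D_2=\sqrt{N^2+8N}-N$, $D_3=\sqrt{N^2+12N+12}-N$. $\mathbf{\Phi}_2=(\phi_{2,1},\dots,\phi_{2,N_2})$, where $\{\phi_{2,i}\}_{i=1}^{N_2}$ is an $L^2(\mathbb{S}^{N-1})$-orthonormal basis of real-valued spherical harmonics of degree $2$, and $\mathbf{\Phi}_2(x)$ means $\mathbf{\Phi}_2(x/|x|)$. With ${}_1F_1$ Kummer's confluent hypergeometric function, $$\Theta_{1}(x;\beta):={}_{1}F_{1}\left(\frac{D_{1}}{4}+\frac{N+1}{2},\frac{N+2}{2};-\beta|x|^{2}\right),\qquad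 \Theta_{2}(x;\beta):={}_{1}F_{1}\left(\frac{D_{2}}{4}+\frac{N}{2}+1,\frac{N}{2}+2;-\beta|x|^{2}\right),$$ $$\mathcal{L}(x;\beta):=\left(2\beta|x|^{2}-\frac{N-2}{2}\right)e^{-\beta|x|^{2}}.$$ $\|\cdot\|_2$ is the $L^2(\mathbb{R}^N)$ norm, and the dot products are bilinear. *)

theory Defs
  imports "HOL-Analysis.Analysis"
begin

section \<open>Differential operators and test functions\<close>

definition partial :: "'n::finite \<Rightarrow> (real^'n \<Rightarrow> 'b::real_normed_vector) \<Rightarrow> real^'n \<Rightarrow> 'b" where
  "partial i f x = frechet_derivative f (at x) (axis i 1)"

definition grad :: "(real^'n::finite \<Rightarrow> complex) \<Rightarrow> real^'n \<Rightarrow> complex^'n" where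
  "grad f x = (\<chi> i. partial i f x)"

definition laplacian :: "(real^'n::finite \<Rightarrow> 'b::real_normed_vector) \<Rightarrow> real^'n \<Rightarrow> 'b" where
  "laplacian f x = (\<Sum>i\<in>UNIV. partial i (partial i f) x)"

primrec C_k :: "nat \<Rightarrow> (real^'n::finite \<Rightarrow> 'b::real_normed_vector) \<Rightarrow> bool" where
  "C_k 0 f \<longleftrightarrow> continuous_on UNIV f"
| "C_k (Suc k) f \<longleftrightarrow> (\<forall>x. f differentiable (at x)) \<and> (\<forall>i. C_k k (partial i f))"

definition test_function :: "(real^'n::finite \<Rightarrow> complex) \<Rightarrow> bool" where
  "test_function f \<longleftrightarrow> (\<forall>k. C_k k f) \<and> compact (closure {x. f x \<noteq> 0})"

section \<open>The completion \<open>X\<close> and gradients of its elements\<close>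

definition X_seminorm :: "(real^'n::finite \<Rightarrow> complex) \<Rightarrow> real" where
  "X_seminorm f = sqrt ((LINT x|lborel. (norm (laplacian f x))\<^sup>2)
                      + (LINT x|lborel. (norm x)\<^sup>2 * (norm (grad f x))\<^sup>2))"

definition X_cauchy :: "(nat \<Rightarrow> real^'n::finite \<Rightarrow> complex) set" where
  "X_cauchy = {\<phi>. (\<forall>n. test_function (\<phi> n)) \<and>
     (\<forall>e>0. \<exists>M. \<forall>m\<ge>M. \<forall>n\<ge>M. X_seminorm (\<lambda>x. \<phi> m x - \<phi> n x) < e)}"

definition X_equiv :: "(nat \<Rightarrow> real^'n::finite \<Rightarrow> complex) rel" where
  "X_equiv = {(\<phi>, \<psi>). \<phi> \<in> X_cauchy \<and> \<psi> \<in> X_cauchy \<and>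
     (\<lambda>n. X_seminorm (\<lambda>x. \<phi> n x - \<psi> n x)) \<longlonglongrightarrow> 0}"

definition X_space :: "(nat \<Rightarrow> real^'n::finite \<Rightarrow> complex) set set" where
  "X_space = X_cauchy // X_equiv"

text \<open>
  On test functions the gradient is bounded from the seminorm into
  \<open>L\<^sup>2(|x|\<^sup>2 dx)\<close>; \<open>\<nabla>u\<close> for an element \<open>u\<close> of the completion is the value of the
  continuous extension, i.e. the limit in \<open>L\<^sup>2(|x|\<^sup>2 dx)\<close> of the gradients along a
  representing Cauchy sequence. The predicate says that \<open>U\<close> is a representative of this
  a.e.-class. The integral is a nonnegative one, so that divergence is not read as \<open>0\<close>.
\<close>

definition X_gradient ::
  "(nat \<Rightarrow> real^'n::finite \<Rightarrow> complex) set \<Rightarrow> (real^'n \<Rightarrow> complex^'n) \<Rightarrow> bool" where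
  "X_gradient u U \<longleftrightarrow> U \<in> borel_measurable lborel \<and>
     (\<exists>\<phi>\<in>u. (\<lambda>n. \<integral>\<^sup>+ x. ennreal ((norm x)\<^sup>2 * (norm (grad (\<phi> n) x - U x))\<^sup>2) \<partial>lborel)
               \<longlonglongrightarrow> 0)"

definition real_valued :: "(real^'n::finite \<Rightarrow> complex^'n) \<Rightarrow> bool" where
  "real_valued U \<longleftrightarrow> (AE x in lborel. \<forall>i. U x $ i \<in> \<real>)"

section \<open>Weak Jacobian and deficit\<close>

definition locally_integrable :: "(real^'n::finite \<Rightarrow> 'b::euclidean_space) \<Rightarrow> bool" where
  "locally_integrable f \<longleftrightarrow> (\<forall>K. compact K \<longrightarrow> set_integrable lborel K f)"

definition is_weak_jacobian ::
  "(real^'n::finite \<Rightarrow> complex^'n) \<Rightarrow> (real^'n \<Rightarrow> complex^'n^'n) \<Rightarrow> bool" where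
  "is_weak_jacobian U V \<longleftrightarrow>
     U \<in> borel_measurable lborel \<and> V \<in> borel_measurable lborel \<and>
     locally_integrable U \<and> locally_integrable V \<and>
     (\<forall>\<phi> i j. test_function \<phi> \<longrightarrow>
        (LINT x|lborel. U x $ i * partial j \<phi> x) = - (LINT x|lborel. V x $ i $ j * \<phi> x))"

text \<open>Weak Jacobians are unique a.e., so integrals do not depend on the choice made here.\<close>

definition weak_jacobian :: "(real^'n::finite \<Rightarrow> complex^'n) \<Rightarrow> real^'n \<Rightarrow> complex^'n^'n" where
  "weak_jacobian U = (SOME V. is_weak_jacobian U V)"

definition delta_CF :: "(real^'n::finite \<Rightarrow> complex^'n) \<Rightarrow> real" where
  "delta_CF U =
     sqrt (LINT x|lborel. (norm (weak_jacobian U x))\<^sup>2)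
       * sqrt (LINT x|lborel. (norm x)\<^sup>2 * (norm (U x))\<^sup>2)
     - (real CARD('n) + 2) / 2 * (LINT x|lborel. (norm (U x))\<^sup>2)"

definition L2_norm :: "(real^'n::finite \<Rightarrow> complex^'n) \<Rightarrow> real" where
  "L2_norm F = sqrt (LINT x|lborel. (norm (F x))\<^sup>2)"

text \<open>Real fields are regarded as fields with values in the complex vectors.\<close>

definition E_CF :: "(real^'n::finite \<Rightarrow> complex^'n) set" where
  "E_CF = {\<lambda>x. \<chi> i. complex_of_real (\<alpha> * exp (- \<beta> * (norm x)\<^sup>2) * x $ i) | \<alpha> \<beta>. \<beta> > 0}"

section \<open>Spherical harmonics\<close>

text \<open>
  Surface measure on the unit sphere by polar coordinates: the measure of \<open>A\<close> is \<open>N\<close> times the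
  volume of the cone \<open>{x. 0 < |x| < 1, x/|x| \<in> A}\<close>.
\<close>

definition sphere_measure :: "(real^'n::finite) measure" where
  "sphere_measure = scale_measure (of_nat CARD('n))
     (distr (restrict_space lborel (ball 0 1 - {0})) borel (\<lambda>x. x /\<^sub>R norm x))"

definition solid_harmonic :: "nat \<Rightarrow> (real^'n::finite \<Rightarrow> real) \<Rightarrow> bool" where
  "solid_harmonic k p \<longleftrightarrow> real_polynomial_function p \<and>
     (\<forall>t x. p (t *\<^sub>R x) = t ^ k * p x) \<and> (\<forall>x. laplacian p x = 0)"

text \<open>Only the values on the unit sphere matter here; elsewhere \<open>Y\<close> is arbitrary.\<close>

definition spherical_harmonic :: "nat \<Rightarrow> (real^'n::finite \<Rightarrow> real) \<Rightarrow> bool" where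
  "spherical_harmonic k Y \<longleftrightarrow> (\<exists>p. solid_harmonic k p \<and> (\<forall>x\<in>sphere 0 1. Y x = p x))"

definition spherical_harmonic_basis :: "nat \<Rightarrow> (real^'n::finite \<Rightarrow> real^'m::finite) \<Rightarrow> bool" where
  "spherical_harmonic_basis k \<Phi> \<longleftrightarrow>
     (\<forall>i. spherical_harmonic k (\<lambda>x. \<Phi> x $ i)) \<and>
     (\<forall>i j. (LINT x:sphere 0 1|sphere_measure. \<Phi> x $ i * \<Phi> x $ j) = (if i = j then 1 else 0)) \<and>
     (\<forall>Y. spherical_harmonic k Y \<longrightarrow>
        (\<exists>c::real^'m. \<forall>x\<in>sphere 0 1. Y x = (\<Sum>i\<in>UNIV. c $ i * \<Phi> x $ i)))"

section \<open>The comparison functions\<close>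

definition D_const :: "nat \<Rightarrow> nat \<Rightarrow> real" where
  "D_const N k = sqrt ((real N)\<^sup>2 + 4 * real k * (real N + real k - 2)) - real N"

definition kummer :: "real \<Rightarrow> real \<Rightarrow> real \<Rightarrow> real" where
  "kummer a b z = eval_fps (fps_hypergeo [a] [b] 1) z"

definition Theta1 :: "real \<Rightarrow> real^'n::finite \<Rightarrow> real" where
  "Theta1 \<beta> x = kummer (D_const CARD('n) 1 / 4 + (real CARD('n) + 1) / 2)
                       ((real CARD('n) + 2) / 2) (- \<beta> * (norm x)\<^sup>2)"

definition Theta2 :: "real \<Rightarrow> real^'n::finite \<Rightarrow> real" where
  "Theta2 \<beta> x = kummer (D_const CARD('n) 2 / 4 + real CARD('n) / 2 + 1)
                       (real CARD('n) / 2 + 2) (- \<beta> * (norm x)\<^sup>2)"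

definition L_fun :: "real \<Rightarrow> real^'n::finite \<Rightarrow> real" where
  "L_fun \<beta> x = (2 * \<beta> * (norm x)\<^sup>2 - (real CARD('n) - 2) / 2) * exp (- \<beta> * (norm x)\<^sup>2)"

definition bilinear_dot :: "complex^'k::finite \<Rightarrow> real^'k \<Rightarrow> complex" where
  "bilinear_dot a y = (\<Sum>i\<in>UNIV. a $ i * complex_of_real (y $ i))"

text \<open>Parameters are tuples \<open>(\<alpha>, \<tau>, a, b, \<beta>)\<close>.\<close>

type_synonym ('n, 'm) params = "complex \<times> complex \<times> (complex^'n) \<times> (complex^'m) \<times> real"

definition complex_params :: "('n::finite, 'm::finite) params set" where
  "complex_params = {(\<alpha>, \<tau>, a, b, \<beta>). \<beta> > 0}"

definition real_params :: "('n::finite, 'm::finite) params set" where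
  "real_params = {(\<alpha>, \<tau>, a, b, \<beta>). \<alpha> \<in> \<real> \<and> \<tau> \<in> \<real> \<and> (\<forall>i. a $ i \<in> \<real>) \<and> (\<forall>i. b $ i \<in> \<real>) \<and> \<beta> > 0}"

fun w0 :: "('n::finite, 'm::finite) params \<Rightarrow> real^'n \<Rightarrow> complex" where
  "w0 (\<alpha>, \<tau>, a, b, \<beta>) x = \<alpha> * complex_of_real (exp (- \<beta> * (norm x)\<^sup>2))"

fun w1 :: "('n::finite, 'm::finite) params \<Rightarrow> real^'n \<Rightarrow> complex" where
  "w1 (\<alpha>, \<tau>, a, b, \<beta>) x =
     w0 (\<alpha>, \<tau>, a, b, \<beta>) x + complex_of_real (Theta1 \<beta> x) * bilinear_dot a x"

text \<open>At the origin \<open>x /\<^sub>R norm x\<close> is \<open>0\<close>, but the factor \<open>|x|\<^sup>2\<close> makes the last term vanish there,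
  which is its continuous (indeed smooth) extension.\<close>

fun w2 :: "(real^'n::finite \<Rightarrow> real^'m::finite) \<Rightarrow> ('n, 'm) params \<Rightarrow> real^'n \<Rightarrow> complex" where
  "w2 \<Phi> (\<alpha>, \<tau>, a, b, \<beta>) x =
     w1 (\<alpha>, \<tau>, a, b, \<beta>) x
     + complex_of_real (Theta2 \<beta> x * (norm x)\<^sup>2) * bilinear_dot b (\<Phi> (x /\<^sub>R norm x))"

fun w3 :: "(real^'n::finite \<Rightarrow> real^'m::finite) \<Rightarrow> ('n, 'm) params \<Rightarrow> real^'n \<Rightarrow> complex" where
  "w3 \<Phi> (\<alpha>, \<tau>, a, b, \<beta>) x = w2 \<Phi> (\<alpha>, \<tau>, a, b, \<beta>) x + \<tau> * complex_of_real (L_fun \<beta> x)"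

definition remainder ::
  "(real^'n::finite \<Rightarrow> real^'m::finite) \<Rightarrow> (real^'n \<Rightarrow> complex^'n) \<Rightarrow> ('n, 'm) params \<Rightarrow> real" where
  "remainder \<Phi> U P =
     (let D = D_const CARD('n) in
       D 1 / 2 * (L2_norm (\<lambda>x. U x - grad (w0 P) x))\<^sup>2
     + (D 2 - D 1) / 2 * (L2_norm (\<lambda>x. U x - grad (w1 P) x))\<^sup>2
     + (4 - D 2) / 2 * (L2_norm (\<lambda>x. U x - grad (w2 \<Phi> P) x))\<^sup>2
     + (D 3 - 4) / 2 * (L2_norm (\<lambda>x. U x - grad (w3 \<Phi> P) x))\<^sup>2)"

end

theory Submission
  imports Defs "HOL-Real_Asymp.Real_Asymp"
begin

text \<open>
  By the arithmetic-geometric mean inequality it suffices to bound, for each \<open>\<lambda> = 2\<beta>\<close>, the quadratic form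
  \<open>Q(u) = \<parallel>\<Delta>u\<parallel>\<^sup>2 + \<lambda>\<^sup>2 \<parallel>|x|\<nabla>u\<parallel>\<^sup>2 - (N+2)\<lambda> \<parallel>\<nabla>u\<parallel>\<^sup>2\<close> from below. On functions whose angular part is a
  spherical harmonic of degree \<open>k\<close> it factorises as \<open>Q(u) = D\<^sub>k \<lambda> \<parallel>\<nabla>u\<parallel>\<^sup>2 + \<parallel>A u\<parallel>\<^sup>2\<close> with
  \<open>A u = \<Delta>u + \<lambda>(x\<cdot>\<nabla>u + c u)\<close> and \<open>c = N + D\<^sub>k/2\<close>. The kernel of \<open>A\<close> consists of Kummer functions times solid
  harmonics (Gaussians if \<open>k = 0\<close>), and a partner identity for the adjoint of \<open>A\<close> yields the gap
  \<open>\<parallel>A u\<parallel>\<^sup>2 \<ge> 4\<lambda> \<parallel>\<nabla>(u - v)\<parallel>\<^sup>2\<close> for a suitable \<open>v\<close> in this kernel; in the radial sector the second gap, of size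
  \<open>8\<lambda>\<close>, accounts for \<open>L_fun\<close>. For a polynomial times a Gaussian the sectors are orthogonal and only finitely many occur,
  so the bounds add up, and these functions are dense in the energy norm.

  The Kummer functions do not decay fast enough to be integrated by parts freely. By Kummer's transformation they are
  Gaussians times power series with positive coefficients, and the partial sums are elements of the
  sector on which \<open>A\<close> becomes arbitrarily small. With \<open>k = 1\<close> and a cutoff these partial sums also prove sharpness:
  they are odd, so their gradients are even, hence orthogonal to the odd fields in \<open>E\<^sub>C\<^sub>F\<close>.
\<close>

section \<open>Partial derivatives\<close>

text \<open>The weights of the remainder come from a count over sectors; they add up to D_3, in
  units of \<lambda>/2 or 1/2. Components of degree at least 3 meet no subtraction and supply D_3
  alone. Degree 1 supplies D_1 untouched and 4 more once its ground state is removed, which suffices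
  because D_3 - D_1 \<le> 4; degree 2 is similar. The radial part supplies 4 after removal of the
  Gaussian and, by the second gap, another D_3 - 4 \<le> 4 after removal of \<open>L_fun\<close>.
  The obstacle is that all identities for A are proved on Schwartz functions, and the Kummer ground
  states are not among them. The gap is therefore proved on the image of the partner operator, where
  it is a Cauchy-Schwarz estimate. That image misses one direction per harmonic, which is cancelled
  by a multiple of a truncated Kummer series. The multiple is under control: otherwise the
  truncations would nearly lie in the image, where the gap would force their gradients to 0. Ground
  states are thus reached only in the limit, and the inequalities carry an error \<epsilon> until
  the infimum is taken.\<close>

lemma partial_eqI: "(f has_derivative f') (at x) \<Longrightarrow> partial i f x = f' (axis i 1)"
  unfolding partial_def by (metis frechet_derivative_at)

lemma has_derivative_partial:
  fixes f :: "real^'n::finite \<Rightarrow> 'b::real_normed_vector"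
  assumes "f differentiable (at x)"
  shows "(f has_derivative (\<lambda>h. \<Sum>i\<in>UNIV. h $ i *\<^sub>R partial i f x)) (at x)"
proof -
  let ?D = "frechet_derivative f (at x)"
  have D: "(f has_derivative ?D) (at x)"
    using assms frechet_derivative_works by blast
  then interpret bounded_linear ?D by (rule has_derivative_bounded_linear)
  have "?D h = (\<Sum>i\<in>UNIV. h $ i *\<^sub>R partial i f x)" for h
  proof -
    have "h = (\<Sum>i\<in>UNIV. h $ i *\<^sub>R axis i 1)"
      by (metis basis_expansion scalar_mult_eq_scaleR)
    then have "?D h = ?D (\<Sum>i\<in>UNIV. h $ i *\<^sub>R axis i 1)" by simp
    then show ?thesis by (simp add: sum scaleR partial_def)
  qed
  then have "?D = (\<lambda>h. \<Sum>i\<in>UNIV. h $ i *\<^sub>R partial i f x)" by blast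
  with D show ?thesis by simp
qed

lemma partial_add:
  assumes "f differentiable (at x)" "g differentiable (at x)"
  shows "partial i (\<lambda>x. f x + g x) x = partial i f x + partial i g x"
  by (rule partial_eqI[THEN trans, OF has_derivative_add[OF has_derivative_partial has_derivative_partial]])
     (use assms in \<open>auto simp: axis_def if_distrib[of "\<lambda>z. z *\<^sub>R _"] cong: if_cong\<close>)

lemma partial_cmult:
  fixes f :: "real^'n::finite \<Rightarrow> real"
  assumes "f differentiable (at x)"
  shows "partial i (\<lambda>x. c * f x) x = c * partial i f x"
  by (rule partial_eqI[THEN trans, OF has_derivative_mult_right[OF has_derivative_partial]])
     (use assms in \<open>auto simp: axis_def if_distrib[of "\<lambda>z. z * _"] cong: if_cong\<close>)

lemma partial_mult:
  fixes f g :: "real^'n::finite \<Rightarrow> 'b::real_normed_algebra"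
  assumes "f differentiable (at x)" "g differentiable (at x)"
  shows "partial i (\<lambda>x. f x * g x) x = f x * partial i g x + partial i f x * g x"
  by (rule partial_eqI[THEN trans, OF has_derivative_mult[OF has_derivative_partial has_derivative_partial]])
     (use assms in \<open>auto simp: axis_def if_distrib[of "\<lambda>z. z *\<^sub>R _"] cong: if_cong\<close>)

lemma partial_const [simp]: "partial i (\<lambda>x. c) = (\<lambda>x. 0)"
  by (rule ext) (rule partial_eqI[THEN trans, OF has_derivative_const], simp)

lemma partial_bounded_linear: "bounded_linear l \<Longrightarrow> partial i l x = l (axis i 1)"
  by (rule partial_eqI) (rule bounded_linear_imp_has_derivative)

lemma partial_component [simp]: "partial i (\<lambda>x. x $ j) = (\<lambda>x. if i = j then 1 else 0)"
  by (rule ext) (simp add: partial_bounded_linear[OF bounded_linear_vec_nth] axis_def)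

text \<open>\<open>frechet_derivative\<close> is a choice, so the two functions are shown to admit
  the same derivatives; this also covers points where neither is differentiable.\<close>

lemma partial_cong:
  assumes "open S" "x \<in> S" "\<And>y. y \<in> S \<Longrightarrow> f y = g y"
  shows "partial i f x = partial i g x"
proof -
  have "(f has_derivative D) (at x) \<longleftrightarrow> (g has_derivative D) (at x)" for D
    using assms has_derivative_transform_within_open[of _ D x UNIV S] by (metis)
  then show ?thesis by (simp add: partial_def frechet_derivative_def)
qed

lemma partial_compose_real:
  fixes f :: "real^'n::finite \<Rightarrow> real" and \<psi> :: "real \<Rightarrow> real"
  assumes "f differentiable (at x)" "(\<psi> has_real_derivative d) (at (f x))"
  shows "partial i (\<lambda>x. \<psi> (f x)) x = d * partial i f x"
proof -
  have "((\<lambda>x. \<psi> (f x)) has_derivative (\<lambda>h. d * (\<Sum>i\<in>UNIV. h $ i *\<^sub>R partial i f x))) (at x)"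
    using has_derivative_compose[OF has_derivative_partial[OF assms(1)] assms(2)[unfolded has_field_derivative_def]]
    by simp
  from partial_eqI[OF this] show ?thesis
    by (simp add: axis_def if_distrib[of "\<lambda>z. z * _"] cong: if_cong)
qed

lemma norm_sq_sum: "(norm (x::real^'n::finite))\<^sup>2 = (\<Sum>i\<in>UNIV. (x $ i)\<^sup>2)"
  by (simp add: norm_vec_def L2_set_def real_sqrt_pow2 sum_nonneg)

lemma differentiable_norm_sq: "(\<lambda>x::real^'n::finite. (norm x)\<^sup>2) differentiable (at x)"
  unfolding norm_sq_sum
  by (intro differentiable_sum differentiable_power bounded_linear_imp_differentiable[OF bounded_linear_vec_nth] finite ballI)

lemma differentiable_component: "(\<lambda>x::real^'n::finite. x $ i) differentiable (at x)"
  by (intro bounded_linear_imp_differentiable bounded_linear_vec_nth)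

lemma partial_norm_sq: "partial i (\<lambda>x::real^'n::finite. (norm x)\<^sup>2) x = 2 * x $ i"
proof -
  have "((\<lambda>x::real^'n. x \<bullet> x) has_derivative (\<lambda>h. x \<bullet> h + h \<bullet> x)) (at x)"
    by (rule has_derivative_inner) (auto intro!: has_derivative_ident)
  from partial_eqI[OF this] show ?thesis
    by (simp add: power2_norm_eq_inner inner_axis inner_axis' )
qed

section \<open>Rapidly decreasing functions\<close>

definition decays :: "(real^'n::finite \<Rightarrow> real) \<Rightarrow> bool" where
  "decays f \<longleftrightarrow> (\<forall>k::nat. \<exists>C. \<forall>x. (1 + norm x) ^ k * \<bar>f x\<bar> \<le> C)"

text \<open>The Schwartz space, graded by the number of derivatives so that closure properties
  follow by induction on \<open>k\<close> with the function arbitrary.\<close>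

primrec schwartz_k :: "nat \<Rightarrow> (real^'n::finite \<Rightarrow> real) \<Rightarrow> bool" where
  "schwartz_k 0 f \<longleftrightarrow> continuous_on UNIV f \<and> decays f"
| "schwartz_k (Suc k) f \<longleftrightarrow> decays f \<and> (\<forall>x. f differentiable (at x)) \<and> (\<forall>i. schwartz_k k (partial i f))"

definition schwartz :: "(real^'n::finite \<Rightarrow> real) \<Rightarrow> bool" where
  "schwartz f \<longleftrightarrow> (\<forall>k. schwartz_k k f)"

lemma decaysE:
  assumes "decays f"
  obtains C where "C \<ge> 0" "\<And>x. (1 + norm x) ^ k * \<bar>f x\<bar> \<le> C"
proof -
  obtain C where C: "\<And>x. (1 + norm x) ^ k * \<bar>f x\<bar> \<le> C"
    using assms unfolding decays_def by blast
  moreover have "C \<ge> 0" using C[of 0] by (smt (verit) zero_le_mult_iff zero_le_power norm_ge_zero abs_ge_zero)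
  ultimately show thesis using that by blast
qed

lemma decays_add: "decays f \<Longrightarrow> decays g \<Longrightarrow> decays (\<lambda>x. f x + g x)"
  unfolding decays_def
proof
  fix k assume "\<forall>k. \<exists>C. \<forall>x. (1 + norm x) ^ k * \<bar>f x\<bar> \<le> C" "\<forall>k. \<exists>C. \<forall>x. (1 + norm x) ^ k * \<bar>g x\<bar> \<le> C"
  then obtain C D where CD: "\<And>x. (1 + norm x) ^ k * \<bar>f x\<bar> \<le> C" "\<And>x. (1 + norm x) ^ k * \<bar>g x\<bar> \<le> D" by blast
  have "(1 + norm x) ^ k * \<bar>f x + g x\<bar> \<le> C + D" for x
  proof -
    have "(1 + norm x) ^ k * \<bar>f x + g x\<bar> \<le> (1 + norm x) ^ k * (\<bar>f x\<bar> + \<bar>g x\<bar>)"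
      by (intro mult_left_mono) auto
    also have "\<dots> \<le> C + D" using CD[of x] by (simp add: distrib_left)
    finally show ?thesis .
  qed
  then show "\<exists>C. \<forall>x. (1 + norm x) ^ k * \<bar>f x + g x\<bar> \<le> C" by blast
qed

lemma decays_growth:
  assumes "decays f" "\<And>x. \<bar>p x\<bar> \<le> K * (1 + norm x) ^ m"
  shows "decays (\<lambda>x. p x * f x)"
  unfolding decays_def
proof
  fix k
  obtain C where C: "C \<ge> 0" "\<And>x. (1 + norm x) ^ (k + m) * \<bar>f x\<bar> \<le> C" using decaysE[OF assms(1)] by metis
  have K: "K \<ge> 0" using assms(2)[of 0] by simp
  have "(1 + norm x) ^ k * \<bar>p x * f x\<bar> \<le> K * C" for x
  proof -
    have "(1 + norm x) ^ k * \<bar>p x * f x\<bar> = (1 + norm x) ^ k * \<bar>f x\<bar> * \<bar>p x\<bar>" by (simp add: abs_mult)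
    also have "\<dots> \<le> (1 + norm x) ^ k * \<bar>f x\<bar> * (K * (1 + norm x) ^ m)"
      by (intro mult_left_mono assms) auto
    also have "\<dots> = K * ((1 + norm x) ^ (k + m) * \<bar>f x\<bar>)" by (simp add: power_add)
    also have "\<dots> \<le> K * C" using C K by (intro mult_left_mono) auto
    finally show ?thesis .
  qed
  then show "\<exists>C. \<forall>x. (1 + norm x) ^ k * \<bar>p x * f x\<bar> \<le> C" by blast
qed

lemma decays_bounded_mult:
  assumes "decays f" "\<And>x. \<bar>p x\<bar> \<le> K" shows "decays (\<lambda>x. p x * f x)"
  using decays_growth[OF assms(1), of p K 0] assms(2) by simp

lemma decays_cmult: "decays f \<Longrightarrow> decays (\<lambda>x. c * f x)"
  by (rule decays_bounded_mult[where K = "\<bar>c\<bar>"]) auto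

lemma decays_component: "decays f \<Longrightarrow> decays (\<lambda>x. x $ i * f x)"
  by (rule decays_growth[where K = 1 and m = 1]) (use component_le_norm_cart[of _ i] in \<open>auto intro: add_increasing\<close>)

lemma decays_bounded:
  assumes "decays f" obtains C where "C \<ge> 0" "\<And>x. \<bar>f x\<bar> \<le> C"
  using decaysE[OF assms, of 0] by auto

lemma decays_mult: "decays f \<Longrightarrow> decays g \<Longrightarrow> decays (\<lambda>x. f x * g x)"
  by (metis decays_bounded decays_bounded_mult)

lemma schwartz_k_decays: "schwartz_k k f \<Longrightarrow> decays f"
  by (cases k) auto

lemma schwartz_k_continuous: "schwartz_k k f \<Longrightarrow> continuous_on UNIV f"
  by (cases k) (auto simp: differentiable_imp_continuous_on differentiable_on_def
      intro: differentiable_at_withinI)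

lemma schwartz_k_Suc: "schwartz_k (Suc k) f \<Longrightarrow> schwartz_k k f"
proof (induction k arbitrary: f)
  case 0 then show ?case using schwartz_k_continuous schwartz_k_decays by (metis schwartz_k.simps(1))
next
  case (Suc k) then show ?case by (metis schwartz_k.simps(2))
qed

lemma schwartz_k_add: "schwartz_k k f \<Longrightarrow> schwartz_k k g \<Longrightarrow> schwartz_k k (\<lambda>x. f x + g x)"
proof (induction k arbitrary: f g)
  case 0 then show ?case by (auto intro: continuous_intros decays_add)
next
  case (Suc k)
  then have "partial i (\<lambda>x. f x + g x) = (\<lambda>x. partial i f x + partial i g x)" for i
    by (auto simp: partial_add)
  with Suc show ?case by (auto intro: decays_add)
qed

lemma schwartz_k_cmult: "schwartz_k k f \<Longrightarrow> schwartz_k k (\<lambda>x. c * f x)"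
proof (induction k arbitrary: f)
  case 0 then show ?case by (auto intro: continuous_intros decays_cmult)
next
  case (Suc k)
  then have "partial i (\<lambda>x. c * f x) = (\<lambda>x. c * partial i f x)" for i
    by (auto simp: partial_cmult)
  with Suc show ?case by (auto intro: decays_cmult)
qed

lemma schwartz_k_mult: "schwartz_k k f \<Longrightarrow> schwartz_k k g \<Longrightarrow> schwartz_k k (\<lambda>x. f x * g x)"
proof (induction k arbitrary: f g)
  case 0 then show ?case by (auto intro: continuous_intros decays_mult)
next
  case (Suc k)
  then have "partial i (\<lambda>x. f x * g x) = (\<lambda>x. f x * partial i g x + partial i f x * g x)" for i
    by (auto simp: partial_mult)
  with Suc show ?case using schwartz_k_Suc[OF Suc.prems(1)] schwartz_k_Suc[OF Suc.prems(2)]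
    by (auto intro!: decays_mult schwartz_k_add)
qed

lemma schwartz_k_component: "schwartz_k k f \<Longrightarrow> schwartz_k k (\<lambda>x. x $ i * f x)"
proof (induction k arbitrary: f)
  case 0 then show ?case by (auto intro!: continuous_intros decays_component)
next
  case (Suc k)
  then have "partial j (\<lambda>x. x $ i * f x) = (\<lambda>x. x $ i * partial j f x + (if j = i then 1 else 0) * f x)" for j
    by (auto simp: partial_mult differentiable_component)
  with Suc show ?case using schwartz_k_Suc[OF Suc.prems(1)]
    by (auto intro!: decays_component schwartz_k_add schwartz_k_cmult differentiable_mult differentiable_component)
qed

lemma schwartz_add: "schwartz f \<Longrightarrow> schwartz g \<Longrightarrow> schwartz (\<lambda>x. f x + g x)"
  by (simp add: schwartz_def schwartz_k_add)
lemma schwartz_cmult: "schwartz f \<Longrightarrow> schwartz (\<lambda>x. c * f x)"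
  by (simp add: schwartz_def schwartz_k_cmult)
lemma schwartz_mult: "schwartz f \<Longrightarrow> schwartz g \<Longrightarrow> schwartz (\<lambda>x. f x * g x)"
  by (simp add: schwartz_def schwartz_k_mult)
lemma schwartz_component: "schwartz f \<Longrightarrow> schwartz (\<lambda>x. x $ i * f x)"
  by (simp add: schwartz_def schwartz_k_component)
lemma schwartz_partial: "schwartz f \<Longrightarrow> schwartz (partial i f)"
  unfolding schwartz_def by (metis schwartz_k.simps(2))
lemma schwartz_differentiable: "schwartz f \<Longrightarrow> f differentiable (at x)"
  unfolding schwartz_def by (metis schwartz_k.simps(2))
lemma schwartz_continuous: "schwartz f \<Longrightarrow> continuous_on UNIV f"
  unfolding schwartz_def by (metis schwartz_k.simps(1))
lemma schwartz_decays: "schwartz f \<Longrightarrow> decays f"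
  unfolding schwartz_def by (metis schwartz_k.simps(1))
lemma schwartz_measurable [measurable_dest]: "schwartz f \<Longrightarrow> f \<in> borel_measurable borel"
  by (simp add: borel_measurable_continuous_onI schwartz_continuous)
lemma schwartz_zero: "schwartz (\<lambda>x. 0)"
proof -
  have "schwartz_k k (\<lambda>x::real^'a. 0)" for k
    by (induction k) (auto simp: decays_def)
  then show ?thesis by (simp add: schwartz_def)
qed
lemma schwartz_diff: "schwartz f \<Longrightarrow> schwartz g \<Longrightarrow> schwartz (\<lambda>x. f x - g x)"
  using schwartz_add[of f "\<lambda>x. -1 * g x"] schwartz_cmult[of g "-1"] by simp
lemma schwartz_uminus: "schwartz f \<Longrightarrow> schwartz (\<lambda>x. - f x)"
  using schwartz_cmult[of f "-1"] by simp
lemma schwartz_sum: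
  "(\<And>i. i \<in> I \<Longrightarrow> schwartz (f i)) \<Longrightarrow> schwartz (\<lambda>x. \<Sum>i\<in>I. f i x)"
  by (induction I rule: infinite_finite_induct) (auto intro: schwartz_zero schwartz_add)

lemma schwartz_polynomial:
  fixes p :: "real^'n::finite \<Rightarrow> real"
  shows "real_polynomial_function p \<Longrightarrow> schwartz f \<Longrightarrow> schwartz (\<lambda>x. p x * f x)"
proof (induction p arbitrary: f rule: real_polynomial_function.induct)
  case (linear l)
  define c where "c i = l (axis i 1)" for i
  have leq: "l = (\<lambda>x. \<Sum>i\<in>UNIV. c i * x $ i)"
  proof
    fix x
    have "l x = l (\<Sum>i\<in>UNIV. x $ i *\<^sub>R axis i 1)"
      by (metis basis_expansion scalar_mult_eq_scaleR)
    also have "\<dots> = (\<Sum>i\<in>UNIV. c i * x $ i)" unfolding c_def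
      using bounded_linear.linear[OF linear(1)] by (simp only: linear_sum linear_cmul real_scaleR_def mult.commute)
    finally show "l x = (\<Sum>i\<in>UNIV. c i * x $ i)" .
  qed
  have "schwartz (\<lambda>x. \<Sum>i\<in>UNIV. c i * (x $ i * f x))"
    using linear by (intro schwartz_sum schwartz_cmult schwartz_component)
  then show ?case unfolding leq by (simp add: sum_distrib_right mult.assoc)
next
  case (const c) then show ?case by (rule schwartz_cmult)
next
  case (add p q) then show ?case by (simp add: distrib_right schwartz_add)
next
  case (mult p q) then show ?case by (simp add: mult.assoc)
qed

section \<open>Gaussians\<close>

definition gauss :: "real \<Rightarrow> real^'n::finite \<Rightarrow> real" where
  "gauss \<beta> x = exp (- \<beta> * (norm x)\<^sup>2)"

lemma gauss_differentiable: "gauss \<beta> differentiable (at x)"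
  unfolding gauss_def[abs_def]
proof -
  have "((\<lambda>x. exp (- \<beta> * (norm x)\<^sup>2)) has_derivative (\<lambda>h. - (\<beta> * (2 * (x \<bullet> h)) * exp (- (\<beta> * (norm x)\<^sup>2))))) (at x)"
    by (auto intro!: derivative_eq_intros)
  then show "(\<lambda>x. exp (- \<beta> * (norm x)\<^sup>2)) differentiable (at x)" by (rule differentiableI)
qed

lemma partial_gauss: "partial i (gauss \<beta>) x = - 2 * \<beta> * x $ i * gauss \<beta> x"
proof -
  have "((\<lambda>t. exp (- \<beta> * t)) has_real_derivative (- \<beta> * exp (- \<beta> * t))) (at t)" for t :: real
    by (auto intro!: derivative_eq_intros)
  from partial_compose_real[OF differentiable_norm_sq this] show ?thesis
    unfolding gauss_def[abs_def] by (simp add: partial_norm_sq algebra_simps)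
qed

lemma gauss_decays: assumes "\<beta> > 0" shows "decays (gauss \<beta> :: real^'n::finite \<Rightarrow> real)"
  unfolding decays_def
proof
  fix k
  define \<phi> where "\<phi> = (\<lambda>r::real. (1 + r) ^ k * exp (- \<beta> * r\<^sup>2))"
  have "(\<phi> \<longlongrightarrow> 0) at_top" unfolding \<phi>_def using assms by real_asymp
  then have "\<forall>\<^sub>F r in at_top. \<phi> r < 1" by (rule order_tendstoD) simp
  then obtain R where R: "\<And>r. r \<ge> R \<Longrightarrow> \<phi> r < 1" unfolding eventually_at_top_linorder by blast
  have "continuous_on {0..R} \<phi>" unfolding \<phi>_def by (intro continuous_intros)
  then obtain C where C: "\<And>r. r \<in> {0..R} \<Longrightarrow> \<phi> r \<le> C"
    using compact_Icc compact_continuous_image bounded_real compact_imp_bounded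
    by (metis (no_types, lifting) abs_le_D1 imageI)
  have "(1 + norm x) ^ k * \<bar>gauss \<beta> x\<bar> \<le> max 1 C" for x :: "real^'n"
    using R[of "norm x"] C[of "norm x"] by (cases "norm x \<ge> R") (auto simp: \<phi>_def gauss_def)
  then show "\<exists>C. \<forall>x::real^'n. (1 + norm x) ^ k * \<bar>gauss \<beta> x\<bar> \<le> C" by blast
qed

text \<open>A partial derivative of a Gaussian is a constant times a coordinate times the same
  Gaussian, so the induction hypothesis applies through \<open>schwartz_k_component\<close>.\<close>

lemma gauss_schwartz: assumes "\<beta> > 0" shows "schwartz (gauss \<beta> :: real^'n::finite \<Rightarrow> real)"
proof -
  have "schwartz_k k (gauss \<beta> :: real^'n \<Rightarrow> real)" for k
  proof (induction k)
    case 0 then show ?case using gauss_decays[OF assms] by (auto simp: gauss_def[abs_def] intro!: continuous_intros)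
  next
    case (Suc k)
    have "partial i (gauss \<beta>) = (\<lambda>x::real^'n. (- 2 * \<beta>) * (x $ i * gauss \<beta> x))" for i
      by (auto simp: partial_gauss)
    moreover have "schwartz_k k (\<lambda>x::real^'n. (- 2 * \<beta>) * (x $ i * gauss \<beta> x))" for i
      by (intro schwartz_k_cmult schwartz_k_component Suc)
    ultimately
 show ?case unfolding schwartz_k.simps by (auto intro: gauss_decays[OF assms] gauss_differentiable)
  qed
  then show ?thesis by (simp add: schwartz_def)
qed

section \<open>Integrability and integration by parts\<close>

text \<open>Dyadic decomposition: where 2^j \<le> 1 + |x| < 2^(j+1) the function is at most 2^(-pj),
  and the ball of radius 2^(j+1) has volume proportional to 2^((j+1)N). The resulting series is
  geometric with ratio \<open>q\<close>, which is below 1 exactly because p > N.\<close>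

lemma integrable_powr_decay:
  assumes "p > real CARD('n)"
  shows "integrable lborel (\<lambda>x::real^'n::finite. (1 + norm x) powr (- p))"
proof (rule integrableI_bounded)
  show "(\<lambda>x::real^'n. (1 + norm x) powr (- p)) \<in> borel_measurable lborel" by measurable
  let ?N = "CARD('n)"
  let ?V = "unit_ball_vol (real ?N)"
  define q :: real where "q = 2 powr (- (p - real ?N))"
  have q: "0 < q" "q < 1" using assms by (auto simp: q_def intro: powr_less_one)
  have le: "ennreal (norm ((1 + norm x) powr (- p)))
      \<le> (\<Sum>j. ennreal (2 powr (- p * real j)) * indicator (ball 0 (2 ^ Suc j)) x)" for x :: "real^'n"
  proof -
    define j where "j = nat \<lfloor>log 2 (1 + norm x)\<rfloor>"
    have l0: "log 2 (1 + norm x) \<ge> 0" by (rule zero_le_log_cancel_iff[THEN iffD2]) (auto intro: add_pos_nonneg)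
    have j: "real j \<le> log 2 (1 + norm x)" "log 2 (1 + norm x) < real j + 1"
      using l0 unfolding j_def by linarith+
    have pos: "1 + norm x > 0" by (simp add: add_pos_nonneg)
    have up: "1 + norm x < 2 powr (real j + 1)"
      using j(2) pos by (simp add: log_less_iff)
    have lo: "2 powr (real j) \<le> 1 + norm x"
      using j(1) pos by (simp add: le_log_iff)
    have "norm x < 2 ^ Suc j" using up by (simp add: powr_realpow powr_add)
    then have ind: "indicator (ball 0 (2 ^ Suc j)) x = (1::ennreal)" by simp
    have "(1 + norm x) powr (- p) \<le> (2 powr real j) powr (- p)"
      using lo assms by (intro powr_mono2') auto
    then have "ennreal (norm ((1 + norm x) powr (- p))) \<le> ennreal (2 powr (- p * real j))"
      by (simp add: powr_powr mult.commute ennreal_leI)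
    also have "\<dots> = ennreal (2 powr (- p * real j)) * indicator (ball 0 (2 ^ Suc j)) x" by (simp add: ind del: power_Suc)
    also have "\<dots> = (\<Sum>i\<in>{j}. ennreal (2 powr (- p * real i)) * indicator (ball 0 (2 ^ Suc i)) x)" by (subst sum.insert) auto
    also have "\<dots> \<le> (\<Sum>j. ennreal (2 powr (- p * real j)) * indicator (ball 0 (2 ^ Suc j)) x)"
      by (rule sum_le_suminf) auto
    finally show ?thesis .
  qed
  have "(\<integral>\<^sup>+ (x::real^'n). ennreal (norm ((1 + norm x) powr (- p))) \<partial>lborel)
     \<le> (\<integral>\<^sup>+ (x::real^'n). (\<Sum>j. ennreal (2 powr (- p * real j)) * indicator (ball 0 (2 ^ Suc j)) x) \<partial>lborel)"
    by (intro nn_integral_mono le)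
  also have "\<dots> = (\<Sum>j. \<integral>\<^sup>+ (x::real^'n). ennreal (2 powr (- p * real j)) * indicator (ball 0 (2 ^ Suc j)) x \<partial>lborel)"
  proof -
    have "(\<lambda>x::real^'n. ennreal (2 powr (- p * real j)) * indicator (ball 0 (2 ^ Suc j)) x) \<in> borel_measurable lborel" for j
      by (intro borel_measurable_times_ennreal borel_measurable_const borel_measurable_indicator) simp
    from nn_integral_suminf[OF this] show ?thesis .
  qed
  also have "\<dots> = (\<Sum>j. ennreal (2 powr (- p * real j)) * emeasure lborel (ball (0::real^'n) (2 ^ Suc j)))"
    by (simp add: nn_integral_cmult_indicator del: power_Suc)
  also have "\<dots> = (\<Sum>j. ennreal (?V * 2 ^ ?N * q ^ j))"
  proof (intro suminf_cong)
    fix j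
    have "2 powr (- p * real j) * (?V * (2 ^ Suc j) ^ ?N) = ?V * 2 ^ ?N * q ^ j"
    proof -
      have "q ^ j = 2 powr (- (p - real ?N) * real j)"
        by (simp add: q_def powr_realpow[symmetric] powr_powr)
      also have "\<dots> = 2 powr (- p * real j) * 2 powr (real j * real ?N)"
        by (simp add: powr_add[symmetric] algebra_simps)
      also have "2 powr (real j * real ?N) = ((2::real) ^ j) ^ ?N"
        by (simp add: powr_realpow[symmetric] powr_powr)
      finally show ?thesis by (simp add: power_mult_distrib)
    qed
    moreover have "emeasure lborel (ball (0::real^'n) (2 ^ Suc j)) = ennreal (?V * (2 ^ Suc j) ^ ?N)"
      by (simp add: emeasure_ball del: power_Suc)
    ultimately show "ennreal (2 powr (- p * real j)) * emeasure lborel (ball (0::real^'n) (2 ^ Suc j)) = ennreal (?V * 2 ^ ?N * q ^ j)"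
      by (metis ennreal_mult' powr_ge_zero)
  qed
  also have "\<dots> = ennreal (\<Sum>j. ?V * 2 ^ ?N * q ^ j)"
    using q by (intro suminf_ennreal2) (auto intro!: summable_mult summable_geometric)
  also have "\<dots> < \<infinity>" by simp
  finally show "(\<integral>\<^sup>+ (x::real^'n). ennreal (norm ((1 + norm x) powr (- p))) \<partial>lborel) < \<infinity>" .
qed

lemma integrable_decay_power:
  "integrable lborel (\<lambda>x::real^'n::finite. C / (1 + norm x) ^ (CARD('n) + 1))"
proof -
  have "C / (1 + norm x) ^ (CARD('n) + 1) = C * (1 + norm x) powr (- (real CARD('n) + 1))" for x :: "real^'n"
    by (subst powr_minus_divide) (simp add: powr_realpow[symmetric] add_pos_nonneg powr_add)
  then show ?thesis using integrable_powr_decay[of "real CARD('n) + 1", where ?'n = 'n]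
    by (auto intro!: integrable_mult_right)
qed

lemma decays_integrable:
  fixes f :: "real^'n::finite \<Rightarrow> real"
  assumes "decays f" "f \<in> borel_measurable borel"
  shows "integrable lborel f"
proof -
  obtain C where C: "\<And>x. (1 + norm x) ^ (CARD('n) + 1) * \<bar>f x\<bar> \<le> C" using decaysE[OF assms(1)] by metis
  show ?thesis
  proof (rule Bochner_Integration.integrable_bound[OF integrable_decay_power[where C = C]])
    show "f \<in> borel_measurable lborel" using assms by simp
    show "AE x in lborel. norm (f x) \<le> norm (C / (1 + norm x) ^ (CARD('n) + 1))"
    proof (rule AE_I2)
      fix x :: "real^'n"
      have "\<bar>f x\<bar> \<le> C / (1 + norm x) ^ (CARD('n) + 1)"
        using C[of x] by (simp add: pos_le_divide_eq add_pos_nonneg mult.commute del: power_Suc power_add)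
      then show "norm (f x) \<le> norm (C / (1 + norm x) ^ (CARD('n) + 1))"
        using abs_ge_self order_trans by (fastforce simp del: power_Suc)
    qed
  qed
qed

lemma schwartz_integrable: "schwartz f \<Longrightarrow> integrable lborel f"
  using decays_integrable schwartz_decays schwartz_measurable by blast

lemma integral_translation:
  fixes f :: "'a::euclidean_space \<Rightarrow> real"
  assumes "integrable lborel f"
  shows "integrable lborel (\<lambda>x. f (a + x))" "(LINT x|lborel. f (a + x)) = (LINT x|lborel. f x)"
proof -
  have m: "(\<lambda>x. a + x) \<in> measurable lborel borel" by measurable
  have f: "f \<in> borel_measurable borel" using assms by auto
  show "integrable lborel (\<lambda>x. f (a + x))"
    using assms integrable_distr[OF m, of f] f by (simp add: lborel_distr_plus)
  show "(LINT x|lborel. f (a + x)) = (LINT x|lborel. f x)"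
    using integral_distr[OF m f] by (simp add: lborel_distr_plus)
qed

text \<open>The difference quotients of \<open>f\<close> have integral \<open>0\<close> by translation invariance, and they are
  dominated by the decay of the derivative.\<close>

lemma integral_partial_eq_0:
  fixes f :: "real^'n::finite \<Rightarrow> real"
  assumes int: "integrable lborel f" and diff: "\<And>x. f differentiable (at x)"
    and cont: "continuous_on UNIV (partial i f)" and dec: "decays (partial i f)"
  shows "(LINT x|lborel. partial i f x) = 0"
proof -
  let ?e = "axis i 1 :: real^'n"
  let ?h = "\<lambda>n. 1 / real (Suc n)"
  let ?q = "\<lambda>n x. (f (?h n *\<^sub>R ?e + x) - f x) / ?h n"
  obtain C where C: "C \<ge> 0" "\<And>x. (1 + norm x) ^ (CARD('n) + 1) * \<bar>partial i f x\<bar> \<le> C"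
    using decaysE[OF dec] by metis
  have der: "((\<lambda>t. f (x + t *\<^sub>R ?e)) has_real_derivative partial i f (x + t *\<^sub>R ?e)) (at t)" for x t
  proof -
    have "((\<lambda>t. x + t *\<^sub>R ?e) has_derivative (\<lambda>h. h *\<^sub>R ?e)) (at t)"
      by (auto intro!: derivative_eq_intros)
    from has_derivative_compose[OF this has_derivative_partial[OF diff]]
    show ?thesis unfolding has_field_derivative_def
      by (rule has_derivative_eq_rhs)
         (auto simp: axis_def if_distrib[of "\<lambda>z. _ * z"] if_distrib[of "\<lambda>z. z * _"] mult.commute cong: if_cong)
  qed
  have norm_e: "norm ?e = 1" by (simp add: norm_axis_1)
  have "(\<lambda>n. LINT x|lborel. ?q n x) \<longlonglongrightarrow> (LINT x|lborel. partial i f x)"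
  proof (rule integral_dominated_convergence[where w = "\<lambda>x. C * 2 ^ (CARD('n) + 1) / (1 + norm x) ^ (CARD('n) + 1)"])
    show "integrable lborel (\<lambda>x::real^'n. C * 2 ^ (CARD('n) + 1) / (1 + norm x) ^ (CARD('n) + 1))"
      by (rule integrable_decay_power)
    show "partial i f \<in> borel_measurable lborel" using cont by (simp add: borel_measurable_continuous_onI)
    have fm: "f \<in> borel_measurable borel" using int by auto
    show "?q n \<in> borel_measurable lborel" for n using fm by measurable
    show "AE x in lborel. (\<lambda>n. ?q n x) \<longlonglongrightarrow> partial i f x"
    proof (rule AE_I2)
      fix x
      have "((\<lambda>h. (f (x + (0 + h) *\<^sub>R ?e) - f (x + 0 *\<^sub>R ?e)) / h) \<longlongrightarrow> partial i f (x + 0 *\<^sub>R ?e)) (at 0)"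
        using der[of x 0] unfolding DERIV_def .
      moreover have "filterlim ?h (at 0) sequentially"
        unfolding filterlim_at using LIMSEQ_inverse_real_of_nat by (auto simp: inverse_eq_divide)
      ultimately show "(\<lambda>n. ?q n x) \<longlonglongrightarrow> partial i f x"
        using filterlim_compose by (fastforce simp: add.commute)
    qed
    show "AE x in lborel. norm (?q n x) \<le> C * 2 ^ (CARD('n) + 1) / (1 + norm x) ^ (CARD('n) + 1)" for n
    proof (rule AE_I2)
      fix x
      have h: "?h n > 0" "?h n \<le> 1" by auto
      obtain z where z: "0 < z" "z < ?h n"
        "f (x + ?h n *\<^sub>R ?e) - f (x + 0 *\<^sub>R ?e) = (?h n - 0) * partial i f (x + z *\<^sub>R ?e)"
        using MVT2[OF h(1), of "\<lambda>t. f (x + t *\<^sub>R ?e)" "\<lambda>t. partial i f (x + t *\<^sub>R ?e)"] der by blast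
      let ?y = "x + z *\<^sub>R ?e"
      have q: "?q n x = partial i f ?y" using z(3) h(1) by (simp add: add.commute del: of_nat_Suc)
      \<comment> \<open>The intermediate point is at distance at most 1 from \<open>x\<close>, since
        the step size is at most 1; this is the origin of the factor 2 ^ (N + 1) in the dominating
        function.\<close>
      have "1 + norm x \<le> 2 * (1 + norm ?y)"
      proof -
        have "norm x \<le> norm ?y + norm (z *\<^sub>R ?e)" using norm_triangle_ineq4[of ?y "z *\<^sub>R ?e"] by simp
        moreover have "norm (z *\<^sub>R ?e) \<le> 1" using z(1) less_le_trans[OF z(2) h(2)] norm_e by simp
        ultimately have "norm x \<le> norm ?y + 1" by (metis add_left_mono order_trans)
        then have "1 + norm x \<le> 2 + 1 * norm ?y" by simp
        also have "\<dots> \<le> 2 + 2 * norm ?y" by (intro add_left_mono mult_right_mono) auto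
        finally show ?thesis by (simp only: distrib_left mult_1_right)
      qed
      then have "(1 + norm x) ^ (CARD('n) + 1) \<le> (2 * (1 + norm ?y)) ^ (CARD('n) + 1)"
        by (intro power_mono) auto
      then have "(1 + norm x) ^ (CARD('n) + 1) * \<bar>partial i f ?y\<bar> \<le> (2 * (1 + norm ?y)) ^ (CARD('n) + 1) * \<bar>partial i f ?y\<bar>"
        by (intro mult_right_mono) auto
      also have "\<dots> \<le> 2 ^ (CARD('n) + 1) * C"
        unfolding power_mult_distrib mult.assoc using C(2)[of ?y] by (intro mult_left_mono) auto
      finally have "\<bar>partial i f ?y\<bar> \<le> C * 2 ^ (CARD('n) + 1) / (1 + norm x) ^ (CARD('n) + 1)"
        by (simp add: pos_le_divide_eq add_pos_nonneg mult.commute del: power_Suc power_add)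
      then show "norm (?q n x) \<le> C * 2 ^ (CARD('n) + 1) / (1 + norm x) ^ (CARD('n) + 1)"
        unfolding q by (simp del: power_Suc)
    qed
  qed
  moreover have "(LINT x|lborel. ?q n x) = 0" for n
    using integral_translation[OF int, of "?h n *\<^sub>R ?e"] int
    by (subst integral_divide_zero) (simp add: Bochner_Integration.integral_diff)
  ultimately have "(\<lambda>n. 0::real) \<longlonglongrightarrow> (LINT x|lborel. partial i f x)" by simp
  then show ?thesis by (simp add: LIMSEQ_const_iff)
qed

section \<open>The Euler operator, the Laplacian and their commutators\<close>

lemma has_real_derivative_along_axis:
  fixes f :: "real^'n::finite \<Rightarrow> real"
  assumes "\<And>x. f differentiable (at x)"
  shows "((\<lambda>t. f (x + t *\<^sub>R axis i 1)) has_real_derivative partial i f (x + t *\<^sub>R axis i 1)) (at t)"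
proof -
  have "((\<lambda>t. x + t *\<^sub>R axis i 1) has_derivative (\<lambda>h. h *\<^sub>R axis i 1)) (at t)"
    by (auto intro!: derivative_eq_intros)
  from has_derivative_compose[OF this has_derivative_partial[OF assms]]
  show ?thesis unfolding has_field_derivative_def
    by (rule has_derivative_eq_rhs)
       (auto simp: axis_def if_distrib[of "\<lambda>z. _ * z"] if_distrib[of "\<lambda>z. z * _"] mult.commute cong: if_cong)
qed

text \<open>The second difference on the left is symmetric in \<open>i\<close> and \<open>j\<close>,
  the mixed derivative on the right a priori is not. Comparing both orders as \<open>h\<close> tends
  to 0 yields the symmetry of mixed partials.\<close>

lemma mixed_difference_mean_value:
  fixes f :: "real^'n::finite \<Rightarrow> real"
  assumes "\<And>x. f differentiable (at x)" "\<And>x. partial i f differentiable (at x)" "h > 0"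
  shows "\<exists>\<sigma> \<tau>. 0 < \<sigma> \<and> \<sigma> < h \<and> 0 < \<tau> \<and> \<tau> < h \<and>
    f (x + h *\<^sub>R axis i 1 + h *\<^sub>R axis j 1) - f (x + h *\<^sub>R axis i 1) - f (x + h *\<^sub>R axis j 1) + f x
      = h * h * partial j (partial i f) (x + \<sigma> *\<^sub>R axis i 1 + \<tau> *\<^sub>R axis j 1)"
proof -
  let ?ei = "axis i 1 :: real^'n" and ?ej = "axis j 1 :: real^'n"
  define g where "g t = f (x + h *\<^sub>R ?ej + t *\<^sub>R ?ei) - f (x + t *\<^sub>R ?ei)" for t
  have "(g has_real_derivative partial i f (x + h *\<^sub>R ?ej + t *\<^sub>R ?ei) - partial i f (x + t *\<^sub>R ?ei)) (at t)" for t
    unfolding g_def[abs_def] by (intro DERIV_diff has_real_derivative_along_axis assms)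
  then obtain s where s: "0 < s" "s < h"
    "g h - g 0 = (h - 0) * (partial i f (x + h *\<^sub>R ?ej + s *\<^sub>R ?ei) - partial i f (x + s *\<^sub>R ?ei))"
    using MVT2[OF assms(3), of g "\<lambda>t. partial i f (x + h *\<^sub>R ?ej + t *\<^sub>R ?ei) - partial i f (x + t *\<^sub>R ?ei)"] by blast
  obtain t where t: "0 < t" "t < h"
    "partial i f (x + s *\<^sub>R ?ei + h *\<^sub>R ?ej) - partial i f (x + s *\<^sub>R ?ei + 0 *\<^sub>R ?ej)
       = (h - 0) * partial j (partial i f) (x + s *\<^sub>R ?ei + t *\<^sub>R ?ej)"
    using MVT2[OF assms(3) has_real_derivative_along_axis[OF assms(2), of "x + s *\<^sub>R ?ei" j]] by blast
  have "f (x + h *\<^sub>R ?ei + h *\<^sub>R ?ej) - f (x + h *\<^sub>R ?ei) - f (x + h *\<^sub>R ?ej) + f x = g h - g 0"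
    by (simp add: g_def algebra_simps)
  also have "\<dots> = h * (h * partial j (partial i f) (x + s *\<^sub>R ?ei + t *\<^sub>R ?ej))"
    using s(3) t(3) by (simp add: add_ac)
  finally show ?thesis using s t by (auto simp: mult.assoc)
qed

lemma schwartz_partial_commute:
  assumes "schwartz f"
  shows "partial i (partial j f) = partial j (partial i f)"
proof
  fix x
  let ?h = "\<lambda>n. 1 / real (Suc n)"
  note d = schwartz_differentiable[OF assms] schwartz_differentiable[OF schwartz_partial[OF assms]]
  have "\<exists>p q. norm (p - x) \<le> 2 * ?h n \<and> norm (q - x) \<le> 2 * ?h n \<and> partial i (partial j f) p = partial j (partial i f) q" for n
  proof -
    have h: "?h n > 0" by simp
    obtain s t where st: "0 < s" "s < ?h n" "0 < t" "t < ?h n"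
      "f (x + ?h n *\<^sub>R axis i 1 + ?h n *\<^sub>R axis j 1) - f (x + ?h n *\<^sub>R axis i 1) - f (x + ?h n *\<^sub>R axis j 1) + f x
      = ?h n * ?h n * partial j (partial i f) (x + s *\<^sub>R axis i 1 + t *\<^sub>R axis j 1)"
      using mixed_difference_mean_value[OF d h] by blast
    obtain s' t' where st': "0 < s'" "s' < ?h n" "0 < t'" "t' < ?h n"
      "f (x + ?h n *\<^sub>R axis j 1 + ?h n *\<^sub>R axis i 1) - f (x + ?h n *\<^sub>R axis j 1) - f (x + ?h n *\<^sub>R axis i 1) + f x
      = ?h n * ?h n * partial i (partial j f) (x + s' *\<^sub>R axis j 1 + t' *\<^sub>R axis i 1)"
      using mixed_difference_mean_value[OF d h] by blast
    have "?h n * ?h n * partial j (partial i f) (x + s *\<^sub>R axis i 1 + t *\<^sub>R axis j 1)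
       = ?h n * ?h n * partial i (partial j f) (x + s' *\<^sub>R axis j 1 + t' *\<^sub>R axis i 1)"
    proof -
      have "x + ?h n *\<^sub>R axis j 1 + ?h n *\<^sub>R axis i 1 = x + ?h n *\<^sub>R axis i 1 + ?h n *\<^sub>R axis j 1"
        by (simp only: add_ac)
      from st'(5)[unfolded this] st(5) show ?thesis by linarith
    qed
    then have eq: "partial i (partial j f) (x + s' *\<^sub>R axis j 1 + t' *\<^sub>R axis i 1)
        = partial j (partial i f) (x + s *\<^sub>R axis i 1 + t *\<^sub>R axis j 1)" by simp
    have b: "norm ((x + a *\<^sub>R axis k 1 + b *\<^sub>R axis l 1) - x) \<le> 2 * ?h n" if "0 < a" "a < ?h n" "0 < b" "b < ?h n" for a b k l
    proof -
      have "norm ((x + a *\<^sub>R axis k 1 + b *\<^sub>R axis l 1) - x) \<le> norm (a *\<^sub>R axis k (1::real) :: real^'a) + norm (b *\<^sub>R axis l (1::real) :: real^'a)"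
        using norm_triangle_ineq[of "a *\<^sub>R axis k (1::real) :: real^'a" "b *\<^sub>R axis l (1::real)"]
        by (simp add: add.assoc)
      also have "\<dots> \<le> 2 * ?h n" using that by (simp add: norm_axis_1 del: of_nat_Suc)
      finally show ?thesis .
    qed
    show ?thesis using eq b st st' by blast
  qed
  then obtain p q where pq: "\<And>n. norm (p n - x) \<le> 2 * ?h n" "\<And>n. norm (q n - x) \<le> 2 * ?h n"
    "\<And>n. partial i (partial j f) (p n) = partial j (partial i f) (q n)" by metis
  have h0: "(\<lambda>n. 2 * ?h n) \<longlonglongrightarrow> 0" by real_asymp
  have lim: "r \<longlonglongrightarrow> x" if "\<And>n. norm (r n - x) \<le> 2 * ?h n" for r
  proof (rule LIM_zero_cancel)
    show "(\<lambda>n. r n - x) \<longlonglongrightarrow> 0"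
      by (rule Lim_null_comparison[OF _ h0]) (rule always_eventually, rule allI, rule that)
  qed
  have cont: "isCont (partial k (partial l f)) x" for k l
    using schwartz_continuous[OF schwartz_partial[OF schwartz_partial[OF assms]]] by (simp add: continuous_on_eq_continuous_at)
  have "(\<lambda>n. partial i (partial j f) (p n)) \<longlonglongrightarrow> partial i (partial j f) x"
    by (rule isCont_tendsto_compose[OF cont lim]) (rule pq)
  moreover have "(\<lambda>n. partial j (partial i f) (q n)) \<longlonglongrightarrow> partial j (partial i f) x"
    by (rule isCont_tendsto_compose[OF cont lim]) (rule pq)
  ultimately show "partial i (partial j f) x = partial j (partial i f) x"
    using pq(3) LIMSEQ_unique by simp
qed

section \<open>Commutators of the Euler operator, the Laplacian and multiplication by the squared
  norm\<close>

definition eul :: "(real^'n::finite \<Rightarrow> real) \<Rightarrow> real^'n \<Rightarrow> real" where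
  "eul f x = (\<Sum>i\<in>UNIV. x $ i * partial i f x)"

definition sq :: "(real^'n::finite \<Rightarrow> real) \<Rightarrow> real^'n \<Rightarrow> real" where
  "sq f x = (norm x)\<^sup>2 * f x"

lemma schwartz_laplacian: "schwartz f \<Longrightarrow> schwartz (laplacian f)"
  unfolding laplacian_def[abs_def] by (intro schwartz_sum schwartz_partial)

lemma schwartz_eul: "schwartz f \<Longrightarrow> schwartz (eul f)"
  unfolding eul_def[abs_def] by (intro schwartz_sum schwartz_component schwartz_partial)

lemma schwartz_sq: "schwartz f \<Longrightarrow> schwartz (sq f)"
proof -
  assume "schwartz f"
  then have "schwartz (\<lambda>x. \<Sum>i\<in>UNIV. x $ i * (x $ i * f x))" by (intro schwartz_sum schwartz_component)
  then show ?thesis unfolding sq_def[abs_def] norm_sq_sum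
    by (simp add: sum_distrib_right power2_eq_square mult.assoc)
qed

lemmas schwartz_intros = schwartz_add schwartz_diff schwartz_uminus schwartz_cmult schwartz_mult schwartz_zero schwartz_sum
  schwartz_partial schwartz_laplacian schwartz_eul schwartz_sq

lemma partial_sum:
  assumes "\<And>k. k \<in> I \<Longrightarrow> schwartz (f k)"
  shows "partial i (\<lambda>x. \<Sum>k\<in>I. f k x) x = (\<Sum>k\<in>I. partial i (f k) x)"
  using assms
  by (induction I rule: infinite_finite_induct) (simp_all add: partial_add schwartz_differentiable schwartz_sum)

lemma laplacian_add: "schwartz f \<Longrightarrow> schwartz g \<Longrightarrow> laplacian (\<lambda>x. f x + g x) = (\<lambda>x. laplacian f x + laplacian g x)"
proof -
  assume *: "schwartz f" "schwartz g"
  then have "partial i (\<lambda>x. f x + g x) = (\<lambda>x. partial i f x + partial i g x)" for i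
    by (auto simp: partial_add schwartz_differentiable)
  with * show ?thesis by (auto simp: laplacian_def partial_add schwartz_differentiable schwartz_partial sum.distrib)
qed

lemma laplacian_cmult: "schwartz f \<Longrightarrow> laplacian (\<lambda>x. c * f x) = (\<lambda>x. c * laplacian f x)"
proof -
  assume *: "schwartz f"
  then have "partial i (\<lambda>x. c * f x) = (\<lambda>x. c * partial i f x)" for i
    by (auto simp: partial_cmult schwartz_differentiable)
  with * show ?thesis by (auto simp: laplacian_def partial_cmult schwartz_differentiable schwartz_partial sum_distrib_left)
qed

lemma eul_add: "schwartz f \<Longrightarrow> schwartz g \<Longrightarrow> eul (\<lambda>x. f x + g x) = (\<lambda>x. eul f x + eul g x)"
  by (auto simp: eul_def partial_add schwartz_differentiable sum.distrib distrib_left)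

lemma eul_cmult: "schwartz f \<Longrightarrow> eul (\<lambda>x. c * f x) = (\<lambda>x. c * eul f x)"
  by (auto simp: eul_def partial_cmult schwartz_differentiable sum_distrib_left mult.left_commute)

lemma sq_add: "sq (\<lambda>x. f x + g x) = (\<lambda>x. sq f x + sq g x)"
  by (auto simp: sq_def distrib_left)

lemma sq_cmult: "sq (\<lambda>x. c * f x) = (\<lambda>x. c * sq f x)"
  by (auto simp: sq_def)

lemma laplacian_diff: "schwartz f \<Longrightarrow> schwartz g \<Longrightarrow> laplacian (\<lambda>x. f x - g x) = (\<lambda>x. laplacian f x - laplacian g x)"
  using laplacian_add[of f "\<lambda>x. -1 * g x"] laplacian_cmult[of g "-1"] schwartz_cmult[of g "-1"] by simp

lemma eul_diff: "schwartz f \<Longrightarrow> schwartz g \<Longrightarrow> eul (\<lambda>x. f x - g x) = (\<lambda>x. eul f x - eul g x)"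
  using eul_add[of f "\<lambda>x. -1 * g x"] eul_cmult[of g "-1"] schwartz_cmult[of g "-1"] by simp

lemma sq_diff: "sq (\<lambda>x. f x - g x) = (\<lambda>x. sq f x - sq g x)"
  by (auto simp: sq_def right_diff_distrib)

lemmas op_linear = laplacian_add laplacian_cmult laplacian_diff eul_add eul_cmult eul_diff sq_add sq_cmult sq_diff

lemma laplacian_zero [simp]: "laplacian (\<lambda>x. 0::real) = (\<lambda>x. 0)" by (auto simp: laplacian_def)
lemma eul_zero [simp]: "eul (\<lambda>x. 0) = (\<lambda>x. 0)" by (auto simp: eul_def)
lemma sq_zero [simp]: "sq (\<lambda>x. 0) = (\<lambda>x. 0)" by (auto simp: sq_def)

lemma laplacian_sum:
  "(\<And>k. k \<in> I \<Longrightarrow> schwartz (f k)) \<Longrightarrow> laplacian (\<lambda>x. \<Sum>k\<in>I. f k x) = (\<lambda>x. \<Sum>k\<in>I. laplacian (f k) x)"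
  by (induction I rule: infinite_finite_induct) (simp_all add: laplacian_add schwartz_sum)

lemma eul_sum:
  "(\<And>k. k \<in> I \<Longrightarrow> schwartz (f k)) \<Longrightarrow> eul (\<lambda>x. \<Sum>k\<in>I. f k x) = (\<lambda>x. \<Sum>k\<in>I. eul (f k) x)"
  by (induction I rule: infinite_finite_induct) (simp_all add: eul_add schwartz_sum)

lemma sq_sum: "sq (\<lambda>x. \<Sum>k\<in>I. f k x) = (\<lambda>x. \<Sum>k\<in>I. sq (f k) x)"
  by (auto simp: sq_def sum_distrib_left)

lemma partial_eul:
  assumes f: "schwartz f"
  shows "partial j (eul f) = (\<lambda>x. eul (partial j f) x + partial j f x)"
proof
  fix x
  have "partial j (eul f) x = (\<Sum>i\<in>UNIV. partial j (\<lambda>x. x $ i * partial i f x) x)"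
    unfolding eul_def[abs_def] by (rule partial_sum) (intro schwartz_component schwartz_partial f)
  also have "\<dots> = (\<Sum>i\<in>UNIV. x $ i * partial i (partial j f) x + (if j = i then partial i f x else 0))"
    by (intro sum.cong refl)
       (simp add: partial_mult differentiable_component schwartz_differentiable schwartz_partial f
          schwartz_partial_commute[OF f, of _ j])
  finally show "partial j (eul f) x = eul (partial j f) x + partial j f x"
    by (simp add: eul_def sum.distrib)
qed

text \<open>Together with \<open>laplacian_sq\<close> and \<open>eul_sq\<close> these are the
  relations of the sl(2) triple formed by \<open>laplacian\<close>, \<open>sq\<close> and a shift of
  \<open>eul\<close>; the operator identities for \<open>op\<close> and \<open>ang\<close> reduce to
  them.\<close>

lemma laplacian_eul:
  assumes f: "schwartz f"
  shows "laplacian (eul f) = (\<lambda>x. eul (laplacian f) x + 2 * laplacian f x)"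
proof
  fix x
  have "partial j (partial j (eul f)) x = eul (partial j (partial j f)) x + 2 * partial j (partial j f) x" for j
    using f by (simp add: partial_eul partial_add schwartz_differentiable schwartz_intros)
  then have "laplacian (eul f) x = (\<Sum>j\<in>UNIV. eul (partial j (partial j f)) x) + 2 * laplacian f x"
    by (simp add: laplacian_def sum.distrib sum_distrib_left)
  also have "(\<Sum>j\<in>UNIV. eul (partial j (partial j f)) x) = eul (laplacian f) x"
    unfolding laplacian_def[abs_def] using f by (simp add: eul_sum schwartz_intros)
  finally show "laplacian (eul f) x = eul (laplacian f) x + 2 * laplacian f x" .
qed

lemma partial_sq:
  assumes f: "schwartz f"
  shows "partial j (sq f) = (\<lambda>x. sq (partial j f) x + 2 * (x $ j * f x))"
  using f unfolding sq_def[abs_def]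
  by (auto simp: partial_mult differentiable_norm_sq schwartz_differentiable partial_norm_sq)

lemma partial_component_mult:
  assumes f: "schwartz f"
  shows "partial j (\<lambda>x. x $ i * f x) = (\<lambda>x. x $ i * partial j f x + (if j = i then f x else 0))"
  using f by (auto simp: partial_mult differentiable_component schwartz_differentiable)

lemma laplacian_sq:
  fixes f :: "real^'n::finite \<Rightarrow> real"
  assumes f: "schwartz f"
  shows "laplacian (sq f) = (\<lambda>x. sq (laplacian f) x + 4 * eul f x + 2 * real CARD('n) * f x)"
proof
  fix x
  have "partial j (partial j (sq f)) x = sq (partial j (partial j f)) x + 4 * (x $ j * partial j f x) + 2 * f x" for j
    using f by (simp add: partial_sq partial_add partial_cmult schwartz_differentiable schwartz_intros schwartz_component
        partial_component_mult)
  then show "laplacian (sq f) x = sq (laplacian f) x + 4 * eul f x + 2 * real CARD('n) * f x"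
    by (simp add: laplacian_def sum.distrib sum_distrib_left sq_def eul_def)
qed

lemma eul_sq:
  assumes f: "schwartz f"
  shows "eul (sq f) = (\<lambda>x. sq (eul f) x + 2 * sq f x)"
proof
  fix x
  have "eul (sq f) x = (\<Sum>i\<in>UNIV. sq (\<lambda>x. x $ i * partial i f x) x) + 2 * (\<Sum>i\<in>UNIV. (x $ i)\<^sup>2) * f x"
    unfolding eul_def partial_sq[OF f]
    by (simp add: distrib_left sum.distrib sum_distrib_left sum_distrib_right sq_def power2_eq_square mult_ac)
  then show "eul (sq f) x = sq (eul f) x + 2 * sq f x"
    by (simp add: sq_def eul_def norm_sq_sum sum_distrib_left)
qed

section \<open>The inner product\<close>

definition ip :: "(real^'n::finite \<Rightarrow> real) \<Rightarrow> (real^'n \<Rightarrow> real) \<Rightarrow> real" where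
  "ip f g = (LINT x|lborel. f x * g x)"

abbreviation isq :: "(real^'n::finite \<Rightarrow> real) \<Rightarrow> real" where "isq f \<equiv> ip f f"

lemma ip_commute: "ip f g = ip g f" by (simp add: ip_def mult.commute)

lemma ip_integrable: "schwartz f \<Longrightarrow> schwartz g \<Longrightarrow> integrable lborel (\<lambda>x. f x * g x)"
  by (intro schwartz_integrable schwartz_mult)

lemma ip_add_left: "schwartz f \<Longrightarrow> schwartz g \<Longrightarrow> schwartz h \<Longrightarrow> ip (\<lambda>x. f x + g x) h = ip f h + ip g h"
  by (simp add: ip_def distrib_right Bochner_Integration.integral_add ip_integrable)
lemma ip_diff_left: "schwartz f \<Longrightarrow> schwartz g \<Longrightarrow> schwartz h \<Longrightarrow> ip (\<lambda>x. f x - g x) h = ip f h - ip g h"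
  by (simp add: ip_def left_diff_distrib Bochner_Integration.integral_diff ip_integrable)
lemma ip_cmult_left: "ip (\<lambda>x. c * f x) h = c * ip f h"
  by (simp add: ip_def mult.assoc)
lemma ip_add_right: "schwartz f \<Longrightarrow> schwartz g \<Longrightarrow> schwartz h \<Longrightarrow> ip h (\<lambda>x. f x + g x) = ip h f + ip h g"
  by (simp add: ip_commute[of h] ip_add_left)
lemma ip_diff_right: "schwartz f \<Longrightarrow> schwartz g \<Longrightarrow> schwartz h \<Longrightarrow> ip h (\<lambda>x. f x - g x) = ip h f - ip h g"
  by (simp add: ip_commute[of h] ip_diff_left)
lemma ip_cmult_right: "ip h (\<lambda>x. c * f x) = c * ip h f"
  by (simp add: ip_commute[of h] ip_cmult_left)
lemma ip_zero [simp]: "ip (\<lambda>x. 0) g = 0" "ip g (\<lambda>x. 0) = 0" by (simp_all add: ip_def)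

lemmas ip_linear = ip_add_left ip_diff_left ip_cmult_left ip_add_right ip_diff_right ip_cmult_right

lemma ip_sum_left: "(\<And>k. k \<in> I \<Longrightarrow> schwartz (f k)) \<Longrightarrow> schwartz g \<Longrightarrow> ip (\<lambda>x. \<Sum>k\<in>I. f k x) g = (\<Sum>k\<in>I. ip (f k) g)"
  by (induction I rule: infinite_finite_induct) (simp_all add: ip_add_left schwartz_sum)
lemma ip_sum_right: "(\<And>k. k \<in> I \<Longrightarrow> schwartz (f k)) \<Longrightarrow> schwartz g \<Longrightarrow> ip g (\<lambda>x. \<Sum>k\<in>I. f k x) = (\<Sum>k\<in>I. ip g (f k))"
  by (simp add: ip_commute[of g] ip_sum_left)

lemma ip_nonneg: "ip f f \<ge> 0" by (simp add: ip_def)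

lemma ip_partial:
  assumes "schwartz f" "schwartz g"
  shows "ip (partial i f) g = - ip f (partial i g)"
proof -
  have s: "schwartz (\<lambda>x. f x * g x)" using assms by (rule schwartz_mult)
  have "partial i (\<lambda>x. f x * g x) = (\<lambda>x. f x * partial i g x + partial i f x * g x)"
    using assms by (auto simp: partial_mult schwartz_differentiable)
  moreover have "(LINT x|lborel. partial i (\<lambda>x. f x * g x) x) = 0"
    by (rule integral_partial_eq_0) (auto intro: s schwartz_integrable schwartz_differentiable schwartz_continuous schwartz_decays schwartz_partial)
  ultimately have "ip f (partial i g) + ip (partial i f) g = 0"
    using assms by (simp add: ip_def ip_integrable schwartz_partial Bochner_Integration.integral_add)
  then show ?thesis by simp
qed

lemma ip_partial_partial:
  assumes "schwartz f" "schwartz g"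
  shows "(\<Sum>i\<in>UNIV. ip (partial i f) (partial i g)) = - ip (laplacian f) g"
proof -
  have "- ip (laplacian f) g = (\<Sum>i\<in>UNIV. - ip (partial i (partial i f)) g)"
    unfolding laplacian_def[abs_def] using assms by (simp add: ip_sum_left schwartz_intros sum_negf)
  also have "\<dots> = (\<Sum>i\<in>UNIV. ip (partial i f) (partial i g))"
    using assms by (simp add: ip_partial schwartz_intros)
  finally show ?thesis by simp
qed

lemma ip_laplacian: "schwartz f \<Longrightarrow> schwartz g \<Longrightarrow> ip (laplacian f) g = ip f (laplacian g)"
  using ip_partial_partial[of f g] ip_partial_partial[of g f] by (simp add: ip_commute)

lemma ip_eul:
  fixes f g :: "real^'n::finite \<Rightarrow> real"
  assumes "schwartz f" "schwartz g"
  shows "ip (eul f) g = - ip f (eul g) - real CARD('n) * ip f g"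
proof -
  have *: "ip (\<lambda>x. x $ i * partial i f x) g = - ip f (\<lambda>x. x $ i * partial i g x) - ip f g" for i
  proof -
    have "ip (\<lambda>x. x $ i * partial i f x) g = ip (partial i f) (\<lambda>x. x $ i * g x)"
      by (simp add: ip_def mult_ac)
    also have "\<dots> = - ip f (partial i (\<lambda>x. x $ i * g x))" by (intro ip_partial schwartz_component assms)
    also have "partial i (\<lambda>x. x $ i * g x) = (\<lambda>x. x $ i * partial i g x + g x)"
      using partial_component_mult[OF assms(2)] by auto
    finally show ?thesis using assms by (simp add: ip_add_right schwartz_component schwartz_intros)
  qed
  have "ip (eul f) g = (\<Sum>i\<in>UNIV. ip (\<lambda>x. x $ i * partial i f x) g)"
    unfolding eul_def[abs_def] using assms by (intro ip_sum_left schwartz_component schwartz_partial) auto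
  also have "\<dots> = - (\<Sum>i\<in>UNIV. ip f (\<lambda>x. x $ i * partial i g x)) - real CARD('n) * ip f g"
    by (simp add: * sum_subtractf sum_negf)
  also have "(\<Sum>i\<in>UNIV. ip f (\<lambda>x. x $ i * partial i g x)) = ip f (eul g)"
    unfolding eul_def[abs_def] using assms by (intro ip_sum_right[symmetric] schwartz_component schwartz_partial) auto
  finally show ?thesis .
qed

lemma ip_sq: "ip (sq f) g = ip f (sq g)"
  by (simp add: ip_def sq_def mult_ac)

section \<open>The Dirichlet form, its weighted version and the Hessian\<close>

definition gip :: "(real^'n::finite \<Rightarrow> real) \<Rightarrow> (real^'n \<Rightarrow> real) \<Rightarrow> real" where
  "gip f g = (\<Sum>i\<in>UNIV. ip (partial i f) (partial i g))"

abbreviation gsq :: "(real^'n::finite \<Rightarrow> real) \<Rightarrow> real" where "gsq f \<equiv> gip f f"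

definition xip :: "(real^'n::finite \<Rightarrow> real) \<Rightarrow> (real^'n \<Rightarrow> real) \<Rightarrow> real" where
  "xip f g = (\<Sum>i\<in>UNIV. ip (sq (partial i f)) (partial i g))"

lemma gip_eq: "schwartz f \<Longrightarrow> schwartz g \<Longrightarrow> gip f g = - ip (laplacian f) g"
  unfolding gip_def by (rule ip_partial_partial)

lemma xip_eq:
  assumes "schwartz f" "schwartz g"
  shows "xip f g = - ip (sq (laplacian f)) g - 2 * ip (eul f) g"
proof -
  have "ip (sq (partial i f)) (partial i g) = - ip (sq (partial i (partial i f))) g - 2 * ip (\<lambda>x. x $ i * partial i f x) g" for i
  proof -
    have "ip (sq (partial i f)) (partial i g) = - ip (partial i (sq (partial i f))) g"
      using ip_partial[of "sq (partial i f)" g i] assms by (simp add: schwartz_intros)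
    then show ?thesis using assms
      by (simp add: partial_sq schwartz_intros schwartz_component ip_add_left ip_cmult_left)
  qed
  then have "xip f g = - (\<Sum>i\<in>UNIV. ip (sq (partial i (partial i f))) g) - 2 * (\<Sum>i\<in>UNIV. ip (\<lambda>x. x $ i * partial i f x) g)"
    by (simp add: xip_def sum_subtractf sum_negf sum_distrib_left)
  also have "(\<Sum>i\<in>UNIV. ip (sq (partial i (partial i f))) g) = ip (sq (laplacian f)) g"
    unfolding laplacian_def[abs_def] sq_sum using assms by (simp add: ip_sum_left schwartz_intros)
  also have "(\<Sum>i\<in>UNIV. ip (\<lambda>x. x $ i * partial i f x) g) = ip (eul f) g"
    unfolding eul_def[abs_def] using assms by (simp add: ip_sum_left schwartz_intros schwartz_component)
  finally show ?thesis .
qed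

text \<open>Two integrations by parts and the symmetry of mixed partials. This reconciles the
  deficit, which contains the full Jacobian of the gradient, with the seminorm and the
  factorisations, which contain only the Laplacian.\<close>

lemma ip_hessian:
  assumes "schwartz f"
  shows "(\<Sum>i\<in>UNIV. \<Sum>j\<in>UNIV. isq (partial j (partial i f))) = isq (laplacian f)"
proof -
  have "(\<Sum>j\<in>UNIV. isq (partial j (partial i f))) = ip (partial i (partial i f)) (laplacian f)" for i
  proof -
    have "(\<Sum>j\<in>UNIV. isq (partial j (partial i f))) = - ip (partial i f) (laplacian (partial i f))"
      using ip_partial_partial[of "partial i f" "partial i f"] assms by (simp add: schwartz_intros ip_commute)
    also have "laplacian (partial i f) = partial i (laplacian f)"
    proof
      fix x
      have "partial j (partial j (partial i f)) x = partial i (partial j (partial j f)) x" for j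
        using schwartz_partial_commute[OF assms, of j i] schwartz_partial_commute[OF schwartz_partial[OF assms], of j i j] by simp
      then show "laplacian (partial i f) x = partial i (laplacian f) x"
        unfolding laplacian_def[abs_def] using assms by (simp add: partial_sum schwartz_intros)
    qed
    also have "- ip (partial i f) (partial i (laplacian f)) = ip (partial i (partial i f)) (laplacian f)"
      using assms by (simp add: ip_partial schwartz_intros)
    finally show ?thesis .
  qed
  then show ?thesis
    unfolding laplacian_def[abs_def] using assms by (simp add: ip_sum_left schwartz_intros laplacian_def[abs_def, symmetric])
qed

section \<open>First-order factorisations\<close>

text \<open>The operator A at \<open>l = \<lambda>\<close>. The two-parameter family is closed under
  formal adjoints (\<open>op_adjoint\<close>) and intertwined with itself by the Laplacian
  (\<open>laplacian_op\<close>), so that A, its adjoint and all partners are instances of one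
  definition.\<close>

definition op :: "real \<Rightarrow> real \<Rightarrow> (real^'n::finite \<Rightarrow> real) \<Rightarrow> real^'n \<Rightarrow> real" where
  "op l c f x = laplacian f x + l * (eul f x + c * f x)"

lemma schwartz_op: "schwartz f \<Longrightarrow> schwartz (op l c f)"
  unfolding op_def[abs_def] by (intro schwartz_intros)

lemma op_add: "schwartz f \<Longrightarrow> schwartz g \<Longrightarrow> op l c (\<lambda>x. f x + g x) = (\<lambda>x. op l c f x + op l c g x)"
  by (auto simp: op_def op_linear algebra_simps)

lemma op_cmult: "schwartz f \<Longrightarrow> op l c (\<lambda>x. a * f x) = (\<lambda>x. a * op l c f x)"
  by (auto simp: op_def op_linear algebra_simps)

lemma op_diff: "schwartz f \<Longrightarrow> schwartz g \<Longrightarrow> op l c (\<lambda>x. f x - g x) = (\<lambda>x. op l c f x - op l c g x)"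
  by (auto simp: op_def op_linear algebra_simps)

lemma op_adjoint:
  fixes f g :: "real^'n::finite \<Rightarrow> real"
  assumes "schwartz f" "schwartz g"
  shows "ip (op l c f) g = ip f (op (- l) (real CARD('n) - c) g)"
  unfolding op_def[abs_def] using assms
  by (simp add: ip_linear schwartz_intros ip_laplacian ip_eul) (simp add: algebra_simps)

lemma laplacian_op: "schwartz f \<Longrightarrow> laplacian (op l c f) = op l (c + 2) (laplacian f)"
  unfolding op_def[abs_def] by (auto simp: op_linear laplacian_eul schwartz_intros algebra_simps)

text \<open>The Euler parts commute with each other; what survives is the commutator of the
  Laplacian with \<open>eul\<close>, once from each factor and with the same sign.\<close>

lemma op_op_commute:
  assumes "schwartz f"
  shows "op l c (op (- l) c' f) x = op (- l) c' (op l c f) x - 4 * l * laplacian f x"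
  unfolding op_def[abs_def] using assms
  by (simp add: op_linear laplacian_eul schwartz_intros algebra_simps)

lemma ip_eul_self: "schwartz f \<Longrightarrow> 2 * ip (eul f) f = - real CARD('n) * ip f f" for f :: "real^'n::finite \<Rightarrow> real"
  using ip_eul[of f f] by (simp add: ip_commute)

text \<open>The Rellich-Pohozaev identity: the Laplacian is moved to the other side, commuted with
  \<open>eul\<close>, and \<open>eul\<close> is moved back.\<close>

lemma ip_laplacian_eul: "schwartz f \<Longrightarrow> 2 * ip (laplacian f) (eul f) = (2 - real CARD('n)) * ip (laplacian f) f"
  for f :: "real^'n::finite \<Rightarrow> real"
proof -
  assume f: "schwartz f"
  have "ip (laplacian f) (eul f) = ip f (laplacian (eul f))" using f by (simp add: ip_laplacian schwartz_intros)
  also have "\<dots> = ip f (eul (laplacian f)) + 2 * ip f (laplacian f)" using f by (simp add: laplacian_eul ip_linear schwartz_intros)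
  also have "ip f (eul (laplacian f)) = - ip (laplacian f) (eul f) - real CARD('n) * ip (laplacian f) f"
    using ip_eul[of "laplacian f" f] f by (simp add: schwartz_intros ip_commute)
  finally show ?thesis by (simp add: algebra_simps ip_commute[of f])
qed

lemma ip_op_self:
  fixes f :: "real^'n::finite \<Rightarrow> real"
  assumes "schwartz f"
  shows "isq (op l c f) = isq (laplacian f) + l * (2 * c + 2 - real CARD('n)) * ip (laplacian f) f
     + l\<^sup>2 * (isq (eul f) + c * (c - real CARD('n)) * ip f f)"
proof -
  have "isq (op l c f) = isq (laplacian f) + l * (2 * ip (laplacian f) (eul f) + 2 * c * ip (laplacian f) f)
     + l\<^sup>2 * (isq (eul f) + c * (2 * ip (eul f) f) + c\<^sup>2 * ip f f)"
    unfolding op_def[abs_def] using assms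
    by (simp add: ip_linear schwartz_intros ip_commute[of f "eul f"] ip_commute[of f "laplacian f"] ip_commute[of "eul f" "laplacian f"])
       (simp add: algebra_simps power2_eq_square)
  also have "\<dots> = isq (laplacian f) + l * ((2 - real CARD('n)) * ip (laplacian f) f + 2 * c * ip (laplacian f) f)
     + l\<^sup>2 * (isq (eul f) + c * (- real CARD('n) * ip f f) + c\<^sup>2 * ip f f)"
    by (simp only: ip_laplacian_eul[OF assms] ip_eul_self[OF assms])
  finally show ?thesis by (simp add: algebra_simps power2_eq_square)
qed

text \<open>The form of the right-hand side prepares the partner identity. With
  \<open>m = c + 2 - N\<close>, replacing (l, c) by (-l, -m) preserves the product
  \<open>c * (c + 2 - N)\<close> and hence the whole quadratic coefficient in \<open>l\<close>; only
  the linear coefficient changes, and it changes by exactly 4.\<close>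

lemma gip_op_self:
  fixes f :: "real^'n::finite \<Rightarrow> real"
  assumes "schwartz f"
  defines "w \<equiv> laplacian f"
  shows "gsq (op l c f) = - ip (laplacian w) w - l * (2 * c + 4 - real CARD('n)) * ip w w
     - l\<^sup>2 * (ip (eul w) (eul f) + (2 - real CARD('n)) * ip w f + c * (c + 2 - real CARD('n)) * ip w f)"
proof -
  have w: "schwartz w" unfolding w_def by (intro schwartz_intros assms)
  have "gsq (op l c f) = - ip (op l (c + 2) w) (op l c f)"
    unfolding w_def using assms by (simp add: gip_eq schwartz_op laplacian_op)
  also have "\<dots> = - (ip (laplacian w) w + l * (ip (laplacian w) (eul f) + c * ip (laplacian w) f + ip (eul w) w + (c + 2) * ip w w)
     + l\<^sup>2 * (ip (eul w) (eul f) + c * ip (eul w) f + (c + 2) * ip w (eul f) + c * (c + 2) * ip w f))"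
    unfolding op_def[abs_def] w_def[symmetric] using assms(1) w
    by (simp add: ip_linear schwartz_intros) (simp add: algebra_simps power2_eq_square)
  also have "ip (laplacian w) (eul f) = ip (eul w) w + 2 * ip w w"
    using assms w by (simp add: ip_laplacian schwartz_intros laplacian_eul w_def[symmetric] ip_linear ip_commute[of w "eul w"])
  also have "ip (laplacian w) f = ip w w"
    using assms w by (simp add: ip_laplacian w_def[symmetric])
  finally show ?thesis
    using ip_eul[OF w assms(1)] ip_eul_self[OF w] ip_laplacian_eul[OF assms(1), folded w_def] by algebra
qed

text \<open>The supersymmetric partner identities: they replace \<open>A A\<^sup>* = A'\<^sup>* A' + 4\<lambda>\<close> and its successor for the
  harmonic oscillator with an inverse-square potential that appears after a Fourier transform.\<close>

lemma gip_op_partner: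
  fixes f :: "real^'n::finite \<Rightarrow> real"
  assumes "schwartz f" "m = c + 2 - real CARD('n)"
  shows "gsq (op (- l) (- m) f) = gsq (op l c f) + 4 * l * isq (laplacian f)"
  unfolding gip_op_self[OF assms(1)] assms(2) by (simp add: algebra_simps power2_eq_square)

lemma ip_op_partner:
  fixes f :: "real^'n::finite \<Rightarrow> real"
  assumes "schwartz f" "m = c + 2 - real CARD('n)"
  shows "isq (op (- l) (- m) f) = isq (op l (c + 2) f) + 4 * l * gip f f"
  unfolding ip_op_self[OF assms(1)] gip_eq[OF assms(1,1)] assms(2) by (simp add: algebra_simps power2_eq_square)

text \<open>The shift by 2 in \<open>laplacian_op\<close> turns -m into N - c, which is the
  parameter of the adjoint of \<open>op l c\<close>. In particular a function annihilated by
  \<open>op l c\<close> is orthogonal, in the gradient form, to the image of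
  \<open>op (- l) (- m)\<close>.\<close>

lemma gip_op_right:
  fixes u z :: "real^'n::finite \<Rightarrow> real"
  assumes "schwartz u" "schwartz z" "m = c + 2 - real CARD('n)"
  shows "gip u (op (- l) (- m) z) = - ip (op l c u) (laplacian z)"
proof -
  have "gip u (op (- l) (- m) z) = - ip (laplacian (op (- l) (- m) z)) u"
    using assms by (simp add: gip_def ip_commute[of "partial _ u"] gip_eq[unfolded gip_def] schwartz_op)
  also have "\<dots> = - ip u (op (- l) (- m + 2) (laplacian z))" using assms by (simp add: laplacian_op ip_commute)
  also have "- m + 2 = real CARD('n) - c" using assms by simp
  finally show ?thesis using assms by (simp add: op_adjoint schwartz_intros)
qed

section \<open>Angular sectors\<close>

text \<open>\<open>ang\<close> is minus the spherical Laplacian, \<open>-\<Delta>\<^sub>S = (x\<cdot>\<nabla>)\<^sup>2 + (N-2) x\<cdot>\<nabla> - |x|\<^sup>2 \<Delta>\<close>.\<close>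

definition ang :: "(real^'n::finite \<Rightarrow> real) \<Rightarrow> real^'n \<Rightarrow> real" where
  "ang f x = eul (eul f) x + (real CARD('n) - 2) * eul f x - sq (laplacian f) x"

definition sector :: "real \<Rightarrow> (real^'n::finite \<Rightarrow> real) \<Rightarrow> bool" where
  "sector \<mu> f \<longleftrightarrow> schwartz f \<and> ang f = (\<lambda>x. \<mu> * f x)"

lemma ang_self_adjoint:
  assumes "schwartz f" "schwartz g" shows "ip (ang f) g = ip f (ang g)"
  unfolding ang_def[abs_def] using assms
  by (simp add: ip_linear schwartz_intros ip_eul ip_sq ip_laplacian laplacian_sq) (simp add: algebra_simps)

lemma ang_laplacian: "schwartz f \<Longrightarrow> ang (laplacian f) = laplacian (ang f)"
  unfolding ang_def[abs_def]
  by (rule ext) (simp add: op_linear schwartz_intros laplacian_eul laplacian_sq, simp add: algebra_simps)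

lemma ang_eul: "schwartz f \<Longrightarrow> ang (eul f) = eul (ang f)"
  unfolding ang_def[abs_def]
  by (rule ext) (simp add: op_linear schwartz_intros laplacian_eul eul_sq)

lemma ang_sq: "schwartz f \<Longrightarrow> ang (sq f) = sq (ang f)"
  unfolding ang_def[abs_def]
  by (rule ext) (simp add: op_linear schwartz_intros laplacian_eul laplacian_sq eul_sq, simp add: algebra_simps)

lemma ang_add: "schwartz f \<Longrightarrow> schwartz g \<Longrightarrow> ang (\<lambda>x. f x + g x) = (\<lambda>x. ang f x + ang g x)"
  unfolding ang_def[abs_def] by (auto simp: op_linear schwartz_intros algebra_simps)

lemma sector_schwartz: "sector \<mu> f \<Longrightarrow> schwartz f" by (simp add: sector_def)
lemma sector_laplacian: "sector \<mu> f \<Longrightarrow> sector \<mu> (laplacian f)"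
  by (auto simp: sector_def schwartz_intros ang_laplacian laplacian_cmult)
lemma sector_eul: "sector \<mu> f \<Longrightarrow> sector \<mu> (eul f)"
  by (auto simp: sector_def schwartz_intros ang_eul eul_cmult)
lemma sector_sq: "sector \<mu> f \<Longrightarrow> sector \<mu> (sq f)"
  by (auto simp: sector_def schwartz_intros ang_sq sq_cmult)
lemma sector_add: "sector \<mu> f \<Longrightarrow> sector \<mu> g \<Longrightarrow> sector \<mu> (\<lambda>x. f x + g x)"
  by (auto simp: sector_def schwartz_intros ang_add algebra_simps)
lemma sector_orthogonal:
  assumes "sector \<mu> f" "sector \<nu> g" "\<mu> \<noteq> \<nu>" shows "ip f g = 0"
proof -
  have "\<mu> * ip f g = \<nu> * ip f g"
    using ang_self_adjoint[of f g] assms by (simp add: sector_def ip_linear)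
  then show ?thesis using assms(3) by simp
qed

text \<open>\<open>2\<lambda>\<close> times the deficit, with the product of norms replaced by the larger mean
  \<open>(\<parallel>\<Delta>f\<parallel>\<^sup>2/\<lambda> + \<lambda> \<parallel>|x|\<nabla>f\<parallel>\<^sup>2)/2\<close>.\<close>

definition qform :: "real \<Rightarrow> (real^'n::finite \<Rightarrow> real) \<Rightarrow> (real^'n \<Rightarrow> real) \<Rightarrow> real" where
  "qform l f g = ip (laplacian f) (laplacian g) + l\<^sup>2 * xip f g - (real CARD('n) + 2) * l * gip f g"

text \<open>The eigenvalue equation for \<open>ang\<close> expresses |x|^2 times the Laplacian
  through \<open>eul\<close>, so the weighted form becomes the sum of a radial part
  \<open>isq (eul f)\<close> and an angular part \<mu> \<open>isq f\<close>. Then the square of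
  \<open>op l c f\<close> can be completed, and c is the root of c (c - N) = \<mu> that makes the
  zero-order terms agree.\<close>

lemma qform_sector:
  fixes f :: "real^'n::finite \<Rightarrow> real"
  assumes "sector \<mu> f" "\<mu> = c * (c - real CARD('n))"
  shows "qform l f f = 2 * (c - real CARD('n)) * l * gip f f + isq (op l c f)"
proof -
  have f: "schwartz f" using assms sector_schwartz by blast
  have "sq (laplacian f) = (\<lambda>x. eul (eul f) x + (real CARD('n) - 2) * eul f x - \<mu> * f x)"
    using assms(1) by (auto simp: sector_def ang_def fun_eq_iff algebra_simps)
  then have "ip (sq (laplacian f)) f = ip (eul (eul f)) f + (real CARD('n) - 2) * ip (eul f) f - \<mu> * ip f f"
    using f by (simp add: ip_linear schwartz_intros)
  also have "ip (eul (eul f)) f = - isq (eul f) - real CARD('n) * ip (eul f) f"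
    using f by (simp add: ip_eul[of "eul f"] schwartz_intros)
  finally have "xip f f = isq (eul f) + \<mu> * ip f f"
    using f by (simp add: xip_eq algebra_simps)
  then show ?thesis
    unfolding qform_def ip_op_self[OF f] gip_eq[OF f f] assms(2) by algebra
qed

lemma gip_sector_orthogonal:
  assumes "sector \<mu> f" "sector \<nu> g" "\<mu> \<noteq> \<nu>" shows "gip f g = 0"
  using assms sector_orthogonal[OF sector_laplacian[OF assms(1)] assms(2,3)]
  by (simp add: gip_eq sector_schwartz)

lemma qform_sector_orthogonal:
  assumes "sector \<mu> f" "sector \<nu> g" "\<mu> \<noteq> \<nu>" shows "qform l f g = 0"
  using assms sector_orthogonal[OF sector_laplacian[OF assms(1)] sector_laplacian[OF assms(2)] assms(3)]
    sector_orthogonal[OF sector_sq[OF sector_laplacian[OF assms(1)]] assms(2,3)]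
    sector_orthogonal[OF sector_eul[OF assms(1)] assms(2,3)]
  by (simp add: qform_def gip_sector_orthogonal xip_eq sector_schwartz)

section \<open>Polynomials and solid harmonics\<close>

lemma partial_scale:
  fixes f :: "real^'n::finite \<Rightarrow> 'b::real_normed_vector"
  assumes "f differentiable (at (t *\<^sub>R x))"
  shows "partial i (\<lambda>y. f (t *\<^sub>R y)) x = t *\<^sub>R partial i f (t *\<^sub>R x)"
proof -
  have "((\<lambda>y. t *\<^sub>R y) has_derivative (\<lambda>h. t *\<^sub>R h)) (at x)" by (auto intro!: derivative_eq_intros)
  from partial_eqI[OF has_derivative_compose[OF this has_derivative_partial[OF assms]]]
  show ?thesis by (simp add: axis_def if_distrib[of "\<lambda>z. z *\<^sub>R _"] if_distrib[of "\<lambda>z. _ * z"] cong: if_cong)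
qed

lemma polynomial_partial:
  fixes p :: "real^'n::finite \<Rightarrow> real"
  shows "real_polynomial_function p \<Longrightarrow> real_polynomial_function (partial i p)"
proof (induction p rule: real_polynomial_function.induct)
  case (linear l)
  have "partial i l = (\<lambda>x. l (axis i 1))" using linear by (auto simp: partial_bounded_linear)
  then show ?case by (simp add: real_polynomial_function.intros(2))
next
  case (const c) then show ?case by (simp add: real_polynomial_function.intros(2))
next
  case (add p q)
  then have "partial i (\<lambda>x. p x + q x) = (\<lambda>x. partial i p x + partial i q x)"
    by (auto simp: partial_add differentiable_at_real_polynomial_function)
  with add show ?case by auto
next
  case (mult p q)
  then have "partial i (\<lambda>x. p x * q x) = (\<lambda>x. p x * partial i q x + partial i p x * q x)"
    by (auto simp: partial_mult differentiable_at_real_polynomial_function)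
  with mult show ?case by auto
qed

lemma polynomial_component: "real_polynomial_function (\<lambda>x::real^'n::finite. x $ i)"
  by (rule real_polynomial_function.intros(1)) (rule bounded_linear_vec_nth)

lemma polynomial_norm_sq: "real_polynomial_function (\<lambda>x::real^'n::finite. (norm x)\<^sup>2)"
  unfolding norm_sq_sum
  by (rule real_polynomial_function_sum[of UNIV "\<lambda>x i. (x $ i)\<^sup>2"])
     (rule finite, rule real_polynomial_function_power, rule polynomial_component)

lemma laplacian_polynomial_add:
  fixes p q :: "real^'n::finite \<Rightarrow> real"
  assumes "real_polynomial_function p" "real_polynomial_function q"
  shows "laplacian (\<lambda>x. p x + q x) x = laplacian p x + laplacian q x"
proof -
  have "partial i (\<lambda>x. p x + q x) = (\<lambda>x. partial i p x + partial i q x)" for i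
    using assms by (auto simp: partial_add differentiable_at_real_polynomial_function)
  then show ?thesis using assms
    by (simp add: laplacian_def partial_add differentiable_at_real_polynomial_function polynomial_partial sum.distrib)
qed

lemma laplacian_polynomial_cmult:
  fixes p :: "real^'n::finite \<Rightarrow> real"
  assumes "real_polynomial_function p"
  shows "laplacian (\<lambda>x. c * p x) x = c * laplacian p x"
proof -
  have "partial i (\<lambda>x. c * p x) = (\<lambda>x. c * partial i p x)" for i
    using assms by (auto simp: partial_cmult differentiable_at_real_polynomial_function)
  then show ?thesis using assms
    by (simp add: laplacian_def partial_cmult differentiable_at_real_polynomial_function polynomial_partial sum_distrib_left)
qed

lemma laplacian_norm_sq_mult:
  fixes p :: "real^'n::finite \<Rightarrow> real"
  assumes "real_polynomial_function p"
  shows "laplacian (\<lambda>x. (norm x)\<^sup>2 * p x) x = (norm x)\<^sup>2 * laplacian p x + 4 * eul p x + 2 * real CARD('n) * p x"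
proof -
  note d = differentiable_at_real_polynomial_function differentiable_norm_sq differentiable_component differentiable_mult differentiable_add
  have 1: "partial j (\<lambda>x. (norm x)\<^sup>2 * p x) = (\<lambda>x. (norm x)\<^sup>2 * partial j p x + 2 * (x $ j) * p x)" for j
    using assms by (auto simp: partial_mult d partial_norm_sq)
  have 2: "partial j (\<lambda>x. (norm x)\<^sup>2 * partial j p x + 2 * (x $ j) * p x) x
     = (norm x)\<^sup>2 * partial j (partial j p) x + 4 * (x $ j * partial j p x) + 2 * p x" for j
    using assms by (simp add: partial_add partial_mult d partial_norm_sq polynomial_partial)
  show ?thesis
    by (simp add: laplacian_def 1 2 sum.distrib sum_distrib_left eul_def)
qed

definition hom :: "nat \<Rightarrow> (real^'n::finite \<Rightarrow> real) \<Rightarrow> bool" where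
  "hom d q \<longleftrightarrow> real_polynomial_function q \<and> (\<forall>t x. q (t *\<^sub>R x) = t ^ d * q x)"

lemma hom_poly: "hom d q \<Longrightarrow> real_polynomial_function q" by (simp add: hom_def)

lemma hom_add: "hom d p \<Longrightarrow> hom d q \<Longrightarrow> hom d (\<lambda>x. p x + q x)"
  by (auto simp: hom_def distrib_left)
lemma hom_cmult: "hom d p \<Longrightarrow> hom d (\<lambda>x. c * p x)"
  by (auto simp: hom_def)
lemma hom_mult: "hom d p \<Longrightarrow> hom e q \<Longrightarrow> hom (d + e) (\<lambda>x. p x * q x)"
  by (auto simp: hom_def power_add)
lemma hom_norm_sq: "hom 2 (\<lambda>x::real^'n::finite. (norm x)\<^sup>2)"
  by (auto simp: hom_def polynomial_norm_sq power_mult_distrib)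
lemma hom_sum: "finite I \<Longrightarrow> (\<And>i. i \<in> I \<Longrightarrow> hom d (f i)) \<Longrightarrow> hom d (\<lambda>x. \<Sum>i\<in>I. f i x)"
  by (induction I rule: finite_induct) (auto intro: hom_add simp: hom_def distrib_left real_polynomial_function.intros(2))

lemma hom_partial:
  fixes q :: "real^'n::finite \<Rightarrow> real"
  assumes "hom (Suc d) q" shows "hom d (partial i q)"
proof -
  have rq: "real_polynomial_function q" and sc: "\<And>t x. q (t *\<^sub>R x) = t ^ Suc d * q x"
    using assms by (auto simp: hom_def)
  have ne: "partial i q (t *\<^sub>R x) = t ^ d * partial i q x" if "t \<noteq> 0" for t x
  proof -
    have "t * partial i q (t *\<^sub>R x) = partial i (\<lambda>y. q (t *\<^sub>R y)) x"
      using partial_scale[OF differentiable_at_real_polynomial_function[OF rq], where t = t and x = x and i = i] by simp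
    also have "\<dots> = t ^ Suc d * partial i q x"
      unfolding sc by (rule partial_cmult) (rule differentiable_at_real_polynomial_function[OF rq])
    finally show ?thesis using that by simp
  qed
  \<comment> \<open>Cancelling a factor \<open>t\<close> needs t \<noteq> 0. The homogeneity of the
    partial derivative at t = 0 follows by continuity, including the case d = 0, where 0 ^ 0 =
    1.\<close>
  have "partial i q (0 *\<^sub>R x) = 0 ^ d * partial i q x" for x
  proof -
    have "isCont (partial i q) (0 *\<^sub>R x)"
      using differentiable_at_real_polynomial_function[OF polynomial_partial[OF rq]] differentiable_imp_continuous_within by blast
    then have "isCont (\<lambda>t. partial i q (t *\<^sub>R x)) 0"
      by (intro isCont_o2[where f = "\<lambda>t. t *\<^sub>R x" and g = "partial i q"]) (auto intro!: continuous_intros)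
    then have 1: "((\<lambda>t. partial i q (t *\<^sub>R x)) \<longlongrightarrow> partial i q (0 *\<^sub>R x)) (at 0)" by (simp add: isCont_def)
    have 2: "((\<lambda>t::real. t ^ d * partial i q x) \<longlongrightarrow> 0 ^ d * partial i q x) (at 0)"
      by (intro tendsto_intros)
    have "\<forall>\<^sub>F t::real in at 0. t ^ d * partial i q x = partial i q (t *\<^sub>R x)"
      using eventually_neq_at_within[of 0] by eventually_elim (simp add: ne)
    from tendsto_unique[OF at_neq_bot 1 Lim_transform_eventually[OF 2 this]] show ?thesis .
  qed
  with ne show ?thesis using polynomial_partial[OF rq] unfolding hom_def by metis
qed

lemma hom_0_const: "hom 0 q \<Longrightarrow> q = (\<lambda>x. q 0)"
  unfolding hom_def by (metis mult_1 power_0 scaleR_zero_left)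

lemma laplacian_hom_low:
  fixes q :: "real^'n::finite \<Rightarrow> real"
  assumes "hom d q" "d < 2" shows "laplacian q x = 0"
proof (cases d)
  case 0
  then have q: "q = (\<lambda>x. q 0)" using assms hom_0_const by blast
  have "partial i q = (\<lambda>x. 0)" for i by (subst q) simp
  then show ?thesis by (simp add: laplacian_def)
next
  case (Suc e)
  then have "hom 0 (partial i q)" for i using assms by (auto intro: hom_partial)
  then have q: "partial i q = (\<lambda>x. partial i q 0)" for i using hom_0_const by blast
  have "partial i (partial i q) x = 0" for i by (subst q) simp
  then show ?thesis by (simp add: laplacian_def)
qed

lemma hom_laplacian:
  fixes q :: "real^'n::finite \<Rightarrow> real"
  shows "hom (Suc (Suc d)) q \<Longrightarrow> hom d (laplacian q)"
  unfolding laplacian_def[abs_def] by (intro hom_sum hom_partial) auto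

lemma hom_eul:
  fixes q :: "real^'n::finite \<Rightarrow> real"
  assumes "hom d q" shows "eul q x = real d * q x"
proof -
  have "((\<lambda>t. t *\<^sub>R x) has_derivative (\<lambda>h. h *\<^sub>R x)) (at (1::real))" by (auto intro!: derivative_eq_intros)
  from has_derivative_compose[OF this has_derivative_partial[OF differentiable_at_real_polynomial_function[OF hom_poly[OF assms]]]]
  have "((\<lambda>t. q (t *\<^sub>R x)) has_real_derivative eul q x) (at 1)"
    unfolding has_field_derivative_def
    by (rule has_derivative_eq_rhs) (auto simp: eul_def sum_distrib_right sum_distrib_left mult_ac)
  moreover have "((\<lambda>t. q (t *\<^sub>R x)) has_real_derivative real d * q x) (at 1)"
    using assms unfolding hom_def by (auto intro!: derivative_eq_intros)
  ultimately show ?thesis by (rule DERIV_unique)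
qed

section \<open>Solid harmonics and the Fischer decomposition of homogeneous polynomials\<close>

lemma solid_harmonic_hom: "solid_harmonic k h \<Longrightarrow> hom k h"
  by (simp add: solid_harmonic_def hom_def)
lemma solid_harmonic_poly: "solid_harmonic k h \<Longrightarrow> real_polynomial_function h"
  by (simp add: solid_harmonic_def)
lemma solid_harmonic_add: "solid_harmonic k h \<Longrightarrow> solid_harmonic k h' \<Longrightarrow> solid_harmonic k (\<lambda>x. h x + h' x)"
  by (auto simp: solid_harmonic_def laplacian_polynomial_add distrib_left)
lemma solid_harmonic_cmult: "solid_harmonic k h \<Longrightarrow> solid_harmonic k (\<lambda>x. c * h x)"
  by (auto simp: solid_harmonic_def laplacian_polynomial_cmult)
lemma solid_harmonic_zero: "solid_harmonic k (\<lambda>x. 0)"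
  by (auto simp: solid_harmonic_def intro: real_polynomial_function.intros(2))

inductive harmonic_span :: "nat \<Rightarrow> (real^'n::finite \<Rightarrow> real) \<Rightarrow> bool" where
  base: "solid_harmonic k h \<Longrightarrow> harmonic_span (k + 2 * j) (\<lambda>x. ((norm x)\<^sup>2) ^ j * h x)"
| add: "harmonic_span d p \<Longrightarrow> harmonic_span d q \<Longrightarrow> harmonic_span d (\<lambda>x. p x + q x)"

lemma hom_norm_power: "hom (2 * j) (\<lambda>x::real^'n::finite. ((norm x)\<^sup>2) ^ j)"
proof (induction j)
  case 0 then show ?case by (simp add: hom_def real_polynomial_function.intros(2))
next
  case (Suc j) from hom_mult[OF hom_norm_sq this] show ?case by simp
qed

lemma harmonic_span_hom: "harmonic_span d q \<Longrightarrow> hom d q"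
proof (induction rule: harmonic_span.induct)
  case (base k h j)
  show ?case using hom_mult[OF hom_norm_power solid_harmonic_hom[OF base]] by (simp add: add.commute)
qed (rule hom_add)

lemma laplacian_norm_power_harmonic:
  fixes h :: "real^'n::finite \<Rightarrow> real"
  assumes "solid_harmonic k h"
  shows "laplacian (\<lambda>x. ((norm x)\<^sup>2) ^ Suc j * h x) x
    = 2 * real (Suc j) * (2 * real j + 2 * real k + real CARD('n)) * (((norm x)\<^sup>2) ^ j * h x)"
proof (induction j arbitrary: x)
  case 0
  have "laplacian h x = 0" using assms by (simp add: solid_harmonic_def)
  then show ?case using laplacian_norm_sq_mult[OF solid_harmonic_poly[OF assms], of x] hom_eul[OF solid_harmonic_hom[OF assms], of x]
    by (simp add: algebra_simps)
next
  case (Suc j)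
  have hm: "hom (2 * Suc j + k) (\<lambda>x. ((norm x)\<^sup>2) ^ Suc j * h x)"
    by (rule hom_mult[OF hom_norm_power solid_harmonic_hom[OF assms]])
  have "laplacian (\<lambda>x. ((norm x)\<^sup>2) ^ Suc (Suc j) * h x) x = laplacian (\<lambda>x. (norm x)\<^sup>2 * (((norm x)\<^sup>2) ^ Suc j * h x)) x"
    by (simp add: mult.assoc)
  also have "\<dots> = (norm x)\<^sup>2 * laplacian (\<lambda>x. ((norm x)\<^sup>2) ^ Suc j * h x) x + 4 * (real (2 * Suc j + k) * (((norm x)\<^sup>2) ^ Suc j * h x))
     + 2 * real CARD('n) * (((norm x)\<^sup>2) ^ Suc j * h x)"
    unfolding laplacian_norm_sq_mult[OF hom_poly[OF hm]] hom_eul[OF hm] ..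
  also have "\<dots> = 2 * real (Suc (Suc j)) * (2 * real (Suc j) + 2 * real k + real CARD('n)) * (((norm x)\<^sup>2) ^ Suc j * h x)"
    unfolding Suc.IH by (simp add: algebra_simps)
  finally show ?case .
qed

text \<open>On each generator the inverse is explicit: the Laplacian of |x|^(2j+2) h is a nonzero
  multiple of |x|^(2j) h.\<close>

lemma harmonic_span_laplacian_inverse:
  fixes p :: "real^'n::finite \<Rightarrow> real"
  assumes "harmonic_span d p"
  shows "\<exists>r. harmonic_span (Suc (Suc d)) r \<and> laplacian r = p"
  using assms
proof (induction rule: harmonic_span.induct)
  case (base k h j)
  define c where "c = 2 * real (Suc j) * (2 * real j + 2 * real k + real CARD('n))"
  have c: "c \<noteq> 0" unfolding c_def using zero_less_card_finite[where 'a = 'n] by (smt (verit) of_nat_0_less_iff of_nat_0_le_iff mult_eq_0_iff of_nat_neq_0)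
  have h': "solid_harmonic k (\<lambda>x. 1 / c * h x)" by (rule solid_harmonic_cmult[OF base])
  have "harmonic_span (Suc (Suc (k + 2 * j))) (\<lambda>x. ((norm x)\<^sup>2) ^ Suc j * (1 / c * h x))"
    using harmonic_span.base[OF h', of "Suc j"] by simp
  moreover have "laplacian (\<lambda>x. ((norm x)\<^sup>2) ^ Suc j * (1 / c * h x)) = (\<lambda>x. ((norm x)\<^sup>2) ^ j * h x)"
    using c by (intro ext) (simp only: laplacian_norm_power_harmonic[OF h'] c_def[symmetric], simp)
  ultimately show ?case by blast
next
  case (add d p q)
  then obtain r r' where r: "harmonic_span (Suc (Suc d)) r" "laplacian r = p" "harmonic_span (Suc (Suc d)) r'" "laplacian r' = q" by blast
  have "laplacian (\<lambda>x. r x + r' x) = (\<lambda>x. p x + q x)"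
    using laplacian_polynomial_add[OF hom_poly[OF harmonic_span_hom[OF r(1)]] hom_poly[OF harmonic_span_hom[OF r(3)]]] r(2,4)
    by auto
  with r harmonic_span.add show ?case by blast
qed

text \<open>Induction on the degree: the Laplacian of \<open>q\<close> lies in the span, so it has a
  preimage \<open>r\<close> in the span, and \<open>q - r\<close> is a solid harmonic.\<close>

lemma hom_harmonic_span:
  fixes q :: "real^'n::finite \<Rightarrow> real"
  shows "hom d q \<Longrightarrow> harmonic_span d q"
proof (induction d arbitrary: q rule: less_induct)
  case (less d)
  have solid: "harmonic_span d q'" if "hom d q'" "\<And>x. laplacian q' x = 0" for q' :: "real^'n \<Rightarrow> real"
    using harmonic_span.base[of d q' 0] that by (simp add: solid_harmonic_def hom_def)
  show ?case
  proof (cases "d < 2")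
    case True then show ?thesis using solid less.prems laplacian_hom_low by blast
  next
    case False
    then obtain e where d: "d = Suc (Suc e)" by (metis One_nat_def Suc_1 less_2_cases_iff not0_implies_Suc)
    then have "harmonic_span e (laplacian q)" using less.IH[of e] hom_laplacian[of e q] less.prems by simp
    then obtain r where r: "harmonic_span d r" "laplacian r = laplacian q"
      using harmonic_span_laplacian_inverse d by metis
    have r': "hom d (\<lambda>x. -1 * r x)" using r(1) harmonic_span_hom hom_cmult by blast
    have "laplacian (\<lambda>x. q x + (-1 * r x)) x = 0" for x
      using laplacian_polynomial_add[OF hom_poly[OF less.prems] hom_poly[OF r'], of x]
        laplacian_polynomial_cmult[OF hom_poly[OF harmonic_span_hom[OF r(1)]], of "-1" x] r(2) by simp
    then have "harmonic_span d (\<lambda>x. q x + (-1 * r x))"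
      by (intro solid hom_add[OF less.prems r'])
    from harmonic_span.add[OF this r(1)] show ?thesis by simp
  qed
qed

section \<open>Polynomials times a Gaussian\<close>

definition fj :: "real \<Rightarrow> (real^'n::finite \<Rightarrow> real) \<Rightarrow> nat \<Rightarrow> real^'n \<Rightarrow> real" where
  "fj \<beta> h j x = ((norm x)\<^sup>2) ^ j * h x * gauss \<beta> x"

lemma sq_fj: "sq (fj \<beta> h j) = fj \<beta> h (Suc j)"
  by (auto simp: sq_def fj_def)

lemma schwartz_fj: "\<beta> > 0 \<Longrightarrow> real_polynomial_function h \<Longrightarrow> schwartz (fj \<beta> h j)"
proof -
  assume "\<beta> > 0" "real_polynomial_function h"
  moreover have "real_polynomial_function (\<lambda>x::real^'a. ((norm x)\<^sup>2) ^ j * h x)" using calculation polynomial_norm_sq by auto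
  ultimately show ?thesis unfolding fj_def[abs_def] by (intro schwartz_polynomial gauss_schwartz)
qed

lemma fj_linear:
  "fj \<beta> (\<lambda>x. h x + h' x) j = (\<lambda>x. fj \<beta> h j x + fj \<beta> h' j x)"
  "fj \<beta> (\<lambda>x. c * h x) j = (\<lambda>x. c * fj \<beta> h j x)"
  by (auto simp: fj_def algebra_simps)

lemma partial_poly_gauss:
  fixes q :: "real^'n::finite \<Rightarrow> real"
  assumes "real_polynomial_function q"
  shows "partial i (\<lambda>x. q x * gauss \<beta> x) = (\<lambda>x. partial i q x * gauss \<beta> x - 2 * \<beta> * (x $ i * q x * gauss \<beta> x))"
  using assms by (auto simp: partial_mult differentiable_at_real_polynomial_function gauss_differentiable partial_gauss)

lemma eul_poly_gauss:
  fixes q :: "real^'n::finite \<Rightarrow> real"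
  assumes "hom d q"
  shows "eul (fj \<beta> q 0) x = real d * fj \<beta> q 0 x - 2 * \<beta> * fj \<beta> q 1 x"
proof -
  have "eul (fj \<beta> q 0) x = eul q x * gauss \<beta> x - 2 * \<beta> * ((\<Sum>i\<in>UNIV. (x $ i)\<^sup>2) * q x * gauss \<beta> x)"
    unfolding fj_def[abs_def]
    by (simp add: eul_def partial_poly_gauss[OF hom_poly[OF assms]] right_diff_distrib sum_subtractf sum_distrib_left
        sum_distrib_right power2_eq_square mult_ac)
  then show ?thesis by (simp add: hom_eul[OF assms] fj_def norm_sq_sum)
qed

lemma laplacian_poly_gauss:
  fixes q :: "real^'n::finite \<Rightarrow> real"
  assumes "hom d q"
  shows "laplacian (fj \<beta> q 0) x = laplacian q x * gauss \<beta> x - 2 * \<beta> * (2 * real d + real CARD('n)) * fj \<beta> q 0 x + 4 * \<beta>\<^sup>2 * fj \<beta> q 1 x"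
proof -
  note q = hom_poly[OF assms]
  have xq: "real_polynomial_function (\<lambda>x. x $ i * q x)" for i
    by (rule real_polynomial_function.intros(4)[OF polynomial_component q])
  have pxq: "partial i (\<lambda>x. x $ i * q x) x = x $ i * partial i q x + q x" for i x
    using q by (simp add: partial_mult differentiable_component differentiable_at_real_polynomial_function)
  have d: "(\<lambda>x. p x * gauss \<beta> x) differentiable (at x)" if "real_polynomial_function p" for p x
    using that by (intro differentiable_mult differentiable_at_real_polynomial_function gauss_differentiable)
  have "partial i (partial i (\<lambda>x. q x * gauss \<beta> x)) x = partial i (partial i q) x * gauss \<beta> x
     - 4 * \<beta> * (x $ i * partial i q x) * gauss \<beta> x - 2 * \<beta> * q x * gauss \<beta> x + 4 * \<beta>\<^sup>2 * ((x $ i)\<^sup>2 * q x * gauss \<beta> x)" for i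
  proof -
    have "partial i (partial i (\<lambda>x. q x * gauss \<beta> x)) x
       = partial i (\<lambda>x. partial i q x * gauss \<beta> x + (- 2 * \<beta>) * (x $ i * q x * gauss \<beta> x)) x"
      unfolding partial_poly_gauss[OF q] by simp
    also have "\<dots> = partial i (\<lambda>x. partial i q x * gauss \<beta> x) x + (- 2 * \<beta>) * partial i (\<lambda>x. x $ i * q x * gauss \<beta> x) x"
      by (subst partial_add, intro d polynomial_partial q, intro differentiable_mult differentiable_const d xq,
          subst partial_cmult, intro d xq, rule refl)
    finally show ?thesis
      unfolding partial_poly_gauss[OF polynomial_partial[OF q]] partial_poly_gauss[OF xq] pxq
      by (simp add: algebra_simps power2_eq_square)
  qed
  then have "laplacian (fj \<beta> q 0) x = laplacian q x * gauss \<beta> x - 4 * \<beta> * eul q x * gauss \<beta> x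
     - real CARD('n) * (2 * \<beta> * q x * gauss \<beta> x) + 4 * \<beta>\<^sup>2 * ((\<Sum>i\<in>UNIV. (x $ i)\<^sup>2) * q x * gauss \<beta> x)"
    by (simp add: fj_def[abs_def] laplacian_def sum.distrib sum_subtractf eul_def sum_distrib_left sum_distrib_right mult_ac)
  then show ?thesis by (simp add: hom_eul[OF assms] fj_def norm_sq_sum algebra_simps)
qed

lemma eul_fj:
  assumes h: "hom k h" and b: "\<beta> > 0"
  shows "eul (fj \<beta> h j) = (\<lambda>x. (2 * real j + real k) * fj \<beta> h j x - 2 * \<beta> * fj \<beta> h (Suc j) x)"
proof (induction j)
  case 0 show ?case using eul_poly_gauss[OF h] by (auto simp: fun_eq_iff)
next
  case (Suc j)
  have s: "schwartz (fj \<beta> h j)" for j using schwartz_fj[OF b hom_poly[OF h]] .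
  have "eul (sq (fj \<beta> h j)) = (\<lambda>x. sq (eul (fj \<beta> h j)) x + 2 * sq (fj \<beta> h j) x)" by (rule eul_sq[OF s])
  then show ?case unfolding Suc.IH sq_diff sq_cmult sq_fj by (auto simp: fun_eq_iff algebra_simps)
qed

text \<open>\<open>b\<close> is the second Kummer parameter of the sector. The induction runs
  through \<open>fj \<beta> h (Suc j) = sq (fj \<beta> h j)\<close> and the commutator
  \<open>laplacian_sq\<close>. At j = 0 the truncated index \<open>j - 1\<close> is multiplied by
  0.\<close>

lemma laplacian_fj:
  fixes h :: "real^'n::finite \<Rightarrow> real"
  assumes h: "solid_harmonic k h" and b: "\<beta> > 0" and bb: "b = real k + real CARD('n) / 2"
  shows "laplacian (fj \<beta> h j) = (\<lambda>x. 4 * real j * (real j - 1 + b) * fj \<beta> h (j - 1) x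
     - 4 * \<beta> * (2 * real j + b) * fj \<beta> h j x + 4 * \<beta>\<^sup>2 * fj \<beta> h (Suc j) x)"
proof (induction j)
  case 0 show ?case
    using laplacian_poly_gauss[OF solid_harmonic_hom[OF h], of \<beta>] h bb
    by (auto simp: solid_harmonic_def fun_eq_iff algebra_simps)
next
  case (Suc j)
  have s: "schwartz (fj \<beta> h j)" for j using schwartz_fj[OF b solid_harmonic_poly[OF h]] .
  have 1: "laplacian (sq (fj \<beta> h j)) = (\<lambda>x. sq (laplacian (fj \<beta> h j)) x + 4 * eul (fj \<beta> h j) x + 2 * real CARD('n) * fj \<beta> h j x)"
    by (rule laplacian_sq[OF s])
  have j: "real j * fj \<beta> h (Suc (j - 1)) x = real j * fj \<beta> h j x" for x by (cases j) auto
  have N: "real CARD('n) = 2 * (b - real k)" using bb by simp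
  show ?case
  proof
    fix x
    have "laplacian (fj \<beta> h (Suc j)) x = 4 * (real j - 1 + b) * (real j * fj \<beta> h (Suc (j - 1)) x) - 4 * \<beta> * (2 * real j + b) * fj \<beta> h (Suc j) x
      + 4 * \<beta>\<^sup>2 * fj \<beta> h (Suc (Suc j)) x + 4 * ((2 * real j + real k) * fj \<beta> h j x - 2 * \<beta> * fj \<beta> h (Suc j) x) + 4 * (b - real k) * fj \<beta> h j x"
      using 1 unfolding sq_fj Suc.IH eul_fj[OF solid_harmonic_hom[OF h] b] N sq_diff sq_add sq_cmult
      by (simp add: sq_fj)
    then show "laplacian (fj \<beta> h (Suc j)) x = 4 * real (Suc j) * (real (Suc j) - 1 + b) * fj \<beta> h (Suc j - 1) x
     - 4 * \<beta> * (2 * real (Suc j) + b) * fj \<beta> h (Suc j) x + 4 * \<beta>\<^sup>2 * fj \<beta> h (Suc (Suc j)) x"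
      unfolding j by (simp add: algebra_simps)
  qed
qed

definition mu :: "nat \<Rightarrow> nat \<Rightarrow> real" where "mu n k = real k * (real k + real n - 2)"

lemma sector_fj:
  fixes h :: "real^'n::finite \<Rightarrow> real"
  assumes h: "solid_harmonic k h" and b: "\<beta> > 0"
  shows "sector (mu CARD('n) k) (fj \<beta> h j)"
proof (induction j)
  case 0
  have s: "schwartz (fj \<beta> h j)" for j using schwartz_fj[OF b solid_harmonic_poly[OF h]] .
  have "ang (fj \<beta> h 0) = (\<lambda>x. mu CARD('n) k * fj \<beta> h 0 x)"
    unfolding ang_def[abs_def] laplacian_fj[OF h b refl] eul_fj[OF solid_harmonic_hom[OF h] b]
      sq_diff sq_add sq_cmult sq_fj eul_diff[OF schwartz_cmult[OF s] schwartz_cmult[OF s]] eul_cmult[OF s]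
    by (rule ext) (simp add: mu_def field_simps power2_eq_square)
  then show ?case using s by (simp add: sector_def)
next
  case (Suc j) from sector_sq[OF this] show ?case by (simp add: sq_fj)
qed

text \<open>The members of the sector of degree \<open>k\<close> that are a polynomial times
  \<open>gauss \<beta>\<close>. Scalars are absorbed into the harmonic \<open>h\<close>, so sums are
  the only closure rule that has to be imposed.\<close>

inductive VK :: "real \<Rightarrow> nat \<Rightarrow> (real^'n::finite \<Rightarrow> real) \<Rightarrow> bool" for \<beta> k where
  base: "solid_harmonic k h \<Longrightarrow> VK \<beta> k (fj \<beta> h j)"
| add: "VK \<beta> k f \<Longrightarrow> VK \<beta> k g \<Longrightarrow> VK \<beta> k (\<lambda>x. f x + g x)"

lemma VK_sector:
  fixes f :: "real^'n::finite \<Rightarrow> real"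
  shows "VK \<beta> k f \<Longrightarrow> \<beta> > 0 \<Longrightarrow> sector (mu CARD('n) k) f"
  by (induction rule: VK.induct) (auto intro: sector_fj sector_add)

lemma VK_schwartz: "VK \<beta> k f \<Longrightarrow> \<beta> > 0 \<Longrightarrow> schwartz f"
  using VK_sector sector_schwartz by blast

lemma VK_cmult: "VK \<beta> k f \<Longrightarrow> VK \<beta> k (\<lambda>x. c * f x)"
proof (induction rule: VK.induct)
  case (base h j) from VK.base[OF solid_harmonic_cmult[OF base], of \<beta> c j] show ?case by (simp add: fj_linear)
next
  case (add f g) then show ?case using VK.add by (fastforce simp: distrib_left)
qed

lemma VK_zero: "VK \<beta> k (\<lambda>x. 0)"
  using VK.base[OF solid_harmonic_zero, of \<beta> k 0] by (simp add: fj_def[abs_def])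

lemma VK_diff: "VK \<beta> k f \<Longrightarrow> VK \<beta> k g \<Longrightarrow> VK \<beta> k (\<lambda>x. f x - g x)"
  using VK.add[of \<beta> k f "\<lambda>x. -1 * g x"] VK_cmult[of \<beta> k g "-1"] by simp

lemma VK_sum: "(\<And>i. i \<in> I \<Longrightarrow> VK \<beta> k (f i)) \<Longrightarrow> VK \<beta> k (\<lambda>x. \<Sum>i\<in>I. f i x)"
  by (induction I rule: infinite_finite_induct) (auto intro: VK_zero VK.add)

lemma harmonic_span_VK:
  fixes q :: "real^'n::finite \<Rightarrow> real"
  assumes "harmonic_span d q"
  shows "\<exists>u. (\<forall>k. VK \<beta> k (u k)) \<and> (\<forall>x. q x * gauss \<beta> x = (\<Sum>k\<le>d. u k x))"
  using assms
proof (induction rule: harmonic_span.induct)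
  case (base k h j)
  let ?u = "\<lambda>l x. if l = k then fj \<beta> h j x else 0"
  have "VK \<beta> l (?u l)" for l using VK.base[OF base] VK_zero by (cases "l = k") auto
  moreover have "((norm x)\<^sup>2) ^ j * h x * gauss \<beta> x = (\<Sum>l\<le>k + 2 * j. ?u l x)" for x by (simp add: fj_def)
  ultimately show ?case by (intro exI[of _ ?u]) simp
next
  case (add d p q)
  then obtain u v where *: "\<And>k. VK \<beta> k (u k)" "\<And>x. p x * gauss \<beta> x = (\<Sum>k\<le>d. u k x)"
    "\<And>k. VK \<beta> k (v k)" "\<And>x. q x * gauss \<beta> x = (\<Sum>k\<le>d. v k x)" by blast
  then show ?case by (intro exI[of _ "\<lambda>k x. u k x + v k x"]) (auto simp: distrib_right sum.distrib intro: VK.add)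
qed

lemma polynomial_hom_sum:
  fixes p :: "real^'n::finite \<Rightarrow> real"
  assumes "real_polynomial_function p"
  shows "\<exists>n q. (\<forall>d. hom d (q d)) \<and> (\<forall>x. p x = (\<Sum>d\<le>n. q d x))"
  using assms
proof (induction p rule: real_polynomial_function.induct)
  case (linear l)
  have z: "hom d (\<lambda>x::real^'n. 0)" for d by (simp add: hom_def real_polynomial_function.intros(2))
  have "hom 1 l" using linear by (auto simp: hom_def linear_cmul bounded_linear.linear)
  then have "hom d (\<lambda>x. if d = 1 then l x else 0)" for d using z by (cases "d = 1") auto
  then show ?case by (intro exI[of _ 1] exI[of _ "\<lambda>d x. if d = 1 then l x else 0"]) auto
next
  case (const c)
  have z: "hom d (\<lambda>x::real^'n. 0)" for d by (simp add: hom_def real_polynomial_function.intros(2))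
  have "hom d (\<lambda>x::real^'n. if d = 0 then c else 0)" for d
    using z by (cases "d = 0") (auto simp: hom_def real_polynomial_function.intros(2))
  then show ?case by (intro exI[of _ 0] exI[of _ "\<lambda>d x. if d = 0 then c else 0"]) auto
next
  case (add p p')
  then obtain n q n' q' where *: "\<And>d. hom d (q d)" "\<And>x. p x = (\<Sum>d\<le>n. q d x)" "\<And>d. hom d (q' d)" "\<And>x. p' x = (\<Sum>d\<le>n'. q' d x)" by metis
  have z: "hom d (\<lambda>x::real^'n. 0)" for d by (simp add: hom_def real_polynomial_function.intros(2))
  let ?r = "\<lambda>d x. (if d \<le> n then q d x else 0) + (if d \<le> n' then q' d x else 0)"
  have "hom d (?r d)" for d using * z by (cases "d \<le> n"; cases "d \<le> n'") (auto intro: hom_add)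
  moreover have "p x + p' x = (\<Sum>d\<le>max n n'. ?r d x)" for x
    unfolding sum.distrib *
    by (intro arg_cong2[of _ _ _ _ "(+)"] sum.mono_neutral_cong_left) auto
  ultimately show ?case by (intro exI[of _ "max n n'"] exI[of _ ?r]) auto
next
  case (mult p p')
  then obtain n q n' q' where *: "\<And>d. hom d (q d)" "\<And>x. p x = (\<Sum>d\<le>n. q d x)" "\<And>d. hom d (q' d)" "\<And>x. p' x = (\<Sum>d\<le>n'. q' d x)" by metis
  let ?I = "{..n} \<times> {..n'}"
  let ?r = "\<lambda>d x. \<Sum>z\<in>{z \<in> ?I. fst z + snd z = d}. q (fst z) x * q' (snd z) x"
  have "hom d (?r d)" for d using * by (intro hom_sum) (auto intro!: hom_mult)
  moreover have "p x * p' x = (\<Sum>d\<le>n + n'. ?r d x)" for x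
  proof -
    have "p x * p' x = (\<Sum>z\<in>?I. q (fst z) x * q' (snd z) x)"
      by (simp add: * sum_product sum.cartesian_product case_prod_beta)
    also have "\<dots> = (\<Sum>d\<le>n + n'. ?r d x)"
      by (rule sum.group[symmetric, where g = "\<lambda>z. fst z + snd z"]) auto
    finally show ?thesis .
  qed
  ultimately show ?case by (intro exI[of _ "n + n'"] exI[of _ ?r]) auto
qed

lemma polynomial_gauss_sectors:
  fixes p :: "real^'n::finite \<Rightarrow> real"
  assumes "real_polynomial_function p"
  shows "\<exists>K u. (\<forall>k. VK \<beta> k (u k)) \<and> (\<forall>x. p x * gauss \<beta> x = (\<Sum>k\<le>K. u k x))"
proof -
  obtain n q where q: "\<And>d. hom d (q d)" "\<And>x. p x = (\<Sum>d\<le>n. q d x)" using polynomial_hom_sum[OF assms] by blast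
  have "\<forall>d. \<exists>u. (\<forall>k. VK \<beta> k (u k)) \<and> (\<forall>x. q d x * gauss \<beta> x = (\<Sum>k\<le>d. u k x))"
    using harmonic_span_VK hom_harmonic_span q(1) by blast
  then obtain u where u: "\<And>d k. VK \<beta> k (u d k)" "\<And>d x. q d x * gauss \<beta> x = (\<Sum>k\<le>d. u d k x)" by metis
  have "p x * gauss \<beta> x = (\<Sum>k\<le>n. \<Sum>d\<in>{k..n}. u d k x)" for x
  proof -
    have "p x * gauss \<beta> x = (\<Sum>d\<le>n. \<Sum>k\<le>d. u d k x)" by (simp add: q sum_distrib_right u)
    also have "\<dots> = (\<Sum>d\<le>n. \<Sum>k\<in>{..n}. if k \<le> d then u d k x else 0)"
      by (intro sum.cong refl sum.mono_neutral_cong_left) auto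
    also have "\<dots> = (\<Sum>k\<le>n. \<Sum>d\<le>n. if k \<le> d then u d k x else 0)" by (rule sum.swap)
    also have "\<dots> = (\<Sum>k\<le>n. \<Sum>d\<in>{k..n}. u d k x)"
      by (intro sum.cong refl sum.mono_neutral_cong_right) auto
    finally show ?thesis .
  qed
  moreover have "VK \<beta> k (\<lambda>x. \<Sum>d\<in>{k..n}. u d k x)" for k by (intro VK_sum u)
  ultimately show ?thesis by (intro exI[of _ n] exI[of _ "\<lambda>k x. \<Sum>d\<in>{k..n}. u d k x"]) blast
qed

text \<open>At l = 2\<beta> the top-order terms of the Laplacian and of the Euler operator cancel
  for +l and add up for -l. Hence the first operator does not raise the power of |x|^2, and its two
  remaining coefficients are those of Kummer's recursion with a = (k + c)/2; the second operator
  raises the power by one.\<close>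

lemma op_fj:
  fixes h :: "real^'n::finite \<Rightarrow> real"
  assumes h: "solid_harmonic k h" and b: "\<beta> > 0" and bb: "b = real k + real CARD('n) / 2"
  shows "op (2 * \<beta>) c (fj \<beta> h j) = (\<lambda>x. 4 * real j * (real j - 1 + b) * fj \<beta> h (j - 1) x
     + 4 * \<beta> * ((real k + c) / 2 - b - real j) * fj \<beta> h j x)"
    "op (- (2 * \<beta>)) (- m) (fj \<beta> h j) = (\<lambda>x. 4 * real j * (real j - 1 + b) * fj \<beta> h (j - 1) x
     - 2 * \<beta> * (6 * real j + 2 * b + real k - m) * fj \<beta> h j x + 8 * \<beta>\<^sup>2 * fj \<beta> h (Suc j) x)"
  unfolding op_def[abs_def] laplacian_fj[OF h b bb] eul_fj[OF solid_harmonic_hom[OF h] b]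
  by (auto simp: fun_eq_iff field_simps power2_eq_square)

text \<open>The operator \<open>op (-2\<beta>) (-m)\<close> raises the degree of the polynomial factor of a sector element by exactly
  one in \<open>|x|\<^sup>2\<close>; hence its image has a complement spanned by the degree-\<open>0\<close> terms.\<close>

lemma fj_op_image:
  "\<exists>\<kappa>. \<forall>h::real^'n::finite \<Rightarrow> real. solid_harmonic k h \<longrightarrow> (\<exists>z. VK \<beta> k z \<and> fj \<beta> h j = (\<lambda>x. op (- (2 * \<beta>)) (- m) z x + \<kappa> * fj \<beta> h 0 x))"
  if b: "\<beta> > 0"
proof (induction j rule: less_induct)
  case (less j)
  show ?case
  proof (cases j)
    case 0
    have "\<exists>z. VK \<beta> k z \<and> fj \<beta> h j = (\<lambda>x. op (- (2 * \<beta>)) (- m) z x + 1 * fj \<beta> h 0 x)" for h :: "real^'n \<Rightarrow> real"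
      by (rule exI[of _ "\<lambda>x. 0"]) (auto simp: VK_zero 0 op_def)
    then show ?thesis by blast
  next
    case (Suc i)
    \<comment> \<open>The coefficients of the two lower terms in \<open>op_fj(2)\<close> at index
      \<open>i\<close>. For i = 0 the truncated index \<open>i - 1\<close> does no harm, because
      \<open>c1\<close> vanishes there.\<close>
    define c1 where "c1 = 4 * real i * (real i - 1 + (real k + real CARD('n) / 2))"
    define c2 where "c2 = - 2 * \<beta> * (6 * real i + 2 * (real k + real CARD('n) / 2) + real k - m)"
    let ?B = "op (- (2 * \<beta>)) (- m)"
    obtain \<kappa> where \<kappa>: "\<And>h::real^'n \<Rightarrow> real. solid_harmonic k h \<Longrightarrow> (\<exists>z. VK \<beta> k z \<and> fj \<beta> h i = (\<lambda>x. ?B z x + \<kappa> * fj \<beta> h 0 x))"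
      using less.IH[of i] Suc by auto
    obtain \<kappa>' where \<kappa>': "\<And>h::real^'n \<Rightarrow> real. solid_harmonic k h \<Longrightarrow> (\<exists>z. VK \<beta> k z \<and> fj \<beta> h (i - 1) = (\<lambda>x. ?B z x + \<kappa>' * fj \<beta> h 0 x))"
    proof -
      have "i - 1 < j" using Suc by simp
      from less.IH[OF this] show thesis using that by blast
    qed
    have "\<exists>z. VK \<beta> k z \<and> fj \<beta> h j = (\<lambda>x. ?B z x + (- (c1 * \<kappa>' + c2 * \<kappa>) / (8 * \<beta>\<^sup>2)) * fj \<beta> h 0 x)"
      if h: "solid_harmonic k h" for h :: "real^'n \<Rightarrow> real"
    proof -
      obtain z where z1: "VK \<beta> k z" "fj \<beta> h i = (\<lambda>x. ?B z x + \<kappa> * fj \<beta> h 0 x)" using \<kappa>[OF h] by blast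
      obtain z' where z2: "VK \<beta> k z'" "fj \<beta> h (i - 1) = (\<lambda>x. ?B z' x + \<kappa>' * fj \<beta> h 0 x)" using \<kappa>'[OF h] by blast
      note z = z1 z2
      let ?z = "\<lambda>x. 1 / (8 * \<beta>\<^sup>2) * (fj \<beta> h i x - (c1 * z' x + c2 * z x))"
      have v: "VK \<beta> k ?z" by (intro VK_cmult VK_diff VK.add z VK.base h)
      note s = VK_schwartz[OF z(1) b] VK_schwartz[OF z(3) b] schwartz_fj[OF b solid_harmonic_poly[OF h]]
      have Bz: "?B ?z = (\<lambda>x. 1 / (8 * \<beta>\<^sup>2) * (?B (fj \<beta> h i) x - (c1 * ?B z' x + c2 * ?B z x)))"
        by (simp only: op_cmult op_diff op_add s schwartz_intros)
      have "8 * \<beta>\<^sup>2 * fj \<beta> h j x = ?B (fj \<beta> h i) x - c1 * fj \<beta> h (i - 1) x - c2 * fj \<beta> h i x" for x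
        unfolding op_fj(2)[OF h b refl] c1_def c2_def Suc by (simp add: algebra_simps)
      note e8 = this
      have zi: "?B z x + \<kappa> * fj \<beta> h 0 x = fj \<beta> h i x" "?B z' x + \<kappa>' * fj \<beta> h 0 x = fj \<beta> h (i - 1) x" for x
        by (rule fun_cong[OF z(2), symmetric], rule fun_cong[OF z(4), symmetric])
      have "fj \<beta> h j x = 1 / (8 * \<beta>\<^sup>2) * (?B (fj \<beta> h i) x - c1 * (?B z' x + \<kappa>' * fj \<beta> h 0 x) - c2 * (?B z x + \<kappa> * fj \<beta> h 0 x))" for x
        unfolding zi e8[of x, symmetric] using b by simp
      note e = this
      have "fj \<beta> h j x = ?B ?z x + (- (c1 * \<kappa>' + c2 * \<kappa>) / (8 * \<beta>\<^sup>2)) * fj \<beta> h 0 x" for x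
        unfolding Bz e[of x] using b by (simp add: field_simps)
      with v show ?thesis by blast
    qed
    then show ?thesis by blast
  qed
qed

lemma VK_op_image:
  assumes b: "\<beta> > 0" and "VK \<beta> k f"
  shows "\<exists>h z. solid_harmonic k h \<and> VK \<beta> k z \<and> f = (\<lambda>x. op (- (2 * \<beta>)) (- m) z x + fj \<beta> h 0 x)"
  using assms(2)
proof (induction rule: VK.induct)
  case (base h j)
  obtain \<kappa> z where z: "VK \<beta> k z" "fj \<beta> h j = (\<lambda>x. op (- (2 * \<beta>)) (- m) z x + \<kappa> * fj \<beta> h 0 x)"
    using fj_op_image[OF b, of k j m] base by blast
  show ?case by (rule exI[of _ "\<lambda>x. \<kappa> * h x"], rule exI[of _ z]) (auto simp: z fj_linear solid_harmonic_cmult base)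
next
  case (add f g)
  from add.IH(1) obtain h z where 1: "solid_harmonic k h" "VK \<beta> k z" "f = (\<lambda>x. op (- (2 * \<beta>)) (- m) z x + fj \<beta> h 0 x)" by blast
  from add.IH(2) obtain h' z' where 2: "solid_harmonic k h'" "VK \<beta> k z'" "g = (\<lambda>x. op (- (2 * \<beta>)) (- m) z' x + fj \<beta> h' 0 x)" by blast
  note * = 1 2
  have "(\<lambda>x. f x + g x) = (\<lambda>x. op (- (2 * \<beta>)) (- m) (\<lambda>x. z x + z' x) x + fj \<beta> (\<lambda>x. h x + h' x) 0 x)"
    unfolding op_add[OF VK_schwartz[OF *(2) b] VK_schwartz[OF *(5) b]] fj_linear *(3,6) by (simp add: add_ac)
  with * show ?case using solid_harmonic_add VK.add by blast
qed

section \<open>Kummer's function on the negative half-line\<close>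

text \<open>Up to the factor 1/j!, the Taylor coefficients of the Kummer function M(b-a, b,
  t).\<close>

definition kc :: "real \<Rightarrow> real \<Rightarrow> nat \<Rightarrow> real" where
  "kc a b j = pochhammer (b - a) j / pochhammer b j"

text \<open>Kummer's transformation: \<open>M(a,b,-t) = e\<^sup>-\<^sup>t M(b-a,b,t)\<close>; the right-hand side has positive
  coefficients for \<open>a < b\<close>.\<close>

definition kP :: "real \<Rightarrow> real \<Rightarrow> real \<Rightarrow> real" where
  "kP a b t = exp (- t) * (\<Sum>j. kc a b j / fact j * t ^ j)"

definition kS :: "real \<Rightarrow> real \<Rightarrow> nat \<Rightarrow> real \<Rightarrow> real" where
  "kS a b n t = exp (- t) * (\<Sum>j\<le>n. kc a b j / fact j * t ^ j)"

text \<open>The Chu-Vandermonde identity; it is the coefficient of t^n in Kummer's transformation,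
  up to sign and n!.\<close>

lemma vandermonde_kc:
  fixes a b :: real
  assumes "b > 0"
  shows "(\<Sum>i\<le>n. kc a b i * (- 1) ^ i * of_nat (n choose i)) = pochhammer a n / pochhammer b n"
proof -
  have c: "\<forall>i\<in>{0..<n}. b \<noteq> - of_nat i" using assms by (auto simp: eq_neg_iff_add_eq_0)
  have "(\<Sum>i\<le>n. kc a b i * (- 1) ^ i * of_nat (n choose i)) =
    (\<Sum>i = 0..n. pochhammer (b - a) i * pochhammer (- real n) i / (real (fact i) * pochhammer b i))"
  proof (rule sum.cong)
    fix i
    have "real (n choose i) = (- 1) ^ i * pochhammer (- real n) i / fact i"
      unfolding binomial_gbinomial gbinomial_pochhammer ..
    then have "(-1) ^ i * real (n choose i) = pochhammer (- real n) i / fact i"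
      by (simp add: mult.assoc[symmetric] power_mult_distrib[symmetric])
    then show "kc a b i * (- 1) ^ i * real (n choose i) = pochhammer (b - a) i * pochhammer (- real n) i / (real (fact i) * pochhammer b i)"
      by (simp add: kc_def mult.assoc)
  qed auto
  also have "\<dots> = pochhammer (b - (b - a)) n / pochhammer b n" by (rule Vandermonde_pochhammer[OF c])
  finally show ?thesis by simp
qed

text \<open>With 0 < a < b the coefficients \<open>kc\<close> are positive and decreasing, hence
  bounded by 1. The condition b < a + 1 makes the coefficients in \<open>euler_coefficient\<close>
  negative and thereby yields the decay of order t^(-a). For the sector of degree k with constant D
  the two upper conditions read D < 2k and D > 2k - 4.\<close>

locale kummer_param =
  fixes a b :: real
  assumes a: "0 < a" and ab: "a < b" and ba: "b < a + 1"
begin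

lemma b: "0 < b" using a ab by simp

lemma kc_pos: "kc a b j > 0"
  unfolding kc_def using ab b by (intro divide_pos_pos pochhammer_pos) auto

lemma kc_Suc: "kc a b (Suc j) = kc a b j * ((b - a + real j) / (b + real j))"
  by (simp add: kc_def pochhammer_Suc)

lemma kc_dec: "kc a b (Suc j) \<le> kc a b j"
proof -
  have q: "(b - a + real j) / (b + real j) \<le> 1" using a b by (simp add: divide_le_eq add_pos_nonneg)
  show ?thesis unfolding kc_Suc using mult_left_mono[OF q, of "kc a b j"] kc_pos[of j] by simp
qed

lemma kc_le_1: "kc a b j \<le> 1"
proof (induction j)
  case 0 show ?case by (simp add: kc_def)
next
  case (Suc j) then show ?case using kc_dec order_trans by blast
qed

lemma summable_exp_real: "summable (\<lambda>j. 1 / fact j * \<bar>t::real\<bar> ^ j)"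
  using summable_exp_generic[of "\<bar>t\<bar>"] by (simp add: divide_inverse)

lemma summable_bounded_coeff:
  assumes "\<And>j. \<bar>c j\<bar> \<le> K" shows "summable (\<lambda>j. norm (c j / fact j * (t::real) ^ j))" "summable (\<lambda>j. c j / fact j * t ^ j)"
proof -
  show *: "summable (\<lambda>j. norm (c j / fact j * (t::real) ^ j))"
  proof (rule summable_comparison_test')
    show "summable (\<lambda>j. K * (1 / fact j * \<bar>t\<bar> ^ j))" by (intro summable_mult summable_exp_real)
    show "norm (norm (c j / fact j * t ^ j)) \<le> K * (1 / fact j * \<bar>t\<bar> ^ j)" for j
      using assms[of j] by (simp add: abs_mult power_abs divide_right_mono mult_right_mono)
  qed
  show "summable (\<lambda>j. c j / fact j * t ^ j)" using * by (rule summable_norm_cancel)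
qed

lemma kc_abs: "\<bar>kc a b j\<bar> \<le> 1" using kc_pos[of j] kc_le_1[of j] by simp

lemma kummer_eq: "kummer a b (- t) = kP a b t"
proof -
  let ?A = "\<lambda>j. kc a b j / fact j * t ^ j" and ?B = "\<lambda>j. (1::real) / fact j * (- t) ^ j"
  have sA: "summable (\<lambda>j. norm (?A j))" by (rule summable_bounded_coeff[OF kc_abs])
  have sB: "summable (\<lambda>j. norm (?B j))" by (rule summable_bounded_coeff[where K = 1]) simp
  have e: "exp (- t) = (\<Sum>j. ?B j)" unfolding exp_def by (simp add: divide_inverse)
  have "kP a b t = (\<Sum>j. ?A j) * (\<Sum>j. ?B j)" by (simp add: kP_def e mult.commute)
  also have "\<dots> = (\<Sum>n. \<Sum>i\<le>n. ?A i * ?B (n - i))" by (rule Cauchy_product[OF sA sB])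
  also have "\<dots> = (\<Sum>n. pochhammer a n / (pochhammer b n * fact n) * (- t) ^ n)"
  proof (rule suminf_cong)
    fix n
    have "(\<Sum>i\<le>n. ?A i * ?B (n - i)) = (- t) ^ n / fact n * (\<Sum>i\<le>n. kc a b i * (- 1) ^ i * of_nat (n choose i))"
      unfolding sum_distrib_left
    proof (rule sum.cong)
      fix i assume "i \<in> {..n}"
      then have i: "i \<le> n" by simp
      have "(- t) ^ n = (- t) ^ i * (- t) ^ (n - i)" using i by (simp add: power_add[symmetric])
      also have "(- t) ^ i = (- 1) ^ i * t ^ i" by (simp add: power_mult_distrib[symmetric])
      finally have 1: "t ^ i * (- t) ^ (n - i) = (- t) ^ n * (- 1) ^ i"
        by (simp add: power_mult_distrib[symmetric] mult_ac)
      have "?A i * ?B (n - i) = kc a b i * (t ^ i * (- t) ^ (n - i)) / (fact i * fact (n - i))" by simp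
      also have "\<dots> = kc a b i * (- 1) ^ i * ((- t) ^ n / fact n) * (fact n / (fact i * fact (n - i)))"
        unfolding 1 by (simp add: mult_ac)
      finally show "?A i * ?B (n - i) = (- t) ^ n / fact n * (kc a b i * (- 1) ^ i * of_nat (n choose i))"
        by (simp only: binomial_fact[OF i] mult_ac)
    qed simp
    then show "(\<Sum>i\<le>n. ?A i * ?B (n - i)) = pochhammer a n / (pochhammer b n * fact n) * (- t) ^ n"
      unfolding vandermonde_kc[OF b] by (simp add: mult_ac)
  qed
  also have "\<dots> = kummer a b (- t)" by (simp add: kummer_def eval_fps_def)
  finally show ?thesis by simp
qed

section \<open>Derivatives of the series and bounds uniform in the truncation\<close>

definition kD :: "real \<Rightarrow> real" where
  "kD t = - exp (- t) * (\<Sum>j. (kc a b j - kc a b (Suc j)) / fact j * t ^ j)"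

text \<open>Differentiating the factor \<open>exp (- t)\<close> turns coefficients into differences
  of consecutive ones. The top coefficient of a truncated series has no successor, hence the
  separate boundary term.\<close>

definition kSD :: "nat \<Rightarrow> real \<Rightarrow> real" where
  "kSD n t = - exp (- t) * ((\<Sum>j<n. (kc a b j - kc a b (Suc j)) / fact j * t ^ j) + kc a b n / fact n * t ^ n)"

lemma kc_diff: "0 \<le> kc a b j - kc a b (Suc j)" "kc a b j - kc a b (Suc j) \<le> kc a b j" "\<bar>kc a b j - kc a b (Suc j)\<bar> \<le> 1"
  using kc_dec[of j] kc_pos[of "Suc j"] kc_le_1[of j] by auto

lemma kP_deriv: "(kP a b has_real_derivative kD t) (at t)"
proof -
  let ?c = "\<lambda>j. kc a b j / fact j"
  have s: "\<And>y. summable (\<lambda>n. ?c n * y ^ n)" by (rule summable_bounded_coeff(2)[OF kc_abs])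
  have d: "diffs ?c j = kc a b (Suc j) / fact j" for j by (simp add: diffs_def del: of_nat_Suc)
  have "kD t = exp (- t) * (\<Sum>j. diffs ?c j * t ^ j) - exp (- t) * (\<Sum>j. ?c j * t ^ j)"
  proof -
    have s': "summable (\<lambda>j. kc a b (Suc j) / fact j * t ^ j)" by (rule summable_bounded_coeff(2)[OF kc_abs])
    have "(\<Sum>j. (kc a b j - kc a b (Suc j)) / fact j * t ^ j) = (\<Sum>j. ?c j * t ^ j) - (\<Sum>j. kc a b (Suc j) / fact j * t ^ j)"
      by (subst suminf_diff[OF s s']) (simp add: diff_divide_distrib left_diff_distrib)
    then show ?thesis unfolding kD_def d by (simp add: right_diff_distrib)
  qed
  moreover have "((\<lambda>t. exp (- t)) has_real_derivative - exp (- t)) (at t)" by (auto intro!: derivative_eq_intros)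
  note DERIV_mult[OF this termdiffs_strong_converges_everywhere[OF s]]
  ultimately show ?thesis unfolding kP_def[abs_def] by (elim DERIV_cong) (simp add: mult.commute)
qed

lemma kS_deriv: "(kS a b n has_real_derivative kSD n t) (at t)"
proof (induction n)
  case 0
  have "kS a b 0 = (\<lambda>t. exp (- t))" by (auto simp: kS_def kc_def)
  then show ?case by (auto intro!: derivative_eq_intros simp: kSD_def kc_def)
next
  case (Suc n)
  have eq: "kS a b (Suc n) = (\<lambda>t. kS a b n t + exp (- t) * (kc a b (Suc n) / fact (Suc n) * t ^ Suc n))"
    by (auto simp: kS_def distrib_left)
  define Z where "Z = kc a b (Suc n) / fact (Suc n) * t ^ Suc n"
  have c: "kc a b (Suc n) / fact (Suc n) * (real (Suc n) * t ^ n) = kc a b (Suc n) / fact n * t ^ n" by (simp del: of_nat_Suc)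
  have "((\<lambda>t. kS a b n t + exp (- t) * (kc a b (Suc n) / fact (Suc n) * t ^ Suc n)) has_real_derivative
     kSD n t + (- exp (- t) * (kc a b (Suc n) / fact (Suc n) * t ^ Suc n) + exp (- t) * (kc a b (Suc n) / fact (Suc n) * (real (Suc n) * t ^ n)))) (at t)"
  proof -
    have d1: "((\<lambda>t. exp (- t)) has_real_derivative - exp (- t)) (at t)" by (auto intro!: derivative_eq_intros)
    have d2: "((\<lambda>t. K * t ^ Suc n) has_real_derivative K * (real (Suc n) * t ^ n)) (at t)" for K
      by (rule DERIV_cong[OF DERIV_cmult[OF DERIV_pow]]) simp
    show ?thesis by (rule DERIV_cong[OF DERIV_add[OF Suc DERIV_mult[OF d1 d2]]]) (simp only: mult.commute)
  qed
  moreover have "kSD n t + (- exp (- t) * Z + exp (- t) * (kc a b (Suc n) / fact n * t ^ n)) = kSD (Suc n) t"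
    unfolding kSD_def sum.lessThan_Suc Z_def[symmetric] by (simp add: diff_divide_distrib left_diff_distrib algebra_simps)
  ultimately show ?case unfolding eq c Z_def[symmetric] by (metis DERIV_cong)
qed

context fixes t :: real assumes t: "t \<ge> 0" begin

lemma kS_nonneg: "0 \<le> kS a b n t"
  unfolding kS_def using kc_pos t by (intro mult_nonneg_nonneg sum_nonneg divide_nonneg_pos) (auto intro: less_imp_le)

lemma kS_le_kP: "kS a b n t \<le> kP a b t"
proof -
  have q: "0 \<le> kc a b j / fact j * t ^ j" for j using kc_pos[of j] t by simp
  have "(\<Sum>j\<le>n. kc a b j / fact j * t ^ j) \<le> (\<Sum>j. kc a b j / fact j * t ^ j)"
    by (rule sum_le_suminf[OF summable_bounded_coeff(2)[OF kc_abs, where t = t]]) (simp, rule q)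
  then show ?thesis unfolding kS_def kP_def by (intro mult_left_mono) auto
qed

lemma kP_nonneg: "0 \<le> kP a b t" using kS_nonneg kS_le_kP order_trans by blast

lemma kP_pos: "0 < kP a b t"
proof -
  have "kS a b 0 t > 0" by (simp add: kS_def kc_def)
  then show ?thesis using kS_le_kP less_le_trans by blast
qed

lemma kP_le_1: "kP a b t \<le> 1"
proof -
  have "(\<Sum>j. kc a b j / fact j * t ^ j) \<le> (\<Sum>j. 1 / fact j * t ^ j)"
  proof (rule suminf_le)
    show "kc a b j / fact j * t ^ j \<le> 1 / fact j * t ^ j" for j
      using kc_le_1[of j] t by (intro mult_right_mono divide_right_mono) auto
    show "summable (\<lambda>j. 1 / fact j * t ^ j)" using summable_exp_real[of t] t by simp
  qed (rule summable_bounded_coeff(2)[OF kc_abs])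
  also have "\<dots> = exp t" unfolding exp_def by (simp add: divide_inverse mult.commute)
  finally have "kP a b t \<le> exp (- t) * exp t" unfolding kP_def by (intro mult_left_mono) auto
  then show ?thesis by (simp add: exp_add[symmetric])
qed

text \<open>The coefficients of -\<open>kD\<close> lie between 0 and those of \<open>kP\<close>, by
  monotonicity of \<open>kc\<close>. So the derivative decays at least as fast as the function, and
  one majorant will serve for both.\<close>

lemma kD_abs: "\<bar>kD t\<bar> \<le> kP a b t"
proof -
  let ?d = "\<lambda>j. (kc a b j - kc a b (Suc j)) / fact j * t ^ j"
  have "0 \<le> (\<Sum>j. ?d j)"
    using kc_diff t by (intro suminf_nonneg summable_bounded_coeff(2)[OF kc_diff(3)] mult_nonneg_nonneg divide_nonneg_pos) auto
  moreover have "(\<Sum>j. ?d j) \<le> (\<Sum>j. kc a b j / fact j * t ^ j)"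
    using kc_diff t by (intro suminf_le summable_bounded_coeff(2)[OF kc_diff(3)] summable_bounded_coeff(2)[OF kc_abs] mult_right_mono divide_right_mono) auto
  ultimately show ?thesis unfolding kD_def kP_def by (simp add: abs_mult mult_left_mono)
qed

text \<open>One multiple of \<open>kP\<close> bounds the sum, the second one the boundary term. The
  bound does not depend on \<open>n\<close>, as dominated convergence of the truncations
  requires.\<close>

lemma kSD_abs: "\<bar>kSD n t\<bar> \<le> 2 * kP a b t"
proof -
  let ?d = "\<lambda>j. (kc a b j - kc a b (Suc j)) / fact j * t ^ j"
  have p: "0 \<le> ?d j" for j using kc_diff[of j] t by simp
  have q: "0 \<le> kc a b j / fact j * t ^ j" for j using kc_pos[of j] t by simp
  let ?K = "\<Sum>j. kc a b j / fact j * t ^ j"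
  have 1: "(\<Sum>j<n. ?d j) \<le> ?K"
  proof -
    have "(\<Sum>j<n. ?d j) \<le> (\<Sum>j<n. kc a b j / fact j * t ^ j)"
      using kc_diff t by (intro sum_mono mult_right_mono divide_right_mono) auto
    also have "\<dots> \<le> ?K" by (rule sum_le_suminf[OF summable_bounded_coeff(2)[OF kc_abs]]) (simp, rule q)
    finally show ?thesis .
  qed
  have 2: "kc a b n / fact n * t ^ n \<le> ?K"
  proof -
    have "(\<Sum>j\<in>{n}. kc a b j / fact j * t ^ j) \<le> ?K"
      by (rule sum_le_suminf[OF summable_bounded_coeff(2)[OF kc_abs]]) (simp, rule q)
    then show ?thesis by simp
  qed
  have 3: "0 \<le> (\<Sum>j<n. ?d j) + kc a b n / fact n * t ^ n" by (intro add_nonneg_nonneg sum_nonneg p q)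
  have "\<bar>kSD n t\<bar> = exp (- t) * ((\<Sum>j<n. ?d j) + kc a b n / fact n * t ^ n)"
    unfolding kSD_def using 3 by (simp add: abs_mult)
  also have "\<dots> \<le> exp (- t) * (2 * ?K)" using 1 2 by (intro mult_left_mono) auto
  finally show ?thesis by (simp add: kP_def)
qed

end

lemma kS_tendsto: "(\<lambda>n. kS a b n t) \<longlonglongrightarrow> kP a b t"
  unfolding kS_def kP_def
  by (intro tendsto_mult_left summable_LIMSEQ' summable_bounded_coeff(2)[OF kc_abs])

lemma kSD_tendsto: "(\<lambda>n. kSD n t) \<longlonglongrightarrow> kD t"
proof -
  have 1: "(\<lambda>n. \<Sum>j<n. (kc a b j - kc a b (Suc j)) / fact j * t ^ j) \<longlonglongrightarrow> (\<Sum>j. (kc a b j - kc a b (Suc j)) / fact j * t ^ j)"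
    by (intro summable_LIMSEQ summable_bounded_coeff(2)[OF kc_diff(3)])
  have 2: "(\<lambda>n. kc a b n / fact n * t ^ n) \<longlonglongrightarrow> 0"
    by (intro summable_LIMSEQ_zero summable_bounded_coeff(2)[OF kc_abs])
  have "(\<lambda>n. kSD n t) \<longlonglongrightarrow> - exp (- t) * ((\<Sum>j. (kc a b j - kc a b (Suc j)) / fact j * t ^ j) + 0)"
    unfolding kSD_def by (intro tendsto_mult_left tendsto_add 1 2)
  then show ?thesis by (simp add: kD_def)
qed

text \<open>The coefficients of exp(t) (a M + t M'). By \<open>kc_Suc\<close> the one of index j + 1
  is \<open>kc a b j / (b + j)\<close> times a (b - a - 1), and the last factor is negative since b
  < a + 1.\<close>

lemma euler_coefficient:
  "a * kc a b (Suc j) - real (Suc j) * (kc a b j - kc a b (Suc j)) \<le> 0"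
  "a * kc a b 1 - 1 * (kc a b 0 - kc a b 1) = a * (b - a - 1) / b"
proof -
  have bj: "b + real j > 0" using b by simp
  have "a * kc a b (Suc j) - real (Suc j) * (kc a b j - kc a b (Suc j))
     = kc a b j / (b + real j) * (a * (b - a + real j) - real (Suc j) * a)"
  proof -
    define K where "K = kc a b j / (b + real j)"
    have "kc a b j = K * (b + real j)" using bj by (simp add: K_def)
    moreover have "kc a b (Suc j) = K * (b - a + real j)" by (simp add: kc_Suc K_def)
    ultimately show ?thesis unfolding K_def[symmetric] by (simp only:) (simp add: algebra_simps)
  qed
  also have "\<dots> = kc a b j / (b + real j) * (a * (b - a - 1))" by (simp add: algebra_simps)
  also have "\<dots> \<le> 0" using kc_pos[of j] bj a ba by (intro mult_nonneg_nonpos) (auto simp: mult_nonneg_nonpos)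
  finally show "a * kc a b (Suc j) - real (Suc j) * (kc a b j - kc a b (Suc j)) \<le> 0" .
  show "a * kc a b 1 - 1 * (kc a b 0 - kc a b 1) = a * (b - a - 1) / b"
    using b by (simp add: kc_def field_simps)
qed

text \<open>\<open>a M + t M' = a M(a+1,b,-t)\<close> is eventually negative, so \<open>t\<^sup>a M(a,b,-t)\<close> is eventually decreasing.\<close>

lemma euler_nonpos:
  assumes t: "t \<ge> b / (a + 1 - b)"
  shows "a * kP a b t + t * kD t \<le> 0"
proof -
  have t0: "t > 0" using t b ba by (smt (verit) divide_pos_pos)
  let ?e = "\<lambda>j. a * kc a b j - real j * (kc a b (j - 1) - kc a b j)"
  let ?d = "\<lambda>j. (kc a b j - kc a b (Suc j)) / fact j * t ^ j"
  have sd: "summable ?d" by (rule summable_bounded_coeff(2)[OF kc_diff(3)])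
  have s1: "summable (\<lambda>j. a * (kc a b j / fact j * t ^ j))" by (intro summable_mult summable_bounded_coeff(2)[OF kc_abs])
  have shift: "(\<lambda>j. real (Suc j) * (kc a b j - kc a b (Suc j)) / fact (Suc j) * t ^ Suc j) = (\<lambda>j. t * ?d j)"
    by (rule ext) (simp del: of_nat_Suc)
  have s2': "summable (\<lambda>j. real j * (kc a b (j - 1) - kc a b j) / fact j * t ^ j)"
    by (subst summable_Suc_iff[symmetric]) (simp only: shift diff_Suc_1, intro summable_mult sd)
  have "t * (\<Sum>j. ?d j) = (\<Sum>j. real j * (kc a b (j - 1) - kc a b j) / fact j * t ^ j)"
  proof -
    have "t * (\<Sum>j. ?d j) = (\<Sum>j. real (Suc j) * (kc a b (Suc j - 1) - kc a b (Suc j)) / fact (Suc j) * t ^ Suc j)"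
      unfolding diff_Suc_1 shift by (rule suminf_mult[OF sd, symmetric])
    also have "\<dots> = (\<Sum>j. real j * (kc a b (j - 1) - kc a b j) / fact j * t ^ j)"
      unfolding suminf_split_head[OF s2'] by simp
    finally show ?thesis .
  qed
  then have "a * (\<Sum>j. kc a b j / fact j * t ^ j) - t * (\<Sum>j. ?d j) = (\<Sum>j. ?e j / fact j * t ^ j)"
    using s1 s2' summable_bounded_coeff(2)[OF kc_abs, where t = t]
    by (simp add: suminf_mult[symmetric] suminf_diff diff_divide_distrib left_diff_distrib mult.assoc)
  \<comment> \<open>The terms beyond index 1 are nonpositive and may be dropped. What remains is a
    linear polynomial in \<open>t\<close> whose zero is the threshold b / (a + 1 - b).\<close>
  also have "\<dots> \<le> (\<Sum>j\<in>{0,1}. ?e j / fact j * t ^ j)"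
  proof -
    have se: "summable (\<lambda>j. - (?e j / fact j * t ^ j))"
      using summable_diff[OF s1 s2'] by (intro summable_minus) (simp add: diff_divide_distrib left_diff_distrib mult.assoc)
    have "0 \<le> - (?e j / fact j * t ^ j)" if "j \<notin> {0, 1}" for j
    proof -
      obtain i where "j = Suc i" using \<open>j \<notin> {0, 1}\<close> by (cases j) auto
      then have "?e j \<le> 0" using euler_coefficient(1)[of i] by simp
      then show ?thesis using t0 by (simp add: mult_nonpos_nonneg divide_nonpos_pos)
    qed
    then have "(\<Sum>j\<in>{0,1}. - (?e j / fact j * t ^ j)) \<le> (\<Sum>j. - (?e j / fact j * t ^ j))"
      by (intro sum_le_suminf[OF se]) auto
    then show ?thesis using summable_minus[OF se] by (simp add: suminf_minus[OF summable_minus[OF se, simplified]])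
  qed
  also have "\<dots> = a + a * (b - a - 1) / b * t"
    using euler_coefficient(2) by (simp add: kc_def)
  also have "\<dots> = a / b * (b - (a + 1 - b) * t)" using b by (simp add: field_simps)
  also have "\<dots> \<le> 0"
    using t ba a b by (intro mult_nonneg_nonpos) (auto simp: divide_le_eq mult.commute)
  finally have "a * (\<Sum>j. kc a b j / fact j * t ^ j) - t * (\<Sum>j. ?d j) \<le> 0" .
  then have "exp (- t) * (a * (\<Sum>j. kc a b j / fact j * t ^ j) - t * (\<Sum>j. ?d j)) \<le> 0" by (simp add: mult_nonneg_nonpos)
  then show ?thesis by (simp add: kP_def kD_def algebra_simps)
qed

text \<open>Beyond \<open>t1\<close> the function t^a M is nonincreasing, and up to
  \<open>t1\<close> the bound M \<le> 1 suffices; the constant (1 + t1)^a works on both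
  ranges.\<close>

lemma kP_decay: "\<exists>C>0. \<forall>t\<ge>0. kP a b t \<le> C * (1 + t) powr (- a)"
proof -
  define t1 where "t1 = b / (a + 1 - b)"
  have t1: "t1 > 0" unfolding t1_def using b ba by simp
  have mono: "t powr a * kP a b t \<le> t1 powr a * kP a b t1" if "t \<ge> t1" for t
  proof (rule DERIV_nonpos_imp_nonincreasing[OF that])
    fix x assume x: "t1 \<le> x" "x \<le> t"
    then have x0: "x > 0" using t1 by simp
    have "((\<lambda>t. t powr a * kP a b t) has_real_derivative x powr (a - 1) * (a * kP a b x + x * kD x)) (at x)"
      using x0 by (auto intro!: derivative_eq_intros kP_deriv simp: algebra_simps powr_mult_base)
    moreover have "x powr (a - 1) * (a * kP a b x + x * kD x) \<le> 0"
      using euler_nonpos x unfolding t1_def by (intro mult_nonneg_nonpos) auto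
    ultimately show "\<exists>y. ((\<lambda>t. t powr a * kP a b t) has_real_derivative y) (at x) \<and> y \<le> 0" by blast
  qed
  have "kP a b t \<le> (1 + t1) powr a * (1 + t) powr (- a)" if t: "t \<ge> 0" for t
  proof (cases "t \<le> t1")
    case True
    have "kP a b t \<le> 1" by (rule kP_le_1[OF t])
    also have "1 = (1 + t) powr a * (1 + t) powr (- a)" using t by (simp add: powr_add[symmetric])
    also have "\<dots> \<le> (1 + t1) powr a * (1 + t) powr (- a)"
      using True t a by (intro mult_right_mono powr_mono2) auto
    finally show ?thesis .
  next
    case False
    then have t': "t \<ge> t1" "t > 0" using t1 by auto
    have "t powr a * kP a b t \<le> t1 powr a * 1"
      using order_trans[OF mono[OF t'(1)] mult_left_mono[OF kP_le_1[of t1], of "t1 powr a"]] t1 by simp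
    moreover have "t1 powr a * (1 + t) powr a \<le> (1 + t1) powr a * t powr a"
    proof -
      have "t1 * (1 + t) \<le> (1 + t1) * t" using t' by (simp add: algebra_simps)
      then show ?thesis using t' t1 a by (simp add: powr_mult[symmetric] powr_mono2)
    qed
    ultimately have "t powr a * kP a b t * (1 + t) powr a \<le> (1 + t1) powr a * t powr a"
      using mult_right_mono[of "t powr a * kP a b t" "t1 powr a * 1" "(1 + t) powr a"] by simp
    then have "t powr a * (kP a b t * (1 + t) powr a) \<le> t powr a * (1 + t1) powr a" by (simp only: mult_ac)
    then have "kP a b t * (1 + t) powr a \<le> (1 + t1) powr a" using t' by (simp add: mult_le_cancel_left_pos)
    then show ?thesis using t by (simp add: powr_minus field_simps)
  qed
  then show ?thesis using t1 by (intro exI[of _ "(1 + t1) powr a"]) auto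
qed

text \<open>The sequence bounds, up to a constant, the squared norm of A on the truncated Kummer
  series. By the Gamma limit for Pochhammer symbols it behaves like n^(1 + b - 2a).\<close>

lemma residual_tendsto:
  assumes "2 * a - b > 1"
  shows "(\<lambda>n. (real n + b - a)\<^sup>2 * (kc a b n)\<^sup>2 * pochhammer b n / fact n) \<longlonglongrightarrow> 0"
proof -
  define p where "p = b - a"
  have p: "p > 0" using ab by (simp add: p_def)
  let ?G = "\<lambda>z n. Gamma_series' z n :: real"
  have G: "?G z \<longlonglongrightarrow> Gamma z" for z by (rule Gamma_series'_LIMSEQ)
  have nz: "Gamma p \<noteq> 0" "Gamma b \<noteq> 0" using Gamma_real_pos[OF p] Gamma_real_pos[OF b] by auto
  have "(\<lambda>n. (real n + b) * real (Suc n) powr (2 * p - b)) \<longlonglongrightarrow> 0"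
    using assms unfolding p_def by real_asymp
  moreover have "(\<lambda>n. ?G b (Suc n) / (?G p (Suc n))\<^sup>2) \<longlonglongrightarrow> Gamma b / (Gamma p)\<^sup>2"
    using nz by (intro tendsto_divide tendsto_power LIMSEQ_Suc[OF G]) auto
  ultimately have lim: "(\<lambda>n. (real n + b) * real (Suc n) powr (2 * p - b) * (?G b (Suc n) / (?G p (Suc n))\<^sup>2)) \<longlonglongrightarrow> 0 * (Gamma b / (Gamma p)\<^sup>2)"
    by (rule tendsto_mult)
  have eq: "(real n + b - a)\<^sup>2 * (kc a b n)\<^sup>2 * pochhammer b n / fact n
     = (real n + b) * real (Suc n) powr (2 * p - b) * (?G b (Suc n) / (?G p (Suc n))\<^sup>2)" for n
  proof -
    have pb: "pochhammer b n > 0" "pochhammer p n > 0" using b p by (auto intro: pochhammer_pos)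
    have bn: "b + real n > 0" "p + real n > 0" using b p by auto
    have GE: "?G z (Suc n) = fact n * real (Suc n) powr z / (pochhammer z n * (z + real n))" for z
      by (simp add: Gamma_series'_def pochhammer_Suc powr_def)
    define X where "X = real (Suc n) powr p"
    define Y where "Y = real (Suc n) powr b"
    have XY: "X > 0" "Y > 0" by (auto simp: X_def Y_def)
    have pw: "real (Suc n) powr (2 * p - b) = X\<^sup>2 / Y"
      unfolding X_def Y_def by (simp add: powr_diff power2_eq_square powr_add[symmetric] del: of_nat_Suc)
    have f: "(fact n :: real) > 0" by simp
    have gen: "v\<^sup>2 * (P / B)\<^sup>2 * B / f = u * (X\<^sup>2 / Y) * ((f * Y / (B * u)) / (f * X / (P * v))\<^sup>2)"
      if "u > 0" "v > 0" "P > 0" "B > 0" "f > 0" for u v P B f :: real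
      using that XY by (simp add: field_simps power2_eq_square)
    have "(p + real n)\<^sup>2 * (pochhammer p n / pochhammer b n)\<^sup>2 * pochhammer b n / fact n
      = (b + real n) * (X\<^sup>2 / Y) * ((fact n * Y / (pochhammer b n * (b + real n))) / (fact n * X / (pochhammer p n * (p + real n)))\<^sup>2)"
      by (rule gen[OF bn(1,2) pb(2,1) f])
    then show ?thesis unfolding GE pw X_def[symmetric] Y_def[symmetric] kc_def p_def[symmetric]
      by (simp add: p_def algebra_simps)
  qed
  show ?thesis unfolding eq using lim by simp
qed

end

section \<open>Square-integrable fields\<close>

definition sqi :: "(real^'n::finite \<Rightarrow> 'b::euclidean_space) \<Rightarrow> bool" where
  "sqi F \<longleftrightarrow> F \<in> borel_measurable lborel \<and> integrable lborel (\<lambda>x. (norm (F x))\<^sup>2)"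

text \<open>The squared L2 norm. It carries this meaning only together with \<open>sqi\<close>,
  since a Bochner integral that does not exist has the value 0.\<close>

definition n2 :: "(real^'n::finite \<Rightarrow> 'b::euclidean_space) \<Rightarrow> real" where
  "n2 F = (LINT x|lborel. (norm (F x))\<^sup>2)"

lemma n2_nonneg: "n2 F \<ge> 0" by (simp add: n2_def)

text \<open>The weighted form is needed because the leading terms of the remainder may lose only a
  factor 1 + e under approximation, while the approximation error may be multiplied by any
  constant.\<close>

lemma norm_add_sq_le:
  assumes "e > 0" shows "(norm (u + v :: 'b::real_normed_vector))\<^sup>2 \<le> (1 + e) * (norm u)\<^sup>2 + (1 + 1 / e) * (norm v)\<^sup>2"
proof -
  have "(norm (u + v))\<^sup>2 \<le> (norm u + norm v)\<^sup>2" by (intro power_mono norm_triangle_ineq) auto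
  also have "\<dots> = (1 + e) * (norm u)\<^sup>2 + (1 + 1 / e) * (norm v)\<^sup>2 - e * (norm u - norm v / e)\<^sup>2"
    using assms by (simp add: power2_eq_square field_simps)
  also have "\<dots> \<le> (1 + e) * (norm u)\<^sup>2 + (1 + 1 / e) * (norm v)\<^sup>2" using assms by simp
  finally show ?thesis .
qed

lemma sqi_add: assumes "sqi F" "sqi G" shows "sqi (\<lambda>x. F x + G x)"
proof -
  have m: "F \<in> borel_measurable lborel" "G \<in> borel_measurable lborel" using assms by (auto simp: sqi_def)
  have "integrable lborel (\<lambda>x. (norm (F x + G x))\<^sup>2)"
  proof (rule Bochner_Integration.integrable_bound)
    show "integrable lborel (\<lambda>x. (1 + 1) * (norm (F x))\<^sup>2 + (1 + 1 / 1) * (norm (G x))\<^sup>2)"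
      using assms unfolding sqi_def by (intro Bochner_Integration.integrable_add integrable_mult_right) auto
    show "(\<lambda>x. (norm (F x + G x))\<^sup>2) \<in> borel_measurable lborel" using m by measurable
    show "AE x in lborel. norm ((norm (F x + G x))\<^sup>2) \<le> norm ((1 + 1) * (norm (F x))\<^sup>2 + (1 + 1 / 1) * (norm (G x))\<^sup>2)"
      using norm_add_sq_le[of 1] by (intro AE_I2) auto
  qed
  with m show ?thesis by (simp add: sqi_def)
qed

lemma sqi_scaleR: "sqi F \<Longrightarrow> sqi (\<lambda>x. c *\<^sub>R F x)"
  by (auto simp: sqi_def power_mult_distrib)

lemma sqi_uminus: "sqi F \<Longrightarrow> sqi (\<lambda>x. - F x)" by (auto simp: sqi_def)

lemma sqi_diff: "sqi F \<Longrightarrow> sqi G \<Longrightarrow> sqi (\<lambda>x. F x - G x)"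
  using sqi_add[of F "\<lambda>x. - G x"] sqi_uminus[of G] by simp

lemma n2_add_le:
  assumes "e > 0" "sqi F" "sqi G" shows "n2 (\<lambda>x. F x + G x) \<le> (1 + e) * n2 F + (1 + 1 / e) * n2 G"
proof -
  have "n2 (\<lambda>x. F x + G x) \<le> (LINT x|lborel. (1 + e) * (norm (F x))\<^sup>2 + (1 + 1 / e) * (norm (G x))\<^sup>2)"
    unfolding n2_def
    using sqi_add[OF assms(2,3)] assms norm_add_sq_le[OF assms(1)] by (intro integral_mono) (auto simp: sqi_def)
  also have "\<dots> = (1 + e) * n2 F + (1 + 1 / e) * n2 G"
    using assms unfolding n2_def sqi_def by (subst Bochner_Integration.integral_add) auto
  finally show ?thesis .
qed

lemma n2_scaleR: "n2 (\<lambda>x. c *\<^sub>R F x) = c\<^sup>2 * n2 F"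
  by (simp add: n2_def power_mult_distrib)

definition rgrad :: "(real^'n::finite \<Rightarrow> real) \<Rightarrow> real^'n \<Rightarrow> real^'n" where
  "rgrad f x = (\<chi> i. partial i f x)"

lemma norm_rgrad_sq: "(norm (rgrad f x))\<^sup>2 = (\<Sum>i\<in>UNIV. (partial i f x)\<^sup>2)"
  by (simp add: norm_sq_sum rgrad_def)

lemma borel_measurable_vec_lambda:
  assumes "\<And>i. (\<lambda>x. f i x) \<in> borel_measurable M"
  shows "(\<lambda>x. (\<chi> i. f i x) :: 'b::euclidean_space^'n::finite) \<in> borel_measurable M"
proof -
  have "(\<lambda>x. \<Sum>i\<in>UNIV. axis i (f i x)) \<in> borel_measurable M"
  proof (intro borel_measurable_sum)
    fix i :: 'n
    have "continuous_on UNIV (\<lambda>y::'b. axis i y :: 'b^'n)"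
      unfolding axis_def
    proof (intro continuous_on_vec_lambda)
      show "continuous_on UNIV (\<lambda>y::'b. if j = i then y else 0)" for j
        by (cases "j = i") (auto intro: continuous_on_id)
    qed
    from borel_measurable_continuous_on[OF this assms[of i]] show "(\<lambda>x. axis i (f i x)) \<in> borel_measurable M" .
  qed
  moreover have "(\<Sum>i\<in>UNIV. axis i (f i x)) = ((\<chi> i. f i x) :: 'b^'n)" for x
    by (simp add: vec_eq_iff axis_def if_distrib cong: if_cong)
  ultimately show ?thesis by simp
qed

lemma sqi_rgradI:
  assumes "\<And>i. partial i f \<in> borel_measurable lborel" "\<And>i. integrable lborel (\<lambda>x. (partial i f x)\<^sup>2)"
  shows "sqi (rgrad f)"
  unfolding sqi_def norm_rgrad_sq using assms
  by (auto simp: rgrad_def[abs_def] intro!: borel_measurable_vec_lambda)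

lemma schwartz_sqi_rgrad: assumes "schwartz f" shows "sqi (rgrad f)" "n2 (rgrad f) = gip f f"
proof -
  have i: "integrable lborel (\<lambda>x. partial i f x * partial i f x)" for i
    using assms by (intro ip_integrable schwartz_partial)
  then show "sqi (rgrad f)" using assms schwartz_measurable[OF schwartz_partial[OF assms]]
    by (intro sqi_rgradI) (auto simp: power2_eq_square)
  show "n2 (rgrad f) = gip f f"
    unfolding n2_def norm_rgrad_sq gip_def ip_def
    by (subst Bochner_Integration.integral_sum) (auto simp: power2_eq_square i)
qed

lemma rgrad_add: "f differentiable (at x) \<Longrightarrow> g differentiable (at x) \<Longrightarrow> rgrad (\<lambda>x. f x + g x) x = rgrad f x + rgrad g x"
  by (simp add: rgrad_def vec_eq_iff partial_add)
lemma rgrad_cmult: "f differentiable (at x) \<Longrightarrow> rgrad (\<lambda>x. c * f x) x = c *\<^sub>R rgrad f x"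
  by (simp add: rgrad_def vec_eq_iff partial_cmult)

lemma ip_cauchy_schwarz:
  assumes f: "schwartz f" and g: "schwartz g"
  shows "(ip f g)\<^sup>2 \<le> ip f f * ip g g"
proof (cases "ip g g = 0")
  case False
  then have B: "ip g g > 0" using ip_nonneg[of g] by simp
  have "0 \<le> isq (\<lambda>x. ip g g * f x - ip f g * g x)" by (rule ip_nonneg)
  also have "\<dots> = ip g g * (ip f f * ip g g - (ip f g)\<^sup>2)"
    using f g by (simp add: ip_linear schwartz_intros ip_commute[of g f]) (simp add: algebra_simps power2_eq_square)
  finally show ?thesis using B by (simp add: zero_le_mult_iff)
next
  case True
  have "0 \<le> ip f f + 2 * t * ip f g" for t
  proof -
    have "0 \<le> isq (\<lambda>x. f x + t * g x)" by (rule ip_nonneg)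
    also have "\<dots> = ip f f + 2 * t * ip f g"
      using f g True by (simp add: ip_linear schwartz_intros ip_commute[of g f])
    finally show ?thesis .
  qed
  from this[of "- (ip f f + 1) / (2 * ip f g)"] have "ip f g = 0"
    by (cases "ip f g = 0") (auto simp: field_simps)
  with True show ?thesis by simp
qed

lemma gip_nonneg: "gip f f \<ge> 0" by (simp add: gip_def sum_nonneg ip_nonneg)

lemma gip_add_left: "schwartz f \<Longrightarrow> schwartz g \<Longrightarrow> schwartz h \<Longrightarrow> gip (\<lambda>x. f x + g x) h = gip f h + gip g h"
  by (simp add: gip_eq schwartz_intros op_linear ip_linear)
lemma gip_diff_left: "schwartz f \<Longrightarrow> schwartz g \<Longrightarrow> schwartz h \<Longrightarrow> gip (\<lambda>x. f x - g x) h = gip f h - gip g h"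
  by (simp add: gip_eq schwartz_intros op_linear ip_linear)
lemma gip_cmult_left: "schwartz f \<Longrightarrow> schwartz h \<Longrightarrow> gip (\<lambda>x. c * f x) h = c * gip f h"
  by (simp add: gip_eq schwartz_intros op_linear ip_linear)
lemma gip_commute: "gip f g = gip g f" by (simp add: gip_def ip_commute)
lemma gip_add_right: "schwartz f \<Longrightarrow> schwartz g \<Longrightarrow> schwartz h \<Longrightarrow> gip h (\<lambda>x. f x + g x) = gip h f + gip h g"
  by (simp add: gip_commute[of h] gip_add_left)
lemma gip_diff_right: "schwartz f \<Longrightarrow> schwartz g \<Longrightarrow> schwartz h \<Longrightarrow> gip h (\<lambda>x. f x - g x) = gip h f - gip h g"
  by (simp add: gip_commute[of h] gip_diff_left)
lemma gip_cmult_right: "schwartz f \<Longrightarrow> schwartz h \<Longrightarrow> gip h (\<lambda>x. c * f x) = c * gip h f"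
  by (simp add: gip_commute[of h] gip_cmult_left)
lemmas gip_linear = gip_add_left gip_diff_left gip_cmult_left gip_add_right gip_diff_right gip_cmult_right

section \<open>Spectral gap on the image of the adjoint\<close>

text \<open>The common last step of the gap estimates: \<open>X\<close> is the gradient form,
  \<open>X\<^sup>2 \<le> Z * Y\<close> is Cauchy-Schwarz and \<open>K * Y \<le> X\<close> is the
  partner identity with a nonnegative term dropped.\<close>

lemma le_of_square_le: "X \<le> Z / K" if "X\<^sup>2 \<le> Z * Y" "K * Y \<le> X" "K > 0" "X \<ge> 0" "Z \<ge> 0" for X Y Z K :: real
proof (cases "X = 0")
  case True then show ?thesis using that by simp
next
  case False
  then have X: "X > 0" using that by simp
  have "K * X\<^sup>2 \<le> Z * (K * Y)" using that(1,3) by (simp add: mult_left_mono mult.left_commute)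
  also have "\<dots> \<le> Z * X" using that by (intro mult_left_mono) auto
  finally have "(K * X) * X \<le> Z * X" by (simp add: power2_eq_square mult_ac)
  then show ?thesis using X that(3) by (simp add: pos_le_divide_eq mult.commute)
qed

text \<open>Pairing \<open>u\<close> with itself as an element of the image moves
  \<open>op l c\<close> onto \<open>u\<close> and leaves the Laplacian of \<open>z\<close>. The
  partner identity bounds that Laplacian by the gradient of \<open>u\<close> with factor 4l, and
  Cauchy-Schwarz closes the estimate.\<close>

lemma gap_image:
  fixes z :: "real^'n::finite \<Rightarrow> real"
  assumes z: "schwartz z" and l: "l > 0" and m: "m = c + 2 - real CARD('n)"
  defines "u \<equiv> op (- l) (- m) z"
  shows "4 * l * gip u u \<le> isq (op l c u)"
proof -
  have u: "schwartz u" unfolding u_def by (rule schwartz_op[OF z])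
  have "gip u u = - ip (op l c u) (laplacian z)" using gip_op_right[OF u z m] by (simp add: u_def)
  then have "(gip u u)\<^sup>2 \<le> isq (op l c u) * isq (laplacian z)"
    using ip_cauchy_schwarz[OF schwartz_op[OF u] schwartz_laplacian[OF z]] by simp
  moreover have "4 * l * isq (laplacian z) \<le> gip u u"
    unfolding u_def gip_op_partner[OF z m] using gip_nonneg by simp
  ultimately have "gip u u \<le> isq (op l c u) / (4 * l)"
    using l by (intro le_of_square_le) (auto simp: gip_nonneg ip_nonneg)
  then show ?thesis using l by (simp add: pos_le_divide_eq mult.commute)
qed

text \<open>If \<open>z\<close> is itself such an image, so is its Laplacian, by intertwining. The
  argument of \<open>gap_image\<close> one level up, with \<open>ip_op_partner\<close>, then shows
  that the term dropped there is at least 4l \<open>isq (laplacian z)\<close>, which doubles the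
  constant.\<close>

lemma gap_image2:
  fixes y :: "real^'n::finite \<Rightarrow> real"
  assumes y: "schwartz y" and l: "l > 0" and m: "m = c + 2 - real CARD('n)"
  defines "z \<equiv> op (- l) (- (m + 2)) y"
  defines "u \<equiv> op (- l) (- m) z"
  shows "8 * l * gip u u \<le> isq (op l c u)"
proof -
  have z: "schwartz z" and u: "schwartz u" unfolding u_def z_def by (intro schwartz_op y)+
  let ?w = "laplacian y"
  have w: "schwartz ?w" by (rule schwartz_laplacian[OF y])
  have Lz: "laplacian z = op (- l) (- m) ?w" unfolding z_def laplacian_op[OF y] by simp
  have "isq (laplacian z) = - gip (op l c z) ?w"
  proof -
    have "gip (op l c z) ?w = - ip (op l (c + 2) (laplacian z)) ?w" by (simp add: gip_eq schwartz_op z w laplacian_op)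
    also have "\<dots> = - ip (laplacian z) (op (- l) (real CARD('n) - (c + 2)) ?w)" by (simp add: op_adjoint schwartz_laplacian z w)
    also have "real CARD('n) - (c + 2) = - m" using m by simp
    finally show ?thesis by (simp add: Lz)
  qed
  also have "\<dots> = ip (laplacian ?w) (op l c z)" using gip_eq[OF w schwartz_op[OF z]] by (simp add: gip_commute)
  finally have *: "isq (laplacian z) = - gip (op l c z) ?w" "gip (op l c z) ?w = - ip (laplacian ?w) (op l c z)"
    using gip_eq[OF w schwartz_op[OF z]] by (simp_all add: gip_commute)
  have cs: "(gip f g)\<^sup>2 \<le> gip f f * gip g g" if f: "schwartz f" and g: "schwartz g" for f g :: "real^'n \<Rightarrow> real"
  proof -
    have 0: "0 \<le> gip f f + 2 * t * gip f g + t\<^sup>2 * gip g g" for t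
    proof -
      have "0 \<le> gsq (\<lambda>x. f x + t * g x)" by (rule gip_nonneg)
      also have "\<dots> = gip f f + 2 * t * gip f g + t\<^sup>2 * gip g g"
        using f g by (simp add: gip_linear schwartz_intros gip_commute[of g f] power2_eq_square algebra_simps)
      finally show ?thesis .
    qed
    show ?thesis
    proof (cases "gip g g = 0")
      case True
      from 0[of "- (gip f f + 1) / (2 * gip f g)"] True have "gip f g = 0" by (cases "gip f g = 0") (auto simp: field_simps)
      with True show ?thesis by simp
    next
      case False
      then have B: "gip g g > 0" using gip_nonneg[of g] by simp
      from 0[of "- gip f g / gip g g"] B show ?thesis by (simp add: power2_eq_square field_simps)
    qed
  qed
  have "(isq (laplacian z))\<^sup>2 \<le> gsq (op l c z) * gip ?w ?w"
    using cs[OF schwartz_op[OF z] w, of l c] unfolding *(1) by simp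
  moreover have "4 * l * gip ?w ?w \<le> isq (laplacian z)"
    unfolding Lz ip_op_partner[OF w m] using ip_nonneg by simp
  ultimately have "isq (laplacian z) \<le> gsq (op l c z) / (4 * l)"
    using l by (intro le_of_square_le) (auto simp: gip_nonneg ip_nonneg)
  then have "4 * l * isq (laplacian z) \<le> gsq (op l c z)"
    using l by (simp add: pos_le_divide_eq mult.commute)
  then have "8 * l * isq (laplacian z) \<le> gip u u"
    unfolding u_def gip_op_partner[OF z m] by simp
  moreover have "gip u u = - ip (op l c u) (laplacian z)" using gip_op_right[OF u z m] by (simp add: u_def)
  then have "(gip u u)\<^sup>2 \<le> isq (op l c u) * isq (laplacian z)"
    using ip_cauchy_schwarz[OF schwartz_op[OF u] schwartz_laplacian[OF z]] by simp
  ultimately have "gip u u \<le> isq (op l c u) / (8 * l)"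
    using l by (intro le_of_square_le) (auto simp: gip_nonneg ip_nonneg)
  then show ?thesis using l by (simp add: pos_le_divide_eq mult.commute)
qed

section \<open>The radial sector\<close>

lemma L_fun_eq: "L_fun \<beta> = (\<lambda>x::real^'n::finite. 2 * fj \<beta> (\<lambda>x. 1) 1 x * \<beta> - (real CARD('n) - 2) / 2 * fj \<beta> (\<lambda>x. 1) 0 x)"
  by (auto simp: L_fun_def fj_def gauss_def algebra_simps)

lemma solid_harmonic_1: "solid_harmonic 0 (\<lambda>x. 1)"
  by (auto simp: solid_harmonic_def laplacian_def real_polynomial_function.intros(2))

text \<open>Here k = 0, c = N and m = 2. \<open>e0\<close> is annihilated by \<open>?A\<close>, and
  \<open>?B e0 = 4 \<beta> e1\<close>: this is the origin of \<open>L_fun\<close>. Peeling off the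
  image of the partner operator twice leaves \<open>u\<close> as a combination of \<open>e0\<close>
  and \<open>e1\<close> plus a \<open>v\<close> in the doubly iterated image. The three pieces are
  orthogonal in the gradient form and \<open>?A e1\<close> is orthogonal to \<open>?A v\<close>, so
  that the gap 4 is applied to \<open>e1\<close> and the gap 8 to \<open>v\<close>.\<close>

lemma radial_sector:
  fixes u :: "real^'n::finite \<Rightarrow> real"
  assumes b: "\<beta> > 0" and u: "VK \<beta> 0 u" and g: "0 \<le> g" "g \<le> 4"
  shows "\<exists>\<alpha> \<tau>. 4 * (2 * \<beta>) * gsq (\<lambda>x. u x - \<alpha> * gauss \<beta> x)
     + g * (2 * \<beta>) * gsq (\<lambda>x. u x - (\<alpha> * gauss \<beta> x + \<tau> * L_fun \<beta> x))
     \<le> qform (2 * \<beta>) u u \<and> VK \<beta> 0 (\<lambda>x::real^'n. \<alpha> * gauss \<beta> x) \<and> VK \<beta> 0 (\<lambda>x::real^'n. \<alpha> * gauss \<beta> x + \<tau> * L_fun \<beta> x)"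
proof -
  let ?l = "2 * \<beta>" and ?N = "real CARD('n)"
  let ?A = "op ?l ?N" and ?B = "op (- ?l) (- 2)"
  define e0 where "e0 = (gauss \<beta> :: real^'n \<Rightarrow> real)"
  define e1 where "e1 = (L_fun \<beta> :: real^'n \<Rightarrow> real)"
  have l: "?l > 0" using b by simp
  have e0f: "e0 = fj \<beta> (\<lambda>x. 1) 0" by (auto simp: e0_def fj_def)
  have V0: "VK \<beta> 0 e0" unfolding e0f by (rule VK.base[OF solid_harmonic_1])
  have V1: "VK \<beta> 0 e1"
  proof -
    have "e1 = (\<lambda>x. 2 * \<beta> * fj \<beta> (\<lambda>x. 1) 1 x - (?N - 2) / 2 * fj \<beta> (\<lambda>x. 1) 0 x)" unfolding e1_def L_fun_eq by (simp add: mult_ac)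
    then show ?thesis by (simp only:) (intro VK_diff VK_cmult VK.base solid_harmonic_1)
  qed
  have s0: "schwartz e0" and s1: "schwartz e1" and su: "schwartz u" using V0 V1 u VK_schwartz[OF _ b] by auto
  have Be0: "?B e0 = (\<lambda>x. 4 * \<beta> * e1 x)"
    unfolding e0f op_fj(2)[OF solid_harmonic_1 b refl] e1_def L_fun_eq by (simp add: fun_eq_iff field_simps power2_eq_square)
  have Ae0: "?A e0 = (\<lambda>x. 0)"
    unfolding e0f op_fj(1)[OF solid_harmonic_1 b refl] by (simp add: fun_eq_iff)
  have Ae1: "?A e1 = (\<lambda>x. - 2 * laplacian e0 x)"
  proof
    fix x
    have "4 * \<beta> * ?A e1 x = ?A (?B e0) x" unfolding Be0 op_cmult[OF s1] ..
    also have "\<dots> = - 4 * ?l * laplacian e0 x"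
      unfolding op_op_commute[OF s0] Ae0 by (simp add: op_def)
    finally have "\<beta> * (?A e1 x + 2 * laplacian e0 x) = 0" by (simp add: algebra_simps)
    then show "?A e1 x = - 2 * laplacian e0 x" using b by (simp add: eq_neg_iff_add_eq_0)
  qed
  obtain h z where z: "solid_harmonic 0 h" "VK \<beta> 0 z" "u = (\<lambda>x. ?B z x + fj \<beta> h 0 x)"
    using VK_op_image[OF b u, of 2] by blast
  obtain h' y where y: "solid_harmonic 0 h'" "VK \<beta> 0 y" "z = (\<lambda>x. op (- ?l) (- (2 + 2)) y x + fj \<beta> h' 0 x)"
    using VK_op_image[OF b z(2), of "2 + 2"] by blast
  \<comment> \<open>Solid harmonics of degree 0 are constant; their value is read off at the
    origin.\<close>
  define \<alpha> where "\<alpha> = h 0"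
  define \<sigma> where "\<sigma> = h' 0"
  define \<tau> where "\<tau> = 4 * \<beta> * \<sigma>"
  have hc: "fj \<beta> h 0 = (\<lambda>x. \<alpha> * e0 x)" "fj \<beta> h' 0 = (\<lambda>x. \<sigma> * e0 x)"
    using hom_0_const[OF solid_harmonic_hom[OF z(1)]] hom_0_const[OF solid_harmonic_hom[OF y(1)]]
    by (auto simp: fun_eq_iff e0f fj_def \<alpha>_def \<sigma>_def)
  define y' where "y' = op (- ?l) (- (2 + 2)) y"
  define v where "v = ?B y'"
  have sy: "schwartz y" using y VK_schwartz[OF _ b] by blast
  have sy': "schwartz y'" unfolding y'_def by (rule schwartz_op[OF sy])
  have sv: "schwartz v" unfolding v_def by (rule schwartz_op[OF sy'])
  have u_eq: "u = (\<lambda>x. \<alpha> * e0 x + \<tau> * e1 x + v x)"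
    unfolding z(3) hc y(3) y'_def[symmetric] op_add[OF sy' schwartz_cmult[OF s0]] op_cmult[OF s0] Be0 v_def \<tau>_def
    by (auto simp: fun_eq_iff)
  have mm: "(2::real) = ?N + 2 - ?N" by simp
  have z00: "gip e0 (?B w) = 0" if "schwartz w" for w
    using gip_op_right[OF s0 that mm, of ?l] by (simp add: Ae0)
  have z01: "gip e0 e1 = 0"
    using z00[OF s0] b unfolding Be0 by (simp add: gip_linear s0 s1)
  have z0v: "gip e0 v = 0" unfolding v_def by (rule z00[OF sy'])
  have z1v: "gip e1 v = 0"
  proof -
    have "gip e1 v = - ip (?A e1) (laplacian y')" using gip_op_right[OF s1 sy' mm, of ?l] by (simp add: v_def)
    also have "\<dots> = 2 * ip (laplacian e0) (laplacian y')" unfolding Ae1 ip_cmult_left by simp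
    also have "\<dots> = 2 * ip (op (- ?l) (- 2) (laplacian y)) (laplacian e0)"
      unfolding y'_def laplacian_op[OF sy] by (simp add: ip_commute)
    also have "ip (op (- ?l) (- 2) (laplacian y)) (laplacian e0) = ip (laplacian y) (op ?l (?N + 2) (laplacian e0))"
      using op_adjoint[OF schwartz_laplacian[OF sy] schwartz_laplacian[OF s0], of "- ?l" "- 2"] by simp
    also have "op ?l (?N + 2) (laplacian e0) = laplacian (?A e0)" by (rule laplacian_op[OF s0, symmetric])
    finally show ?thesis by (simp add: Ae0)
  qed
  have Av: "schwartz (?A v)" "schwartz (?A e1)" by (intro schwartz_op sv s1)+
  have A1v: "ip (?A e1) (?A v) = 0"
  proof -
    have "ip (?A e1) (?A v) = - 2 * ip (?A v) (laplacian e0)" unfolding Ae1 ip_cmult_left by (simp add: ip_commute)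
    also have "ip (?A v) (laplacian e0) = - gip v (?B e0)" using gip_op_right[OF sv s0 mm, of ?l] by simp
    also have "\<dots> = 0" unfolding Be0 using z1v by (simp add: gip_linear sv s1 gip_commute)
    finally show ?thesis by simp
  qed
  have A11: "4 * ?l * gip e1 e1 \<le> isq (?A e1)"
  proof -
    have "e1 = op (- ?l) (- 2) (\<lambda>x. 1 / (4 * \<beta>) * e0 x)" unfolding op_cmult[OF s0] Be0 using b by auto
    then show ?thesis using gap_image[OF schwartz_cmult[OF s0, of "1 / (4 * \<beta>)"] l mm] by simp
  qed
  have Avv: "8 * ?l * gip v v \<le> isq (?A v)"
    using gap_image2[OF sy l mm] unfolding v_def y'_def by simp
  have Q: "qform ?l u u = isq (?A u)"
  proof -
    have "sector (?N * (?N - ?N)) u" using VK_sector[OF u b] by (simp add: mu_def)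
    from qform_sector[OF this refl, of ?l] show ?thesis by simp
  qed
  have Au: "?A u = (\<lambda>x. \<tau> * ?A e1 x + ?A v x)"
    unfolding u_eq by (simp add: op_add op_cmult schwartz_intros s0 s1 sv Ae0)
  have "isq (?A u) = \<tau>\<^sup>2 * isq (?A e1) + isq (?A v)"
    unfolding Au using A1v by (simp add: ip_linear schwartz_intros Av ip_commute[of "?A v" "?A e1"] power2_eq_square)
  also have "\<dots> \<ge> \<tau>\<^sup>2 * (4 * ?l * gip e1 e1) + 8 * ?l * gip v v"
    using A11 Avv by (intro add_mono mult_left_mono) auto
  finally have lower: "\<tau>\<^sup>2 * (4 * ?l * gip e1 e1) + 8 * ?l * gip v v \<le> qform ?l u u" unfolding Q .
  have d0: "gsq (\<lambda>x. u x - \<alpha> * e0 x) = \<tau>\<^sup>2 * gip e1 e1 + gip v v"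
  proof -
    have "(\<lambda>x. u x - \<alpha> * e0 x) = (\<lambda>x. \<tau> * e1 x + v x)" by (simp add: u_eq)
    then show ?thesis using z1v by (simp add: gip_linear schwartz_intros s1 sv gip_commute[of v e1] power2_eq_square)
  qed
  have d1: "(\<lambda>x. u x - (\<alpha> * e0 x + \<tau> * e1 x)) = v" by (simp add: u_eq)
  \<comment> \<open>The gap 8 on \<open>v\<close> pays twice: 4 for the distance to the Gaussian,
    and g \<le> 4 for the distance to the two-dimensional span.\<close>
  have "g * ?l * gip v v \<le> 4 * ?l * gip v v" using g l gip_nonneg[of v] by (intro mult_right_mono) auto
  then have "4 * ?l * (\<tau>\<^sup>2 * gip e1 e1 + gip v v) + g * ?l * gip v v \<le> qform ?l u u"
    using lower by (simp add: algebra_simps)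
  then show ?thesis
    using VK_cmult[OF V0, of \<alpha>] VK.add[OF VK_cmult[OF V0, of \<alpha>] VK_cmult[OF V1, of \<tau>]] d0 d1
    unfolding e0_def e1_def by - (rule exI[of _ \<alpha>], rule exI[of _ \<tau>], simp)
qed

section \<open>Approximating the Kummer ground states by sector elements\<close>

lemma hom_bound:
  fixes p :: "real^'n::finite \<Rightarrow> real"
  assumes "hom d p" shows "\<exists>C\<ge>0. \<forall>x. \<bar>p x\<bar> \<le> C * (1 + norm x) ^ d"
proof -
  have "compact (sphere (0::real^'n) 1)" by simp
  moreover have "continuous_on (sphere 0 1) p"
    using hom_poly[OF assms] by (intro continuous_on_polymonial_function) (simp add: real_polynomial_function_eq[symmetric])
  ultimately have "bounded (p ` sphere 0 1)" using compact_continuous_image compact_imp_bounded by blast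
  then obtain C where C: "\<And>x. norm x = 1 \<Longrightarrow> \<bar>p x\<bar> \<le> C"
    unfolding bounded_iff by (auto simp: sphere_def dist_norm)
  have sc: "p (t *\<^sub>R x) = t ^ d * p x" for t x using assms by (simp add: hom_def)
  have C0: "C \<ge> 0" using C[of "axis undefined 1"] by (simp add: norm_axis_1)
  have "\<bar>p x\<bar> \<le> max C \<bar>p 0\<bar> * (1 + norm x) ^ d" for x
  proof (cases "x = 0")
    case False
    have "p x = norm x ^ d * p ((1 / norm x) *\<^sub>R x)" using sc[of "norm x" "(1 / norm x) *\<^sub>R x"] False by simp
    then have "\<bar>p x\<bar> \<le> norm x ^ d * C" using C[of "(1 / norm x) *\<^sub>R x"] False by (simp add: abs_mult mult_left_mono)
    also have "\<dots> \<le> (1 + norm x) ^ d * max C \<bar>p 0\<bar>" using C0 by (intro mult_mono power_mono) auto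
    finally show ?thesis by (simp add: mult.commute)
  qed auto
  then show ?thesis using C0 by (intro exI[of _ "max C \<bar>p 0\<bar>"]) auto
qed

lemma square_powr: "(C * r powr e)\<^sup>2 = C\<^sup>2 * r powr (2 * e)" for C r e :: real
  by (simp add: power_mult_distrib power2_eq_square powr_add[symmetric])

lemma continuous_AE_zero:
  fixes f :: "real^'n::finite \<Rightarrow> real"
  assumes c: "continuous_on UNIV f" and ae: "AE x in lborel. f x = 0"
  shows "f x = 0"
proof (rule ccontr)
  assume "f x \<noteq> 0"
  have "open {x. f x \<noteq> 0}" using open_Collect_neq[OF c continuous_on_const[of UNIV "0::real"]] by simp
  then obtain e where e: "e > 0" "ball x e \<subseteq> {x. f x \<noteq> 0}" using \<open>f x \<noteq> 0\<close> open_contains_ball by blast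
  have "AE y in lborel. y \<notin> ball x e" using ae by eventually_elim (use e in auto)
  then have "emeasure lborel (ball x e) = 0" by (subst (asm) AE_iff_measurable[of "ball x e"]) auto
  then have "measure lborel (ball x e) = 0" by (simp add: measure_def)
  then show False using e(1) content_ball_gt_0_iff[of x e] by simp
qed

lemma integral_eul_schwartz:
  fixes f :: "real^'n::finite \<Rightarrow> real"
  assumes f: "schwartz f" shows "(LINT x|lborel. eul f x) = - real CARD('n) * (LINT x|lborel. f x)"
proof -
  have s: "schwartz (\<lambda>x. x $ i * f x)" for i by (rule schwartz_component[OF f])
  have p: "partial i (\<lambda>x. x $ i * f x) = (\<lambda>x. x $ i * partial i f x + f x)" for i
    using partial_component_mult[OF f] by auto
  have "(LINT x|lborel. partial i (\<lambda>x. x $ i * f x) x) = 0" for i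
    by (rule integral_partial_eq_0) (auto intro: s schwartz_integrable schwartz_differentiable schwartz_continuous schwartz_decays schwartz_partial)
  then have "(LINT x|lborel. x $ i * partial i f x) = - (LINT x|lborel. f x)" for i
    unfolding p using f by (subst (asm) Bochner_Integration.integral_add) (auto intro!: schwartz_integrable schwartz_component schwartz_partial simp: eq_neg_iff_add_eq_0)
  moreover have "(LINT x|lborel. eul f x) = (\<Sum>i\<in>UNIV. LINT x|lborel. x $ i * partial i f x)"
    unfolding eul_def using f by (intro Bochner_Integration.integral_sum) (auto intro!: schwartz_integrable schwartz_component schwartz_partial)
  ultimately show ?thesis by simp
qed

text \<open>\<open>a\<close> and \<open>b\<close> are the parameters of the Kummer function that
  generates the kernel of A on harmonics of degree \<open>k\<close>. The condition N + D > 2 enters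
  twice, each time sharply in the exponent: it makes the gradient of the ground state square
  integrable and the residual of the truncations tend to 0. \<open>dummy\<close> carries the
  dimension as a type.\<close>

locale kummer_sector = kummer_param a b for a b :: real +
  fixes \<beta> :: real and k :: nat and c D :: real and dummy :: "'n::finite itself"
  assumes \<beta>: "\<beta> > 0" and k: "k \<ge> 1"
    and c: "c = real CARD('n) + D / 2" and a_eq: "a = (real k + c) / 2"
    and b_eq: "b = real k + real CARD('n) / 2" and ND: "real CARD('n) + D > 2"
begin

definition Th :: "(real^'n \<Rightarrow> real) \<Rightarrow> real^'n \<Rightarrow> real" where
  "Th h x = kP a b (\<beta> * (norm x)\<^sup>2) * h x"

definition thn :: "nat \<Rightarrow> (real^'n \<Rightarrow> real) \<Rightarrow> real^'n \<Rightarrow> real" where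
  "thn n h x = kS a b n (\<beta> * (norm x)\<^sup>2) * h x"

lemma thn_sum: "thn n h = (\<lambda>x. \<Sum>j\<le>n. kc a b j * \<beta> ^ j / fact j * fj \<beta> h j x)"
  by (auto simp: thn_def kS_def fj_def gauss_def sum_distrib_left sum_distrib_right power_mult_distrib mult_ac)

lemma thn_VK: "solid_harmonic k h \<Longrightarrow> VK \<beta> k (thn n h)"
  unfolding thn_sum by (intro VK_sum VK_cmult VK.base)

lemma thn_Suc: "thn (Suc n) h = (\<lambda>x. thn n h x + kc a b (Suc n) * \<beta> ^ Suc n / fact (Suc n) * fj \<beta> h (Suc n) x)"
  unfolding thn_sum by simp

text \<open>The coefficients satisfy Kummer's recursion, so applying A telescopes: the lower term
  produced by each new summand cancels what was left before, and only a multiple of the top summand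
  remains.\<close>

lemma op_thn:
  assumes h: "solid_harmonic k h"
  shows "op (2 * \<beta>) c (thn n h) = (\<lambda>x. - (4 * \<beta> * (real n + b - a) * kc a b n * \<beta> ^ n / fact n) * fj \<beta> h n x)"
proof (induction n)
  case 0
  have "thn 0 h = fj \<beta> h 0" by (auto simp: thn_sum kc_def)
  then show ?case by (simp only: op_fj(1)[OF h \<beta> b_eq] a_eq[symmetric]) (simp add: kc_def fun_eq_iff algebra_simps)
next
  case (Suc n)
  have s: "schwartz (thn n h)" "schwartz (fj \<beta> h j)" for j
    using VK_schwartz[OF thn_VK[OF h] \<beta>] VK_schwartz[OF VK.base[OF h] \<beta>] by auto
  define K where "K = kc a b n * \<beta> ^ Suc n / fact n"
  have b0: "b + real n > 0" using b by simp
  \<comment> \<open>The recursion itself: the term of index n produced by the new summand is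
    opposite to the remainder of the induction hypothesis.\<close>
  have K1: "kc a b (Suc n) * \<beta> ^ Suc n / fact (Suc n) * (4 * real (Suc n) * (real (Suc n) - 1 + b)) = 4 * K * (b - a + real n)"
  proof -
    have gen: "\<kappa> * (q / u) * B / (s * f) * (4 * s * u) = 4 * (\<kappa> * B / f) * q" if "u > 0" "s > 0" "f > 0" for \<kappa> q u B s f :: real
      using that by simp
    have "real (Suc n) - 1 + b = b + real n" by simp
    then show ?thesis unfolding kc_Suc K_def fact_Suc by (simp only:) (rule gen, use b0 in auto)
  qed
  have K2: "4 * \<beta> * (real n + b - a) * kc a b n * \<beta> ^ n / fact n = 4 * K * (b - a + real n)"
    unfolding K_def by (simp add: algebra_simps)
  show ?case
  proof
    fix x
    have "op (2 * \<beta>) c (thn (Suc n) h) x = op (2 * \<beta>) c (thn n h) x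
       + kc a b (Suc n) * \<beta> ^ Suc n / fact (Suc n) * op (2 * \<beta>) c (fj \<beta> h (Suc n)) x"
      unfolding thn_Suc by (simp only: op_add[OF s(1) schwartz_cmult[OF s(2)]] op_cmult[OF s(2)])
    also have "\<dots> = - (4 * K * (b - a + real n)) * fj \<beta> h n x
       + kc a b (Suc n) * \<beta> ^ Suc n / fact (Suc n) * (4 * real (Suc n) * (real (Suc n) - 1 + b)) * fj \<beta> h n x
       + kc a b (Suc n) * \<beta> ^ Suc n / fact (Suc n) * (4 * \<beta> * (a - b - real (Suc n))) * fj \<beta> h (Suc n) x"
      unfolding Suc.IH op_fj(1)[OF h \<beta> b_eq] K2 a_eq[symmetric] diff_Suc_1
    proof -
      define Q where "Q = kc a b (Suc n) * \<beta> ^ Suc n / fact (Suc n)"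
      show "- (4 * K * (b - a + real n)) * fj \<beta> h n x + kc a b (Suc n) * \<beta> ^ Suc n / fact (Suc n) *
          (4 * real (Suc n) * (real (Suc n) - 1 + b) * fj \<beta> h n x + 4 * \<beta> * (a - b - real (Suc n)) * fj \<beta> h (Suc n) x)
        = - (4 * K * (b - a + real n)) * fj \<beta> h n x
       + kc a b (Suc n) * \<beta> ^ Suc n / fact (Suc n) * (4 * real (Suc n) * (real (Suc n) - 1 + b)) * fj \<beta> h n x
       + kc a b (Suc n) * \<beta> ^ Suc n / fact (Suc n) * (4 * \<beta> * (a - b - real (Suc n))) * fj \<beta> h (Suc n) x"
        unfolding Q_def[symmetric] by (simp add: algebra_simps)
    qed
    also have "\<dots> = kc a b (Suc n) * \<beta> ^ Suc n / fact (Suc n) * (4 * \<beta> * (a - b - real (Suc n))) * fj \<beta> h (Suc n) x"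
      unfolding K1 by simp
    finally show "op (2 * \<beta>) c (thn (Suc n) h) x
      = - (4 * \<beta> * (real (Suc n) + b - a) * kc a b (Suc n) * \<beta> ^ Suc n / fact (Suc n)) * fj \<beta> h (Suc n) x"
    proof -
      have gen: "\<kappa> * B / f * (4 * \<beta> * (a - b - N)) = - (4 * \<beta> * (N + b - a) * \<kappa> * B / f)" for \<kappa> B f N :: real
        by (simp add: algebra_simps diff_divide_distrib add_divide_distrib)
      assume "op (2 * \<beta>) c (thn (Suc n) h) x
        = kc a b (Suc n) * \<beta> ^ Suc n / fact (Suc n) * (4 * \<beta> * (a - b - real (Suc n))) * fj \<beta> h (Suc n) x"
      then show ?thesis unfolding gen .
    qed
  qed
qed

text \<open>The integral of \<open>eul\<close> is -N times the integral. Applied to the Gaussian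
  moments this gives a one-step recursion with factor (b + n)/\<beta>.\<close>

lemma gauss_moment:
  fixes h :: "real^'n \<Rightarrow> real"
  assumes h: "solid_harmonic k h"
  shows "(LINT x|lborel. fj \<beta> (\<lambda>x. h x * h x) n x) = pochhammer b n / \<beta> ^ n * (LINT x|lborel. fj \<beta> (\<lambda>x. h x * h x) 0 x)"
proof (induction n)
  case (Suc n)
  have hh: "hom (k + k) (\<lambda>x. h x * h x)" by (intro hom_mult solid_harmonic_hom h)
  let ?f = "fj \<beta> (\<lambda>x. h x * h x)"
  have s: "schwartz (?f j)" for j by (rule schwartz_fj[OF \<beta> hom_poly[OF hh]])
  have "(LINT x|lborel. eul (?f n) x) = (2 * real n + real (k + k)) * (LINT x|lborel. ?f n x) - 2 * \<beta> * (LINT x|lborel. ?f (Suc n) x)"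
    unfolding eul_fj[OF hh \<beta>] using schwartz_integrable[OF s]
    by (subst Bochner_Integration.integral_diff) auto
  with integral_eul_schwartz[OF s, of n] have "2 * \<beta> * (LINT x|lborel. ?f (Suc n) x) = (2 * real n + 2 * b) * (LINT x|lborel. ?f n x)"
    unfolding b_eq by (simp add: algebra_simps)
  then have "(LINT x|lborel. ?f (Suc n) x) = (b + real n) / \<beta> * (LINT x|lborel. ?f n x)"
    using \<beta> by (simp add: field_simps)
  then show ?case unfolding Suc.IH by (simp add: pochhammer_Suc mult_ac)
qed simp

text \<open>In the squared norm of the residual one factor (\<beta> |x|^2)^n / n! times the Gaussian
  is bounded by 1 pointwise; what is left is the moment computed in \<open>gauss_moment\<close>. The
  quotient of Pochhammer symbols that results is the sequence of
  \<open>residual_tendsto\<close>.\<close>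

lemma op_thn_tendsto:
  assumes h: "solid_harmonic k h"
  shows "(\<lambda>n. isq (op (2 * \<beta>) c (thn n h))) \<longlonglongrightarrow> 0"
proof -
  let ?f = "fj \<beta> (\<lambda>x. h x * h x)"
  define J where "J = (LINT x|lborel. ?f 0 x)"
  let ?F = "\<lambda>n. (real n + b - a)\<^sup>2 * (kc a b n)\<^sup>2 * pochhammer b n / fact n"
  have hh: "real_polynomial_function (\<lambda>x. h x * h x)" using solid_harmonic_poly[OF h] by auto
  have s: "schwartz (fj \<beta> h n)" "schwartz (?f n)" for n
    using schwartz_fj[OF \<beta> solid_harmonic_poly[OF h]] schwartz_fj[OF \<beta> hh] by auto
  have bound: "\<beta> ^ n / fact n * isq (fj \<beta> h n) \<le> pochhammer b n / \<beta> ^ n * J" for n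
  proof -
    have "\<beta> ^ n / fact n * isq (fj \<beta> h n) = (LINT x|lborel. \<beta> ^ n / fact n * (fj \<beta> h n x * fj \<beta> h n x))"
      by (simp add: ip_def)
    also have "\<dots> \<le> (LINT x|lborel. ?f n x)"
    proof (rule integral_mono)
      show "integrable lborel (\<lambda>x. \<beta> ^ n / fact n * (fj \<beta> h n x * fj \<beta> h n x))"
        by (intro integrable_mult_right ip_integrable s)
      show "integrable lborel (?f n)" by (rule schwartz_integrable[OF s(2)])
      fix x :: "real^'n"
      have "(\<beta> * (norm x)\<^sup>2) ^ n / fact n \<le> exp (\<beta> * (norm x)\<^sup>2)"
        using sum_le_suminf[OF summable_exp_generic[of "\<beta> * (norm x)\<^sup>2"], of "{n}"] \<beta>
        by (simp add: exp_def divide_inverse mult.commute)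
      then have "(\<beta> * (norm x)\<^sup>2) ^ n / fact n * gauss \<beta> x \<le> exp (\<beta> * (norm x)\<^sup>2) * gauss \<beta> x"
        by (intro mult_right_mono) (auto simp: gauss_def)
      also have "\<dots> = 1" by (simp add: gauss_def exp_add[symmetric])
      finally have "(\<beta> * (norm x)\<^sup>2) ^ n / fact n * gauss \<beta> x * (((norm x)\<^sup>2) ^ n * (h x * h x) * gauss \<beta> x) \<le> 1 * (((norm x)\<^sup>2) ^ n * (h x * h x) * gauss \<beta> x)"
        by (intro mult_right_mono) (auto simp: gauss_def)
      then show "\<beta> ^ n / fact n * (fj \<beta> h n x * fj \<beta> h n x) \<le> ?f n x"
        by (simp add: fj_def power_mult_distrib mult_ac)
    qed
    finally show ?thesis by (simp only: gauss_moment[OF h, of n] J_def)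
  qed
  have le: "isq (op (2 * \<beta>) c (thn n h)) \<le> 16 * \<beta>\<^sup>2 * J * ?F n" for n
  proof -
    have "isq (op (2 * \<beta>) c (thn n h))
      = 16 * \<beta>\<^sup>2 * (real n + b - a)\<^sup>2 * (kc a b n)\<^sup>2 * (\<beta> ^ n / fact n) * (\<beta> ^ n / fact n * isq (fj \<beta> h n))"
    proof -
      define X where "X = real n + b - a"
      show ?thesis unfolding op_thn[OF h] X_def[symmetric] ip_cmult_left ip_cmult_right by (simp add: power2_eq_square mult_ac)
    qed
    also have "\<dots> \<le> 16 * \<beta>\<^sup>2 * (real n + b - a)\<^sup>2 * (kc a b n)\<^sup>2 * (\<beta> ^ n / fact n) * (pochhammer b n / \<beta> ^ n * J)"
      using \<beta> by (intro mult_left_mono bound) auto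
    also have "\<dots> = 16 * \<beta>\<^sup>2 * J * ?F n" using \<beta> by (simp add: mult_ac)
    finally show ?thesis .
  qed
  have "2 * a - b > 1" using ND unfolding a_eq b_eq c by (simp add: field_simps)
  from tendsto_mult_left[OF residual_tendsto[OF this], of "16 * \<beta>\<^sup>2 * J"]
  have lim: "(\<lambda>n. 16 * \<beta>\<^sup>2 * J * ?F n) \<longlonglongrightarrow> 0" by simp
  have e1: "\<forall>\<^sub>F n in sequentially. 0 \<le> isq (op (2 * \<beta>) c (thn n h))"
    by (simp add: ip_nonneg)
  have e2: "\<forall>\<^sub>F n in sequentially. isq (op (2 * \<beta>) c (thn n h)) \<le> 16 * \<beta>\<^sup>2 * J * ?F n"
    by (intro always_eventually allI le)
  show ?thesis by (rule tendsto_sandwich[OF e1 e2 tendsto_const lim])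
qed

section \<open>Gradients of the Kummer ground states and of their truncations\<close>

lemma radial_mult_partial:
  assumes h: "real_polynomial_function h" and q: "\<And>t. (q has_real_derivative q' t) (at t)"
  shows "(\<lambda>x::real^'n. q (\<beta> * (norm x)\<^sup>2) * h x) differentiable (at x)"
    "partial i (\<lambda>x::real^'n. q (\<beta> * (norm x)\<^sup>2) * h x) x = 2 * \<beta> * x $ i * q' (\<beta> * (norm x)\<^sup>2) * h x + q (\<beta> * (norm x)\<^sup>2) * partial i h x"
proof -
  have d: "(\<lambda>x::real^'n. \<beta> * (norm x)\<^sup>2) differentiable (at x)"
    by (intro differentiable_mult differentiable_const differentiable_norm_sq)
  have dq: "(\<lambda>x::real^'n. q (\<beta> * (norm x)\<^sup>2)) differentiable (at x)"
    using has_derivative_compose[OF has_derivative_partial[OF d] q[unfolded has_field_derivative_def]]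
    by (rule differentiableI)
  show "(\<lambda>x::real^'n. q (\<beta> * (norm x)\<^sup>2) * h x) differentiable (at x)"
    by (intro differentiable_mult dq differentiable_at_real_polynomial_function h)
  have "partial i (\<lambda>x::real^'n. q (\<beta> * (norm x)\<^sup>2)) x = q' (\<beta> * (norm x)\<^sup>2) * (\<beta> * (2 * x $ i))"
    unfolding partial_compose_real[OF d q] by (simp add: partial_cmult differentiable_norm_sq partial_norm_sq)
  then show "partial i (\<lambda>x::real^'n. q (\<beta> * (norm x)\<^sup>2) * h x) x = 2 * \<beta> * x $ i * q' (\<beta> * (norm x)\<^sup>2) * h x + q (\<beta> * (norm x)\<^sup>2) * partial i h x"
    by (simp add: partial_mult dq differentiable_at_real_polynomial_function h)
qed

lemma kD_continuous: "continuous_on UNIV kD"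
proof -
  have "isCont (\<lambda>t. \<Sum>j. (kc a b j - kc a b (Suc j)) / fact j * t ^ j) t" for t
    by (rule isCont_powser_converges_everywhere) (rule summable_bounded_coeff(2)[OF kc_diff(3)])
  then show ?thesis unfolding kD_def[abs_def]
    by (intro continuous_intros continuous_at_imp_continuous_on) auto
qed

lemma kP_continuous: "continuous_on UNIV (kP a b)"
  by (intro continuous_at_imp_continuous_on ballI DERIV_isCont[OF kP_deriv])

lemma Th_partial:
  assumes h: "real_polynomial_function h"
  shows "Th h differentiable (at x)"
    "partial i (Th h) x = 2 * \<beta> * x $ i * kD (\<beta> * (norm x)\<^sup>2) * h x + kP a b (\<beta> * (norm x)\<^sup>2) * partial i h x"
  unfolding Th_def[abs_def] by (rule radial_mult_partial[OF h kP_deriv])+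

lemma thn_partial:
  assumes h: "real_polynomial_function h"
  shows "partial i (thn n h) x = 2 * \<beta> * x $ i * kSD n (\<beta> * (norm x)\<^sup>2) * h x + kS a b n (\<beta> * (norm x)\<^sup>2) * partial i h x"
  unfolding thn_def[abs_def] by (rule radial_mult_partial[OF h kS_deriv])

lemma polynomial_continuous: "real_polynomial_function h \<Longrightarrow> continuous_on UNIV (h :: real^'n \<Rightarrow> real)"
  by (intro continuous_on_polymonial_function) (simp add: real_polynomial_function_eq[symmetric])

lemma Th_partial_continuous:
  assumes h: "real_polynomial_function h"
  shows "continuous_on UNIV (partial i (Th h))"
proof -
  have "partial i (Th h) = (\<lambda>x. 2 * \<beta> * x $ i * kD (\<beta> * (norm x)\<^sup>2) * h x + kP a b (\<beta> * (norm x)\<^sup>2) * partial i h x)"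
    using Th_partial(2)[OF h] by auto
  then show ?thesis
    by (simp only:) (intro continuous_intros continuous_on_compose2[OF kD_continuous] continuous_on_compose2[OF kP_continuous]
        polynomial_continuous polynomial_partial h; simp)
qed

text \<open>One majorant for two purposes. The constant 4\<beta> instead of the 2\<beta> of the
  product rule makes twice the left-hand side dominate also the difference between the gradients of
  a truncation and of its limit.\<close>

lemma decay_bound:
  assumes h: "hom k h"
  shows "\<exists>C\<ge>0. \<forall>x i. \<bar>kP a b (\<beta> * (norm x)\<^sup>2)\<bar> * (4 * \<beta> * norm x * \<bar>h x\<bar> + \<bar>partial i h x\<bar>)
     \<le> C * (1 + norm (x::real^'n)) powr (real k + 1 - 2 * a)"
proof -
  obtain C1 where C1: "C1 > 0" "\<And>t. t \<ge> 0 \<Longrightarrow> kP a b t \<le> C1 * (1 + t) powr (- a)" using kP_decay by blast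
  obtain C2 where C2: "C2 \<ge> 0" "\<And>x. \<bar>h x\<bar> \<le> C2 * (1 + norm x) ^ k" using hom_bound[OF h] by blast
  obtain j where j: "k = Suc j" using k by (cases k) auto
  have "\<exists>C\<ge>0. \<forall>x. \<bar>partial i h x\<bar> \<le> C * (1 + norm x) ^ j" for i
    using hom_bound[OF hom_partial] h j by blast
  then obtain C3 where C3: "\<And>i. C3 i \<ge> 0" "\<And>i x. \<bar>partial i h x\<bar> \<le> C3 i * (1 + norm x) ^ j" by metis
  define C4 where "C4 = (\<Sum>i\<in>UNIV. C3 i)"
  have C4: "C4 \<ge> 0" "C3 i \<le> C4" for i using C3(1) by (auto simp: C4_def intro: sum_nonneg member_le_sum)
  \<comment> \<open>Chosen such that (1 + r)^2 \<le> M (1 + \<beta> r^2) for all r \<ge> 0, which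
    converts decay in \<beta> r^2 into decay in 1 + r.\<close>
  define M where "M = 2 * (1 + 1 / \<beta>)"
  have M: "M > 0" using \<beta> by (simp add: M_def add_pos_pos)
  define C where "C = C1 * M powr a * (4 * \<beta> * C2 + C4)"
  have "\<bar>kP a b (\<beta> * (norm x)\<^sup>2)\<bar> * (4 * \<beta> * norm x * \<bar>h x\<bar> + \<bar>partial i h x\<bar>)
     \<le> C * (1 + norm x) powr (real k + 1 - 2 * a)" for x :: "real^'n" and i
  proof -
    let ?r = "norm x"
    let ?t = "\<beta> * ?r\<^sup>2"
    have t: "?t \<ge> 0" using \<beta> by simp
    have r: "1 + ?r > 0" by (simp add: add_pos_nonneg)
    have "(1 + ?r)\<^sup>2 \<le> 2 * (1 + ?r\<^sup>2)"
      using sum_squares_bound[of 1 ?r] by (simp add: power2_sum power2_eq_square algebra_simps)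
    also have "\<dots> \<le> M * (1 + ?t)" using \<beta> by (simp add: M_def algebra_simps)
    finally have "(1 + ?r)\<^sup>2 \<le> M * (1 + ?t)" .
    then have "((1 + ?r)\<^sup>2 / M) \<le> 1 + ?t" using M by (simp add: divide_le_eq mult.commute)
    then have "(1 + ?t) powr (- a) \<le> ((1 + ?r)\<^sup>2 / M) powr (- a)"
      using M r a by (intro powr_mono2') auto
    also have "\<dots> = M powr a * (1 + ?r) powr (- 2 * a)"
    proof -
      have 1: "((1 + ?r)\<^sup>2) powr (- a) = (1 + ?r) powr (- 2 * a)"
        using powr_powr[of "1 + ?r" 2 "- a"] r by simp
      have "((1 + ?r)\<^sup>2 / M) powr (- a) = ((1 + ?r)\<^sup>2) powr (- a) / M powr (- a)"
        using M by (intro powr_divide)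
      also have "\<dots> = ((1 + ?r)\<^sup>2) powr (- a) * M powr a" by (simp add: powr_minus divide_inverse)
      finally show ?thesis unfolding 1 by (simp add: mult.commute)
    qed
    finally have P: "\<bar>kP a b ?t\<bar> \<le> C1 * (M powr a * (1 + ?r) powr (- 2 * a))"
      using order_trans[OF C1(2)[OF t] mult_left_mono[OF _ less_imp_le[OF C1(1)]]] kP_nonneg[OF t] by simp
    have "4 * \<beta> * ?r * \<bar>h x\<bar> \<le> 4 * \<beta> * (1 + ?r) * (C2 * (1 + ?r) ^ k)"
      using \<beta> C2 by (intro mult_mono) auto
    moreover have "\<bar>partial i h x\<bar> \<le> C4 * (1 + ?r) ^ (k + 1)"
    proof -
      have "\<bar>partial i h x\<bar> \<le> C3 i * (1 + ?r) ^ j" by (rule C3)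
      also have "\<dots> \<le> C4 * (1 + ?r) ^ (k + 1)" using C4 C3(1) j by (intro mult_mono power_increasing) auto
      finally show ?thesis .
    qed
    ultimately have Q: "4 * \<beta> * ?r * \<bar>h x\<bar> + \<bar>partial i h x\<bar> \<le> (4 * \<beta> * C2 + C4) * (1 + ?r) ^ (k + 1)"
      by (simp add: algebra_simps)
    have "\<bar>kP a b ?t\<bar> * (4 * \<beta> * ?r * \<bar>h x\<bar> + \<bar>partial i h x\<bar>)
       \<le> C1 * (M powr a * (1 + ?r) powr (- 2 * a)) * ((4 * \<beta> * C2 + C4) * (1 + ?r) ^ (k + 1))"
      using P Q \<beta> C1 M by (intro mult_mono) auto
    also have "\<dots> = C * ((1 + ?r) powr (- 2 * a) * (1 + ?r) ^ (k + 1))" by (simp add: C_def mult_ac)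
    also have "(1 + ?r) powr (- 2 * a) * (1 + ?r) ^ (k + 1) = (1 + ?r) powr (real k + 1 - 2 * a)"
    proof -
      have "(1 + ?r) ^ (k + 1) = (1 + ?r) powr (real k + 1)" using powr_realpow[OF r, of "k + 1"] by (simp add: add.commute)
      then show ?thesis by (simp only: powr_add[symmetric]) (simp add: algebra_simps)
    qed
    finally show ?thesis .
  qed
  moreover have "C \<ge> 0" unfolding C_def using C1 C2 C4 \<beta> by simp
  ultimately show ?thesis by blast
qed

lemma decay_integrable: "integrable lborel (\<lambda>x::real^'n. C * (1 + norm x) powr (2 * (real k + 1 - 2 * a)))"
proof -
  have "2 * (real k + 1 - 2 * a) = - (2 * real CARD('n) + D - 2)" unfolding a_eq c by (simp add: field_simps)
  moreover have "2 * real CARD('n) + D - 2 > real CARD('n)" using ND by simp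
  ultimately show ?thesis by (intro integrable_mult_right) (simp only: integrable_powr_decay)
qed

lemma Th_sqi:
  assumes h: "solid_harmonic k h" shows "sqi (rgrad (Th h))"
proof (rule sqi_rgradI)
  fix i
  note hp = solid_harmonic_poly[OF h]
  show m: "partial i (Th h) \<in> borel_measurable lborel"
    using Th_partial_continuous[OF hp] by (simp add: borel_measurable_continuous_onI)
  obtain C where C: "C \<ge> 0" "\<And>x i. \<bar>kP a b (\<beta> * (norm x)\<^sup>2)\<bar> * (4 * \<beta> * norm x * \<bar>h x\<bar> + \<bar>partial i h x\<bar>)
     \<le> C * (1 + norm x) powr (real k + 1 - 2 * a)" using decay_bound[OF solid_harmonic_hom[OF h]] by blast
  show "integrable lborel (\<lambda>x. (partial i (Th h) x)\<^sup>2)"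
  proof (rule Bochner_Integration.integrable_bound[OF decay_integrable[of "C\<^sup>2"]])
    show "(\<lambda>x. (partial i (Th h) x)\<^sup>2) \<in> borel_measurable lborel" using m by measurable
    show "AE x in lborel. norm ((partial i (Th h) x)\<^sup>2) \<le> norm (C\<^sup>2 * (1 + norm x) powr (2 * (real k + 1 - 2 * a)))"
    proof (rule AE_I2)
      fix x :: "real^'n"
      let ?t = "\<beta> * (norm x)\<^sup>2"
      have t: "?t \<ge> 0" using \<beta> by simp
      have "\<bar>partial i (Th h) x\<bar> \<le> \<bar>2 * \<beta> * x $ i * kD ?t * h x\<bar> + \<bar>kP a b ?t * partial i h x\<bar>"
        unfolding Th_partial(2)[OF hp] by (rule abs_triangle_ineq)
      also have "\<dots> = 2 * \<beta> * \<bar>x $ i\<bar> * \<bar>kD ?t\<bar> * \<bar>h x\<bar> + \<bar>kP a b ?t\<bar> * \<bar>partial i h x\<bar>" using \<beta> by (simp add: abs_mult)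
      also have "\<dots> \<le> 4 * \<beta> * norm x * \<bar>kP a b ?t\<bar> * \<bar>h x\<bar> + \<bar>kP a b ?t\<bar> * \<bar>partial i h x\<bar>"
        using \<beta> kD_abs[OF t] component_le_norm_cart[of x i] kP_nonneg[OF t] by (intro add_mono mult_mono) auto
      also have "\<dots> = \<bar>kP a b ?t\<bar> * (4 * \<beta> * norm x * \<bar>h x\<bar> + \<bar>partial i h x\<bar>)" by (simp add: algebra_simps)
      also have "\<dots> \<le> C * (1 + norm x) powr (real k + 1 - 2 * a)" by (rule C)
      finally have "\<bar>partial i (Th h) x\<bar>\<^sup>2 \<le> (C * (1 + norm x) powr (real k + 1 - 2 * a))\<^sup>2" by (intro power_mono) auto
      also have "\<dots> = C\<^sup>2 * (1 + norm x) powr (2 * (real k + 1 - 2 * a))" by (rule square_powr)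
      finally show "norm ((partial i (Th h) x)\<^sup>2) \<le> norm (C\<^sup>2 * (1 + norm x) powr (2 * (real k + 1 - 2 * a)))" by simp
    qed
  qed
qed

lemma thn_Th_tendsto:
  assumes h: "solid_harmonic k h"
  shows "(\<lambda>n. n2 (\<lambda>x. rgrad (thn n h) x - rgrad (Th h) x)) \<longlonglongrightarrow> 0"
proof -
  note hp = solid_harmonic_poly[OF h]
  obtain C where C: "C \<ge> 0" "\<And>x i. \<bar>kP a b (\<beta> * (norm x)\<^sup>2)\<bar> * (4 * \<beta> * norm x * \<bar>h x\<bar> + \<bar>partial i h x\<bar>)
     \<le> C * (1 + norm x) powr (real k + 1 - 2 * a)" using decay_bound[OF solid_harmonic_hom[OF h]] by blast
  let ?w = "\<lambda>x::real^'n. real CARD('n) * (4 * C\<^sup>2) * (1 + norm x) powr (2 * (real k + 1 - 2 * a))"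
  have m: "partial i (thn n h) \<in> borel_measurable borel" "partial i (Th h) \<in> borel_measurable borel" for i n
    using schwartz_measurable[OF schwartz_partial[OF VK_schwartz[OF thn_VK[OF h] \<beta>]]] Th_partial_continuous[OF hp]
    by (auto simp: borel_measurable_continuous_onI)
  have eq: "n2 (\<lambda>x. rgrad (thn n h) x - rgrad (Th h) x) = (LINT x|lborel. (\<Sum>i\<in>UNIV. (partial i (thn n h) x - partial i (Th h) x)\<^sup>2))" for n
    by (simp add: n2_def norm_sq_sum rgrad_def)
  have "(\<lambda>n. LINT x|lborel. (\<Sum>i\<in>UNIV. (partial i (thn n h) x - partial i (Th h) x)\<^sup>2)) \<longlonglongrightarrow> integral\<^sup>L (lborel :: (real^'n) measure) (\<lambda>x. 0::real)"
  proof (rule integral_dominated_convergence[where w = ?w])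
    show "integrable lborel ?w" by (rule decay_integrable)
    show "(\<lambda>x. \<Sum>i\<in>UNIV. (partial i (thn n h) x - partial i (Th h) x)\<^sup>2) \<in> borel_measurable lborel" for n
      using m by measurable
    show "AE x in lborel. (\<lambda>n. \<Sum>i\<in>UNIV. (partial i (thn n h) x - partial i (Th h) x)\<^sup>2) \<longlonglongrightarrow> 0"
    proof (rule AE_I2)
      fix x :: "real^'n"
      have "(\<lambda>n. partial i (thn n h) x) \<longlonglongrightarrow> partial i (Th h) x" for i
        unfolding thn_partial[OF hp] Th_partial(2)[OF hp] by (intro tendsto_intros kSD_tendsto kS_tendsto)
      then have "(\<lambda>n. \<Sum>i\<in>UNIV. (partial i (thn n h) x - partial i (Th h) x)\<^sup>2) \<longlonglongrightarrow> (\<Sum>i\<in>(UNIV::'n set). (partial i (Th h) x - partial i (Th h) x)\<^sup>2)"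
        by (intro tendsto_intros)
      then show "(\<lambda>n. \<Sum>i\<in>UNIV. (partial i (thn n h) x - partial i (Th h) x)\<^sup>2) \<longlonglongrightarrow> 0" by simp
    qed
    show "AE x in lborel. norm (\<Sum>i\<in>UNIV. (partial i (thn n h) x - partial i (Th h) x)\<^sup>2) \<le> ?w x" for n
    proof (rule AE_I2)
      fix x :: "real^'n"
      let ?t = "\<beta> * (norm x)\<^sup>2"
      have t: "?t \<ge> 0" using \<beta> by simp
      have "(partial i (thn n h) x - partial i (Th h) x)\<^sup>2 \<le> 4 * C\<^sup>2 * (1 + norm x) powr (2 * (real k + 1 - 2 * a))" for i
      proof -
        have 1: "\<bar>kSD n ?t - kD ?t\<bar> \<le> 4 * \<bar>kP a b ?t\<bar>" using kSD_abs[OF t, of n] kD_abs[OF t] kP_nonneg[OF t] by linarith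
        have 2: "\<bar>kS a b n ?t - kP a b ?t\<bar> \<le> 2 * \<bar>kP a b ?t\<bar>" using kS_nonneg[OF t, of n] kS_le_kP[OF t, of n] kP_nonneg[OF t] by linarith
        have "\<bar>partial i (thn n h) x - partial i (Th h) x\<bar> = \<bar>2 * \<beta> * x $ i * (kSD n ?t - kD ?t) * h x + (kS a b n ?t - kP a b ?t) * partial i h x\<bar>"
          unfolding thn_partial[OF hp] Th_partial(2)[OF hp] by (simp add: algebra_simps)
        also have "\<dots> \<le> \<bar>2 * \<beta> * x $ i * (kSD n ?t - kD ?t) * h x\<bar> + \<bar>(kS a b n ?t - kP a b ?t) * partial i h x\<bar>"
          by (rule abs_triangle_ineq)
        also have "\<dots> = 2 * \<beta> * \<bar>x $ i\<bar> * \<bar>kSD n ?t - kD ?t\<bar> * \<bar>h x\<bar> + \<bar>kS a b n ?t - kP a b ?t\<bar> * \<bar>partial i h x\<bar>"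
          using \<beta> by (simp add: abs_mult)
        also have "\<dots> \<le> 2 * \<beta> * norm x * (4 * \<bar>kP a b ?t\<bar>) * \<bar>h x\<bar> + 2 * \<bar>kP a b ?t\<bar> * \<bar>partial i h x\<bar>"
          using \<beta> 1 2 component_le_norm_cart[of x i] by (intro add_mono mult_mono) auto
        also have "\<dots> = 2 * (\<bar>kP a b ?t\<bar> * (4 * \<beta> * norm x * \<bar>h x\<bar> + \<bar>partial i h x\<bar>))" by (simp add: algebra_simps)
        also have "\<dots> \<le> 2 * (C * (1 + norm x) powr (real k + 1 - 2 * a))" by (intro mult_left_mono C) auto
        finally have "\<bar>partial i (thn n h) x - partial i (Th h) x\<bar>\<^sup>2 \<le> (2 * (C * (1 + norm x) powr (real k + 1 - 2 * a)))\<^sup>2" by (intro power_mono) auto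
        also have "\<dots> = 4 * C\<^sup>2 * (1 + norm x) powr (2 * (real k + 1 - 2 * a))"
          by (simp only: power_mult_distrib[of 2] square_powr) simp
        finally show ?thesis by simp
      qed
      then have "(\<Sum>i\<in>UNIV. (partial i (thn n h) x - partial i (Th h) x)\<^sup>2) \<le> (\<Sum>i\<in>(UNIV::'n set). 4 * C\<^sup>2 * (1 + norm x) powr (2 * (real k + 1 - 2 * a)))"
        by (intro sum_mono) blast
      then show "norm (\<Sum>i\<in>UNIV. (partial i (thn n h) x - partial i (Th h) x)\<^sup>2) \<le> ?w x"
        by (simp add: sum_nonneg mult_ac)
    qed
  qed simp
  then show ?thesis unfolding eq by simp
qed

text \<open>A vanishing gradient would make the Euler derivative vanish everywhere. Near the origin,
  however, that derivative is a positive multiple of \<open>h\<close>: the term k \<open>kP\<close>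
  outweighs 2t \<open>kD\<close>, because \<open>kD\<close> is bounded by \<open>kP\<close> and t
  \<le> 1/4.\<close>

lemma Th_gradient_nonzero:
  assumes h: "solid_harmonic k h" and ne: "h x0 \<noteq> 0"
  shows "n2 (rgrad (Th h)) > 0"
proof (rule ccontr)
  note hp = solid_harmonic_poly[OF h]
  assume "\<not> n2 (rgrad (Th h)) > 0"
  then have "n2 (rgrad (Th h)) = 0" using n2_nonneg[of "rgrad (Th h)"] by simp
  then have ae: "AE x in lborel. (norm (rgrad (Th h) x))\<^sup>2 = 0"
    using Th_sqi[OF h] unfolding n2_def sqi_def by (subst (asm) integral_nonneg_eq_0_iff_AE) auto
  have z: "partial i (Th h) x = 0" for i x
  proof (rule continuous_AE_zero[OF Th_partial_continuous[OF hp]])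
    show "AE x in lborel. partial i (Th h) x = 0" using ae by eventually_elim (simp add: rgrad_def vec_eq_iff)
  qed
  have eul: "0 = (2 * (\<beta> * (norm x)\<^sup>2) * kD (\<beta> * (norm x)\<^sup>2) + real k * kP a b (\<beta> * (norm x)\<^sup>2)) * h x" for x
  proof -
    let ?t = "\<beta> * (norm x)\<^sup>2"
    have "0 = (\<Sum>i\<in>UNIV. x $ i * partial i (Th h) x)" by (simp add: z)
    also have "\<dots> = 2 * \<beta> * (\<Sum>i\<in>UNIV. (x $ i)\<^sup>2) * kD ?t * h x + kP a b ?t * eul h x"
      unfolding Th_partial(2)[OF hp] eul_def
      by (simp add: distrib_left sum.distrib sum_distrib_left sum_distrib_right power2_eq_square mult_ac)
    finally show ?thesis unfolding hom_eul[OF solid_harmonic_hom[OF h]] norm_sq_sum[symmetric] by (simp add: algebra_simps)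
  qed
  \<comment> \<open>Scales \<open>x0\<close> into the region where \<beta> |x|^2 \<le> 1/4; by
    homogeneity \<open>h\<close> remains nonzero there.\<close>
  define s where "s = 1 / sqrt (4 * \<beta> * (1 + (norm x0)\<^sup>2))"
  have s0: "s > 0" unfolding s_def using \<beta> by (simp add: add_pos_nonneg)
  define x where "x = s *\<^sub>R x0"
  have "(norm x)\<^sup>2 = (norm x0)\<^sup>2 / (4 * \<beta> * (1 + (norm x0)\<^sup>2))"
    unfolding x_def s_def using \<beta> by (simp add: power_mult_distrib power_divide real_sqrt_pow2 add_nonneg_nonneg)
  then have t: "\<beta> * (norm x)\<^sup>2 \<le> 1 / 4" "0 \<le> \<beta> * (norm x)\<^sup>2"
    using \<beta> by (auto simp: divide_le_eq add_pos_nonneg)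
  let ?t = "\<beta> * (norm x)\<^sup>2"
  have P: "kP a b ?t > 0" by (rule kP_pos[OF t(2)])
  have "2 * ?t * \<bar>kD ?t\<bar> \<le> (1 / 2) * kP a b ?t" using t kD_abs[OF t(2)] by (intro mult_mono) auto
  then have "\<bar>2 * ?t * kD ?t\<bar> \<le> (1 / 2) * kP a b ?t" using t(2) \<beta> by (simp add: abs_mult)
  moreover have "real k * kP a b ?t \<ge> 1 * kP a b ?t" using k P by (intro mult_right_mono) auto
  ultimately have "2 * ?t * kD ?t + real k * kP a b ?t > 0" using P by linarith
  then have "h x = 0" using eul[of x] by simp
  then show False using ne s0 solid_harmonic_hom[OF h] by (simp add: x_def hom_def)
qed

section \<open>The gap in a sector with a Kummer ground state\<close>

lemma c_N: "c = real CARD('n) + D / 2" "2 + D / 2 = c + 2 - real CARD('n)" using c by auto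

lemma sqrt_triangle_ip:
  assumes f: "schwartz f" and g: "schwartz g"
  shows "isq (\<lambda>x. f x - g x) \<le> ip f f + 2 * sqrt (ip f f * ip g g) + ip g g"
proof -
  have "\<bar>ip f g\<bar> \<le> sqrt (ip f f * ip g g)" using ip_cauchy_schwarz[OF f g] by (simp add: real_le_rsqrt real_sqrt_ge_abs1 abs_le_iff real_le_rsqrt)
  then show ?thesis using f g by (simp add: ip_linear schwartz_intros ip_commute[of g f])
qed

text \<open>\<open>u\<close> equals an element of the image of \<open>?B\<close> plus
  \<open>fj \<beta> h 0\<close>. The truncations \<open>t n\<close> have the same shape with a
  factor \<open>\<kappa> n\<close> in front of \<open>fj \<beta> h 0\<close>, so u minus
  \<open>t n / \<kappa> n\<close> lies in the image, where \<open>gap_image\<close> applies. As the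
  residual of \<open>t n\<close> tends to 0, replacing \<open>u\<close> by this difference hardly
  changes the norm of A.\<close>

lemma sector_gap:
  fixes u :: "real^'n \<Rightarrow> real"
  assumes u: "VK \<beta> k u" and e: "\<epsilon> > 0"
  shows "\<exists>h v. solid_harmonic k h \<and> VK \<beta> k v \<and> n2 (\<lambda>x. rgrad v x - rgrad (Th h) x) \<le> \<epsilon>
    \<and> 4 * (2 * \<beta>) * gsq (\<lambda>x. u x - v x) \<le> isq (op (2 * \<beta>) c u) + \<epsilon>"
proof -
  let ?l = "2 * \<beta>" and ?m = "2 + D / 2"
  let ?A = "op ?l c" and ?B = "op (- ?l) (- ?m)"
  have l: "?l > 0" using \<beta> by simp
  have gap: "4 * ?l * gsq (?B z) \<le> isq (?A (?B z))" if "schwartz z" for z :: "real^'n \<Rightarrow> real"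
    by (rule gap_image[OF that l c_N(2)])
  obtain h z where z: "solid_harmonic k h" "VK \<beta> k z" "u = (\<lambda>x. ?B z x + fj \<beta> h 0 x)"
    using VK_op_image[OF \<beta> u, of ?m] by blast
  note hp = solid_harmonic_poly[OF z(1)]
  have sz: "schwartz z" and su: "schwartz u" using VK_schwartz[OF _ \<beta>] z u by auto
  show ?thesis
  proof (cases "\<forall>x. h x = 0")
    case True
    then have "u = ?B z" using z(3) by (auto simp: fj_def)
    then have "4 * ?l * gsq (\<lambda>x. u x - 0) \<le> isq (?A u) + \<epsilon>" using gap[OF sz] e by simp
    moreover have "Th (\<lambda>x. 0) = (\<lambda>x. 0)" by (auto simp: Th_def)
    then have "n2 (\<lambda>x. rgrad (\<lambda>x. 0) x - rgrad (Th (\<lambda>x. 0)) x) \<le> \<epsilon>" using e by (simp add: n2_def)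
    ultimately show ?thesis using solid_harmonic_zero VK_zero by blast
  next
    case False
    then obtain x0 where x0: "h x0 \<noteq> 0" by blast
    define f0 where "f0 = fj \<beta> h 0"
    have s0: "schwartz f0" unfolding f0_def by (rule schwartz_fj[OF \<beta> hp])
    define t where "t n = thn n h" for n
    have Vt: "VK \<beta> k (t n)" for n unfolding t_def by (rule thn_VK[OF z(1)])
    have st: "schwartz (t n)" for n by (rule VK_schwartz[OF Vt \<beta>])
    have "\<forall>j. \<exists>\<kappa> z. VK \<beta> k z \<and> fj \<beta> h j = (\<lambda>x. ?B z x + \<kappa> * f0 x)"
      using fj_op_image[OF \<beta>, of k _ ?m] z(1) unfolding f0_def by blast
    then obtain \<kappa>j zj where zj: "\<And>j. VK \<beta> k (zj j)" "\<And>j. fj \<beta> h j = (\<lambda>x. ?B (zj j) x + \<kappa>j j * f0 x)" by metis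
    have szj: "schwartz (zj j)" for j by (rule VK_schwartz[OF zj(1) \<beta>])
    \<comment> \<open>Each truncation is a finite sum of the \<open>fj \<beta> h j\<close>, and each
      of these is an image plus a multiple of \<open>f0\<close>.\<close>
    have "\<exists>\<kappa> z. schwartz z \<and> t n = (\<lambda>x. ?B z x + \<kappa> * f0 x)" for n
    proof (induction n)
      case 0
      have "t 0 = (\<lambda>x. ?B (zj 0) x + \<kappa>j 0 * f0 x)" unfolding t_def zj(2)[of 0, symmetric] by (auto simp: thn_sum kc_def)
      then show ?case using szj by blast
    next
      case (Suc n)
      then obtain \<kappa> z where zz: "schwartz z" "t n = (\<lambda>x. ?B z x + \<kappa> * f0 x)" by blast
      define q where "q = kc a b (Suc n) * \<beta> ^ Suc n / fact (Suc n)"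
      have "t (Suc n) = (\<lambda>x. t n x + q * fj \<beta> h (Suc n) x)" unfolding t_def thn_Suc q_def ..
      also have "\<dots> = (\<lambda>x. ?B (\<lambda>x. z x + q * zj (Suc n) x) x + (\<kappa> + q * \<kappa>j (Suc n)) * f0 x)"
        unfolding zz(2) zj(2)[of "Suc n"] op_add[OF zz(1) schwartz_cmult[OF szj]] op_cmult[OF szj]
        by (simp add: fun_eq_iff algebra_simps)
      finally show ?case using zz(1) szj by (blast intro: schwartz_add schwartz_cmult)
    qed
    then obtain \<kappa> zn where zn: "\<And>n. schwartz (zn n)" "\<And>n. t n = (\<lambda>x. ?B (zn n) x + \<kappa> n * f0 x)" by metis
    define an where "an n = isq (?A (t n))" for n
    define gn where "gn n = n2 (\<lambda>x. rgrad (t n) x - rgrad (Th h) x)" for n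
    have an: "an \<longlonglongrightarrow> 0" unfolding an_def t_def by (rule op_thn_tendsto[OF z(1)])
    have gn: "gn \<longlonglongrightarrow> 0" unfolding gn_def t_def by (rule thn_Th_tendsto[OF z(1)])
    define G where "G = n2 (rgrad (Th h))"
    have G: "G > 0" unfolding G_def by (rule Th_gradient_nonzero[OF z(1) x0])
    have lowG: "G \<le> 2 * gsq (t n) + 2 * gn n" for n
    proof -
      have "rgrad (Th h) = (\<lambda>x. rgrad (t n) x + (- 1) *\<^sub>R (rgrad (t n) x - rgrad (Th h) x))" by auto
      then have "G = n2 (\<lambda>x. rgrad (t n) x + (- 1) *\<^sub>R (rgrad (t n) x - rgrad (Th h) x))" unfolding G_def by metis
      also have "\<dots> \<le> (1 + 1) * n2 (rgrad (t n)) + (1 + 1 / 1) * n2 (\<lambda>x. (- 1) *\<^sub>R (rgrad (t n) x - rgrad (Th h) x))"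
        by (intro n2_add_le sqi_scaleR sqi_diff schwartz_sqi_rgrad(1) st Th_sqi z(1)) auto
      finally show ?thesis unfolding n2_scaleR schwartz_sqi_rgrad(2)[OF st] gn_def by simp
    qed
    \<comment> \<open>If \<open>\<kappa> n\<close> were small, \<open>t n\<close> would be close to
      the image element \<open>w\<close>; there the gap bounds the gradient by the residual
      \<open>an n\<close>, which tends to 0, against G > 0.\<close>
    have Aest: "4 * ?l * gsq (t n) \<le> 4 * (\<kappa> n)\<^sup>2 * (isq (?A f0) + 4 * ?l * gip f0 f0) + 4 * an n" for n
    proof -
      define w where "w = ?B (zn n)"
      have sw: "schwartz w" unfolding w_def by (rule schwartz_op[OF zn(1)])
      have tn: "t n = (\<lambda>x. w x + \<kappa> n * f0 x)" unfolding w_def by (rule zn(2))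
      have w: "w = (\<lambda>x. t n x - \<kappa> n * f0 x)" using tn by auto
      have "gsq (t n) \<le> 2 * gip w w + 2 * (\<kappa> n)\<^sup>2 * gip f0 f0"
      proof -
        have "0 \<le> gsq (\<lambda>x. w x - \<kappa> n * f0 x)" by (rule gip_nonneg)
        then show ?thesis unfolding tn using sw s0
          by (simp add: gip_linear schwartz_intros gip_commute[of f0 w] power2_eq_square) (simp add: algebra_simps)
      qed
      moreover have "4 * ?l * gip w w \<le> isq (?A w)" unfolding w_def by (rule gap[OF zn(1)])
      moreover have "isq (?A w) \<le> 2 * an n + 2 * (\<kappa> n)\<^sup>2 * isq (?A f0)"
      proof -
        have Aw: "?A w = (\<lambda>x. ?A (t n) x - \<kappa> n * ?A f0 x)"
          unfolding w op_diff[OF st schwartz_cmult[OF s0]] op_cmult[OF s0] ..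
        have "0 \<le> isq (\<lambda>x. ?A (t n) x + \<kappa> n * ?A f0 x)" by (rule ip_nonneg)
        then show ?thesis unfolding Aw an_def using schwartz_op[OF st] schwartz_op[OF s0]
          by (simp add: ip_linear schwartz_intros ip_commute[of "?A f0" "?A (t n)"] power2_eq_square) (simp add: algebra_simps)
      qed
      ultimately have "4 * ?l * gsq (t n) \<le> 2 * (2 * an n + 2 * (\<kappa> n)\<^sup>2 * isq (?A f0)) + 4 * ?l * (2 * (\<kappa> n)\<^sup>2 * gip f0 f0)"
      proof -
        assume h1: "gsq (t n) \<le> 2 * gip w w + 2 * (\<kappa> n)\<^sup>2 * gip f0 f0"
          and h2: "4 * ?l * gip w w \<le> isq (?A w)" and h3: "isq (?A w) \<le> 2 * an n + 2 * (\<kappa> n)\<^sup>2 * isq (?A f0)"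
        have "4 * ?l * gsq (t n) \<le> 4 * ?l * (2 * gip w w + 2 * (\<kappa> n)\<^sup>2 * gip f0 f0)" using h1 l by (intro mult_left_mono) auto
        also have "\<dots> = 2 * (4 * ?l * gip w w) + 4 * ?l * (2 * (\<kappa> n)\<^sup>2 * gip f0 f0)" by (simp add: algebra_simps)
        also have "\<dots> \<le> 2 * (2 * an n + 2 * (\<kappa> n)\<^sup>2 * isq (?A f0)) + 4 * ?l * (2 * (\<kappa> n)\<^sup>2 * gip f0 f0)"
          by (intro add_right_mono mult_left_mono order_trans[OF h2 h3]) simp
        finally show ?thesis .
      qed
      also have "\<dots> \<le> 4 * (\<kappa> n)\<^sup>2 * (isq (?A f0) + 4 * ?l * gip f0 f0) + 4 * an n"
        using l gip_nonneg[of f0] by (simp add: algebra_simps)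
      finally show ?thesis .
    qed
    define K where "K = isq (?A f0) + 4 * ?l * gip f0 f0"
    have K: "K \<ge> 0" unfolding K_def using l by (simp add: ip_nonneg gip_nonneg)
    \<comment> \<open>A bound for the inverse square of \<open>\<kappa> n\<close> that does not
      depend on \<open>n\<close>; it follows from \<open>lowG\<close> and \<open>Aest\<close> once
      \<open>gn n\<close> and \<open>an n\<close> are small compared with \<open>G\<close>.\<close>
    define M where "M = 8 * (K + 1) / (?l * G)"
    have M: "M > 0" unfolding M_def using l G K by (simp add: mult_pos_pos)
    define Ru where "Ru = isq (?A u)"
    have lim: "(\<lambda>n. 2 * sqrt (Ru * (M * an n)) + M * an n) \<longlonglongrightarrow> 2 * sqrt (Ru * (M * 0)) + M * 0"
      by (intro tendsto_intros an)
    have ev: "\<forall>\<^sub>F n in sequentially. gn n < G / 4 \<and> an n < ?l * G / 8 \<and> M * gn n < \<epsilon> \<and> 2 * sqrt (Ru * (M * an n)) + M * an n < \<epsilon>"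
    proof (intro eventually_conj)
      show "\<forall>\<^sub>F n in sequentially. gn n < G / 4" using gn G by (intro order_tendstoD(2)) auto
      show "\<forall>\<^sub>F n in sequentially. an n < ?l * G / 8" using an G l by (intro order_tendstoD(2)) auto
      show "\<forall>\<^sub>F n in sequentially. M * gn n < \<epsilon>"
        using tendsto_mult_left[OF gn, of M] e by (intro order_tendstoD(2)) auto
      show "\<forall>\<^sub>F n in sequentially. 2 * sqrt (Ru * (M * an n)) + M * an n < \<epsilon>"
        using lim e by (intro order_tendstoD(2)) auto
    qed
    then obtain n where n: "gn n < G / 4" "an n < ?l * G / 8" "M * gn n < \<epsilon>" "2 * sqrt (Ru * (M * an n)) + M * an n < \<epsilon>"
      using eventually_happens'[OF sequentially_bot ev] by blast
    have "G / 4 \<le> gsq (t n)" using lowG[of n] n(1) by simp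
    then have "4 * ?l * (G / 4) \<le> 4 * ?l * gsq (t n)" using l by (intro mult_left_mono) auto
    also have "\<dots> \<le> 4 * (\<kappa> n)\<^sup>2 * K + 4 * an n" using Aest[of n] unfolding K_def .
    finally have lG: "?l * G \<le> 4 * (\<kappa> n)\<^sup>2 * K + 4 * an n" by (simp add: mult_ac)
    have kK: "?l * G / 2 < 4 * (\<kappa> n)\<^sup>2 * (K + 1)" if "\<kappa> n \<noteq> 0"
    proof -
      define X where "X = ?l * G"
      define S where "S = 4 * (\<kappa> n)\<^sup>2"
      have "S > 0" using that by (simp add: S_def)
      moreover have "X \<le> S * K + 4 * an n" "an n < X / 8" using lG n(2) by (simp_all add: X_def S_def)
      ultimately have "X / 2 < S * K + S" by linarith
      then show ?thesis unfolding X_def S_def by (simp add: distrib_left)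
    qed
    have kn: "\<kappa> n \<noteq> 0"
    proof
      assume "\<kappa> n = 0"
      then have "?l * G < ?l * G" using lG n(2) mult_pos_pos[OF l G] by simp
      then show False by simp
    qed
    have "inverse ((\<kappa> n)\<^sup>2) \<le> M"
    proof -
      have "?l * G = 2 * (?l * G / 2)" by simp
      also have "\<dots> < 2 * (4 * (\<kappa> n)\<^sup>2 * (K + 1))" by (rule mult_strict_left_mono[OF kK[OF kn]]) simp
      also have "\<dots> = 8 * (K + 1) * (\<kappa> n)\<^sup>2" by (simp add: algebra_simps)
      finally have le: "1 * (?l * G) \<le> 8 * (K + 1) * (\<kappa> n)\<^sup>2" by simp
      have "?l * G > 0" using l G by simp
      with le kn have "1 / (\<kappa> n)\<^sup>2 \<le> 8 * (K + 1) / (?l * G)"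
        by (subst frac_le_eq) (auto simp: divide_le_0_iff)
      then show ?thesis unfolding M_def by (simp add: inverse_eq_divide)
    qed
    then have kM: "(1 / \<kappa> n)\<^sup>2 \<le> M" by (simp add: power_divide inverse_eq_divide)
    define h' where "h' = (\<lambda>x. 1 / \<kappa> n * h x)"
    \<comment> \<open>The factor is chosen to cancel \<open>f0\<close> in u - v. The harmonic is
      rescaled in the same way, so that \<open>v\<close> approximates the ground state of
      \<open>h'\<close>.\<close>
    define v where "v = (\<lambda>x. 1 / \<kappa> n * t n x)"
    have h': "solid_harmonic k h'" unfolding h'_def by (rule solid_harmonic_cmult[OF z(1)])
    have Vv: "VK \<beta> k v" unfolding v_def by (rule VK_cmult[OF Vt])
    have sv: "schwartz v" by (rule VK_schwartz[OF Vv \<beta>])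
    have "Th h' = (\<lambda>x. 1 / \<kappa> n * Th h x)" by (auto simp: Th_def h'_def)
    then have "(\<lambda>x. rgrad v x - rgrad (Th h') x) = (\<lambda>x. (1 / \<kappa> n) *\<^sub>R (rgrad (t n) x - rgrad (Th h) x))"
      by (simp only: v_def rgrad_cmult[OF schwartz_differentiable[OF st]] rgrad_cmult[OF Th_partial(1)[OF hp]] scaleR_diff_right)
    then have "n2 (\<lambda>x. rgrad v x - rgrad (Th h') x) = (1 / \<kappa> n)\<^sup>2 * gn n" by (simp only: n2_scaleR gn_def)
    also have "\<dots> \<le> M * gn n" using kM by (intro mult_right_mono) (auto simp: gn_def n2_nonneg)
    finally have 1: "n2 (\<lambda>x. rgrad v x - rgrad (Th h') x) \<le> \<epsilon>" using n(3) by simp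
    have uv: "(\<lambda>x. u x - v x) = ?B (\<lambda>x. z x - 1 / \<kappa> n * zn n x)"
      unfolding op_diff[OF sz schwartz_cmult[OF zn(1)]] op_cmult[OF zn(1)] z(3) v_def zn(2)[of n] f0_def[symmetric]
      using kn by (simp add: fun_eq_iff field_simps)
    have "4 * ?l * gsq (\<lambda>x. u x - v x) \<le> isq (?A (\<lambda>x. u x - v x))"
      unfolding uv by (intro gap schwartz_diff schwartz_cmult sz zn)
    also have "\<dots> \<le> Ru + 2 * sqrt (Ru * isq (?A v)) + isq (?A v)"
      unfolding op_diff[OF su sv] Ru_def by (intro sqrt_triangle_ip schwartz_op su sv)
    also have "isq (?A v) = (1 / \<kappa> n)\<^sup>2 * an n"
      unfolding v_def op_cmult[OF st] ip_cmult_left ip_cmult_right an_def by (simp add: power2_eq_square)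
    also have "Ru + 2 * sqrt (Ru * ((1 / \<kappa> n)\<^sup>2 * an n)) + (1 / \<kappa> n)\<^sup>2 * an n \<le> Ru + 2 * sqrt (Ru * (M * an n)) + M * an n"
      using kM by (intro add_mono mult_left_mono real_sqrt_le_mono mult_right_mono) (auto simp: Ru_def an_def ip_nonneg)
    finally have "4 * ?l * gsq (\<lambda>x. u x - v x) \<le> Ru + \<epsilon>" using n(4) by simp
    then show ?thesis using 1 h' Vv unfolding Ru_def by blast
  qed
qed

end

section \<open>The constants \<open>D\<^sub>k\<close>\<close>

lemma D_const_sqrt: "D_const N k + real N = sqrt ((real N)\<^sup>2 + 4 * real k * (real N + real k - 2))"
  by (simp add: D_const_def)

lemma D_radicand_nonneg: "N \<ge> 2 \<Longrightarrow> 0 \<le> (real N)\<^sup>2 + 4 * real k * (real N + real k - 2)"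
  by simp

text \<open>This says that c = N + D_k/2 solves c (c - N) = \<mu>, as \<open>qform_sector\<close>
  demands, and there 2 (c - N) becomes D_k.\<close>

lemma D_quadratic:
  assumes "N \<ge> 2" shows "(real N + D_const N k / 2) * (D_const N k / 2) = mu N k"
proof -
  have "(D_const N k + real N)\<^sup>2 = (real N)\<^sup>2 + 4 * real k * (real N + real k - 2)"
    unfolding D_const_sqrt using D_radicand_nonneg[OF assms] by simp
  then show ?thesis by (simp add: mu_def power2_eq_square field_simps)
qed

lemma D_less_iff:
  assumes "N \<ge> 2" "y + real N \<ge> 0"
  shows "D_const N k < y \<longleftrightarrow> 4 * real k * (real N + real k - 2) < y * (y + 2 * real N)"
    "D_const N k \<le> y \<longleftrightarrow> 4 * real k * (real N + real k - 2) \<le> y * (y + 2 * real N)"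
proof -
  have y: "y + real N = sqrt ((y + real N)\<^sup>2)" using assms(2) by simp
  have "D_const N k < y \<longleftrightarrow> D_const N k + real N < y + real N" by simp
  also have "\<dots> \<longleftrightarrow> (real N)\<^sup>2 + 4 * real k * (real N + real k - 2) < (y + real N)\<^sup>2"
    unfolding D_const_sqrt by (subst y) (rule real_sqrt_less_iff)
  finally show "D_const N k < y \<longleftrightarrow> 4 * real k * (real N + real k - 2) < y * (y + 2 * real N)"
    by (simp add: power2_eq_square algebra_simps)
  have "D_const N k \<le> y \<longleftrightarrow> D_const N k + real N \<le> y + real N" by simp
  also have "\<dots> \<longleftrightarrow> (real N)\<^sup>2 + 4 * real k * (real N + real k - 2) \<le> (y + real N)\<^sup>2"
    unfolding D_const_sqrt by (subst y) (rule real_sqrt_le_iff)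
  finally show "D_const N k \<le> y \<longleftrightarrow> 4 * real k * (real N + real k - 2) \<le> y * (y + 2 * real N)"
    by (simp add: power2_eq_square algebra_simps)
qed

lemma D_mono: assumes "N \<ge> 2" "j \<le> k" shows "D_const N j \<le> D_const N k"
proof -
  have "real j * (real N + real j - 2) \<le> real k * (real N + real k - 2)" using assms by (intro mult_mono) auto
  then show ?thesis unfolding D_const_def by (intro diff_right_mono real_sqrt_le_mono) simp
qed

text \<open>The first inequalities make the weights of the remainder nonnegative and give 0 < D_1 <
  2 and D_2 < 4 for the Kummer parameters. The bounds of D_3 by D_1 + 4, D_2 + 4 and 8 say that the
  available gaps pay for the weights in the sectors 1, 2 and 0.\<close>

lemma D_facts:
  assumes N: "N \<ge> 2"
  shows "0 < D_const N 1" "D_const N 1 < 2" "D_const N 1 \<le> D_const N 2" "D_const N 2 < 4" "4 \<le> D_const N 3"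
    "D_const N 3 \<le> D_const N 1 + 4" "D_const N 3 \<le> D_const N 2 + 4" "D_const N 3 \<le> 8" "D_const N 2 \<le> D_const N 3"
proof -
  have n: "real N \<ge> 2" using N by simp
  show "0 < D_const N 1" using D_less_iff(2)[OF N, of 0 1] n by simp
  show "D_const N 1 < 2" using D_less_iff(1)[OF N, of 2 1] n by simp
  show "D_const N 1 \<le> D_const N 2" "D_const N 2 \<le> D_const N 3" by (rule D_mono[OF N], simp)+
  show "D_const N 2 < 4" using D_less_iff(1)[OF N, of 4 2] n by simp
  show "4 \<le> D_const N 3" using D_less_iff(1)[OF N, of 4 3] n by simp
  show "D_const N 3 \<le> 8" using D_less_iff(2)[OF N, of 8 3] n by simp
  have "D_const N 3 \<le> D_const N 1 + 4"
  proof -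
    let ?s = "D_const N 1"
    have s0: "?s \<ge> 0" using \<open>0 < D_const N 1\<close> by simp
    have "?s * (?s + 2 * real N) = 4 * (real N - 1)" using D_quadratic[OF N, of 1] by (simp add: mu_def field_simps)
    then have "4 * 3 * (real N + 3 - 2) \<le> (?s + 4) * (?s + 4 + 2 * real N)" using s0 by (simp add: algebra_simps)
    then show ?thesis using D_less_iff(2)[OF N, of "?s + 4" 3] s0 n by simp
  qed
  then show "D_const N 3 \<le> D_const N 1 + 4" "D_const N 3 \<le> D_const N 2 + 4" using \<open>D_const N 1 \<le> D_const N 2\<close> by auto
qed

lemma mu_less: "N \<ge> 2 \<Longrightarrow> j < k \<Longrightarrow> mu N j < mu N k"
  unfolding mu_def by (intro mult_strict_mono') auto

lemma mu_inj: "N \<ge> 2 \<Longrightarrow> j \<noteq> k \<Longrightarrow> mu N j \<noteq> mu N k"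
  using mu_less[of N j k] mu_less[of N k j] by (cases j k rule: linorder_cases) auto

lemma kummer_sector_D:
  assumes N: "CARD('n::finite) \<ge> 2" and b: "\<beta> > 0" and k: "k = 1 \<or> k = 2"
  defines "D \<equiv> D_const CARD('n) k"
  shows "kummer_sector TYPE('n) ((real k + (real CARD('n) + D / 2)) / 2) (real k + real CARD('n) / 2) \<beta> k
    (real CARD('n) + D / 2) D"
proof -
  have "0 < D" "D < 2 * real k" "2 * real k - 4 < D" using D_facts(1-4)[OF N] k by (auto simp: D_def)
  then show ?thesis using N b k by unfold_locales (auto simp: field_simps)
qed

section \<open>Orthogonal decomposition of the quadratic forms\<close>

lemma gip_sum_sectors:
  fixes g :: "nat \<Rightarrow> real^'n::finite \<Rightarrow> real"
  assumes N: "CARD('n) \<ge> 2" and g: "\<And>k. sector (mu CARD('n) k) (g k)"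
  shows "gsq (\<lambda>x. \<Sum>k\<le>K. g k x) = (\<Sum>k\<le>K. gsq (g k))"
proof (induction K)
  case (Suc K)
  have s: "schwartz (g k)" for k using g sector_schwartz by blast
  have S: "schwartz (\<lambda>x. \<Sum>k\<le>K. g k x)" by (intro schwartz_sum s)
  have c: "gip (\<lambda>x. \<Sum>k\<le>K. g k x) (g (Suc K)) = (\<Sum>k\<le>K. gip (g k) (g (Suc K)))"
    using s S by (simp add: gip_eq laplacian_sum ip_sum_left schwartz_laplacian sum_negf)
  have z: "(\<Sum>k\<le>K. gip (g k) (g (Suc K))) = 0" using mu_inj[OF N] g by (intro sum.neutral ballI gip_sector_orthogonal) auto
  show ?case using Suc s S c z gip_commute[of "g (Suc K)" "\<lambda>x. \<Sum>k\<le>K. g k x"] by (simp add: gip_linear schwartz_intros)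
qed simp

lemma qform_add:
  assumes "schwartz f" "schwartz g" "schwartz h"
  shows "qform l (\<lambda>x. f x + g x) h = qform l f h + qform l g h"
  using assms by (simp add: qform_def xip_eq gip_eq op_linear ip_linear schwartz_intros algebra_simps)

lemma qform_commute: "qform l f g = qform l g f"
proof -
  have "xip f g = xip g f" unfolding xip_def by (intro sum.cong refl) (metis ip_commute ip_sq)
  then show ?thesis by (simp add: qform_def gip_commute[of f g] ip_commute[of "laplacian f"])
qed

lemma qform_add_right:
  assumes "schwartz f" "schwartz g" "schwartz h"
  shows "qform l h (\<lambda>x. f x + g x) = qform l h f + qform l h g"
  unfolding qform_commute[of l h] by (rule qform_add[OF assms])

lemma qform_sum_sectors:
  fixes g :: "nat \<Rightarrow> real^'n::finite \<Rightarrow> real"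
  assumes N: "CARD('n) \<ge> 2" and g: "\<And>k. sector (mu CARD('n) k) (g k)"
  shows "qform l (\<lambda>x. \<Sum>k\<le>K. g k x) (\<lambda>x. \<Sum>k\<le>K. g k x) = (\<Sum>k\<le>K. qform l (g k) (g k))"
proof (induction K)
  case (Suc K)
  have s: "schwartz (g k)" for k using g sector_schwartz by blast
  have S: "schwartz (\<lambda>x. \<Sum>k\<le>K. g k x)" for K by (intro schwartz_sum s)
  have 0: "qform l (\<lambda>x. \<Sum>k\<le>L. g k x) (g j) = 0" if "L < j" for L j
    using that
  proof (induction L)
    case 0 then show ?case using mu_inj[OF N] g by (auto intro!: qform_sector_orthogonal)
  next
    case (Suc L)
    have "qform l (g (Suc L)) (g j) = 0" using mu_inj[OF N] g Suc.prems by (intro qform_sector_orthogonal) auto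
    with Suc show ?case by (simp add: qform_add s S)
  qed
  let ?S = "\<lambda>x. \<Sum>k\<le>K. g k x"
  have "qform l (\<lambda>x. ?S x + g (Suc K) x) (\<lambda>x. ?S x + g (Suc K) x)
     = qform l (\<lambda>x. ?S x + g (Suc K) x) ?S + qform l (\<lambda>x. ?S x + g (Suc K) x) (g (Suc K))"
    by (rule qform_add_right[OF S s schwartz_add[OF S s]])
  also have "\<dots> = qform l ?S ?S + qform l (g (Suc K)) (g (Suc K))"
    using 0[of K "Suc K"] qform_commute[of l "g (Suc K)" ?S] by (simp add: qform_add s S)
  finally have "qform l (\<lambda>x. ?S x + g (Suc K) x) (\<lambda>x. ?S x + g (Suc K) x) = qform l ?S ?S + qform l (g (Suc K)) (g (Suc K))" .
  then show ?case using Suc by simp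
qed simp

section \<open>The stability inequality on polynomials times a Gaussian\<close>

text \<open>Up to rearrangement the parameters of \<open>Theta1\<close> and \<open>Theta2\<close>
  are (k + c)/2 and k + N/2 with c = N + D_k/2, and Kummer's transformation does the rest.\<close>

lemma Theta_Th:
  fixes h :: "real^'n::finite \<Rightarrow> real"
  assumes N: "CARD('n) \<ge> 2" and b: "\<beta> > 0"
  shows "(\<lambda>x. Theta1 \<beta> x * h x) = kummer_sector.Th ((real 1 + (real CARD('n) + D_const CARD('n) 1 / 2)) / 2) (real 1 + real CARD('n) / 2) \<beta> h"
    "(\<lambda>x. Theta2 \<beta> x * h x) = kummer_sector.Th ((real 2 + (real CARD('n) + D_const CARD('n) 2 / 2)) / 2) (real 2 + real CARD('n) / 2) \<beta> h"
proof -
  interpret s1: kummer_sector "(real 1 + (real CARD('n) + D_const CARD('n) 1 / 2)) / 2" "real 1 + real CARD('n) / 2" \<beta> 1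
     "real CARD('n) + D_const CARD('n) 1 / 2" "D_const CARD('n) 1" "TYPE('n)" by (rule kummer_sector_D[OF N b]) simp
  interpret s2: kummer_sector "(real 2 + (real CARD('n) + D_const CARD('n) 2 / 2)) / 2" "real 2 + real CARD('n) / 2" \<beta> 2
     "real CARD('n) + D_const CARD('n) 2 / 2" "D_const CARD('n) 2" "TYPE('n)" by (rule kummer_sector_D[OF N b]) simp
  show "(\<lambda>x. Theta1 \<beta> x * h x) = s1.Th h"
    unfolding Theta1_def s1.Th_def s1.kummer_eq[symmetric] by (rule ext, simp add: add_divide_distrib add_ac)
  show "(\<lambda>x. Theta2 \<beta> x * h x) = s2.Th h"
    unfolding Theta2_def s2.Th_def s2.kummer_eq[symmetric] by (rule ext, simp add: add_divide_distrib add_ac)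
qed

lemma Theta_regular:
  fixes h :: "real^'n::finite \<Rightarrow> real"
  assumes N: "CARD('n) \<ge> 2" and b: "\<beta> > 0"
  shows "solid_harmonic 1 h \<Longrightarrow> (\<lambda>x. Theta1 \<beta> x * h x) differentiable (at x) \<and> sqi (rgrad (\<lambda>x. Theta1 \<beta> x * h x))"
    "solid_harmonic 2 h \<Longrightarrow> (\<lambda>x. Theta2 \<beta> x * h x) differentiable (at x) \<and> sqi (rgrad (\<lambda>x. Theta2 \<beta> x * h x))"
proof -
  interpret s1: kummer_sector "(real 1 + (real CARD('n) + D_const CARD('n) 1 / 2)) / 2" "real 1 + real CARD('n) / 2" \<beta> 1
     "real CARD('n) + D_const CARD('n) 1 / 2" "D_const CARD('n) 1" "TYPE('n)" by (rule kummer_sector_D[OF N b]) simp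
  interpret s2: kummer_sector "(real 2 + (real CARD('n) + D_const CARD('n) 2 / 2)) / 2" "real 2 + real CARD('n) / 2" \<beta> 2
     "real CARD('n) + D_const CARD('n) 2 / 2" "D_const CARD('n) 2" "TYPE('n)" by (rule kummer_sector_D[OF N b]) simp
  show "solid_harmonic 1 h \<Longrightarrow> (\<lambda>x. Theta1 \<beta> x * h x) differentiable (at x) \<and> sqi (rgrad (\<lambda>x. Theta1 \<beta> x * h x))"
    unfolding Theta_Th[OF N b] using s1.Th_partial(1) s1.Th_sqi solid_harmonic_poly by blast
  show "solid_harmonic 2 h \<Longrightarrow> (\<lambda>x. Theta2 \<beta> x * h x) differentiable (at x) \<and> sqi (rgrad (\<lambda>x. Theta2 \<beta> x * h x))"
    unfolding Theta_Th[OF N b] using s2.Th_partial(1) s2.Th_sqi solid_harmonic_poly by blast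
qed

lemma sector_gap_D:
  fixes u :: "real^'n::finite \<Rightarrow> real"
  assumes N: "CARD('n) \<ge> 2" and b: "\<beta> > 0" and e: "\<epsilon> > 0"
  shows "VK \<beta> 1 u \<Longrightarrow> \<exists>h v. solid_harmonic 1 h \<and> VK \<beta> 1 v \<and> n2 (\<lambda>x. rgrad v x - rgrad (\<lambda>x. Theta1 \<beta> x * h x) x) \<le> \<epsilon> \<and>
      D_const CARD('n) 1 * (2 * \<beta>) * gip u u + 4 * (2 * \<beta>) * gsq (\<lambda>x. u x - v x) \<le> qform (2 * \<beta>) u u + \<epsilon>"
    "VK \<beta> 2 u \<Longrightarrow> \<exists>h v. solid_harmonic 2 h \<and> VK \<beta> 2 v \<and> n2 (\<lambda>x. rgrad v x - rgrad (\<lambda>x. Theta2 \<beta> x * h x) x) \<le> \<epsilon> \<and>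
      D_const CARD('n) 2 * (2 * \<beta>) * gip u u + 4 * (2 * \<beta>) * gsq (\<lambda>x. u x - v x) \<le> qform (2 * \<beta>) u u + \<epsilon>"
proof -
  interpret s1: kummer_sector "(real 1 + (real CARD('n) + D_const CARD('n) 1 / 2)) / 2" "real 1 + real CARD('n) / 2" \<beta> 1
     "real CARD('n) + D_const CARD('n) 1 / 2" "D_const CARD('n) 1" "TYPE('n)" by (rule kummer_sector_D[OF N b]) simp
  interpret s2: kummer_sector "(real 2 + (real CARD('n) + D_const CARD('n) 2 / 2)) / 2" "real 2 + real CARD('n) / 2" \<beta> 2
     "real CARD('n) + D_const CARD('n) 2 / 2" "D_const CARD('n) 2" "TYPE('n)" by (rule kummer_sector_D[OF N b]) simp
  have Q: "qform (2 * \<beta>) u u = D_const CARD('n) k * (2 * \<beta>) * gip u u + isq (op (2 * \<beta>) (real CARD('n) + D_const CARD('n) k / 2) u)"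
    if "VK \<beta> k u" for k
  proof -
    have "mu CARD('n) k = (real CARD('n) + D_const CARD('n) k / 2) * (real CARD('n) + D_const CARD('n) k / 2 - real CARD('n))"
      using D_quadratic[OF N] by simp
    from qform_sector[OF VK_sector[OF that b] this] show ?thesis by simp
  qed
  show "\<exists>h v. solid_harmonic 1 h \<and> VK \<beta> 1 v \<and> n2 (\<lambda>x. rgrad v x - rgrad (\<lambda>x. Theta1 \<beta> x * h x) x) \<le> \<epsilon> \<and>
      D_const CARD('n) 1 * (2 * \<beta>) * gip u u + 4 * (2 * \<beta>) * gsq (\<lambda>x. u x - v x) \<le> qform (2 * \<beta>) u u + \<epsilon>" if "VK \<beta> 1 u"
    using s1.sector_gap[OF that e] unfolding Q[OF that] Theta_Th[OF N b] by (elim exE conjE) (intro exI conjI, assumption+, simp)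
  show "\<exists>h v. solid_harmonic 2 h \<and> VK \<beta> 2 v \<and> n2 (\<lambda>x. rgrad v x - rgrad (\<lambda>x. Theta2 \<beta> x * h x) x) \<le> \<epsilon> \<and>
      D_const CARD('n) 2 * (2 * \<beta>) * gip u u + 4 * (2 * \<beta>) * gsq (\<lambda>x. u x - v x) \<le> qform (2 * \<beta>) u u + \<epsilon>" if "VK \<beta> 2 u"
    using s2.sector_gap[OF that e] unfolding Q[OF that] Theta_Th[OF N b] by (elim exE conjE) (intro exI conjI, assumption+, simp)
qed

lemma qform_high_sector:
  fixes u :: "real^'n::finite \<Rightarrow> real"
  assumes N: "CARD('n) \<ge> 2" and b: "\<beta> > 0" and u: "VK \<beta> k u" and k: "j \<le> k"
  shows "D_const CARD('n) j * (2 * \<beta>) * gip u u \<le> qform (2 * \<beta>) u u"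
proof -
  have "mu CARD('n) k = (real CARD('n) + D_const CARD('n) k / 2) * (real CARD('n) + D_const CARD('n) k / 2 - real CARD('n))"
    using D_quadratic[OF N] by simp
  from qform_sector[OF VK_sector[OF u b] this, of "2 * \<beta>"]
  have "D_const CARD('n) k * (2 * \<beta>) * gip u u \<le> qform (2 * \<beta>) u u" using ip_nonneg by simp
  moreover have "D_const CARD('n) j * (2 * \<beta>) * gip u u \<le> D_const CARD('n) k * (2 * \<beta>) * gip u u"
    using D_mono[OF N k] b gip_nonneg[of u] by (intro mult_right_mono) auto
  ultimately show ?thesis by simp
qed

text \<open>Twice the weights of the remainder. For N \<ge> 2 they are nonnegative, whence
  \<open>wsum_mono\<close>, and they add up to \<open>D_const N 3\<close>, which is the factor of
  the constant in \<open>wsum_affine\<close>.\<close>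

definition wsum :: "nat \<Rightarrow> real \<Rightarrow> real \<Rightarrow> real \<Rightarrow> real \<Rightarrow> real" where
  "wsum N r0 r1 r2 r3 = D_const N 1 * r0 + (D_const N 2 - D_const N 1) * r1 + (4 - D_const N 2) * r2 + (D_const N 3 - 4) * r3"

lemma wsum_mono:
  assumes "N \<ge> 2" "r0 \<le> s0" "r1 \<le> s1" "r2 \<le> s2" "r3 \<le> s3"
  shows "wsum N r0 r1 r2 r3 \<le> wsum N s0 s1 s2 s3"
  unfolding wsum_def using D_facts[OF assms(1)] assms(2-) by (intro add_mono mult_left_mono) auto

lemma wsum_affine: "wsum N (c * r0 + d) (c * r1 + d) (c * r2 + d) (c * r3 + d) = c * wsum N r0 r1 r2 r3 + D_const N 3 * d"
  by (simp add: wsum_def algebra_simps)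

lemma core_approximate:
  fixes p :: "real^'n::finite \<Rightarrow> real"
  assumes N: "CARD('n) \<ge> 2" and b: "\<beta> > 0" and p: "real_polynomial_function p" and e: "\<eta> > 0"
  defines "f \<equiv> \<lambda>x. p x * gauss \<beta> x"
  shows "\<exists>\<alpha> \<tau> h1 h2 v1 v2. solid_harmonic 1 h1 \<and> solid_harmonic 2 h2 \<and> schwartz v1 \<and> schwartz v2 \<and>
    n2 (\<lambda>x. rgrad v1 x - rgrad (\<lambda>x. Theta1 \<beta> x * h1 x) x) \<le> \<eta> \<and> n2 (\<lambda>x. rgrad v2 x - rgrad (\<lambda>x. Theta2 \<beta> x * h2 x) x) \<le> \<eta> \<and>
    2 * \<beta> * wsum CARD('n)
      (gsq (\<lambda>x. f x - \<alpha> * gauss \<beta> x))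
      (gsq (\<lambda>x. f x - (\<alpha> * gauss \<beta> x + v1 x)))
      (gsq (\<lambda>x. f x - (\<alpha> * gauss \<beta> x + v1 x + v2 x)))
      (gsq (\<lambda>x. f x - (\<alpha> * gauss \<beta> x + v1 x + v2 x + \<tau> * L_fun \<beta> x)))
     \<le> qform (2 * \<beta>) f f + 2 * \<eta>"
proof -
  let ?N = "CARD('n)" and ?l = "2 * \<beta>"
  let ?D = "D_const ?N"
  obtain K0 u0 where u0: "\<And>k. VK \<beta> k (u0 k)" "\<And>x. p x * gauss \<beta> x = (\<Sum>k\<le>K0. u0 k x)"
    using polynomial_gauss_sectors[OF p] by blast
  \<comment> \<open>Padding with zero components guarantees that the indices 0, 1 and 2 are
    present.\<close>
  define K where "K = max K0 2"
  define u where "u k = (if k \<le> K0 then u0 k else (\<lambda>x. 0))" for k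
  have u: "VK \<beta> k (u k)" for k by (simp add: u_def u0(1) VK_zero)
  have f: "f = (\<lambda>x. \<Sum>k\<le>K. u k x)"
  proof
    fix x
    have "f x = (\<Sum>k\<le>K0. u k x)" by (simp add: f_def u0(2) u_def)
    also have "\<dots> = (\<Sum>k\<le>K. u k x)" by (rule sum.mono_neutral_left) (auto simp: K_def u_def)
    finally show "f x = (\<Sum>k\<le>K. u k x)" .
  qed
  obtain \<alpha> \<tau> where rad: "4 * ?l * gsq (\<lambda>x. u 0 x - \<alpha> * gauss \<beta> x)
     + (?D 3 - 4) * ?l * gsq (\<lambda>x. u 0 x - (\<alpha> * gauss \<beta> x + \<tau> * L_fun \<beta> x))
     \<le> qform ?l (u 0) (u 0)" and Va: "VK \<beta> 0 (\<lambda>x::real^'n. \<alpha> * gauss \<beta> x)" "VK \<beta> 0 (\<lambda>x::real^'n. \<alpha> * gauss \<beta> x + \<tau> * L_fun \<beta> x)"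
    using radial_sector[OF b u, of "?D 3 - 4"] D_facts[OF N] by auto
  obtain h1 v1 where s1: "solid_harmonic 1 h1" "VK \<beta> 1 v1" "n2 (\<lambda>x. rgrad v1 x - rgrad (\<lambda>x. Theta1 \<beta> x * h1 x) x) \<le> \<eta>"
    "?D 1 * ?l * gsq (u 1) + 4 * ?l * gsq (\<lambda>x. u 1 x - v1 x) \<le> qform ?l (u 1) (u 1) + \<eta>"
    using sector_gap_D(1)[OF N b e u] by blast
  obtain h2 v2 where s2: "solid_harmonic 2 h2" "VK \<beta> 2 v2" "n2 (\<lambda>x. rgrad v2 x - rgrad (\<lambda>x. Theta2 \<beta> x * h2 x) x) \<le> \<eta>"
    "?D 2 * ?l * gsq (u 2) + 4 * ?l * gsq (\<lambda>x. u 2 x - v2 x) \<le> qform ?l (u 2) (u 2) + \<eta>"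
    using sector_gap_D(2)[OF N b e u] by blast
  define G where "G w0 w1 w2 = gsq (\<lambda>x. f x - (w0 x + w1 x + w2 x))" for w0 w1 w2 :: "real^'n \<Rightarrow> real"
  have split: "{..K} = insert 0 (insert 1 (insert 2 {3..K}))" by (auto simp: K_def)
  define R where "R = (\<Sum>k\<in>{3..K}. gsq (u k))"
  \<comment> \<open>Only the components of degree 0, 1 and 2 are altered, so the four squared
    distances split along one and the same orthogonal decomposition.\<close>
  have G: "G w0 w1 w2 = gsq (\<lambda>x. u 0 x - w0 x) + gsq (\<lambda>x. u 1 x - w1 x)
     + gsq (\<lambda>x. u 2 x - w2 x) + R" if w: "VK \<beta> 0 w0" "VK \<beta> 1 w1" "VK \<beta> 2 w2" for w0 w1 w2
  proof -
    define g where "g k = (if k = 0 then (\<lambda>x. u 0 x - w0 x) else if k = 1 then (\<lambda>x. u 1 x - w1 x)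
      else if k = 2 then (\<lambda>x. u 2 x - w2 x) else u k)" for k
    have "VK \<beta> k (g k)" for k unfolding g_def using u w by (auto intro: VK_diff)
    then have sg: "sector (mu ?N k) (g k)" for k using VK_sector b by blast
    have "(\<lambda>x. f x - (w0 x + w1 x + w2 x)) = (\<lambda>x. \<Sum>k\<le>K. g k x)"
    proof
      fix x
      have "(\<Sum>k\<in>{3..K}. g k x) = (\<Sum>k\<in>{3..K}. u k x)" by (intro sum.cong) (auto simp: g_def)
      then show "f x - (w0 x + w1 x + w2 x) = (\<Sum>k\<le>K. g k x)" unfolding f split by (simp add: g_def)
    qed
    then have "G w0 w1 w2 = (\<Sum>k\<le>K. gsq (g k))" unfolding G_def by (simp add: gip_sum_sectors[OF N sg])
    moreover have "(\<Sum>k\<in>{3..K}. gsq (g k)) = R" unfolding R_def by (intro sum.cong) (auto simp: g_def)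
    ultimately show ?thesis unfolding split by (simp add: g_def)
  qed
  have Z: "VK \<beta> k (\<lambda>x::real^'n. 0)" for k by (rule VK_zero)
  let ?a = "gsq (\<lambda>x. u 0 x - \<alpha> * gauss \<beta> x)"
  let ?a' = "gsq (\<lambda>x. u 0 x - (\<alpha> * gauss \<beta> x + \<tau> * L_fun \<beta> x))"
  let ?g1 = "gsq (u 1)" and ?g2 = "gsq (u 2)"
  let ?d1 = "gsq (\<lambda>x. u 1 x - v1 x)" and ?d2 = "gsq (\<lambda>x. u 2 x - v2 x)"
  have Q: "qform ?l f f = qform ?l (u 0) (u 0) + qform ?l (u 1) (u 1) + qform ?l (u 2) (u 2) + (\<Sum>k\<in>{3..K}. qform ?l (u k) (u k))"
  proof -
    have "qform ?l f f = (\<Sum>k\<le>K. qform ?l (u k) (u k))" by (simp only: f qform_sum_sectors[OF N VK_sector[OF u b]])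
    then show ?thesis unfolding split by simp
  qed
  have high: "?D 3 * ?l * R \<le> (\<Sum>k\<in>{3..K}. qform ?l (u k) (u k))"
    unfolding R_def sum_distrib_left by (intro sum_mono qform_high_sector[OF N b u]) auto
  \<comment> \<open>Beyond the weight paid by the factorisation, the sectors 1 and 2 owe D_3 - D_1
    and D_3 - D_2 times the distance to their ground states; both are at most the gap 4.\<close>
  have d1: "(?D 3 - ?D 1) * (?l * ?d1) \<le> 4 * (?l * ?d1)" "(?D 3 - ?D 2) * (?l * ?d2) \<le> 4 * (?l * ?d2)"
    using D_facts[OF N] b by (auto intro!: mult_right_mono mult_nonneg_nonneg gip_nonneg)
  have "?l * wsum ?N (?a + ?g1 + ?g2 + R) (?a + ?d1 + ?g2 + R) (?a + ?d1 + ?d2 + R) (?a' + ?d1 + ?d2 + R)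
    = (4 * ?l * ?a + (?D 3 - 4) * ?l * ?a') + (?D 1 * ?l * ?g1 + (?D 3 - ?D 1) * (?l * ?d1)) + (?D 2 * ?l * ?g2 + (?D 3 - ?D 2) * (?l * ?d2)) + ?D 3 * ?l * R"
    by (simp add: wsum_def algebra_simps)
  also have "\<dots> \<le> qform ?l (u 0) (u 0) + (qform ?l (u 1) (u 1) + \<eta>) + (qform ?l (u 2) (u 2) + \<eta>) + (\<Sum>k\<in>{3..K}. qform ?l (u k) (u k))"
  proof -
    have e1: "?D 1 * ?l * ?g1 + (?D 3 - ?D 1) * (?l * ?d1) \<le> qform ?l (u 1) (u 1) + \<eta>"
      using order_trans[OF add_left_mono[OF d1(1)], of "?D 1 * ?l * ?g1"] s1(4) by (simp add: mult.assoc)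
    have e2: "?D 2 * ?l * ?g2 + (?D 3 - ?D 2) * (?l * ?d2) \<le> qform ?l (u 2) (u 2) + \<eta>"
      using order_trans[OF add_left_mono[OF d1(2)], of "?D 2 * ?l * ?g2"] s2(4) by (simp add: mult.assoc)
    show "(4 * ?l * ?a + (?D 3 - 4) * ?l * ?a') + (?D 1 * ?l * ?g1 + (?D 3 - ?D 1) * (?l * ?d1)) + (?D 2 * ?l * ?g2 + (?D 3 - ?D 2) * (?l * ?d2)) + ?D 3 * ?l * R
      \<le> qform ?l (u 0) (u 0) + (qform ?l (u 1) (u 1) + \<eta>) + (qform ?l (u 2) (u 2) + \<eta>) + (\<Sum>k\<in>{3..K}. qform ?l (u k) (u k))"
      by (rule add_mono[OF add_mono[OF add_mono[OF rad e1] e2] high])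
  qed
  finally have main: "?l * wsum ?N (?a + ?g1 + ?g2 + R) (?a + ?d1 + ?g2 + R) (?a + ?d1 + ?d2 + R) (?a' + ?d1 + ?d2 + R) \<le> qform ?l f f + 2 * \<eta>"
    unfolding Q by simp
  have W: "gsq (\<lambda>x. f x - \<alpha> * gauss \<beta> x) = ?a + ?g1 + ?g2 + R"
    "gsq (\<lambda>x. f x - (\<alpha> * gauss \<beta> x + v1 x)) = ?a + ?d1 + ?g2 + R"
    "gsq (\<lambda>x. f x - (\<alpha> * gauss \<beta> x + v1 x + v2 x)) = ?a + ?d1 + ?d2 + R"
    "gsq (\<lambda>x. f x - (\<alpha> * gauss \<beta> x + v1 x + v2 x + \<tau> * L_fun \<beta> x)) = ?a' + ?d1 + ?d2 + R"
    using G[OF Va(1) Z Z] G[OF Va(1) s1(2) Z] G[OF Va(1) s1(2) s2(2)] G[OF Va(2) s1(2) s2(2)]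
    unfolding G_def by (simp_all add: add_ac)
  show ?thesis
    using main s1(1,3) s2(1,3) VK_schwartz[OF s1(2) b] VK_schwartz[OF s2(2) b] unfolding W[symmetric] by blast
qed

text \<open>The real comparison functions, with arbitrary solid harmonics in the places of the
  linear form and of |x|^2 times the combination of spherical harmonics. That every solid harmonic
  of degree 1 or 2 has that form is shown in \<open>lin_surj\<close> and
  \<open>quad_surj\<close>.\<close>

definition rw :: "nat \<Rightarrow> real \<Rightarrow> real \<Rightarrow> real \<Rightarrow> (real^'n::finite \<Rightarrow> real) \<Rightarrow> (real^'n \<Rightarrow> real) \<Rightarrow> real^'n \<Rightarrow> real" where
  "rw j \<beta> \<alpha> \<tau> h1 h2 x = \<alpha> * gauss \<beta> x + (if j \<ge> 1 then Theta1 \<beta> x * h1 x else 0)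
     + (if j \<ge> 2 then Theta2 \<beta> x * h2 x else 0) + (if j \<ge> 3 then \<tau> * L_fun \<beta> x else 0)"

lemma L_fun_schwartz: "\<beta> > 0 \<Longrightarrow> schwartz (L_fun \<beta> :: real^'n::finite \<Rightarrow> real)"
  unfolding L_fun_eq mult.commute[of _ \<beta>]
  by (intro schwartz_diff schwartz_cmult schwartz_fj real_polynomial_function.intros(2))

lemma rw_rgrad:
  fixes h1 h2 :: "real^'n::finite \<Rightarrow> real"
  assumes N: "CARD('n) \<ge> 2" and b: "\<beta> > 0" and h: "solid_harmonic 1 h1" "solid_harmonic 2 h2"
  shows "rw j \<beta> \<alpha> \<tau> h1 h2 differentiable (at x)"
    "rgrad (rw j \<beta> \<alpha> \<tau> h1 h2) x = rgrad (\<lambda>x. \<alpha> * gauss \<beta> x) x + (if j \<ge> 1 then rgrad (\<lambda>x. Theta1 \<beta> x * h1 x) x else 0)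
     + (if j \<ge> 2 then rgrad (\<lambda>x. Theta2 \<beta> x * h2 x) x else 0) + (if j \<ge> 3 then rgrad (\<lambda>x. \<tau> * L_fun \<beta> x) x else 0)"
    "sqi (rgrad (rw j \<beta> \<alpha> \<tau> h1 h2))"
proof -
  note sg = schwartz_cmult[OF gauss_schwartz[OF b], of \<alpha>] schwartz_cmult[OF L_fun_schwartz[OF b], of \<tau>]
  note d = schwartz_differentiable[OF sg(1)] schwartz_differentiable[OF sg(2)]
    Theta_regular(1)[OF N b h(1), THEN conjunct1] Theta_regular(2)[OF N b h(2), THEN conjunct1]
  have z: "rgrad (\<lambda>x::real^'n. 0) y = 0" for y by (simp add: rgrad_def vec_eq_iff)
  have i: "(\<lambda>x. if c then F x else 0) differentiable (at y) \<and> rgrad (\<lambda>x. if c then F x else 0) y = (if c then rgrad F y else 0)"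
    if "F differentiable (at y)" for c and F :: "real^'n \<Rightarrow> real" and y using that by (cases c) (auto simp: z)
  have rw: "rw j \<beta> \<alpha> \<tau> h1 h2 = (\<lambda>x. ((\<alpha> * gauss \<beta> x + (if j \<ge> 1 then Theta1 \<beta> x * h1 x else 0))
     + (if j \<ge> 2 then Theta2 \<beta> x * h2 x else 0)) + (if j \<ge> 3 then \<tau> * L_fun \<beta> x else 0))" by (auto simp: rw_def)
  show "rw j \<beta> \<alpha> \<tau> h1 h2 differentiable (at x)" for x
    unfolding rw by (intro differentiable_add d(1) i[OF d(2), THEN conjunct1] i[OF d(3), THEN conjunct1] i[OF d(4), THEN conjunct1])
  have eq: "rgrad (rw j \<beta> \<alpha> \<tau> h1 h2) x = rgrad (\<lambda>x. \<alpha> * gauss \<beta> x) x + (if j \<ge> 1 then rgrad (\<lambda>x. Theta1 \<beta> x * h1 x) x else 0)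
     + (if j \<ge> 2 then rgrad (\<lambda>x. Theta2 \<beta> x * h2 x) x else 0) + (if j \<ge> 3 then rgrad (\<lambda>x. \<tau> * L_fun \<beta> x) x else 0)" for x
    unfolding rw by (simp only: rgrad_add differentiable_add d(1) i[OF d(2)] i[OF d(3)] i[OF d(4)])
  then show "rgrad (rw j \<beta> \<alpha> \<tau> h1 h2) x = rgrad (\<lambda>x. \<alpha> * gauss \<beta> x) x + (if j \<ge> 1 then rgrad (\<lambda>x. Theta1 \<beta> x * h1 x) x else 0)
     + (if j \<ge> 2 then rgrad (\<lambda>x. Theta2 \<beta> x * h2 x) x else 0) + (if j \<ge> 3 then rgrad (\<lambda>x. \<tau> * L_fun \<beta> x) x else 0)" .
  have si: "sqi (\<lambda>x. if c then F x else 0)" if "sqi F" for c and F :: "real^'n \<Rightarrow> real^'n" using that by (cases c) (auto simp: sqi_def)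
  have "sqi (\<lambda>x. rgrad (rw j \<beta> \<alpha> \<tau> h1 h2) x)" unfolding eq
    by (intro sqi_add si Theta_regular(1)[OF N b h(1), THEN conjunct2] Theta_regular(2)[OF N b h(2), THEN conjunct2]
        schwartz_sqi_rgrad(1)[OF sg(1)] schwartz_sqi_rgrad(1)[OF sg(2)])
  then show "sqi (rgrad (rw j \<beta> \<alpha> \<tau> h1 h2))" .
qed

text \<open>The contribution of one real field to twice the remainder; a complex field gives two of
  these, see \<open>remainder_split\<close>.\<close>

definition rrem :: "real \<Rightarrow> real \<Rightarrow> real \<Rightarrow> (real^'n::finite \<Rightarrow> real) \<Rightarrow> (real^'n \<Rightarrow> real) \<Rightarrow> (real^'n \<Rightarrow> real^'n) \<Rightarrow> real" where
  "rrem \<beta> \<alpha> \<tau> h1 h2 F = (let r = \<lambda>j. n2 (\<lambda>x. F x - rgrad (rw j \<beta> \<alpha> \<tau> h1 h2) x) in wsum CARD('n) (r 0) (r 1) (r 2) (r 3))"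

text \<open>Replaces the Schwartz approximants \<open>v1\<close>, \<open>v2\<close> of
  \<open>core_approximate\<close> by the Kummer ground states themselves. Young's inequality
  multiplies the remainder by 1 + \<delta> and adds a multiple of the approximation error
  \<eta>.\<close>

lemma core:
  fixes p :: "real^'n::finite \<Rightarrow> real"
  assumes N: "CARD('n) \<ge> 2" and b: "\<beta> > 0" and p: "real_polynomial_function p" and e: "\<epsilon> > 0"
  defines "f \<equiv> \<lambda>x. p x * gauss \<beta> x"
  shows "\<exists>\<alpha> \<tau> h1 h2. solid_harmonic 1 h1 \<and> solid_harmonic 2 h2 \<and> 2 * \<beta> * rrem \<beta> \<alpha> \<tau> h1 h2 (rgrad f) \<le> qform (2 * \<beta>) f f + \<epsilon>"
proof -
  let ?N = "CARD('n)" and ?l = "2 * \<beta>"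
  define Q where "Q = \<bar>qform ?l f f\<bar>"
  \<comment> \<open>The relative loss is fixed by the size of the quadratic form, so that \<delta>
    times it stays below \<epsilon>/3.\<close>
  define \<delta> where "\<delta> = \<epsilon> / (3 * (Q + 1))"
  have Q: "Q \<ge> 0" by (simp add: Q_def)
  have \<delta>: "\<delta> > 0" "\<delta> * Q \<le> \<epsilon> / 3"
  proof -
    show "\<delta> > 0" using e Q by (simp add: \<delta>_def)
    have "\<delta> * Q \<le> \<delta> * (Q + 1)" using \<open>\<delta> > 0\<close> by simp
    also have "\<dots> = \<epsilon> / 3" using Q by (simp add: \<delta>_def field_simps)
    finally show "\<delta> * Q \<le> \<epsilon> / 3" .
  qed
  \<comment> \<open>Collects all factors of \<eta> in the final estimate. It depends on \<delta>, so
    \<eta> has to be chosen after \<delta>.\<close>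
  define C where "C = (1 + \<delta>) * 2 + ?l * (D_const ?N 3 * ((1 + 1 / \<delta>) * 4))"
  have C: "C > 0" unfolding C_def using \<delta>(1) b D_facts[OF N] by (intro add_pos_nonneg mult_pos_pos mult_nonneg_nonneg) auto
  define \<eta> where "\<eta> = \<epsilon> / (3 * C)"
  have \<eta>: "\<eta> > 0" "C * \<eta> = \<epsilon> / 3" using e C by (auto simp: \<eta>_def)
  have fs: "schwartz f" unfolding f_def by (rule schwartz_polynomial[OF p gauss_schwartz[OF b]])
  obtain \<alpha> \<tau> h1 h2 v1 v2 where h: "solid_harmonic 1 h1" "solid_harmonic 2 h2" and v: "schwartz v1" "schwartz v2"
    and n: "n2 (\<lambda>x. rgrad v1 x - rgrad (\<lambda>x. Theta1 \<beta> x * h1 x) x) \<le> \<eta>" "n2 (\<lambda>x. rgrad v2 x - rgrad (\<lambda>x. Theta2 \<beta> x * h2 x) x) \<le> \<eta>"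
    and ineq: "?l * wsum ?N
      (gsq (\<lambda>x. f x - \<alpha> * gauss \<beta> x))
      (gsq (\<lambda>x. f x - (\<alpha> * gauss \<beta> x + v1 x)))
      (gsq (\<lambda>x. f x - (\<alpha> * gauss \<beta> x + v1 x + v2 x)))
      (gsq (\<lambda>x. f x - (\<alpha> * gauss \<beta> x + v1 x + v2 x + \<tau> * L_fun \<beta> x)))
     \<le> qform ?l f f + 2 * \<eta>"
    using core_approximate[OF N b p \<eta>(1)] unfolding f_def by blast
  define W where "W j x = \<alpha> * gauss \<beta> x + (if j \<ge> 1 then v1 x else 0) + (if j \<ge> 2 then v2 x else 0) + (if j \<ge> 3 then \<tau> * L_fun \<beta> x else 0)" for j :: nat and x
  note sg = schwartz_cmult[OF gauss_schwartz[OF b], of \<alpha>] schwartz_cmult[OF L_fun_schwartz[OF b], of \<tau>]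
  have sc: "schwartz (\<lambda>x. if c then F x else 0)" if "schwartz F" for c and F :: "real^'n \<Rightarrow> real" using that by (cases c) (auto simp: schwartz_zero)
  have sW: "schwartz (W j)" for j unfolding W_def[abs_def] by (intro schwartz_add sc sg v)
  have z: "rgrad (\<lambda>x::real^'n. 0) y = 0" for y by (simp add: rgrad_def vec_eq_iff)
  have gc: "rgrad (\<lambda>x. if c then F x else 0) y = (if c then rgrad F y else 0)" for c and F :: "real^'n \<Rightarrow> real" and y by (cases c) (auto simp: z)
  have gW: "rgrad (W j) x = rgrad (\<lambda>x. \<alpha> * gauss \<beta> x) x + (if j \<ge> 1 then rgrad v1 x else 0) + (if j \<ge> 2 then rgrad v2 x else 0) + (if j \<ge> 3 then rgrad (\<lambda>x. \<tau> * L_fun \<beta> x) x else 0)" for j x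
    unfolding W_def[abs_def] by (simp only: rgrad_add schwartz_differentiable sc sg v schwartz_add gc)
  have r: "n2 (\<lambda>x. rgrad f x - rgrad (rw j \<beta> \<alpha> \<tau> h1 h2) x) \<le> (1 + \<delta>) * gsq (\<lambda>x. f x - W j x) + (1 + 1 / \<delta>) * (4 * \<eta>)" for j
  proof -
    let ?E = "\<lambda>x. rgrad (W j) x - rgrad (rw j \<beta> \<alpha> \<tau> h1 h2) x"
    have E: "?E = (\<lambda>x. (if j \<ge> 1 then rgrad v1 x - rgrad (\<lambda>x. Theta1 \<beta> x * h1 x) x else 0) + (if j \<ge> 2 then rgrad v2 x - rgrad (\<lambda>x. Theta2 \<beta> x * h2 x) x else 0))"
      unfolding gW rw_rgrad(2)[OF N b h] by (rule ext) auto
    have q1: "sqi (\<lambda>x. rgrad v1 x - rgrad (\<lambda>x. Theta1 \<beta> x * h1 x) x)" "sqi (\<lambda>x. rgrad v2 x - rgrad (\<lambda>x. Theta2 \<beta> x * h2 x) x)"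
      by (intro sqi_diff Theta_regular(1)[OF N b h(1), THEN conjunct2] Theta_regular(2)[OF N b h(2), THEN conjunct2]
          schwartz_sqi_rgrad(1)[OF v(1)] schwartz_sqi_rgrad(1)[OF v(2)])+
    have si: "sqi (\<lambda>x. if c then F x else 0)" "n2 F \<le> \<eta> \<Longrightarrow> n2 (\<lambda>x. if c then F x else 0) \<le> \<eta>" if "sqi F" for c and F :: "real^'n \<Rightarrow> real^'n"
      using that \<eta>(1) by (cases c, auto simp: sqi_def n2_def)+
    have "n2 ?E \<le> (1 + 1) * n2 (\<lambda>x. if j \<ge> 1 then rgrad v1 x - rgrad (\<lambda>x. Theta1 \<beta> x * h1 x) x else 0)
        + (1 + 1 / 1) * n2 (\<lambda>x. if j \<ge> 2 then rgrad v2 x - rgrad (\<lambda>x. Theta2 \<beta> x * h2 x) x else 0)"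
      unfolding E by (intro n2_add_le si(1) q1) simp
    also have "\<dots> \<le> (1 + 1) * \<eta> + (1 + 1 / 1) * \<eta>"
      by (intro add_mono mult_left_mono si(2) q1 n) auto
    finally have "n2 ?E \<le> (1 + 1) * \<eta> + (1 + 1 / 1) * \<eta>" .
    then have nE: "n2 ?E \<le> 4 * \<eta>" by simp
    have "n2 (\<lambda>x. rgrad f x - rgrad (rw j \<beta> \<alpha> \<tau> h1 h2) x) = n2 (\<lambda>x. rgrad (\<lambda>x. f x - W j x) x + ?E x)"
    proof -
      have "rgrad (\<lambda>x. f x + (- 1) * W j x) x = rgrad f x + (- 1) *\<^sub>R rgrad (W j) x" for x
        by (simp only: rgrad_add rgrad_cmult schwartz_differentiable fs sW schwartz_cmult)
      then show ?thesis by simp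
    qed
    also have "\<dots> \<le> (1 + \<delta>) * n2 (rgrad (\<lambda>x. f x - W j x)) + (1 + 1 / \<delta>) * n2 ?E"
      by (intro n2_add_le \<delta> sqi_diff schwartz_sqi_rgrad(1) schwartz_diff fs sW rw_rgrad(3)[OF N b h])
    also have "\<dots> \<le> (1 + \<delta>) * gsq (\<lambda>x. f x - W j x) + (1 + 1 / \<delta>) * (4 * \<eta>)"
      unfolding schwartz_sqi_rgrad(2)[OF schwartz_diff[OF fs sW]] using nE \<delta>(1) by (intro add_mono mult_left_mono) auto
    finally show ?thesis .
  qed
  let ?g = "\<lambda>j. gsq (\<lambda>x. f x - W j x)"
  have "rrem \<beta> \<alpha> \<tau> h1 h2 (rgrad f) \<le> (1 + \<delta>) * wsum ?N (?g 0) (?g 1) (?g 2) (?g 3) + D_const ?N 3 * ((1 + 1 / \<delta>) * (4 * \<eta>))"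
    unfolding rrem_def Let_def wsum_affine[symmetric] by (intro wsum_mono[OF N] r)
  then have "?l * rrem \<beta> \<alpha> \<tau> h1 h2 (rgrad f) \<le> ?l * ((1 + \<delta>) * wsum ?N (?g 0) (?g 1) (?g 2) (?g 3) + D_const ?N 3 * ((1 + 1 / \<delta>) * (4 * \<eta>)))"
    using b by (intro mult_left_mono) auto
  also have "\<dots> = (1 + \<delta>) * (?l * wsum ?N (?g 0) (?g 1) (?g 2) (?g 3)) + ?l * (D_const ?N 3 * ((1 + 1 / \<delta>) * 4)) * \<eta>"
    by (simp add: algebra_simps)
  also have "\<dots> \<le> (1 + \<delta>) * (qform ?l f f + 2 * \<eta>) + ?l * (D_const ?N 3 * ((1 + 1 / \<delta>) * 4)) * \<eta>"
    using ineq \<delta>(1) by (intro add_right_mono mult_left_mono) (auto simp: W_def[abs_def] add_ac)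
  also have "\<dots> = qform ?l f f + \<delta> * qform ?l f f + C * \<eta>" unfolding C_def by (simp add: algebra_simps)
  also have "\<dots> \<le> qform ?l f f + \<delta> * Q + C * \<eta>"
    using \<delta>(1) by (intro add_right_mono add_left_mono mult_left_mono) (auto simp: Q_def)
  also have "\<dots> \<le> qform ?l f f + \<epsilon>" using \<delta>(2) \<eta>(2) e by simp
  finally show ?thesis using h by blast
qed

section \<open>Density of polynomials times a Gaussian\<close>

definition gapprox :: "real \<Rightarrow> (real^'n::finite \<Rightarrow> real) \<Rightarrow> bool" where
  "gapprox \<beta> f \<longleftrightarrow> sqi f \<and> (\<forall>\<epsilon>>0. \<exists>p. real_polynomial_function p \<and> n2 (\<lambda>x. f x - p x * gauss \<beta> x) \<le> \<epsilon>)"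

lemma sqi_schwartz: "schwartz f \<Longrightarrow> sqi f"
  using ip_integrable[of f f] by (auto simp: sqi_def power2_eq_square dest: schwartz_measurable)

lemma n2_schwartz: "n2 (f :: real^'n::finite \<Rightarrow> real) = ip f f"
  by (simp add: n2_def ip_def power2_eq_square)

lemma gapprox_limit:
  assumes "sqi f" and "\<And>\<epsilon>. \<epsilon> > 0 \<Longrightarrow> \<exists>g. gapprox \<beta> g \<and> n2 (\<lambda>x. f x - g x) \<le> \<epsilon>" and b: "\<beta> > 0"
  shows "gapprox \<beta> f"
  unfolding gapprox_def
proof (intro conjI allI impI assms(1))
  fix \<epsilon> :: real assume "\<epsilon> > 0"
  then obtain g where g: "gapprox \<beta> g" "n2 (\<lambda>x. f x - g x) \<le> \<epsilon> / 4" using assms(2)[of "\<epsilon> / 4"] by auto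
  then obtain p where p: "real_polynomial_function p" "n2 (\<lambda>x. g x - p x * gauss \<beta> x) \<le> \<epsilon> / 4"
    unfolding gapprox_def using \<open>\<epsilon> > 0\<close> by (metis divide_pos_pos zero_less_numeral)
  have s: "sqi (\<lambda>x. f x - g x)" "sqi (\<lambda>x. g x - p x * gauss \<beta> x)"
    using g(1) assms(1) sqi_schwartz[OF schwartz_polynomial[OF p(1) gauss_schwartz[OF b]]] by (auto simp: gapprox_def intro!: sqi_diff)
  have "n2 (\<lambda>x. f x - p x * gauss \<beta> x) = n2 (\<lambda>x. (f x - g x) + (g x - p x * gauss \<beta> x))" by simp
  also have "\<dots> \<le> (1 + 1) * n2 (\<lambda>x. f x - g x) + (1 + 1 / 1) * n2 (\<lambda>x. g x - p x * gauss \<beta> x)"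
    by (intro n2_add_le s) simp
  also have "\<dots> \<le> \<epsilon>" using g(2) p(2) by simp
  finally show "\<exists>p. real_polynomial_function p \<and> n2 (\<lambda>x. f x - p x * gauss \<beta> x) \<le> \<epsilon>" using p(1) by blast
qed

lemma gapprox_add:
  assumes f: "gapprox \<beta> f" and g: "gapprox \<beta> g" and b: "\<beta> > 0" shows "gapprox \<beta> (\<lambda>x. f x + g x)"
  unfolding gapprox_def
proof (intro conjI allI impI)
  show "sqi (\<lambda>x. f x + g x)" using f g by (auto simp: gapprox_def intro: sqi_add)
  fix \<epsilon> :: real assume e: "\<epsilon> > 0"
  obtain p where p: "real_polynomial_function p" "n2 (\<lambda>x. f x - p x * gauss \<beta> x) \<le> \<epsilon> / 4"
    using f e unfolding gapprox_def by (metis divide_pos_pos zero_less_numeral)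
  obtain q where q: "real_polynomial_function q" "n2 (\<lambda>x. g x - q x * gauss \<beta> x) \<le> \<epsilon> / 4"
    using g e unfolding gapprox_def by (metis divide_pos_pos zero_less_numeral)
  have s: "sqi (\<lambda>x. f x - p x * gauss \<beta> x)" "sqi (\<lambda>x. g x - q x * gauss \<beta> x)"
    using f g sqi_schwartz[OF schwartz_polynomial[OF p(1) gauss_schwartz[OF b]]] sqi_schwartz[OF schwartz_polynomial[OF q(1) gauss_schwartz[OF b]]]
    by (auto simp: gapprox_def intro!: sqi_diff)
  have "n2 (\<lambda>x. f x + g x - (p x + q x) * gauss \<beta> x) = n2 (\<lambda>x. (f x - p x * gauss \<beta> x) + (g x - q x * gauss \<beta> x))"
    by (simp add: algebra_simps)
  also have "\<dots> \<le> (1 + 1) * n2 (\<lambda>x. f x - p x * gauss \<beta> x) + (1 + 1 / 1) * n2 (\<lambda>x. g x - q x * gauss \<beta> x)"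
    by (intro n2_add_le s) simp
  also have "\<dots> \<le> \<epsilon>" using p(2) q(2) by simp
  finally show "\<exists>p. real_polynomial_function p \<and> n2 (\<lambda>x. f x + g x - p x * gauss \<beta> x) \<le> \<epsilon>"
    using real_polynomial_function.intros(3)[OF p(1) q(1)] by blast
qed

lemma gauss_add: "gauss a x * gauss b x = gauss (a + b) x"
  by (simp add: gauss_def exp_add[symmetric] algebra_simps)

text \<open>In the step from \<open>m\<close> to \<open>m + 1\<close> the additional factor \<open>gauss (\<beta>/2)\<close> is replaced by its Taylor polynomials,
  which are dominated by the inverse of that factor, hence by the Gaussian in front.\<close>

lemma gapprox_narrow:
  fixes q :: "real^'n::finite \<Rightarrow> real"
  assumes b: "\<beta> > 0" and q: "real_polynomial_function q"
  shows "gapprox \<beta> (\<lambda>x. q x * gauss (\<beta> + real m * (\<beta> / 2)) x)"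
  using q
proof (induction m arbitrary: q)
  case 0
  have "sqi (\<lambda>x. q x * gauss \<beta> x)" by (intro sqi_schwartz schwartz_polynomial gauss_schwartz 0 b)
  moreover have "n2 (\<lambda>x. q x * gauss \<beta> x - q x * gauss \<beta> x) = 0" by (simp add: n2_def)
  ultimately show ?case using 0 unfolding gapprox_def by (auto intro!: exI[of _ q])
next
  case (Suc m)
  let ?g = "\<beta> + real m * (\<beta> / 2)"
  define T where "T n t = (\<Sum>i<n. (- t) ^ i / fact i)" for n and t :: real
  have g0: "?g > 0" using b by (simp add: add_pos_nonneg)
  have Tlim: "(\<lambda>n. T n t) \<longlonglongrightarrow> exp (- t)" for t
    using summable_LIMSEQ[OF summable_exp_generic[of "- t"]] unfolding T_def exp_def by (simp add: divide_inverse mult.commute)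
  have Tb: "\<bar>T n t\<bar> \<le> exp t" if "t \<ge> 0" for n t
  proof -
    have "\<bar>T n t\<bar> \<le> (\<Sum>i<n. \<bar>(- t) ^ i / fact i\<bar>)" unfolding T_def by (rule sum_abs)
    also have "\<dots> = (\<Sum>i<n. t ^ i /\<^sub>R fact i)" using that by (intro sum.cong) (auto simp: abs_mult power_abs divide_inverse)
    also have "\<dots> \<le> exp t" unfolding exp_def using that by (intro sum_le_suminf summable_exp_generic) auto
    finally show ?thesis .
  qed
  let ?s = "\<lambda>x::real^'n. \<beta> / 2 * (norm x)\<^sup>2"
  define f where "f x = q x * gauss (\<beta> + real (Suc m) * (\<beta> / 2)) x" for x
  have f: "f x = q x * gauss ?g x * exp (- ?s x)" for x
    unfolding f_def by (simp add: gauss_def exp_add[symmetric] algebra_simps)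
  define fn where "fn n x = (q x * T n (?s x)) * gauss ?g x" for n x
  have poly: "real_polynomial_function (\<lambda>x. q x * T n (?s x))" for n
  proof -
    have s: "real_polynomial_function (\<lambda>x::real^'n. - ?s x)"
      by (intro real_polynomial_function_minus real_polynomial_function.intros(4) real_polynomial_function.intros(2) polynomial_norm_sq)
    show ?thesis unfolding T_def
      by (rule real_polynomial_function.intros(4)[OF Suc.prems])
        (intro real_polynomial_function_sum real_polynomial_function_divide real_polynomial_function_power s finite_lessThan)
  qed
  have gn: "gapprox \<beta> (fn n)" for n unfolding fn_def[abs_def] by (rule Suc.IH[OF poly])
  have sf: "sqi f"
    unfolding f_def[abs_def] using b by (intro sqi_schwartz schwartz_polynomial gauss_schwartz Suc.prems) (auto intro: add_pos_nonneg)
  have dom: "(f x - fn n x)\<^sup>2 \<le> 4 * (q x * gauss (\<beta> / 2) x)\<^sup>2" for n x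
  proof -
    have s: "?s x \<ge> 0" using b by simp
    have "\<bar>f x - fn n x\<bar> = \<bar>q x\<bar> * gauss ?g x * \<bar>exp (- ?s x) - T n (?s x)\<bar>"
    proof -
      have "f x - fn n x = q x * gauss ?g x * (exp (- ?s x) - T n (?s x))" unfolding f fn_def by (simp add: algebra_simps)
      moreover have "\<bar>gauss ?g x\<bar> = gauss ?g x" by (simp add: gauss_def)
      ultimately show ?thesis by (simp add: abs_mult)
    qed
    also have "\<dots> \<le> \<bar>q x\<bar> * gauss ?g x * (2 * exp (?s x))"
    proof (intro mult_left_mono)
      have "exp (- ?s x) \<le> exp (?s x)" using s by simp
      then show "\<bar>exp (- ?s x) - T n (?s x)\<bar> \<le> 2 * exp (?s x)" using Tb[OF s, of n] exp_gt_zero[of "- ?s x"] by linarith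
    qed (auto simp: gauss_def)
    also have "\<dots> = 2 * (\<bar>q x\<bar> * (gauss ?g x * exp (?s x)))" by simp
    also have "\<dots> \<le> 2 * (\<bar>q x\<bar> * gauss (\<beta> / 2) x)"
    proof (intro mult_left_mono)
      have "gauss ?g x * exp (?s x) = exp (- (\<beta> / 2 + real m * (\<beta> / 2)) * (norm x)\<^sup>2)"
        by (simp add: gauss_def exp_add[symmetric] algebra_simps)
      also have "\<dots> \<le> gauss (\<beta> / 2) x" unfolding gauss_def using b
        by (intro iffD2[OF exp_le_cancel_iff] mult_right_mono) auto
      finally show "gauss ?g x * exp (?s x) \<le> gauss (\<beta> / 2) x" .
    qed auto
    finally have "\<bar>f x - fn n x\<bar>\<^sup>2 \<le> (2 * (\<bar>q x\<bar> * gauss (\<beta> / 2) x))\<^sup>2" by (intro power_mono) auto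
    then show ?thesis by (simp add: power_mult_distrib)
  qed
  have qb: "schwartz (\<lambda>x. q x * gauss (\<beta> / 2) x)" using b by (intro schwartz_polynomial gauss_schwartz Suc.prems) auto
  have "(\<lambda>n. LINT x|lborel. (f x - fn n x)\<^sup>2) \<longlonglongrightarrow> integral\<^sup>L (lborel :: (real^'n) measure) (\<lambda>x. 0::real)"
  proof (rule integral_dominated_convergence[where w = "\<lambda>x. 4 * (q x * gauss (\<beta> / 2) x)\<^sup>2"])
    show "integrable lborel (\<lambda>x. 4 * (q x * gauss (\<beta> / 2) x)\<^sup>2)"
      using sqi_schwartz[OF qb] unfolding sqi_def by auto
    have "f \<in> borel_measurable lborel" "fn n \<in> borel_measurable lborel" for n using sf gn[of n] by (auto simp: sqi_def gapprox_def)
    then show "(\<lambda>x. (f x - fn n x)\<^sup>2) \<in> borel_measurable lborel" for n by measurable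
    show "AE x in lborel. (\<lambda>n. (f x - fn n x)\<^sup>2) \<longlonglongrightarrow> 0"
    proof (rule AE_I2)
      fix x
      have "(\<lambda>n. (f x - fn n x)\<^sup>2) \<longlonglongrightarrow> (f x - (q x * exp (- ?s x)) * gauss ?g x)\<^sup>2"
        unfolding fn_def by (intro tendsto_intros Tlim)
      then show "(\<lambda>n. (f x - fn n x)\<^sup>2) \<longlonglongrightarrow> 0" by (simp add: f mult_ac)
    qed
    show "AE x in lborel. norm ((f x - fn n x)\<^sup>2) \<le> 4 * (q x * gauss (\<beta> / 2) x)\<^sup>2" for n using dom by (intro AE_I2) simp
  qed simp
  then have lim: "(\<lambda>n. n2 (\<lambda>x. f x - fn n x)) \<longlonglongrightarrow> 0" by (simp add: n2_def)
  have "gapprox \<beta> f"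
  proof (rule gapprox_limit[OF sf _ b])
    fix \<epsilon> :: real assume "\<epsilon> > 0"
    then have "\<forall>\<^sub>F n in sequentially. n2 (\<lambda>x. f x - fn n x) < \<epsilon>" using lim by (intro order_tendstoD(2)) auto
    then obtain n where "n2 (\<lambda>x. f x - fn n x) < \<epsilon>" using eventually_happens'[OF sequentially_bot] by blast
    then show "\<exists>g. gapprox \<beta> g \<and> n2 (\<lambda>x. f x - g x) \<le> \<epsilon>" using gn by (intro exI[of _ "fn n"]) auto
  qed
  then show ?case by (simp add: f_def[abs_def])
qed

text \<open>A polynomial in the coordinates of the compactification is a sum of polynomials times
  powers of \<open>gauss (\<beta>/2)\<close>. Multiplied by \<open>gauss \<beta>\<close>, its terms
  are those treated by \<open>gapprox_narrow\<close>.\<close>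

lemma gapprox_polynomial_compactification:
  fixes P :: "real \<times> (real^'n::finite) \<Rightarrow> real"
  assumes b: "\<beta> > 0" and P: "real_polynomial_function P"
  shows "\<exists>M q. (\<forall>m. real_polynomial_function (q m)) \<and>
     (\<forall>x. P (gauss (\<beta> / 2) x, gauss (\<beta> / 2) x *\<^sub>R x) = (\<Sum>m\<le>M. q m x * gauss (real m * (\<beta> / 2)) x))"
  using P
proof (induction P rule: real_polynomial_function.induct)
  case (linear l)
  note bl = linear
  interpret bounded_linear l by (rule bl)
  let ?q = "\<lambda>m x. if m = 1 then l (1, 0) + l (0, x) else 0"
  have "bounded_linear (\<lambda>x. l (0, x))"
    by (rule bounded_linear_compose[OF bl]) (intro bounded_linear_Pair bounded_linear_zero bounded_linear_ident)
  then have "real_polynomial_function (?q m)" for m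
    by (cases "m = 1") (auto intro: real_polynomial_function.intros(1) real_polynomial_function.intros(2) real_polynomial_function.intros(3))
  moreover have "l (gauss (\<beta> / 2) x, gauss (\<beta> / 2) x *\<^sub>R x) = (\<Sum>m\<le>1. ?q m x * gauss (real m * (\<beta> / 2)) x)" for x
  proof -
    have "(gauss (\<beta> / 2) x, gauss (\<beta> / 2) x *\<^sub>R x) = gauss (\<beta> / 2) x *\<^sub>R ((1, 0) + (0, x))" by simp
    then have "l (gauss (\<beta> / 2) x, gauss (\<beta> / 2) x *\<^sub>R x) = gauss (\<beta> / 2) x * (l (1, 0) + l (0, x))"
      by (simp only: scaleR add real_scaleR_def)
    then show ?thesis by simp
  qed
  ultimately show ?case by (intro exI[of _ 1] exI[of _ ?q]) blast
next
  case (const c)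
  have "real_polynomial_function (\<lambda>x::real^'n. if m = 0 then c else 0)" for m :: nat by (rule real_polynomial_function.intros(2))
  then show ?case by (intro exI[of _ 0] exI[of _ "\<lambda>m x. if m = 0 then c else 0"]) (auto simp: gauss_def)
next
  case (add P Q)
  from add.IH(1) obtain M q where "\<And>m. real_polynomial_function (q m)" "\<And>x. P (gauss (\<beta> / 2) x, gauss (\<beta> / 2) x *\<^sub>R x) = (\<Sum>m\<le>M. q m x * gauss (real m * (\<beta> / 2)) x)"
    by blast
  moreover from add.IH(2) obtain M' q' where "\<And>m. real_polynomial_function (q' m)" "\<And>x. Q (gauss (\<beta> / 2) x, gauss (\<beta> / 2) x *\<^sub>R x) = (\<Sum>m\<le>M'. q' m x * gauss (real m * (\<beta> / 2)) x)"
    by blast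
  ultimately have *: "\<And>m. real_polynomial_function (q m)" "\<And>x. P (gauss (\<beta> / 2) x, gauss (\<beta> / 2) x *\<^sub>R x) = (\<Sum>m\<le>M. q m x * gauss (real m * (\<beta> / 2)) x)"
    "\<And>m. real_polynomial_function (q' m)" "\<And>x. Q (gauss (\<beta> / 2) x, gauss (\<beta> / 2) x *\<^sub>R x) = (\<Sum>m\<le>M'. q' m x * gauss (real m * (\<beta> / 2)) x)" by auto
  let ?r = "\<lambda>m x. (if m \<le> M then q m x else 0) + (if m \<le> M' then q' m x else 0)"
  have "real_polynomial_function (?r m)" for m using * by (cases "m \<le> M"; cases "m \<le> M'") (auto intro: real_polynomial_function.intros)
  moreover have "(\<Sum>m\<le>M. q m x * gauss (real m * (\<beta> / 2)) x) + (\<Sum>m\<le>M'. q' m x * gauss (real m * (\<beta> / 2)) x) = (\<Sum>m\<le>max M M'. ?r m x * gauss (real m * (\<beta> / 2)) x)" for x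
    unfolding sum.distrib distrib_right by (intro arg_cong2[of _ _ _ _ "(+)"] sum.mono_neutral_cong_left) auto
  ultimately show ?case unfolding *(2,4) by (intro exI[of _ "max M M'"] exI[of _ ?r] conjI allI)
next
  case (mult P Q)
  from mult.IH(1) obtain M q where "\<And>m. real_polynomial_function (q m)" "\<And>x. P (gauss (\<beta> / 2) x, gauss (\<beta> / 2) x *\<^sub>R x) = (\<Sum>m\<le>M. q m x * gauss (real m * (\<beta> / 2)) x)"
    by blast
  moreover from mult.IH(2) obtain M' q' where "\<And>m. real_polynomial_function (q' m)" "\<And>x. Q (gauss (\<beta> / 2) x, gauss (\<beta> / 2) x *\<^sub>R x) = (\<Sum>m\<le>M'. q' m x * gauss (real m * (\<beta> / 2)) x)"
    by blast
  ultimately have *: "\<And>m. real_polynomial_function (q m)" "\<And>x. P (gauss (\<beta> / 2) x, gauss (\<beta> / 2) x *\<^sub>R x) = (\<Sum>m\<le>M. q m x * gauss (real m * (\<beta> / 2)) x)"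
    "\<And>m. real_polynomial_function (q' m)" "\<And>x. Q (gauss (\<beta> / 2) x, gauss (\<beta> / 2) x *\<^sub>R x) = (\<Sum>m\<le>M'. q' m x * gauss (real m * (\<beta> / 2)) x)" by auto
  let ?I = "{..M} \<times> {..M'}"
  let ?r = "\<lambda>m x. \<Sum>z\<in>{z \<in> ?I. fst z + snd z = m}. q (fst z) x * q' (snd z) x"
  have "real_polynomial_function (?r m)" for m using *(1,3)
    by (intro real_polynomial_function_sum[of _ "\<lambda>x z. q (fst z) x * q' (snd z) x"]) (auto intro: real_polynomial_function.intros(4))
  moreover have "(\<Sum>m\<le>M. q m x * gauss (real m * (\<beta> / 2)) x) * (\<Sum>m\<le>M'. q' m x * gauss (real m * (\<beta> / 2)) x) = (\<Sum>m\<le>M + M'. ?r m x * gauss (real m * (\<beta> / 2)) x)" for x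
  proof -
    let ?t = "\<lambda>z. q (fst z) x * q' (snd z) x * gauss (real (fst z + snd z) * (\<beta> / 2)) x"
    have "(\<Sum>m\<le>M. q m x * gauss (real m * (\<beta> / 2)) x) * (\<Sum>m\<le>M'. q' m x * gauss (real m * (\<beta> / 2)) x) = (\<Sum>z\<in>?I. ?t z)"
      unfolding sum_product sum.cartesian_product
    proof (intro sum.cong refl)
      fix z :: "nat \<times> nat"
      have "gauss (real (fst z) * (\<beta> / 2)) x * gauss (real (snd z) * (\<beta> / 2)) x = gauss (real (fst z + snd z) * (\<beta> / 2)) x"
        unfolding gauss_add of_nat_add distrib_right ..
      then show "(case z of (i, j) \<Rightarrow> q i x * gauss (real i * (\<beta> / 2)) x * (q' j x * gauss (real j * (\<beta> / 2)) x)) = ?t z"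
        by (auto simp: case_prod_beta mult_ac)
    qed
    also have "\<dots> = (\<Sum>m\<le>M + M'. \<Sum>z\<in>{z \<in> ?I. fst z + snd z = m}. ?t z)"
      by (rule sum.group[symmetric, where g = "\<lambda>z. fst z + snd z"]) auto
    also have "\<dots> = (\<Sum>m\<le>M + M'. ?r m x * gauss (real m * (\<beta> / 2)) x)"
      unfolding sum_distrib_right by (intro sum.cong refl) auto
    finally show ?thesis .
  qed
  ultimately show ?case unfolding *(2,4) by (intro exI[of _ "M + M'"] exI[of _ ?r] conjI allI)
qed

lemma decays_bounded_support:
  fixes \<phi> :: "real^'n::finite \<Rightarrow> real"
  assumes c: "continuous_on UNIV \<phi>" and supp: "\<And>x. norm x > R \<Longrightarrow> \<phi> x = 0"
  shows "decays \<phi>"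
  unfolding decays_def
proof
  fix k
  have "compact ((\<lambda>x. (1 + norm x) ^ k * \<bar>\<phi> x\<bar>) ` cball 0 R)"
    by (intro compact_continuous_image continuous_intros continuous_on_subset[OF c]) auto
  then have "bounded ((\<lambda>x. (1 + norm x) ^ k * \<bar>\<phi> x\<bar>) ` cball 0 R)" by (rule compact_imp_bounded)
  then obtain B where "\<forall>y\<in>(\<lambda>x. (1 + norm x) ^ k * \<bar>\<phi> x\<bar>) ` cball 0 R. \<bar>y\<bar> \<le> B" unfolding bounded_real ..
  then have B: "(1 + norm x) ^ k * \<bar>\<phi> x\<bar> \<le> B" if "norm x \<le> R" for x using that by (force simp: abs_le_iff)
  have "(1 + norm x) ^ k * \<bar>\<phi> x\<bar> \<le> max 0 B" for x using B[of x] supp[of x] by (cases "norm x \<le> R") auto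
  then show "\<exists>C. \<forall>x. (1 + norm x) ^ k * \<bar>\<phi> x\<bar> \<le> C" by blast
qed

text \<open>Stone--Weierstrass on a compactification: \<open>x \<mapsto> (g x, g x x)\<close> with \<open>g = gauss (\<beta>/2)\<close> has bounded
  range, and a compactly supported function of \<open>x\<close> extends continuously from the image.\<close>

lemma gapprox_compact_support:
  fixes \<phi> :: "real^'n::finite \<Rightarrow> real"
  assumes b: "\<beta> > 0" and c: "continuous_on UNIV \<phi>" and supp: "\<And>x. norm x \<ge> R \<Longrightarrow> \<phi> x = 0" and R: "R > 0"
  shows "gapprox \<beta> \<phi>"
proof -
  define \<iota> where "\<iota> x = (gauss (\<beta> / 2) x, gauss (\<beta> / 2) x *\<^sub>R x)" for x :: "real^'n"
  \<comment> \<open>After division by the Gaussian, a uniform approximation of \<open>g\<close> with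
    error \<delta> becomes an L2 approximation of \<open>\<phi>\<close> with error \<delta> times
    the norm of the Gaussian.\<close>
  define g where "g x = \<phi> x * exp (\<beta> * (norm x)\<^sup>2)" for x
  define d where "d = exp (- (\<beta> / 2) * (R + 1)\<^sup>2)"
  define d2 where "d2 = exp (- (\<beta> / 2) * R\<^sup>2)"
  have d: "0 < d" "d < d2" using b R by (auto simp: d_def d2_def power_strict_mono)
  \<comment> \<open>On the image of the embedding the quotient of the two components recovers
    \<open>x\<close>. The maximum with \<open>d\<close> avoids division by 0, and the last factor,
    equal to 1 for norm at most R and to 0 below the level \<open>d\<close>, makes the extension
    vanish where the quotient is no longer \<open>x\<close>.\<close>
  define F where "F y = g ((1 / max (fst y) d) *\<^sub>R snd y) * min 1 (max 0 ((fst y - d) / (d2 - d)))" for y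
  have gc: "continuous_on UNIV g" unfolding g_def by (intro continuous_intros c)
  have Fc: "continuous_on S F" for S
  proof -
    have "max (fst y) d \<noteq> 0" for y :: "real \<times> (real^'n)" using d(1) by (simp add: max_def)
    then show ?thesis unfolding F_def using d
      by (intro continuous_intros continuous_on_compose2[OF gc]) auto
  qed
  have F: "F (\<iota> x) = g x" for x
  proof -
    let ?y = "gauss (\<beta> / 2) x"
    have y: "?y > 0" by (simp add: gauss_def)
    show ?thesis
    proof (cases "norm x \<le> R")
      case True
      then have "?y \<ge> d2" using b by (simp add: gauss_def d2_def power_mono)
      then have "max ?y d = ?y" "(?y - d) / (d2 - d) \<ge> 1" using d by (auto simp: le_divide_eq)
      then show ?thesis using y by (simp add: F_def \<iota>_def)
    next
      case False
      then have "g x = 0" using supp by (simp add: g_def)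
      moreover have "F (\<iota> x) = 0"
      proof (cases "?y \<ge> d")
        case True
        then have "(1 / max ?y d) *\<^sub>R (?y *\<^sub>R x) = x" using y by (simp add: max_def)
        then show ?thesis using \<open>g x = 0\<close> by (simp add: F_def \<iota>_def)
      next
        case False
        then have "(?y - d) / (d2 - d) \<le> 0" using d by (simp add: divide_nonpos_pos)
        then show ?thesis by (simp add: F_def \<iota>_def)
      qed
      ultimately show ?thesis by simp
    qed
  qed
  have b2: "\<beta> / 2 > 0" using b by simp
  obtain C where C: "C \<ge> 0" "\<And>x::real^'n. (1 + norm x) ^ 1 * \<bar>gauss (\<beta> / 2) x\<bar> \<le> C"
    using decaysE[OF gauss_decays[OF b2]] by metis
  let ?S = "cball (0::real) 1 \<times> cball (0::real^'n) C"
  have \<iota>S: "\<iota> x \<in> ?S" for x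
  proof -
    have "gauss (\<beta> / 2) x \<le> 1" using b by (simp add: gauss_def)
    moreover have "gauss (\<beta> / 2) x * norm x \<le> C" using C(2)[of x] by (simp add: gauss_def algebra_simps) (smt (verit) exp_gt_zero)
    ultimately show ?thesis by (simp add: \<iota>_def gauss_def)
  qed
  have gsq: "sqi (gauss \<beta> :: real^'n \<Rightarrow> real)" by (rule sqi_schwartz[OF gauss_schwartz[OF b]])
  define G where "G = n2 (gauss \<beta> :: real^'n \<Rightarrow> real)"
  have G: "G \<ge> 0" unfolding G_def by (rule n2_nonneg)
  have "decays \<phi>" by (rule decays_bounded_support[OF c, of R]) (use supp in auto)
  then have "decays (\<lambda>x. \<phi> x * \<phi> x)" using decays_mult by blast
  moreover have m: "\<phi> \<in> borel_measurable borel" by (rule borel_measurable_continuous_onI[OF c])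
  moreover have "(\<lambda>x. \<phi> x * \<phi> x) \<in> borel_measurable borel" using m by measurable
  ultimately have sphi: "sqi \<phi>" unfolding sqi_def
    by (auto simp: power2_eq_square intro!: decays_integrable)
  show ?thesis
  proof (rule gapprox_limit[OF sphi _ b])
    fix \<epsilon> :: real assume e: "\<epsilon> > 0"
    define \<delta> where "\<delta> = sqrt (\<epsilon> / (G + 1))"
    have \<delta>: "\<delta> > 0" "\<delta>\<^sup>2 * G \<le> \<epsilon>"
    proof -
      show "\<delta> > 0" using e G by (simp add: \<delta>_def)
      have "\<delta>\<^sup>2 * G \<le> \<delta>\<^sup>2 * (G + 1)" by (intro mult_left_mono) auto
      then show "\<delta>\<^sup>2 * G \<le> \<epsilon>" using e G by (simp add: \<delta>_def)
    qed
    have "compact ?S" by (intro compact_Times compact_cball)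
    then obtain P where P: "real_polynomial_function P" "\<And>y. y \<in> ?S \<Longrightarrow> \<bar>F y - P y\<bar> < \<delta>"
      using Stone_Weierstrass_real_polynomial_function[OF _ Fc \<delta>(1)] by metis
    obtain M q where q: "\<And>m. real_polynomial_function (q m)" "\<And>x. P (\<iota> x) = (\<Sum>m\<le>M. q m x * gauss (real m * (\<beta> / 2)) x)"
      using gapprox_polynomial_compactification[OF b P(1)] unfolding \<iota>_def by blast
    define \<psi> where "\<psi> x = P (\<iota> x) * gauss \<beta> x" for x
    have \<psi>: "\<psi> = (\<lambda>x. \<Sum>m\<le>M. q m x * gauss (\<beta> + real m * (\<beta> / 2)) x)"
      unfolding \<psi>_def q(2) sum_distrib_right mult.assoc gauss_add by (simp add: add.commute)
    have "gapprox \<beta> (\<lambda>x. \<Sum>m\<le>M. q m x * gauss (\<beta> + real m * (\<beta> / 2)) x)" for M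
    proof (induction M)
      case 0
      show ?case using gapprox_narrow[OF b q(1), of 0 0] by simp
    next
      case (Suc M)
      show ?case unfolding sum.atMost_Suc by (rule gapprox_add[OF Suc.IH gapprox_narrow[OF b q(1)] b])
    qed
    then have g\<psi>: "gapprox \<beta> \<psi>" unfolding \<psi> .
    have diff: "\<phi> x - \<psi> x = (g x - P (\<iota> x)) * gauss \<beta> x" for x
      by (simp add: \<psi>_def g_def gauss_def left_diff_distrib exp_minus field_simps)
    have "n2 (\<lambda>x. \<phi> x - \<psi> x) \<le> (LINT x|lborel. \<delta>\<^sup>2 * (norm (gauss \<beta> (x::real^'n)))\<^sup>2)"
      unfolding n2_def
    proof (rule integral_mono)
      show "integrable lborel (\<lambda>x. (norm (\<phi> x - \<psi> x))\<^sup>2)" using sqi_diff[OF sphi, of \<psi>] g\<psi> by (auto simp: gapprox_def sqi_def)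
      show "integrable lborel (\<lambda>x::real^'n. \<delta>\<^sup>2 * (norm (gauss \<beta> x))\<^sup>2)" using gsq by (auto simp: sqi_def)
      fix x
      have "\<bar>g x - P (\<iota> x)\<bar> \<le> \<delta>" using P(2)[OF \<iota>S[of x]] F[of x] by simp
      then have "\<bar>g x - P (\<iota> x)\<bar>\<^sup>2 \<le> \<delta>\<^sup>2" by (intro power_mono) auto
      then show "(norm (\<phi> x - \<psi> x))\<^sup>2 \<le> \<delta>\<^sup>2 * (norm (gauss \<beta> x))\<^sup>2"
        unfolding diff by (simp add: power_mult_distrib mult_right_mono)
    qed
    also have "\<dots> = \<delta>\<^sup>2 * G" by (simp add: G_def n2_def)
    finally show "\<exists>g. gapprox \<beta> g \<and> n2 (\<lambda>x. \<phi> x - g x) \<le> \<epsilon>" using g\<psi> \<delta>(2) by (intro exI[of _ \<psi>]) auto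
  qed
qed

section \<open>Density in the energy norm\<close>

text \<open>The harmonic oscillator with ground state \<open>gauss \<beta>\<close>. It maps
  polynomials times this Gaussian onto themselves and controls the energy, so density in L2
  transfers to density in the energy norm.\<close>

definition osc :: "real \<Rightarrow> (real^'n::finite \<Rightarrow> real) \<Rightarrow> real^'n \<Rightarrow> real" where
  "osc \<beta> f x = 4 * \<beta>\<^sup>2 * sq f x - laplacian f x"

lemma schwartz_osc: "schwartz f \<Longrightarrow> schwartz (osc \<beta> f)"
  unfolding osc_def[abs_def] by (intro schwartz_intros)

lemma osc_add: "schwartz f \<Longrightarrow> schwartz g \<Longrightarrow> osc \<beta> (\<lambda>x. f x + g x) = (\<lambda>x. osc \<beta> f x + osc \<beta> g x)"
  by (auto simp: osc_def op_linear algebra_simps)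
lemma osc_cmult: "schwartz f \<Longrightarrow> osc \<beta> (\<lambda>x. c * f x) = (\<lambda>x. c * osc \<beta> f x)"
  by (auto simp: osc_def op_linear algebra_simps)
lemma osc_diff: "schwartz f \<Longrightarrow> schwartz g \<Longrightarrow> osc \<beta> (\<lambda>x. f x - g x) = (\<lambda>x. osc \<beta> f x - osc \<beta> g x)"
  by (auto simp: osc_def op_linear algebra_simps)

text \<open>On a homogeneous polynomial of degree \<open>d\<close> times the Gaussian the oscillator
  acts as a positive multiple \<open>c\<close> minus the Laplacian of the polynomial; the latter has
  degree d - 2, or is 0, and is corrected by induction.\<close>

lemma osc_surj_hom:
  fixes q :: "real^'n::finite \<Rightarrow> real"
  assumes b: "\<beta> > 0"
  shows "hom d q \<Longrightarrow> \<exists>p. real_polynomial_function p \<and> osc \<beta> (\<lambda>x. p x * gauss \<beta> x) = (\<lambda>x. q x * gauss \<beta> x)"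
proof (induction d arbitrary: q rule: less_induct)
  case (less d)
  define c where "c = 2 * \<beta> * (2 * real d + real CARD('n))"
  have c: "c > 0" unfolding c_def using b by (simp add: add_nonneg_pos)
  note qp = hom_poly[OF less.prems]
  have sg: "schwartz (\<lambda>x. p x * gauss \<beta> x)" if "real_polynomial_function p" for p :: "real^'n \<Rightarrow> real"
    by (rule schwartz_polynomial[OF that gauss_schwartz[OF b]])
  have H: "osc \<beta> (\<lambda>x. q x * gauss \<beta> x) = (\<lambda>x. c * (q x * gauss \<beta> x) - laplacian q x * gauss \<beta> x)"
  proof -
    have "(\<lambda>x. q x * gauss \<beta> x) = fj \<beta> q 0" by (auto simp: fj_def)
    then show ?thesis unfolding osc_def[abs_def] laplacian_poly_gauss[OF less.prems, of \<beta>, folded \<open>(\<lambda>x. q x * gauss \<beta> x) = fj \<beta> q 0\<close>]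
      by (auto simp: fun_eq_iff laplacian_poly_gauss[OF less.prems] sq_def fj_def c_def algebra_simps)
  qed
  have "\<exists>r. real_polynomial_function r \<and> osc \<beta> (\<lambda>x. r x * gauss \<beta> x) = (\<lambda>x. laplacian q x * gauss \<beta> x)"
  proof (cases "d < 2")
    case True
    then show ?thesis using laplacian_hom_low[OF less.prems]
      by (intro exI[of _ "\<lambda>x. 0"]) (auto simp: osc_def real_polynomial_function.intros(2) fun_eq_iff)
  next
    case False
    then obtain e where d: "d = Suc (Suc e)" by (metis One_nat_def Suc_1 less_2_cases_iff not0_implies_Suc)
    show ?thesis using less.IH[of e "laplacian q"] hom_laplacian[of e q] less.prems d by simp
  qed
  then obtain r where r: "real_polynomial_function r" "osc \<beta> (\<lambda>x. r x * gauss \<beta> x) = (\<lambda>x. laplacian q x * gauss \<beta> x)" by blast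
  have "osc \<beta> (\<lambda>x. 1 / c * (q x * gauss \<beta> x + r x * gauss \<beta> x)) = (\<lambda>x. q x * gauss \<beta> x)"
    unfolding osc_cmult[OF schwartz_add[OF sg[OF qp] sg[OF r(1)]]] osc_add[OF sg[OF qp] sg[OF r(1)]] H r(2) using c by auto
  moreover have "(\<lambda>x. 1 / c * (q x * gauss \<beta> x + r x * gauss \<beta> x)) = (\<lambda>x. (1 / c * (q x + r x)) * gauss \<beta> x)" by (simp add: algebra_simps)
  moreover have "real_polynomial_function (\<lambda>x. 1 / c * (q x + r x))" by (intro real_polynomial_function.intros(4) real_polynomial_function.intros(2) real_polynomial_function.intros(3) qp r(1))
  ultimately show ?case by metis
qed

lemma osc_surj:
  fixes q :: "real^'n::finite \<Rightarrow> real"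
  assumes b: "\<beta> > 0" and q: "real_polynomial_function q"
  shows "\<exists>p. real_polynomial_function p \<and> osc \<beta> (\<lambda>x. p x * gauss \<beta> x) = (\<lambda>x. q x * gauss \<beta> x)"
proof -
  obtain n r where r: "\<And>d. hom d (r d)" "\<And>x. q x = (\<Sum>d\<le>n. r d x)" using polynomial_hom_sum[OF q] by blast
  have "\<exists>p. real_polynomial_function p \<and> osc \<beta> (\<lambda>x. p x * gauss \<beta> x) = (\<lambda>x. (\<Sum>d\<le>n. r d x) * gauss \<beta> x)" for n
  proof (induction n)
    case 0 then show ?case using osc_surj_hom[OF b r(1)] by simp
  next
    case (Suc n)
    then obtain p where p: "real_polynomial_function p" "osc \<beta> (\<lambda>x. p x * gauss \<beta> x) = (\<lambda>x. (\<Sum>d\<le>n. r d x) * gauss \<beta> x)" by blast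
    obtain p' where p': "real_polynomial_function p'" "osc \<beta> (\<lambda>x. p' x * gauss \<beta> x) = (\<lambda>x. r (Suc n) x * gauss \<beta> x)"
      using osc_surj_hom[OF b r(1)] by blast
    have "osc \<beta> (\<lambda>x. (p x + p' x) * gauss \<beta> x) = (\<lambda>x. (\<Sum>d\<le>Suc n. r d x) * gauss \<beta> x)"
      unfolding distrib_right osc_add[OF schwartz_polynomial[OF p(1) gauss_schwartz[OF b]] schwartz_polynomial[OF p'(1) gauss_schwartz[OF b]]] p p'
      by (simp add: distrib_right)
    then show ?case using p p' by (blast intro: real_polynomial_function.intros(3))
  qed
  then show ?thesis using r(2) by simp
qed

definition energy :: "(real^'n::finite \<Rightarrow> real) \<Rightarrow> real" where
  "energy f = isq (laplacian f) + xip f f + gip f f"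

lemma xip_nonneg: "xip f f \<ge> 0"
  unfolding xip_def ip_def sq_def by (intro sum_nonneg integral_nonneg_AE AE_I2) (simp add: mult.assoc)

text \<open>Expansion of the squared norm of \<nabla>f + c x f. The cross term is
  \<open>2 * c * ip (eul f) f\<close>, hence a multiple of \<open>ip f f\<close>.\<close>

lemma uncertainty_square:
  fixes f :: "real^'n::finite \<Rightarrow> real"
  assumes f: "schwartz f"
  shows "c * real CARD('n) * ip f f \<le> gip f f + c\<^sup>2 * ip (sq f) f"
proof -
  have "0 \<le> (\<Sum>i\<in>UNIV. isq (\<lambda>x. partial i f x + c * (x $ i * f x)))"
    by (intro sum_nonneg ip_nonneg)
  also have "\<dots> = (\<Sum>i\<in>UNIV. isq (partial i f) + 2 * c * ip (\<lambda>x. x $ i * partial i f x) f + c\<^sup>2 * ip (\<lambda>x. x $ i * (x $ i * f x)) f)"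
  proof (intro sum.cong refl)
    fix i
    have s: "schwartz (partial i f)" "schwartz (\<lambda>x. x $ i * f x)" using f by (auto intro: schwartz_partial schwartz_component)
    have m: "ip (partial i f) (\<lambda>x. x $ i * f x) = ip (\<lambda>x. x $ i * partial i f x) f" "isq (\<lambda>x. x $ i * f x) = ip (\<lambda>x. x $ i * (x $ i * f x)) f"
      by (simp_all add: ip_def mult_ac)
    show "isq (\<lambda>x. partial i f x + c * (x $ i * f x))
       = isq (partial i f) + 2 * c * ip (\<lambda>x. x $ i * partial i f x) f + c\<^sup>2 * ip (\<lambda>x. x $ i * (x $ i * f x)) f"
      unfolding m[symmetric] using s by (simp add: ip_linear schwartz_intros ip_commute[of "\<lambda>x. x $ i * f x" "partial i f"] power2_eq_square)
        (simp add: algebra_simps)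
  qed
  also have "\<dots> = gip f f + 2 * c * ip (eul f) f + c\<^sup>2 * ip (sq f) f"
  proof -
    have "ip (eul f) f = (\<Sum>i\<in>UNIV. ip (\<lambda>x. x $ i * partial i f x) f)"
      unfolding eul_def[abs_def] using f by (intro ip_sum_left schwartz_component schwartz_partial) auto
    moreover have "sq f = (\<lambda>x. \<Sum>i\<in>UNIV. x $ i * (x $ i * f x))"
      unfolding fun_eq_iff sq_def norm_sq_sum sum_distrib_right by (simp add: power2_eq_square mult.assoc)
    then have "ip (sq f) f = (\<Sum>i\<in>UNIV. ip (\<lambda>x. x $ i * (x $ i * f x)) f)"
      using f by (simp only:) (intro ip_sum_left schwartz_component, auto)
    ultimately show ?thesis by (simp add: gip_def sum.distrib sum_distrib_left)
  qed
  finally show ?thesis using arg_cong[OF ip_eul_self[OF f], of "\<lambda>z. c * z"] by (simp add: algebra_simps)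
qed

text \<open>Expanding \<open>isq (osc \<beta> f)\<close> yields the Laplacian and the weighted
  gradient with the right signs, up to a negative multiple of \<open>ip f f\<close>. This multiple
  is absorbed by the spectral bound: \<open>k\<close> is the square of the lowest eigenvalue
  2\<beta>N of the oscillator.\<close>

lemma energy_osc:
  assumes b: "\<beta> > 0"
  shows "\<exists>C\<ge>0. \<forall>f::real^'n::finite \<Rightarrow> real. schwartz f \<longrightarrow> energy f \<le> C * isq (osc \<beta> f)"
proof -
  let ?N = "real CARD('n)"
  define k where "k = (2 * \<beta> * ?N)\<^sup>2"
  define C where "C = (1 + 1 / (8 * \<beta>\<^sup>2)) * (1 + 8 * \<beta>\<^sup>2 * ?N / k) + (1 + 1 / k)"
  have N: "?N > 0" by simp
  have k: "k > 0" unfolding k_def using b by simp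
  have "energy f \<le> C * isq (osc \<beta> f)" if f: "schwartz f" for f :: "real^'n \<Rightarrow> real"
  proof -
    let ?H = "isq (osc \<beta> f)"
    note so = schwartz_osc[OF f, of \<beta>]
    have X: "ip (laplacian f) (sq f) = ?N * ip f f - xip f f"
      using xip_eq[OF f f] ip_eul_self[OF f] by (simp add: ip_sq)
    have H: "?H = isq (laplacian f) + 8 * \<beta>\<^sup>2 * (xip f f - ?N * ip f f) + 16 * \<beta> ^ 4 * isq (sq f)"
    proof -
      have "?H = isq (laplacian f) - 8 * \<beta>\<^sup>2 * ip (laplacian f) (sq f) + (4 * \<beta>\<^sup>2) * (4 * \<beta>\<^sup>2) * isq (sq f)"
        unfolding osc_def[abs_def] using f
        by (simp add: ip_linear schwartz_intros ip_commute[of "sq f" "laplacian f"])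
          (simp add: algebra_simps power2_eq_square power4_eq_xxxx)
      then show ?thesis unfolding X by (simp add: algebra_simps power2_eq_square power4_eq_xxxx)
    qed
    have Hf: "ip (osc \<beta> f) f = gip f f + 4 * \<beta>\<^sup>2 * ip (sq f) f"
      unfolding osc_def[abs_def] using f by (simp add: ip_linear schwartz_intros gip_eq)
    have lower: "2 * \<beta> * ?N * ip f f \<le> ip (osc \<beta> f) f"
      unfolding Hf using uncertainty_square[OF f, of "2 * \<beta>"] by (simp add: power_mult_distrib)
    have cs: "(ip (osc \<beta> f) f)\<^sup>2 \<le> ?H * ip f f" by (rule ip_cauchy_schwarz[OF so f])
    have f2: "k * ip f f \<le> ?H"
    proof (cases "ip f f = 0")
      case True then show ?thesis by (simp add: ip_nonneg)
    next
      case False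
      then have p: "ip f f > 0" using ip_nonneg[of f] by simp
      have "(2 * \<beta> * ?N * ip f f)\<^sup>2 \<le> (ip (osc \<beta> f) f)\<^sup>2" using lower b p by (intro power_mono) auto
      then have "(k * ip f f) * ip f f \<le> ?H * ip f f" using cs unfolding k_def by (simp add: power_mult_distrib power2_eq_square mult_ac)
      then show ?thesis using p by simp
    qed
    then have f3: "ip f f \<le> ?H / k" using k by (simp add: le_divide_eq mult.commute)
    have "gip f f \<le> ip (osc \<beta> f) f" unfolding Hf using b ip_nonneg
      by (simp add: ip_def sq_def mult.assoc)
    also have "\<dots> \<le> ?H + ip f f"
    proof -
      have "0 \<le> isq (\<lambda>x. osc \<beta> f x - f x)" by (rule ip_nonneg)
      then have "2 * ip (osc \<beta> f) f \<le> ?H + ip f f" using so f by (simp add: ip_linear schwartz_intros ip_commute[of f "osc \<beta> f"])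
      then show ?thesis using ip_nonneg[of f] ip_nonneg[of "osc \<beta> f"] by linarith
    qed
    also have "\<dots> \<le> (1 + 1 / k) * ?H" using f3 by (simp add: algebra_simps)
    finally have g: "gip f f \<le> (1 + 1 / k) * ?H" .
    have Z: "isq (laplacian f) + 8 * \<beta>\<^sup>2 * xip f f \<le> (1 + 8 * \<beta>\<^sup>2 * ?N / k) * ?H"
    proof -
      have "isq (laplacian f) + 8 * \<beta>\<^sup>2 * xip f f = ?H + 8 * \<beta>\<^sup>2 * ?N * ip f f - 16 * \<beta> ^ 4 * isq (sq f)"
        unfolding H by (simp add: algebra_simps)
      also have "\<dots> \<le> ?H + 8 * \<beta>\<^sup>2 * ?N * (?H / k)"
      proof -
        have "8 * \<beta>\<^sup>2 * ?N * ip f f \<le> 8 * \<beta>\<^sup>2 * ?N * (?H / k)" by (rule mult_left_mono[OF f3]) simp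
        moreover have "0 \<le> 16 * \<beta> ^ 4 * isq (sq f)" by (rule mult_nonneg_nonneg[OF _ ip_nonneg]) simp
        ultimately show ?thesis by linarith
      qed
      also have "\<dots> = (1 + 8 * \<beta>\<^sup>2 * ?N / k) * ?H" by (simp add: algebra_simps)
      finally show ?thesis .
    qed
    define Y where "Y = (1 + 8 * \<beta>\<^sup>2 * ?N / k) * ?H"
    have "0 \<le> 8 * \<beta>\<^sup>2 * xip f f" by (rule mult_nonneg_nonneg[OF _ xip_nonneg]) simp
    then have "isq (laplacian f) \<le> Y" using Z unfolding Y_def by linarith
    moreover have "8 * \<beta>\<^sup>2 * xip f f \<le> Y" using Z ip_nonneg[of "laplacian f"] unfolding Y_def by linarith
    then have "xip f f \<le> Y / (8 * \<beta>\<^sup>2)" using b by (simp add: le_divide_eq mult.commute)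
    ultimately have "energy f \<le> Y + Y / (8 * \<beta>\<^sup>2) + (1 + 1 / k) * ?H" unfolding energy_def using g by linarith
    also have "\<dots> = C * ?H" unfolding C_def Y_def by (simp only: distrib_right distrib_left mult_1_left times_divide_eq_left mult.assoc add_divide_distrib add_ac)
    finally show ?thesis .
  qed
  moreover have "C \<ge> 0" unfolding C_def using k b by simp
  ultimately show ?thesis by blast
qed

text \<open>\<open>osc \<beta> u\<close> has compact support and is approximated in L2; the
  approximant is the oscillator of some polynomial times the Gaussian, and \<open>energy_osc\<close>
  applies to the difference.\<close>

lemma polynomial_gauss_dense:
  fixes u :: "real^'n::finite \<Rightarrow> real"
  assumes b: "\<beta> > 0" and u: "schwartz u" and supp: "\<And>x. norm x > R \<Longrightarrow> u x = 0" and e: "\<epsilon> > 0"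
  shows "\<exists>p. real_polynomial_function p \<and> energy (\<lambda>x. u x - p x * gauss \<beta> x) \<le> \<epsilon>"
proof -
  obtain C where C: "C \<ge> 0" "\<And>f::real^'n \<Rightarrow> real. schwartz f \<Longrightarrow> energy f \<le> C * isq (osc \<beta> f)"
    using energy_osc[OF b] by blast
  have op: "open {x::real^'n. norm x > R}" by (intro open_Collect_less continuous_intros)
  have z: "partial i f x = 0" if "\<And>x. norm x > R \<Longrightarrow> f x = 0" "norm x > R" for i x and f :: "real^'n \<Rightarrow> real"
    using partial_cong[OF op, of x f "\<lambda>x. 0"] that by simp
  have "laplacian u x = 0" if "norm x > R" for x
    unfolding laplacian_def using that by (intro sum.neutral ballI z[OF z[OF supp]])
  then have "osc \<beta> u x = 0" if "norm x \<ge> max R 0 + 1" for x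
    using that supp[of x] by (simp add: osc_def sq_def)
  then have "gapprox \<beta> (osc \<beta> u)"
    by (intro gapprox_compact_support[OF b schwartz_continuous[OF schwartz_osc[OF u]], of "max R 0 + 1"]) auto
  then obtain q where q: "real_polynomial_function q" "n2 (\<lambda>x. osc \<beta> u x - q x * gauss \<beta> x) \<le> \<epsilon> / (C + 1)"
    unfolding gapprox_def using e C(1) by (metis add_nonneg_pos divide_pos_pos zero_less_one)
  obtain p where p: "real_polynomial_function p" "osc \<beta> (\<lambda>x. p x * gauss \<beta> x) = (\<lambda>x. q x * gauss \<beta> x)"
    using osc_surj[OF b q(1)] by blast
  have sp: "schwartz (\<lambda>x. p x * gauss \<beta> x)" by (rule schwartz_polynomial[OF p(1) gauss_schwartz[OF b]])
  let ?f = "\<lambda>x. u x - p x * gauss \<beta> x"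
  have "energy ?f \<le> C * isq (osc \<beta> ?f)" by (rule C(2)[OF schwartz_diff[OF u sp]])
  also have "isq (osc \<beta> ?f) = n2 (\<lambda>x. osc \<beta> u x - q x * gauss \<beta> x)"
    unfolding osc_diff[OF u sp] p(2) n2_schwartz ..
  also have "C * \<dots> \<le> C * (\<epsilon> / (C + 1))" using C(1) q(2) by (intro mult_left_mono)
  also have "\<dots> \<le> \<epsilon>" using C(1) e by (simp add: field_simps)
  finally show ?thesis using p(1) by blast
qed

section \<open>Limits in the space of square integrable functions\<close>

text \<open>\<open>p\<close> stands for any product whose norm is bounded by that of the factors:
  scalar, complex or with an indicator. Young's inequality with the free parameter \<open>d\<close>
  is all that the limit arguments need.\<close>

lemma l2_pairing:
  fixes F :: "real^'n::finite \<Rightarrow> 'b::euclidean_space" and G :: "real^'n \<Rightarrow> 'c::euclidean_space"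
    and p :: "real^'n \<Rightarrow> 'd::euclidean_space"
  assumes F: "sqi F" and G: "sqi G" and p: "p \<in> borel_measurable lborel" "\<And>x. norm (p x) \<le> norm (F x) * norm (G x)"
  shows "integrable lborel p" "d > 0 \<Longrightarrow> (LINT x|lborel. norm (p x)) \<le> d * n2 F + 1 / d * n2 G"
proof -
  have le: "norm (p x) \<le> d * (norm (F x))\<^sup>2 + 1 / d * (norm (G x))\<^sup>2" if "d > 0" for d x
  proof -
    have "0 \<le> (d * norm (F x) - norm (G x))\<^sup>2" by simp
    then have "2 * d * (norm (F x) * norm (G x)) \<le> d * d * (norm (F x))\<^sup>2 + (norm (G x))\<^sup>2"
      by (simp add: power2_eq_square algebra_simps)
    moreover have "0 \<le> d * (norm (F x) * norm (G x))" using that by simp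
    ultimately have "d * (norm (F x) * norm (G x)) \<le> d * d * (norm (F x))\<^sup>2 + (norm (G x))\<^sup>2" by linarith
    also have "\<dots> = d * (d * (norm (F x))\<^sup>2 + 1 / d * (norm (G x))\<^sup>2)" using that by (simp add: distrib_left)
    finally have "d * (norm (F x) * norm (G x)) \<le> d * (d * (norm (F x))\<^sup>2 + 1 / d * (norm (G x))\<^sup>2)" .
    then show ?thesis using p(2)[of x] mult_le_cancel_left_pos[OF that] by (meson order_trans)
  qed
  have int: "integrable lborel (\<lambda>x. d * (norm (F x))\<^sup>2 + 1 / d * (norm (G x))\<^sup>2)" for d
    using F G by (auto simp: sqi_def)
  show i: "integrable lborel p"
    by (rule Bochner_Integration.integrable_bound[OF int[of 1] p(1)]) (use le[of 1] in \<open>auto intro: order_trans\<close>)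
  assume d: "d > 0"
  have "(LINT x|lborel. norm (p x)) \<le> (LINT x|lborel. (d * (norm (F x))\<^sup>2 + 1 / d * (norm (G x))\<^sup>2))"
    by (rule integral_mono[OF integrable_norm[OF i] int le[OF d]])
  also have "\<dots> = d * n2 F + 1 / d * n2 G" unfolding n2_def using F G by (simp add: sqi_def)
  finally show "(LINT x|lborel. norm (p x)) \<le> d * n2 F + 1 / d * n2 G" .
qed

lemma l2_pairing_tendsto:
  fixes F :: "nat \<Rightarrow> real^'n::finite \<Rightarrow> 'b::euclidean_space" and G :: "real^'n \<Rightarrow> 'c::euclidean_space"
    and p :: "nat \<Rightarrow> real^'n \<Rightarrow> 'd::euclidean_space"
  assumes F: "\<And>n. sqi (F n)" and G: "sqi G" and p: "\<And>n. p n \<in> borel_measurable lborel" "\<And>n x. norm (p n x) \<le> norm (F n x) * norm (G x)"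
    and lim: "(\<lambda>n. n2 (F n)) \<longlonglongrightarrow> 0"
  shows "(\<lambda>n. LINT x|lborel. p n x) \<longlonglongrightarrow> 0"
proof (rule LIMSEQ_I)
  fix e :: real assume e: "e > 0"
  define d where "d = 2 * (n2 G + 1) / e"
  have G0: "n2 G \<ge> 0" by (rule n2_nonneg)
  have d: "d > 0" using e G0 by (simp add: d_def)
  have "1 / d * n2 G = e / 2 * (n2 G / (n2 G + 1))" using e G0 by (simp add: d_def)
  also have "\<dots> \<le> e / 2" using e G0 by (intro mult_left_le) auto
  finally have Ge: "1 / d * n2 G \<le> e / 2" .
  have "\<forall>\<^sub>F n in sequentially. n2 (F n) < e / (2 * d)" using order_tendstoD(2)[OF lim] e d by simp
  then obtain M where M: "\<And>n. n \<ge> M \<Longrightarrow> n2 (F n) < e / (2 * d)" unfolding eventually_sequentially by blast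
  have "norm ((LINT x|lborel. p n x) - 0) < e" if "n \<ge> M" for n
  proof -
    have "norm (LINT x|lborel. p n x) \<le> (LINT x|lborel. norm (p n x))" by (rule integral_norm_bound)
    also have "\<dots> \<le> d * n2 (F n) + 1 / d * n2 G" by (rule l2_pairing(2)[OF F G p d])
    also have "d * n2 (F n) < d * (e / (2 * d))" using M[OF that] d by (intro mult_strict_left_mono)
    also have "d * (e / (2 * d)) = e / 2" using d by simp
    finally show ?thesis using Ge unfolding diff_zero by linarith
  qed
  then show "\<exists>M. \<forall>n\<ge>M. norm ((LINT x|lborel. p n x) - 0) < e" by blast
qed

text \<open>The optimal weight in \<open>n2_add_le\<close> is the quotient of the two norms.\<close>

lemma n2_triangle:
  assumes F: "sqi F" and G: "sqi G" shows "sqrt (n2 (\<lambda>x. F x + G x)) \<le> sqrt (n2 F) + sqrt (n2 G)"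
proof -
  define a b where "a = sqrt (n2 F)" and "b = sqrt (n2 G)"
  have ab: "a \<ge> 0" "b \<ge> 0" "n2 F = a\<^sup>2" "n2 G = b\<^sup>2" by (auto simp: a_def b_def n2_nonneg)
  have "n2 (\<lambda>x. F x + G x) \<le> (a + b)\<^sup>2 + d" if d: "d > 0" for d
  proof -
    \<comment> \<open>Both norms are shifted by \<open>c\<close> so that their quotient exists when
      one of them is 0; the cost c (a + b) is at most \<open>d\<close>.\<close>
    define c where "c = d / (a + b + 1)"
    have c: "c > 0" "c * (a + b) \<le> d" using ab d by (auto simp: c_def field_simps)
    have p: "a + c > 0" "b + c > 0" using ab c by auto
    have "n2 (\<lambda>x. F x + G x) \<le> (1 + (b + c) / (a + c)) * a\<^sup>2 + (1 + 1 / ((b + c) / (a + c))) * b\<^sup>2"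
      unfolding ab(3,4)[symmetric] using p by (intro n2_add_le F G) simp
    also have "\<dots> = a\<^sup>2 + b\<^sup>2 + (b + c) * a * (a / (a + c)) + (a + c) * b * (b / (b + c))"
    proof -
      have "(1 + (b + c) / (a + c)) * a\<^sup>2 = a\<^sup>2 + (b + c) * a * (a / (a + c))" by (simp add: power2_eq_square distrib_right)
      moreover have "(1 + 1 / ((b + c) / (a + c))) * b\<^sup>2 = b\<^sup>2 + (a + c) * b * (b / (b + c))" by (simp add: power2_eq_square distrib_right)
      ultimately show ?thesis by linarith
    qed
    also have "\<dots> \<le> a\<^sup>2 + b\<^sup>2 + (b + c) * a * 1 + (a + c) * b * 1"
      using ab c p by (intro add_mono mult_left_mono) (auto simp: divide_le_eq)
    also have "\<dots> = (a + b)\<^sup>2 + c * (a + b)" by (simp add: power2_eq_square algebra_simps)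
    finally show ?thesis using c by simp
  qed
  then have "n2 (\<lambda>x. F x + G x) \<le> (a + b)\<^sup>2" by (rule field_le_epsilon)
  then have "sqrt (n2 (\<lambda>x. F x + G x)) \<le> sqrt ((a + b)\<^sup>2)" by (rule real_sqrt_le_mono)
  then show ?thesis using ab(1,2) unfolding a_def[symmetric] b_def[symmetric] by simp
qed

lemma n2_minus_commute: "n2 (\<lambda>x. F x - G x) = n2 (\<lambda>x. G x - F x)" by (simp add: n2_def norm_minus_commute)

lemma n2_tendsto_add:
  assumes "\<And>n. sqi (F n)" "\<And>n. sqi (G n)" "(\<lambda>n. n2 (F n)) \<longlonglongrightarrow> 0" "(\<lambda>n. n2 (G n)) \<longlonglongrightarrow> 0"
  shows "(\<lambda>n. n2 (\<lambda>x. F n x + G n x)) \<longlonglongrightarrow> 0"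
proof (rule tendsto_sandwich[of "\<lambda>n. 0" _ _ "\<lambda>n. (1 + 1) * n2 (F n) + (1 + 1 / 1) * n2 (G n)"])
  show "\<forall>\<^sub>F n in sequentially. n2 (\<lambda>x. F n x + G n x) \<le> (1 + 1) * n2 (F n) + (1 + 1 / 1) * n2 (G n)"
    using assms by (intro always_eventually allI n2_add_le) auto
  show "(\<lambda>n. (1 + 1) * n2 (F n) + (1 + 1 / 1) * n2 (G n)) \<longlonglongrightarrow> 0"
    using tendsto_add[OF tendsto_mult_left[OF assms(3), of 2] tendsto_mult_left[OF assms(4), of 2]] by simp
qed (auto simp: n2_nonneg)

lemma n2_tendsto:
  assumes F: "\<And>n. sqi (F n)" and G: "\<And>n. sqi (G n)" and d: "(\<lambda>n. n2 (\<lambda>x. F n x - G n x)) \<longlonglongrightarrow> 0" and g: "(\<lambda>n. n2 (G n)) \<longlonglongrightarrow> L"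
  shows "(\<lambda>n. n2 (F n)) \<longlonglongrightarrow> L"
proof -
  have "\<bar>sqrt (n2 (F n)) - sqrt (n2 (G n))\<bar> \<le> sqrt (n2 (\<lambda>x. F n x - G n x))" for n
    using n2_triangle[OF sqi_diff[OF F G] G, of n n n] n2_triangle[OF sqi_diff[OF G F] F, of n n n]
    unfolding n2_minus_commute[of "G n" "F n"] by simp
  then have "\<forall>\<^sub>F n in sequentially. norm (sqrt (n2 (F n)) - sqrt (n2 (G n))) \<le> sqrt (n2 (\<lambda>x. F n x - G n x))" by simp
  moreover have "(\<lambda>n. sqrt (n2 (\<lambda>x. F n x - G n x))) \<longlonglongrightarrow> 0" using tendsto_real_sqrt[OF d] by simp
  ultimately have "(\<lambda>n. sqrt (n2 (F n)) - sqrt (n2 (G n))) \<longlonglongrightarrow> 0" by (rule Lim_null_comparison)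
  from tendsto_add[OF this tendsto_real_sqrt[OF g]] have "(\<lambda>n. sqrt (n2 (F n))) \<longlonglongrightarrow> sqrt L" by simp
  from tendsto_power[OF this, of 2] have "(\<lambda>n. n2 (F n)) \<longlonglongrightarrow> (sqrt L)\<^sup>2" by (simp add: n2_nonneg)
  moreover have "L \<ge> 0" by (rule LIMSEQ_le_const[OF g]) (auto simp: n2_nonneg)
  ultimately show ?thesis by simp
qed

text \<open>Multiplication by a Gaussian turns an L2-Cauchy sequence into an L1-Cauchy sequence, for
  which an almost everywhere Cauchy subsequence exists. The Gaussian has no zeros, so dividing it
  out preserves pointwise convergence.\<close>

lemma l2_cauchy_subsequence:
  fixes f :: "nat \<Rightarrow> real^'n::finite \<Rightarrow> 'b::euclidean_space"
  assumes f: "\<And>n. sqi (f n)" and cauchy: "\<And>e. e > 0 \<Longrightarrow> \<exists>M. \<forall>m\<ge>M. \<forall>n\<ge>M. n2 (\<lambda>x. f m x - f n x) < e"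
  obtains r g where "strict_mono (r :: nat \<Rightarrow> nat)" "g \<in> borel_measurable lborel" "AE x in lborel. (\<lambda>n. f (r n) x) \<longlonglongrightarrow> g x"
proof -
  let ?w = "gauss 1 :: real^'n \<Rightarrow> real"
  define s where "s n x = ?w x *\<^sub>R f n x" for n x
  have w: "sqi ?w" by (rule sqi_schwartz[OF gauss_schwartz]) simp
  have [measurable]: "?w \<in> borel_measurable lborel" "f n \<in> borel_measurable lborel" for n using w f[of n] by (auto simp: sqi_def)
  have int: "integrable lborel (s n)" for n
    unfolding s_def by (rule l2_pairing(1)[OF f[of n] w]) (auto simp: mult.commute)
  obtain r where r: "strict_mono r" "AE x in lborel. Cauchy (\<lambda>i. s (r i) x)"
  proof (rule cauchy_L1_AE_cauchy_subseq[OF int])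
    fix e :: real assume e: "e > 0"
    define d where "d = 2 * (n2 ?w + 1) / e"
    have w0: "n2 ?w \<ge> 0" by (rule n2_nonneg)
    have d: "d > 0" using e w0 by (simp add: d_def add_nonneg_pos)
    have "1 / d * n2 ?w = e / 2 * (n2 ?w / (n2 ?w + 1))" using e w0 by (simp add: d_def)
    also have "\<dots> \<le> e / 2" using e w0 by (intro mult_left_le) auto
    finally have we: "1 / d * n2 ?w \<le> e / 2" .
    obtain M where M: "\<And>m n. m \<ge> M \<Longrightarrow> n \<ge> M \<Longrightarrow> n2 (\<lambda>x. f m x - f n x) < e / (2 * d)" using cauchy[of "e / (2 * d)"] e d by auto
    have "(LINT x|lborel. norm (s i x - s j x)) < e" if "i \<ge> M" "j \<ge> M" for i j
    proof -
      have "(LINT x|lborel. norm (s i x - s j x)) \<le> d * n2 (\<lambda>x. f i x - f j x) + 1 / d * n2 ?w"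
        by (rule l2_pairing(2)[OF sqi_diff[OF f f] w _ _ d]) (auto simp: s_def scaleR_diff_right[symmetric] mult.commute)
      also have "d * n2 (\<lambda>x. f i x - f j x) < d * (e / (2 * d))" using M[OF that] d by (intro mult_strict_left_mono)
      also have "d * (e / (2 * d)) = e / 2" using d by simp
      finally show ?thesis using we by linarith
    qed
    then show "\<exists>N. \<forall>i\<ge>N. \<forall>j\<ge>N. (LINT x|lborel. norm (s i x - s j x)) < e" by blast
  qed
  define g where "g x = lim (\<lambda>n. f (r n) x)" for x
  have "g \<in> borel_measurable lborel" unfolding g_def[abs_def] by (rule borel_measurable_lim_metric) measurable
  moreover have "AE x in lborel. (\<lambda>n. f (r n) x) \<longlonglongrightarrow> g x"
    using r(2)
  proof eventually_elim
    case (elim x)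
    then obtain l where "(\<lambda>n. s (r n) x) \<longlonglongrightarrow> l" using Cauchy_convergent convergent_def by blast
    from tendsto_scaleR[OF tendsto_const[of "inverse (?w x)"] this] have "(\<lambda>n. f (r n) x) \<longlonglongrightarrow> inverse (?w x) *\<^sub>R l"
      by (simp add: s_def gauss_def)
    then show ?case unfolding g_def by (simp add: limI)
  qed
  ultimately show thesis using r(1) that by blast
qed

text \<open>Completeness by Fatou's lemma. The pointwise limit \<open>g\<close> is given in advance,
  so that the result can identify the L2 limit with a prescribed field.\<close>

lemma l2_cauchy_limit:
  fixes f :: "nat \<Rightarrow> real^'n::finite \<Rightarrow> 'b::euclidean_space"
  assumes f: "\<And>n. sqi (f n)" and cauchy: "\<And>e. e > 0 \<Longrightarrow> \<exists>M. \<forall>m\<ge>M. \<forall>n\<ge>M. n2 (\<lambda>x. f m x - f n x) < e"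
    and r: "strict_mono (r :: nat \<Rightarrow> nat)" and g: "g \<in> borel_measurable lborel" and lim: "AE x in lborel. (\<lambda>n. f (r n) x) \<longlonglongrightarrow> g x"
  shows "sqi g" "(\<lambda>n. n2 (\<lambda>x. f n x - g x)) \<longlonglongrightarrow> 0"
proof -
  have [measurable]: "f n \<in> borel_measurable lborel" for n using f[of n] by (auto simp: sqi_def)
  note g[measurable]
  have key: "\<exists>M. \<forall>m\<ge>M. sqi (\<lambda>x. f m x - g x) \<and> n2 (\<lambda>x. f m x - g x) \<le> e" if e: "e > 0" for e :: real
  proof -
    obtain M where M: "\<And>m n. m \<ge> M \<Longrightarrow> n \<ge> M \<Longrightarrow> n2 (\<lambda>x. f m x - f n x) < e" using cauchy[OF e] by blast
    have "sqi (\<lambda>x. f m x - g x) \<and> n2 (\<lambda>x. f m x - g x) \<le> e" if m: "m \<ge> M" for m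
    proof -
      have "(\<integral>\<^sup>+x. ennreal ((norm (f m x - g x))\<^sup>2) \<partial>lborel) = (\<integral>\<^sup>+x. liminf (\<lambda>k. ennreal ((norm (f m x - f (r k) x))\<^sup>2)) \<partial>lborel)"
      proof (rule nn_integral_cong_AE)
        show "AE x in lborel. ennreal ((norm (f m x - g x))\<^sup>2) = liminf (\<lambda>k. ennreal ((norm (f m x - f (r k) x))\<^sup>2))"
          using lim
        proof eventually_elim
          case (elim x)
          have "(\<lambda>k. ennreal ((norm (f m x - f (r k) x))\<^sup>2)) \<longlonglongrightarrow> ennreal ((norm (f m x - g x))\<^sup>2)"
            by (intro tendsto_intros tendsto_ennrealI elim)
          from lim_imp_Liminf[OF sequentially_bot this] show ?case by simp
        qed
      qed
      also have "\<dots> \<le> liminf (\<lambda>k. \<integral>\<^sup>+x. ennreal ((norm (f m x - f (r k) x))\<^sup>2) \<partial>lborel)"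
        by (rule nn_integral_liminf) measurable
      also have "\<dots> \<le> liminf (\<lambda>k. ennreal e)"
      proof (rule Liminf_mono, unfold eventually_sequentially, intro exI allI impI)
        fix k assume k: "k \<ge> M"
        then have "r k \<ge> M" using seq_suble[OF r, of k] by simp
        have "(\<integral>\<^sup>+x. ennreal ((norm (f m x - f (r k) x))\<^sup>2) \<partial>lborel) = ennreal (n2 (\<lambda>x. f m x - f (r k) x))"
          unfolding n2_def using sqi_diff[OF f[of m] f[of "r k"]] by (intro nn_integral_eq_integral) (auto simp: sqi_def)
        then show "(\<integral>\<^sup>+x. ennreal ((norm (f m x - f (r k) x))\<^sup>2) \<partial>lborel) \<le> ennreal e"
          using M[OF m \<open>r k \<ge> M\<close>] by (simp add: ennreal_leI)
      qed
      also have "\<dots> = ennreal e" by (simp add: Liminf_const)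
      finally have le: "(\<integral>\<^sup>+x. ennreal ((norm (f m x - g x))\<^sup>2) \<partial>lborel) \<le> ennreal e" .
      have "integrable lborel (\<lambda>x. (norm (f m x - g x))\<^sup>2)"
        by (rule integrableI_bounded) (measurable, use le in \<open>simp add: order_le_less_trans[OF le]\<close>)
      moreover from this have "ennreal (n2 (\<lambda>x. f m x - g x)) \<le> ennreal e"
        unfolding n2_def using le by (subst nn_integral_eq_integral[symmetric]) auto
      ultimately show ?thesis using e by (simp add: sqi_def)
    qed
    then show ?thesis by blast
  qed
  obtain M where "sqi (\<lambda>x. f M x - g x)" using key[of 1] by auto
  from sqi_diff[OF f[of M] this] show "sqi g" by simp
  show "(\<lambda>n. n2 (\<lambda>x. f n x - g x)) \<longlonglongrightarrow> 0"
  proof (rule LIMSEQ_I)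
    fix e :: real assume "e > 0"
    then obtain M where "\<forall>m\<ge>M. n2 (\<lambda>x. f m x - g x) \<le> e / 2" using key[of "e / 2"] by auto
    then show "\<exists>M. \<forall>n\<ge>M. norm (n2 (\<lambda>x. f n x - g x) - 0) < e"
      using \<open>e > 0\<close> by (intro exI[of _ M]) (force simp: n2_nonneg)
  qed
qed

section \<open>Continuously differentiable functions\<close>

lemma C_k_continuous: "C_k k f \<Longrightarrow> continuous_on UNIV f"
  by (cases k) (auto simp: differentiable_imp_continuous_on differentiable_on_def intro: differentiable_at_withinI)

lemma C_k_Suc: "C_k (Suc k) f \<Longrightarrow> C_k k f"
proof (induction k arbitrary: f)
  case 0 then show ?case using C_k_continuous by (metis C_k.simps(1))
next
  case (Suc k) then show ?case by (metis C_k.simps(2))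
qed

lemma C_k_const: "C_k k (\<lambda>x. c)"
proof (induction k arbitrary: c)
  case (Suc k) then show ?case by simp
qed simp

lemma C_k_add: "C_k k f \<Longrightarrow> C_k k g \<Longrightarrow> C_k k (\<lambda>x. f x + g x)"
proof (induction k arbitrary: f g)
  case 0 then show ?case by (auto intro: continuous_intros)
next
  case (Suc k)
  then have "partial i (\<lambda>x. f x + g x) = (\<lambda>x. partial i f x + partial i g x)" for i by (auto simp: partial_add)
  with Suc show ?case by auto
qed

lemma C_k_mult:
  fixes f g :: "real^'n::finite \<Rightarrow> 'b::real_normed_algebra"
  shows "C_k k f \<Longrightarrow> C_k k g \<Longrightarrow> C_k k (\<lambda>x. f x * g x)"
proof (induction k arbitrary: f g)
  case 0 then show ?case by (auto intro: continuous_intros)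
next
  case (Suc k)
  then have "partial i (\<lambda>x. f x * g x) = (\<lambda>x. f x * partial i g x + partial i f x * g x)" for i by (auto simp: partial_mult)
  moreover have "C_k k (\<lambda>x. f x * partial i g x + partial i f x * g x)" for i
    using Suc.prems C_k_Suc by (intro C_k_add Suc.IH) auto
  ultimately show ?case using Suc.prems by (auto intro!: differentiable_mult)
qed

lemma partial_bounded_linear_compose:
  assumes l: "bounded_linear l" and f: "f differentiable (at x)"
  shows "(\<lambda>x. l (f x)) differentiable (at x)" "partial i (\<lambda>x. l (f x)) x = l (partial i f x)"
proof -
  interpret bounded_linear l by (rule l)
  have D: "((\<lambda>x. l (f x)) has_derivative (\<lambda>h. l (\<Sum>i\<in>UNIV. h $ i *\<^sub>R partial i f x))) (at x)"
    by (rule has_derivative[OF has_derivative_partial[OF f]])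
  then show "(\<lambda>x. l (f x)) differentiable (at x)" by (auto simp: differentiable_def)
  show "partial i (\<lambda>x. l (f x)) x = l (partial i f x)"
    using partial_eqI[OF D] by (simp add: axis_def if_distrib[of "\<lambda>z. z *\<^sub>R _"] cong: if_cong)
qed

lemma C_k_bounded_linear: "bounded_linear l \<Longrightarrow> C_k k f \<Longrightarrow> C_k k (\<lambda>x. l (f x))"
proof (induction k arbitrary: f)
  case 0
  then show ?case using bounded_linear.continuous_on[of l UNIV f] by simp
next
  case (Suc k)
  then have "partial i (\<lambda>x. l (f x)) = (\<lambda>x. l (partial i f x))" for i
    using partial_bounded_linear_compose(2)[of l f] by auto
  with Suc show ?case by (auto simp: partial_bounded_linear_compose(1))
qed

lemma C_k_linear: "bounded_linear (l :: real^'n::finite \<Rightarrow> 'b::real_normed_vector) \<Longrightarrow> C_k k l"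
proof (cases k)
  case (Suc j)
  assume l: "bounded_linear l"
  have "partial i l = (\<lambda>x. l (axis i 1))" for i by (rule ext) (rule partial_bounded_linear[OF l])
  then show ?thesis using Suc C_k_const l by (auto intro: bounded_linear_imp_differentiable)
qed (auto intro: linear_continuous_on)

lemma C_k_polynomial: "real_polynomial_function (p :: real^'n::finite \<Rightarrow> real) \<Longrightarrow> C_k k p"
  by (induction rule: real_polynomial_function.induct) (auto intro: C_k_linear C_k_const C_k_add C_k_mult)

lemma C_k_prod: "finite I \<Longrightarrow> (\<And>i. i \<in> I \<Longrightarrow> C_k k (f i)) \<Longrightarrow> C_k k (\<lambda>x. \<Prod>i\<in>I. f i x :: real)"
  by (induction I rule: finite_induct) (auto intro: C_k_const C_k_mult)

lemma schwartz_C_k: "schwartz f \<Longrightarrow> C_k k f"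
proof (induction k arbitrary: f)
  case (Suc k) then show ?case by (auto simp: schwartz_differentiable schwartz_partial)
qed (simp add: schwartz_continuous)

lemma partial_zero_outside:
  assumes "\<And>x. norm x > R \<Longrightarrow> f x = 0" "norm x > R"
  shows "partial i f x = 0"
proof -
  have "open {x. norm x > R}" by (intro open_Collect_less continuous_intros)
  from partial_cong[OF this, of x f "\<lambda>x. 0"] show ?thesis using assms by simp
qed

lemma schwartz_bounded_support:
  assumes f: "\<And>k. C_k k f" and supp: "\<And>x. norm x > R \<Longrightarrow> f x = 0"
  shows "schwartz f"
proof -
  have "schwartz_k k f" if "C_k k f" "\<And>x. norm x > R \<Longrightarrow> f x = 0" for k f
    using that
  proof (induction k arbitrary: f)
    case 0 then show ?case using decays_bounded_support[of f R] by simp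
  next
    case (Suc k)
    have "decays f" using decays_bounded_support[OF C_k_continuous[OF Suc.prems(1)], of R] Suc.prems by simp
    moreover have "schwartz_k k (partial i f)" for i
      using Suc.prems partial_zero_outside[of R f] by (intro Suc.IH) auto
    ultimately show ?case using Suc.prems by simp
  qed
  then show ?thesis unfolding schwartz_def using f supp by blast
qed

lemma test_function_iff: "test_function f \<longleftrightarrow> (\<forall>k. C_k k f) \<and> (\<exists>R. \<forall>x. norm x > R \<longrightarrow> f x = 0)"
proof -
  have "compact (closure {x. f x \<noteq> 0}) \<longleftrightarrow> (\<exists>R. \<forall>x. norm x > R \<longrightarrow> f x = 0)"
    unfolding compact_closure bounded_iff by (metis (mono_tags, lifting) mem_Collect_eq not_le)
  then show ?thesis by (simp add: test_function_def)
qed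

lemma test_function_of_real: "schwartz f \<Longrightarrow> (\<And>x. norm x > R \<Longrightarrow> f x = 0) \<Longrightarrow> test_function (\<lambda>x. complex_of_real (f x))"
  unfolding test_function_iff
  by (intro conjI allI exI[of _ R] C_k_bounded_linear[OF bounded_linear_of_real] schwartz_C_k) auto

lemma test_function_parts:
  assumes "test_function f"
  shows "schwartz (\<lambda>x. Re (f x))" "schwartz (\<lambda>x. Im (f x))"
    "\<exists>R. \<forall>x. norm x > R \<longrightarrow> f x = 0"
proof -
  obtain R where R: "\<And>x. norm x > R \<Longrightarrow> f x = 0" "\<And>k. C_k k f" using assms unfolding test_function_iff by blast
  show "schwartz (\<lambda>x. Re (f x))"
    by (rule schwartz_bounded_support[OF C_k_bounded_linear[OF bounded_linear_Re R(2)], of R]) (simp add: R(1))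
  show "schwartz (\<lambda>x. Im (f x))"
    by (rule schwartz_bounded_support[OF C_k_bounded_linear[OF bounded_linear_Im R(2)], of R]) (simp add: R(1))
  show "\<exists>R. \<forall>x. norm x > R \<longrightarrow> f x = 0" using R by blast
qed

section \<open>A flat function and the fundamental lemma\<close>

text \<open>The powers of 1/t make the family closed under differentiation, which reduces smoothness
  to an induction over all \<open>m\<close> simultaneously.\<close>

definition flat :: "nat \<Rightarrow> real \<Rightarrow> real" where
  "flat m t = (if t > 0 then (1 / t) ^ m * exp (- (1 / t)) else 0)"

lemma flat_nonneg: "0 \<le> flat m t" by (simp add: flat_def)

text \<open>A single term of the exponential series of 1/t gives the bound, and the bound gives the
  derivative 0 at the origin.\<close>

lemma flat_le: "t > 0 \<Longrightarrow> flat m t \<le> fact (Suc m) * t"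
proof -
  assume t: "t > 0"
  have "(1 / t) ^ Suc m / fact (Suc m) \<le> exp (1 / t)"
  proof -
    have "(\<Sum>k\<in>{Suc m}. (1 / t) ^ k /\<^sub>R fact k) \<le> (\<Sum>k. (1 / t) ^ k /\<^sub>R fact k)"
      using t by (intro sum_le_suminf summable_exp_generic) auto
    then show ?thesis by (simp add: exp_def divide_inverse mult.commute)
  qed
  then have "(1 / t) ^ Suc m \<le> fact (Suc m) * exp (1 / t)" by (simp add: divide_le_eq mult.commute del: fact_Suc power_Suc)
  then have "(1 / t) ^ Suc m * exp (- (1 / t)) \<le> fact (Suc m)" by (simp add: exp_minus divide_inverse[symmetric] divide_le_eq del: fact_Suc power_Suc)
  from mult_left_mono[OF this, of t] show ?thesis using t by (simp add: flat_def mult.commute)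
qed

lemma flat_deriv: "(flat m has_real_derivative (- real m * flat (m + 1) t + flat (m + 2) t)) (at t)"
proof (cases t "0::real" rule: linorder_cases)
  case less
  have "((\<lambda>t. 0) has_real_derivative 0) (at t)" by simp
  then have "(flat m has_real_derivative 0) (at t)"
    by (rule has_field_derivative_transform_within_open[where S = "{..<0}"]) (use less in \<open>auto simp: flat_def\<close>)
  then show ?thesis using less by (simp add: flat_def)
next
  case greater
  have "((\<lambda>t. (1 / t) ^ m * exp (- (1 / t))) has_real_derivative
      (real m * (1 / t) ^ (m - 1) * (- 1 / t\<^sup>2)) * exp (- (1 / t)) + (1 / t) ^ m * (exp (- (1 / t)) * (1 / t\<^sup>2))) (at t)"
    using greater by (auto intro!: derivative_eq_intros simp: power2_eq_square)
  then have "(flat m has_real_derivative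
      (real m * (1 / t) ^ (m - 1) * (- 1 / t\<^sup>2)) * exp (- (1 / t)) + (1 / t) ^ m * (exp (- (1 / t)) * (1 / t\<^sup>2))) (at t)"
    by (rule has_field_derivative_transform_within_open[where S = "{0<..}"]) (use greater in \<open>auto simp: flat_def\<close>)
  moreover have "(real m * (1 / t) ^ (m - 1) * (- 1 / t\<^sup>2)) * exp (- (1 / t)) + (1 / t) ^ m * (exp (- (1 / t)) * (1 / t\<^sup>2))
      = - real m * flat (m + 1) t + flat (m + 2) t"
    using greater by (cases m) (simp_all add: flat_def power_add power_divide power2_eq_square field_simps)
  ultimately show ?thesis by simp
next
  case equal
  have "((\<lambda>h. (flat m (0 + h) - flat m 0) / h) \<longlongrightarrow> 0) (at 0)"
  proof (rule Lim_null_comparison)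
    show "\<forall>\<^sub>F h in at 0. norm ((flat m (0 + h) - flat m 0) / h) \<le> fact (m + 2) * \<bar>h\<bar>"
    proof (intro always_eventually allI)
      fix h :: real
      have "flat m h / h = flat (m + 1) h" by (simp add: flat_def)
      then show "norm ((flat m (0 + h) - flat m 0) / h) \<le> fact (m + 2) * \<bar>h\<bar>"
      proof (cases "h > 0")
        case True
        then show ?thesis using flat_le[OF True, of "m + 1"] flat_nonneg[of "m + 1" h] \<open>flat m h / h = flat (m + 1) h\<close>
          by (simp add: flat_def[of m 0] del: fact_Suc)
      qed (auto simp: flat_def mult_le_0_iff simp del: fact_Suc)
    qed
    show "((\<lambda>h. fact (m + 2) * \<bar>h\<bar>) \<longlongrightarrow> 0) (at (0::real))" by (auto intro!: tendsto_eq_intros)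
  qed
  then show ?thesis using equal by (simp add: DERIV_def flat_def)
qed

lemma C_k_flat:
  fixes p :: "real^'n::finite \<Rightarrow> real"
  assumes p: "\<And>k. C_k k p" shows "C_k k (\<lambda>x. flat m (p x))"
proof (induction k arbitrary: m)
  case 0
  have "continuous_on UNIV (flat m)" using DERIV_continuous[OF flat_deriv] by (simp add: continuous_on_eq_continuous_within)
  then show ?case using continuous_on_compose2[of UNIV "flat m" UNIV p] p[of 0] by simp
next
  case (Suc k)
  have d: "p differentiable (at x)" for x using p[of 1] by simp
  have "(\<lambda>x. flat m (p x)) differentiable (at x)" for x
    using differentiable_chain_at[OF d, of "flat m" x] flat_deriv[of m "p x"]
    by (auto simp: o_def real_differentiable_def)
  moreover have "partial i (\<lambda>x. flat m (p x)) = (\<lambda>x. (- real m * flat (m + 1) (p x) + flat (m + 2) (p x)) * partial i p x)" for i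
    by (rule ext) (rule partial_compose_real[OF d flat_deriv])
  moreover have "C_k k (partial i p)" for i using p[of "Suc k"] by simp
  moreover have "C_k k (\<lambda>x. (- real m * flat (m + 1) (p x) + flat (m + 2) (p x)) * partial i p x)" if "C_k k (partial i p)" for i
    by (intro C_k_mult C_k_add C_k_const Suc.IH that)
  ultimately show ?case by simp
qed

text \<open>Products of \<open>flat 0\<close> of n (x_i - a_i)(b_i - x_i) are smooth, supported in
  the box, bounded by 1 and converge pointwise to its indicator.\<close>

lemma integral_box_eq_0:
  fixes G :: "real^'n::finite \<Rightarrow> real"
  assumes G: "locally_integrable G" "G \<in> borel_measurable lborel"
    and orth: "\<And>\<phi>. schwartz \<phi> \<Longrightarrow> (\<exists>R. \<forall>x. norm x > R \<longrightarrow> \<phi> x = 0) \<Longrightarrow> (LINT x|lborel. G x * \<phi> x) = 0"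
  shows "(LINT x|lborel. indicator (box a b) x * G x) = 0"
proof (cases "\<forall>i. a $ i < b $ i")
  case False
  then have "box a b = {}" by (auto simp: interval_eq_empty_cart not_less)
  then show ?thesis by simp
next
  case True
  define q where "q i x = (x $ i - a $ i) * (b $ i - x $ i)" for i and x :: "real^'n"
  define \<phi> where "\<phi> n x = (\<Prod>i\<in>UNIV. flat 0 (real (Suc n) * q i x))" for n x
  have q: "q i x > 0 \<longleftrightarrow> a $ i < x $ i \<and> x $ i < b $ i" for i x
    using True[rule_format, of i] unfolding q_def zero_less_mult_iff by auto
  have poly: "real_polynomial_function (q i)" for i
    unfolding q_def[abs_def] by (intro real_polynomial_function.intros(4) real_polynomial_function_diff polynomial_component real_polynomial_function.intros(2))
  have Ck: "C_k k (\<phi> n)" for k n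
    unfolding \<phi>_def[abs_def] by (intro C_k_prod C_k_flat C_k_polynomial real_polynomial_function.intros(4) real_polynomial_function.intros(2) poly) auto
  have out: "\<phi> n x = 0" if "x \<notin> box a b" for n x
  proof -
    have "\<exists>i. \<not> (a $ i < x $ i \<and> x $ i < b $ i)" using that by (simp add: mem_box_cart)
    then obtain i where "\<not> q i x > 0" using q by blast
    then have "flat 0 (real (Suc n) * q i x) = 0" by (simp add: flat_def zero_less_mult_iff del: of_nat_Suc)
    then show ?thesis unfolding \<phi>_def by (simp add: prod_zero_iff) blast
  qed
  have le1: "0 \<le> \<phi> n x" "\<phi> n x \<le> 1" for n x
    unfolding \<phi>_def by (auto intro!: prod_nonneg prod_le_1 simp: flat_def)
  obtain R where R: "\<And>x. x \<in> box a b \<Longrightarrow> norm x \<le> R" using bounded_box[of a b] unfolding bounded_iff by blast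
  have z: "\<phi> n x = 0" if "norm x > R" for n x using out R that by (metis not_less)
  have zero: "(LINT x|lborel. G x * \<phi> n x) = 0" for n
    by (rule orth[OF schwartz_bounded_support[OF Ck]]) (use z in auto)
  have int: "integrable lborel (\<lambda>x. indicator (cbox a b) x * G x)"
    using G(1) unfolding locally_integrable_def set_integrable_def by auto
  have "(\<lambda>n. LINT x|lborel. G x * \<phi> n x) \<longlonglongrightarrow> (LINT x|lborel. indicator (box a b) x * G x)"
  proof (rule integral_dominated_convergence[where w = "\<lambda>x. norm (indicator (cbox a b) x * G x)"])
    show "(\<lambda>x. G x * \<phi> n x) \<in> borel_measurable lborel" for n
      using G(2) borel_measurable_continuous_onI[OF C_k_continuous[OF Ck[of 0 n]]] by simp
    show "(\<lambda>x. indicator (box a b) x * G x) \<in> borel_measurable lborel" using G(2) by measurable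
    show "AE x in lborel. norm (G x * \<phi> n x) \<le> norm (indicator (cbox a b) x * G x)" for n
    proof (rule AE_I2)
      fix x
      show "norm (G x * \<phi> n x) \<le> norm (indicator (cbox a b) x * G x)"
      proof (cases "x \<in> box a b")
        case True
        then have "x \<in> cbox a b" using box_subset_cbox by blast
        then show ?thesis using le1[of n x] by (simp add: abs_mult mult_left_le)
      qed (simp add: out)
    qed
    show "AE x in lborel. (\<lambda>n. G x * \<phi> n x) \<longlonglongrightarrow> indicator (box a b) x * G x"
    proof (rule AE_I2)
      fix x
      show "(\<lambda>n. G x * \<phi> n x) \<longlonglongrightarrow> indicator (box a b) x * G x"
      proof (cases "x \<in> box a b")
        case True
        then have p: "q i x > 0" for i using q by (auto simp: mem_box_cart)
        have "(\<lambda>n. flat 0 (real (Suc n) * q i x)) \<longlonglongrightarrow> 1" for i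
        proof -
          have "(\<lambda>n. exp (- (inverse (real (Suc n)) / q i x))) \<longlonglongrightarrow> exp (- (0 / q i x))"
            by (intro tendsto_intros LIMSEQ_inverse_real_of_nat) (use p[of i] in auto)
          moreover have "flat 0 (real (Suc n) * q i x) = exp (- (inverse (real (Suc n)) / q i x))" for n
            using p[of i] by (simp add: flat_def divide_inverse del: of_nat_Suc)
          ultimately show ?thesis by simp
        qed
        then have "(\<lambda>n. \<phi> n x) \<longlonglongrightarrow> (\<Prod>i\<in>(UNIV::'n set). 1)" unfolding \<phi>_def by (intro tendsto_prod)
        from tendsto_mult[OF tendsto_const[of "G x"] this] show ?thesis using True by simp
      qed (simp add: out)
    qed
  qed (use int in auto)
  then show ?thesis unfolding zero by (simp add: LIMSEQ_const_iff)
qed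

text \<open>The integral of \<open>G\<close> vanishes on boxes. These form an intersection-stable
  generator of the Borel sets, so it vanishes on all Borel sets. The restriction to the cubes
  \<open>K r\<close> is needed since \<open>G\<close> is only locally integrable.\<close>

lemma fundamental_lemma:
  fixes G :: "real^'n::finite \<Rightarrow> real"
  assumes G: "locally_integrable G" "G \<in> borel_measurable lborel"
    and orth: "\<And>\<phi>. schwartz \<phi> \<Longrightarrow> (\<exists>R. \<forall>x. norm x > R \<longrightarrow> \<phi> x = 0) \<Longrightarrow> (LINT x|lborel. G x * \<phi> x) = 0"
  shows "AE x in lborel. G x = 0"
proof -
  define K :: "nat \<Rightarrow> (real^'n) set" where "K r = box (\<chi> i. - real r) (\<chi> i. real r)" for r
  have "AE x in lborel. indicator (K r) x * G x = 0" for r :: nat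
  proof (rule density_unique_real)
    let ?f = "\<lambda>x::real^'n. indicator (K r) x * G x"
    have "integrable lborel (\<lambda>x. indicator (cbox (\<chi> i. - real r) (\<chi> i. real r)) x * G x)"
      using G(1) unfolding locally_integrable_def set_integrable_def by auto
    then have f: "integrable lborel ?f"
      by (rule Bochner_Integration.integrable_bound) (use G(2) in \<open>auto simp: K_def indicator_def dest: box_subset_cbox[THEN subsetD]\<close>)
    then show "integrable lborel ?f" .
    show "integrable lborel (\<lambda>x. 0::real)" by simp
    have base: "(LINT x|lborel. indicator (box a b) x * ?f x) = 0" for a b
    proof -
      obtain c d where "box a b \<inter> K r = box c d" unfolding K_def Int_interval_cart box_Int_box by blast
      then have "(\<lambda>x. indicator (box a b) x * ?f x) = (\<lambda>x. indicator (box c d) x * G x)"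
        by (auto simp: indicator_inter_arith[symmetric] mult.assoc[symmetric])
      then show ?thesis using integral_box_eq_0[OF G orth] by simp
    qed
    have "(LINT x|lborel. indicator A x * ?f x) = 0" if A: "A \<in> sets borel" for A
    proof -
      let ?E = "range (\<lambda>(a, b). box a b :: (real^'n) set)"
      have "Int_stable ?E" "?E \<subseteq> Pow UNIV" "A \<in> sigma_sets UNIV ?E"
        using A by (auto simp: Int_stable_def box_Int_box borel_eq_box sets_measure_of)
      then show ?thesis
      proof (induction rule: sigma_sets_induct_disjoint)
        case (basic A) then show ?case using base by auto
      next
        case empty then show ?case by simp
      next
        case (compl A)
        then have A: "A \<in> sets borel" unfolding borel_eq_box by (simp add: sets_measure_of)
        have "(LINT x|lborel. indicator (UNIV - A) x * ?f x) = (LINT x|lborel. (?f x - indicator A x * ?f x))"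
          by (intro Bochner_Integration.integral_cong) (auto simp: indicator_def)
        also have "\<dots> = (LINT x|lborel. ?f x) - (LINT x|lborel. indicator A x * ?f x)"
          using integrable_mult_indicator[of A lborel ?f] A f by (intro Bochner_Integration.integral_diff) auto
        \<comment> \<open>The total integral is itself an integral over the box \<open>K r\<close>,
          so complements reduce to \<open>base\<close>.\<close>
        also have "(LINT x|lborel. ?f x) = (LINT x|lborel. indicator (K r) x * ?f x)"
          by (intro Bochner_Integration.integral_cong) (auto simp: indicator_def)
        finally show ?case using compl.IH base unfolding K_def by simp
      next
        case (union A)
        then have A: "A i \<in> sets lborel" for i using sets_measure_of[of "range (\<lambda>(a, b). box a b)" "UNIV :: (real^'n) set"]
          unfolding sets_lborel borel_eq_box by blast
        then have U: "(\<Union>i. A i) \<in> sets lborel" by blast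
        have "set_integrable lborel (\<Union>i. A i) ?f"
          unfolding set_integrable_def using integrable_mult_indicator[OF U f] by simp
        from lebesgue_integral_countable_add[OF A _ this] union show ?case
          by (simp add: set_lebesgue_integral_def disjoint_family_on_def)
      qed
    qed
    then show "(LINT x:A|lborel. ?f x) = (LINT x:A|lborel. 0)" if "A \<in> sets lborel" for A
      using that by (simp add: set_lebesgue_integral_def)
  qed
  then have "AE x in lborel. \<forall>r. indicator (K r) x * G x = 0" unfolding AE_all_countable ..
  then show ?thesis
  proof eventually_elim
    case (elim x)
    obtain r where r: "norm x < real r" using reals_Archimedean2 by blast
    have "- real r < x $ i \<and> x $ i < real r" for i using component_le_norm_cart[of x i] r by linarith
    then have "x \<in> K r" by (simp add: K_def mem_box_cart)
    then show ?case using elim[rule_format, of r] by simp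
  qed
qed

section \<open>Complex test functions\<close>

lemma norm_vec_sq: "(norm (x :: 'b::real_normed_vector^'k::finite))\<^sup>2 = (\<Sum>i\<in>UNIV. (norm (x $ i))\<^sup>2)"
  by (simp add: norm_vec_def L2_set_def sum_nonneg)

lemma n2_vec:
  fixes F :: "real^'n::finite \<Rightarrow> 'b::euclidean_space^'k::finite"
  assumes "\<And>i. sqi (\<lambda>x. F x $ i)"
  shows "sqi F" "n2 F = (\<Sum>i\<in>UNIV. n2 (\<lambda>x. F x $ i))"
proof -
  have "F \<in> borel_measurable lborel"
    using borel_measurable_vec_lambda[of "\<lambda>i x. F x $ i" lborel] assms by (simp add: sqi_def)
  then show "sqi F" using assms unfolding sqi_def norm_vec_sq by auto
  show "n2 F = (\<Sum>i\<in>UNIV. n2 (\<lambda>x. F x $ i))"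
    unfolding n2_def norm_vec_sq using assms by (intro Bochner_Integration.integral_sum) (auto simp: sqi_def)
qed

lemma borel_measurable_vec_nth:
  fixes F :: "'a \<Rightarrow> 'b::euclidean_space^'k::finite"
  shows "F \<in> borel_measurable M \<Longrightarrow> (\<lambda>x. F x $ i) \<in> borel_measurable M"
  by (rule borel_measurable_continuous_on[where f = "\<lambda>y. y $ i"]) (auto intro: continuous_intros)

lemma sqi_vec_nth:
  fixes F :: "real^'n::finite \<Rightarrow> 'b::euclidean_space^'k::finite"
  assumes "sqi F" shows "sqi (\<lambda>x. F x $ i)" "n2 (\<lambda>x. F x $ i) \<le> n2 F"
proof -
  have le: "(norm (F x $ i))\<^sup>2 \<le> (norm (F x))\<^sup>2" for x by (intro power_mono Finite_Cartesian_Product.norm_nth_le) auto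
  have m: "(\<lambda>x. F x $ i) \<in> borel_measurable lborel" using assms borel_measurable_vec_nth unfolding sqi_def by blast
  have i: "integrable lborel (\<lambda>x. (norm (F x $ i))\<^sup>2)"
  proof (rule Bochner_Integration.integrable_bound[of lborel "\<lambda>x. (norm (F x))\<^sup>2"])
    show "integrable lborel (\<lambda>x. (norm (F x))\<^sup>2)" using assms by (simp add: sqi_def)
    show "(\<lambda>x. (norm (F x $ i))\<^sup>2) \<in> borel_measurable lborel" using m by simp
    show "AE x in lborel. norm ((norm (F x $ i))\<^sup>2) \<le> norm ((norm (F x))\<^sup>2)"
      using le by (intro AE_I2) (simp only: real_norm_def abs_power2)
  qed
  with m show "sqi (\<lambda>x. F x $ i)" by (simp add: sqi_def)
  show "n2 (\<lambda>x. F x $ i) \<le> n2 F"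
    unfolding n2_def by (rule integral_mono[OF i _ le]) (use assms in \<open>simp add: sqi_def\<close>)
qed

lemma n2_complex:
  fixes f :: "real^'n::finite \<Rightarrow> complex"
  assumes "sqi (\<lambda>x. Re (f x))" "sqi (\<lambda>x. Im (f x))"
  shows "sqi f" "n2 f = n2 (\<lambda>x. Re (f x)) + n2 (\<lambda>x. Im (f x))"
proof -
  have "f \<in> borel_measurable lborel" using assms by (auto simp: sqi_def borel_measurable_complex_iff)
  then show "sqi f" using assms by (auto simp: sqi_def cmod_power2)
  show "n2 f = n2 (\<lambda>x. Re (f x)) + n2 (\<lambda>x. Im (f x))"
    using assms by (simp add: n2_def cmod_power2 sqi_def)
qed

lemma sqi_complex_parts:
  fixes f :: "real^'n::finite \<Rightarrow> complex"
  assumes "sqi f" shows "sqi (\<lambda>x. Re (f x))" "sqi (\<lambda>x. Im (f x))"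
proof -
  have [measurable]: "f \<in> borel_measurable lborel" and i: "integrable lborel (\<lambda>x. (cmod (f x))\<^sup>2)" using assms by (auto simp: sqi_def)
  have "integrable lborel (\<lambda>x. (Re (f x))\<^sup>2)" "integrable lborel (\<lambda>x. (Im (f x))\<^sup>2)"
    by (rule Bochner_Integration.integrable_bound[OF i]; simp add: cmod_power2)+
  then show "sqi (\<lambda>x. Re (f x))" "sqi (\<lambda>x. Im (f x))" by (auto simp: sqi_def)
qed

definition jac :: "(real^'n::finite \<Rightarrow> complex) \<Rightarrow> real^'n \<Rightarrow> complex^'n^'n" where
  "jac f x = (\<chi> i j. partial j (partial i f) x)"

lemma test_function_differentiable: "test_function f \<Longrightarrow> f differentiable (at x)"
  using C_k.simps(2)[of 0 f] unfolding test_function_def by blast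

lemma test_function_partial: "test_function f \<Longrightarrow> test_function (partial i f)"
  unfolding test_function_iff by (metis C_k.simps(2) partial_zero_outside)

lemma test_function_mult: "test_function f \<Longrightarrow> test_function g \<Longrightarrow> test_function (\<lambda>x. f x * g x)"
  unfolding test_function_iff by (metis C_k_mult mult_zero_left)

lemma partial_diff:
  assumes "f differentiable (at x)" "g differentiable (at x)"
  shows "partial i (\<lambda>x. f x - g x) x = partial i f x - partial i g x"
  by (rule partial_eqI[THEN trans, OF has_derivative_diff[OF has_derivative_partial has_derivative_partial]])
     (use assms in \<open>auto simp: axis_def if_distrib[of "\<lambda>z. z *\<^sub>R _"] cong: if_cong\<close>)

lemma complex_differentiable:
  fixes f :: "real^'n::finite \<Rightarrow> complex"
  assumes "(\<lambda>x. Re (f x)) differentiable (at x)" "(\<lambda>x. Im (f x)) differentiable (at x)"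
  shows "f differentiable (at x)"
proof -
  have "(\<lambda>x. complex_of_real (Re (f x)) + \<i> * complex_of_real (Im (f x))) differentiable (at x)"
    by (intro differentiable_add differentiable_mult differentiable_const
        partial_bounded_linear_compose(1)[OF bounded_linear_of_real] assms)
  then show ?thesis by (simp add: complex_eq[symmetric])
qed

lemma partial_complex:
  fixes f :: "real^'n::finite \<Rightarrow> complex"
  assumes "(\<lambda>x. Re (f x)) differentiable (at x)" "(\<lambda>x. Im (f x)) differentiable (at x)"
  shows "Re (partial i f x) = partial i (\<lambda>x. Re (f x)) x" "Im (partial i f x) = partial i (\<lambda>x. Im (f x)) x"
  using partial_bounded_linear_compose(2)[OF bounded_linear_Re complex_differentiable[OF assms]]
    partial_bounded_linear_compose(2)[OF bounded_linear_Im complex_differentiable[OF assms]] by simp_all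

definition cschwartz :: "(real^'n::finite \<Rightarrow> complex) \<Rightarrow> bool" where
  "cschwartz f \<longleftrightarrow> schwartz (\<lambda>x. Re (f x)) \<and> schwartz (\<lambda>x. Im (f x))"

lemma cschwartz_parts: "cschwartz f \<Longrightarrow> schwartz (\<lambda>x. Re (f x))" "cschwartz f \<Longrightarrow> schwartz (\<lambda>x. Im (f x))"
  by (simp_all add: cschwartz_def)

lemma test_function_cschwartz: "test_function f \<Longrightarrow> cschwartz f"
  by (simp add: cschwartz_def test_function_parts)

lemma cschwartz_differentiable: "cschwartz f \<Longrightarrow> f differentiable (at x)"
  by (simp add: cschwartz_def complex_differentiable schwartz_differentiable)

lemma parts_partial:
  assumes "cschwartz f"
  shows "(\<lambda>x. Re (partial i f x)) = partial i (\<lambda>x. Re (f x))" "(\<lambda>x. Im (partial i f x)) = partial i (\<lambda>x. Im (f x))"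
  using assms by (auto simp: cschwartz_def partial_complex schwartz_differentiable)

lemma cschwartz_partial: "cschwartz f \<Longrightarrow> cschwartz (partial i f)"
  unfolding cschwartz_def[of "partial i f"] using parts_partial[of f i] by (simp add: cschwartz_def schwartz_partial)

lemma cschwartz_diff: "cschwartz f \<Longrightarrow> cschwartz g \<Longrightarrow> cschwartz (\<lambda>x. f x - g x)"
  by (simp add: cschwartz_def schwartz_diff)

lemma grad_diff:
  assumes "cschwartz f" "cschwartz g"
  shows "grad (\<lambda>x. f x - g x) x = grad f x - grad g x"
  using assms by (simp add: grad_def vec_eq_iff partial_diff cschwartz_differentiable)

lemma jac_diff:
  assumes "cschwartz f" "cschwartz g"
  shows "jac (\<lambda>x. f x - g x) x = jac f x - jac g x"
proof -
  have "partial i (\<lambda>x. f x - g x) = (\<lambda>x. partial i f x - partial i g x)" for i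
    using assms by (auto simp: partial_diff cschwartz_differentiable)
  then show ?thesis using assms
    by (simp add: jac_def vec_eq_iff partial_diff cschwartz_differentiable cschwartz_partial)
qed

lemma cschwartz_sqi:
  assumes f: "cschwartz f"
  shows "sqi f" "n2 f = isq (\<lambda>x. Re (f x)) + isq (\<lambda>x. Im (f x))"
  using n2_complex[of f] sqi_schwartz[OF cschwartz_parts(1)[OF f]] sqi_schwartz[OF cschwartz_parts(2)[OF f]]
  unfolding n2_schwartz by auto

lemma parts_partial_partial:
  assumes "cschwartz f"
  shows "(\<lambda>x. Re (partial j (partial i f) x)) = partial j (partial i (\<lambda>x. Re (f x)))"
    "(\<lambda>x. Im (partial j (partial i f) x)) = partial j (partial i (\<lambda>x. Im (f x)))"
  using parts_partial[OF cschwartz_partial[OF assms]] parts_partial[OF assms] by auto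

lemma cschwartz_grad:
  assumes f: "cschwartz f"
  shows "sqi (grad f)" "n2 (grad f) = gsq (\<lambda>x. Re (f x)) + gsq (\<lambda>x. Im (f x))"
proof -
  have c: "(\<lambda>x. grad f x $ i) = partial i f" for i by (simp add: grad_def)
  note t = cschwartz_sqi[OF cschwartz_partial[OF f]]
  show "sqi (grad f)" by (rule n2_vec) (simp add: c t)
  have "n2 (grad f) = (\<Sum>i\<in>UNIV. n2 (\<lambda>x. grad f x $ i))" by (rule n2_vec) (simp add: c t)
  then show "n2 (grad f) = gsq (\<lambda>x. Re (f x)) + gsq (\<lambda>x. Im (f x))"
    unfolding c t(2) parts_partial[OF f] by (simp add: gip_def sum.distrib)
qed

lemma schwartz_weighted:
  assumes "schwartz g" shows "sqi (\<lambda>x. norm x * g x)" "n2 (\<lambda>x. norm x * g x) = ip (sq g) g"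
proof -
  have e: "(norm (norm x * g x))\<^sup>2 = sq g x * g x" for x by (simp add: sq_def power2_eq_square)
  have "(\<lambda>x. norm x * g x) \<in> borel_measurable borel" using schwartz_measurable[OF assms] by simp
  then show "sqi (\<lambda>x. norm x * g x)" unfolding sqi_def e using ip_integrable[OF schwartz_sq assms] assms by simp
  show "n2 (\<lambda>x. norm x * g x) = ip (sq g) g" unfolding n2_def e ip_def ..
qed

lemma cschwartz_weighted_grad:
  assumes f: "cschwartz f"
  shows "sqi (\<lambda>x. norm x *\<^sub>R grad f x)"
    "n2 (\<lambda>x. norm x *\<^sub>R grad f x) = xip (\<lambda>x. Re (f x)) (\<lambda>x. Re (f x)) + xip (\<lambda>x. Im (f x)) (\<lambda>x. Im (f x))"
proof -
  let ?u = "\<lambda>x. Re (f x)" and ?v = "\<lambda>x. Im (f x)"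
  have s: "schwartz (partial i ?u)" "schwartz (partial i ?v)" for i by (intro schwartz_partial cschwartz_parts[OF f])+
  have p: "(\<lambda>x. Re (norm x *\<^sub>R partial i f x)) = (\<lambda>x. norm x * partial i ?u x)" "(\<lambda>x. Im (norm x *\<^sub>R partial i f x)) = (\<lambda>x. norm x * partial i ?v x)" for i
    using fun_cong[OF parts_partial(1)[OF f, of i]] fun_cong[OF parts_partial(2)[OF f, of i]] by auto
  have c: "sqi (\<lambda>x. (norm x *\<^sub>R grad f x) $ i)" "n2 (\<lambda>x. (norm x *\<^sub>R grad f x) $ i) = ip (sq (partial i ?u)) (partial i ?u) + ip (sq (partial i ?v)) (partial i ?v)" for i
    using n2_complex[of "\<lambda>x. norm x *\<^sub>R partial i f x"] schwartz_weighted[OF s(1)] schwartz_weighted[OF s(2)]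
    unfolding p by (auto simp: grad_def)
  show "sqi (\<lambda>x. norm x *\<^sub>R grad f x)" by (rule n2_vec(1)[OF c(1)])
  show "n2 (\<lambda>x. norm x *\<^sub>R grad f x) = xip ?u ?u + xip ?v ?v"
    unfolding n2_vec(2)[OF c(1)] c(2) by (simp add: xip_def sum.distrib)
qed

lemma cschwartz_jac:
  assumes f: "cschwartz f"
  shows "sqi (jac f)" "n2 (jac f) = isq (laplacian (\<lambda>x. Re (f x))) + isq (laplacian (\<lambda>x. Im (f x)))"
proof -
  have c: "(\<lambda>x. jac f x $ i $ j) = partial j (partial i f)" for i j by (simp add: jac_def)
  note t = cschwartz_sqi[OF cschwartz_partial[OF cschwartz_partial[OF f]]]
  have r: "sqi (\<lambda>x. jac f x $ i)" "n2 (\<lambda>x. jac f x $ i) = (\<Sum>j\<in>UNIV. n2 (partial j (partial i f)))" for i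
    using n2_vec[of "\<lambda>x. jac f x $ i"] unfolding c by (auto simp: t)
  show "sqi (jac f)" by (rule n2_vec(1)[OF r(1)])
  show "n2 (jac f) = isq (laplacian (\<lambda>x. Re (f x))) + isq (laplacian (\<lambda>x. Im (f x)))"
    unfolding n2_vec(2)[OF r(1)] r(2) t(2) parts_partial_partial[OF f]
    using ip_hessian[OF cschwartz_parts(1)[OF f]] ip_hessian[OF cschwartz_parts(2)[OF f]] by (simp add: sum.distrib)
qed

text \<open>By \<open>ip_hessian\<close> the Laplacian in the seminorm may be replaced by the full
  matrix of second derivatives, so the seminorm controls the Jacobians of the gradients.\<close>

lemma X_seminorm_sq:
  assumes f: "cschwartz f"
  shows "(X_seminorm f)\<^sup>2 = n2 (jac f) + n2 (\<lambda>x. norm x *\<^sub>R grad f x)" "X_seminorm f \<ge> 0"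
proof -
  let ?u = "\<lambda>x. Re (f x)" and ?v = "\<lambda>x. Im (f x)"
  have "(norm (laplacian f x))\<^sup>2 = (laplacian ?u x)\<^sup>2 + (laplacian ?v x)\<^sup>2" for x
    unfolding laplacian_def cmod_power2 Re_sum Im_sum
    using fun_cong[OF parts_partial_partial(1)[OF f]] fun_cong[OF parts_partial_partial(2)[OF f]] by simp
  moreover have "integrable lborel (\<lambda>x. (laplacian ?u x)\<^sup>2)" "integrable lborel (\<lambda>x. (laplacian ?v x)\<^sup>2)"
    using sqi_schwartz[OF schwartz_laplacian[OF cschwartz_parts(1)[OF f]]] sqi_schwartz[OF schwartz_laplacian[OF cschwartz_parts(2)[OF f]]]
    by (auto simp: sqi_def)
  ultimately have "(LINT x|lborel. (norm (laplacian f x))\<^sup>2) = n2 (jac f)"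
    unfolding cschwartz_jac(2)[OF f] by (simp add: ip_def power2_eq_square)
  moreover have "(LINT x|lborel. (norm x)\<^sup>2 * (norm (grad f x))\<^sup>2) = n2 (\<lambda>x. norm x *\<^sub>R grad f x)"
    by (simp add: n2_def power_mult_distrib)
  ultimately have e: "X_seminorm f = sqrt (n2 (jac f) + n2 (\<lambda>x. norm x *\<^sub>R grad f x))" by (simp add: X_seminorm_def)
  then show "(X_seminorm f)\<^sup>2 = n2 (jac f) + n2 (\<lambda>x. norm x *\<^sub>R grad f x)" "X_seminorm f \<ge> 0" by (simp_all add: n2_nonneg)
qed

text \<open>The uncertainty estimate with c = 1, applied to each partial derivative. It puts the
  gradients of elements of the completion into the unweighted L2 space.\<close>

lemma gip_le_energy:
  fixes f :: "real^'n::finite \<Rightarrow> real"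
  assumes f: "schwartz f"
  shows "real CARD('n) * gip f f \<le> isq (laplacian f) + xip f f"
proof -
  have "real CARD('n) * gip f f = (\<Sum>i\<in>UNIV. 1 * real CARD('n) * isq (partial i f))" by (simp add: gip_def sum_distrib_left)
  also have "\<dots> \<le> (\<Sum>i\<in>UNIV. gsq (partial i f) + 1\<^sup>2 * ip (sq (partial i f)) (partial i f))"
    by (intro sum_mono uncertainty_square schwartz_partial f)
  also have "\<dots> = isq (laplacian f) + xip f f"
    unfolding ip_hessian[OF f, symmetric] by (simp add: gip_def xip_def sum.distrib)
  finally show ?thesis .
qed

lemma grad_le_X_seminorm:
  fixes f :: "real^'n::finite \<Rightarrow> complex"
  assumes f: "cschwartz f" shows "n2 (grad f) \<le> (X_seminorm f)\<^sup>2"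
proof -
  have "n2 (grad f) \<le> real CARD('n) * n2 (grad f)" using n2_nonneg[of "grad f"] by (simp add: mult_le_cancel_right1)
  then show ?thesis
    using gip_le_energy[OF cschwartz_parts(1)[OF f]] gip_le_energy[OF cschwartz_parts(2)[OF f]]
    unfolding X_seminorm_sq(1)[OF f] cschwartz_grad(2)[OF f] cschwartz_weighted_grad(2)[OF f] cschwartz_jac(2)[OF f]
    by (simp add: distrib_left)
qed

section \<open>Weak Jacobians\<close>

lemma l2_product_tendsto:
  fixes f :: "nat \<Rightarrow> real^'n::finite \<Rightarrow> complex"
  assumes f: "\<And>n. sqi (f n)" and F: "sqi F" and g: "sqi g" and lim: "(\<lambda>n. n2 (\<lambda>x. f n x - F x)) \<longlonglongrightarrow> 0"
  shows "(\<lambda>n. LINT x|lborel. f n x * g x) \<longlonglongrightarrow> (LINT x|lborel. F x * g x)"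
proof -
  have [measurable]: "F \<in> borel_measurable lborel" "g \<in> borel_measurable lborel" "f n \<in> borel_measurable lborel" for n
    using f F g by (auto simp: sqi_def)
  have i: "integrable lborel (\<lambda>x. h x * g x)" if "sqi h" for h :: "real^'n \<Rightarrow> complex"
  proof -
    have [measurable]: "h \<in> borel_measurable lborel" using that by (simp add: sqi_def)
    show ?thesis by (rule l2_pairing(1)[OF that g]) (auto simp: norm_mult)
  qed
  have "(\<lambda>n. LINT x|lborel. (f n x - F x) * g x) \<longlonglongrightarrow> 0"
    by (rule l2_pairing_tendsto[OF sqi_diff[OF f F] g _ _ lim]) (auto simp: norm_mult)
  moreover have "(LINT x|lborel. (f n x - F x) * g x) = (LINT x|lborel. f n x * g x) - (LINT x|lborel. F x * g x)" for n
    using i[OF f[of n]] i[OF F] by (simp add: left_diff_distrib)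
  ultimately show ?thesis by (simp add: LIM_zero_iff)
qed

lemma integral_partial_test_function:
  fixes f :: "real^'n::finite \<Rightarrow> complex"
  assumes f: "test_function f" shows "integrable lborel f" "(LINT x|lborel. partial i f x) = 0"
proof -
  have int: "integrable lborel f" if "test_function f" for f :: "real^'n \<Rightarrow> complex"
  proof -
    have "integrable lborel (\<lambda>x. complex_of_real (Re (f x)) + \<i> * complex_of_real (Im (f x)))"
      using schwartz_integrable[OF test_function_parts(1)[OF that]] schwartz_integrable[OF test_function_parts(2)[OF that]]
      by (intro Bochner_Integration.integrable_add integrable_mult_right integrable_of_real) auto
    then show ?thesis by (simp add: complex_eq[symmetric])
  qed
  then show "integrable lborel f" using f by blast
  have z: "(LINT x|lborel. partial i u x) = 0" if "schwartz u" for u :: "real^'n \<Rightarrow> real"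
    using that by (intro integral_partial_eq_0 schwartz_integrable schwartz_differentiable schwartz_continuous schwartz_decays schwartz_partial)
  note ip = int[OF test_function_partial[OF f, of i]]
  show "(LINT x|lborel. partial i f x) = 0"
    using integral_bounded_linear[OF bounded_linear_Re ip] integral_bounded_linear[OF bounded_linear_Im ip]
    unfolding parts_partial[OF test_function_cschwartz[OF f]] z[OF test_function_parts(1)[OF f]] z[OF test_function_parts(2)[OF f]] by (simp add: complex_eq_iff)
qed

lemma test_function_by_parts:
  assumes f: "test_function f" and g: "test_function g"
  shows "(LINT x|lborel. f x * partial j g x) = - (LINT x|lborel. partial j f x * g x)"
proof -
  have "partial j (\<lambda>x. f x * g x) = (\<lambda>x. f x * partial j g x + partial j f x * g x)"
    using f g by (auto simp: partial_mult test_function_differentiable)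
  then have "(LINT x|lborel. (f x * partial j g x + partial j f x * g x)) = 0"
    using integral_partial_test_function(2)[OF test_function_mult[OF f g], of j] by simp
  then show ?thesis
    using integral_partial_test_function(1)[OF test_function_mult[OF f test_function_partial[OF g]]]
      integral_partial_test_function(1)[OF test_function_mult[OF test_function_partial[OF f] g]]
    by (simp add: add_eq_0_iff2)
qed

lemma sqi_locally_integrable:
  fixes F :: "real^'n::finite \<Rightarrow> 'b::euclidean_space"
  assumes "sqi F" shows "locally_integrable F"
  unfolding locally_integrable_def set_integrable_def
proof (intro allI impI)
  fix K :: "(real^'n) set" assume K: "compact K"
  have m: "K \<in> sets borel" using K by (simp add: borel_closed compact_imp_closed)
  have "sqi (indicator K :: real^'n \<Rightarrow> real)"
    using m emeasure_compact_finite[OF K] by (simp add: sqi_def power2_eq_square indicator_inter_arith[symmetric])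
  then show "integrable lborel (\<lambda>x. indicator K x *\<^sub>R F x)"
    by (rule l2_pairing(1)[OF assms]) (use assms m in \<open>auto simp: sqi_def\<close>)
qed

text \<open>The fundamental lemma is applied to the real and imaginary part of each entry.
  \<open>l\<close> abstracts from \<open>Re\<close> and \<open>Im\<close>, of which only linearity
  and compatibility with real factors are used.\<close>

lemma weak_jacobian_unique:
  assumes V: "is_weak_jacobian U V" and W: "is_weak_jacobian U W"
  shows "AE x in lborel. V x = W x"
proof -
  have meas: "V \<in> borel_measurable lborel" "W \<in> borel_measurable lborel" and loc: "locally_integrable V" "locally_integrable W"
    using V W by (auto simp: is_weak_jacobian_def)
  have parts: "AE x in lborel. l (V x $ i $ j - W x $ i $ j) = 0"
    if l: "bounded_linear l" "\<And>z r. l (z * complex_of_real r) = l z * r" for l :: "complex \<Rightarrow> real" and i j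
  proof (rule fundamental_lemma)
    interpret bounded_linear l by (rule l)
    have bl: "bounded_linear (\<lambda>Z :: complex^'a^'a. l (Z $ i $ j))"
      by (intro bounded_linear_compose[OF l(1)] bounded_linear_compose[OF bounded_linear_vec_nth] bounded_linear_vec_nth)
    show "locally_integrable (\<lambda>x. l (V x $ i $ j - W x $ i $ j))"
      unfolding locally_integrable_def set_integrable_def
    proof (intro allI impI)
      fix K :: "(real^'a) set" assume K: "compact K"
      have "integrable lborel (\<lambda>x. indicator K x *\<^sub>R V x - indicator K x *\<^sub>R W x)"
        using loc K by (auto simp: locally_integrable_def set_integrable_def)
      from integrable_bounded_linear[OF bl this] show "integrable lborel (\<lambda>x. indicator K x *\<^sub>R l (V x $ i $ j - W x $ i $ j))"
        by (simp add: scaleR_diff_right[symmetric] scaleR)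
    qed
    have "(\<lambda>x. V x - W x) \<in> borel_measurable lborel" using meas by simp
    from borel_measurable_continuous_on[OF linear_continuous_on[OF bl] this]
    show "(\<lambda>x. l (V x $ i $ j - W x $ i $ j)) \<in> borel_measurable lborel" by simp
    fix \<phi> :: "real^'a \<Rightarrow> real" assume \<phi>: "schwartz \<phi>" "\<exists>R. \<forall>x. norm x > R \<longrightarrow> \<phi> x = 0"
    then obtain R where R: "\<And>x. norm x > R \<Longrightarrow> \<phi> x = 0" by blast
    obtain C where C: "\<And>x. \<bar>\<phi> x\<bar> \<le> C" using decays_bounded[OF schwartz_decays[OF \<phi>(1)]] by blast
    have int: "integrable lborel (\<lambda>x. Z x $ i $ j * complex_of_real (\<phi> x))"
      if Z: "locally_integrable Z" "Z \<in> borel_measurable lborel" for Z :: "real^'a \<Rightarrow> complex^'a^'a"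
    proof (rule Bochner_Integration.integrable_bound)
      show "integrable lborel (\<lambda>x. C *\<^sub>R (indicator (cball 0 R) x *\<^sub>R Z x))"
        using Z(1) by (intro integrable_scaleR_right) (simp add: locally_integrable_def set_integrable_def)
      show "(\<lambda>x. Z x $ i $ j * complex_of_real (\<phi> x)) \<in> borel_measurable lborel"
        using schwartz_measurable[OF \<phi>(1)] borel_measurable_vec_nth[OF borel_measurable_vec_nth[OF Z(2)]] by simp
      show "AE x in lborel. norm (Z x $ i $ j * complex_of_real (\<phi> x)) \<le> norm (C *\<^sub>R (indicator (cball 0 R) x *\<^sub>R Z x))"
      proof (rule AE_I2)
        fix x
        have "norm (Z x $ i $ j) \<le> norm (Z x)" by (meson Finite_Cartesian_Product.norm_nth_le order_trans)
        then have "norm (Z x $ i $ j) * \<bar>\<phi> x\<bar> \<le> norm (Z x) * C" using C by (intro mult_mono) auto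
        then show "norm (Z x $ i $ j * complex_of_real (\<phi> x)) \<le> norm (C *\<^sub>R (indicator (cball 0 R) x *\<^sub>R Z x))"
          using R[of x] C[of x] by (cases "norm x \<le> R") (auto simp: norm_mult mult.commute)
      qed
    qed
    have "(LINT x|lborel. V x $ i $ j * complex_of_real (\<phi> x)) = (LINT x|lborel. W x $ i $ j * complex_of_real (\<phi> x))"
    proof -
      have "- (LINT x|lborel. Z x $ i $ j * complex_of_real (\<phi> x)) = (LINT x|lborel. U x $ i * partial j (\<lambda>x. complex_of_real (\<phi> x)) x)"
        if "is_weak_jacobian U Z" for Z
        using that test_function_of_real[OF \<phi>(1) R] unfolding is_weak_jacobian_def by simp
      from trans[OF this[OF V] this[OF W, symmetric]] show ?thesis by (rule iffD1[OF neg_equal_iff_equal])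
    qed
    then have z: "(LINT x|lborel. (V x $ i $ j * complex_of_real (\<phi> x) - W x $ i $ j * complex_of_real (\<phi> x))) = 0"
      using int[OF loc(1) meas(1)] int[OF loc(2) meas(2)] by simp
    have "(LINT x|lborel. l (V x $ i $ j - W x $ i $ j) * \<phi> x) = (LINT x|lborel. l (V x $ i $ j * complex_of_real (\<phi> x) - W x $ i $ j * complex_of_real (\<phi> x)))"
      by (simp add: l(2) left_diff_distrib[symmetric])
    also have "\<dots> = l (LINT x|lborel. (V x $ i $ j * complex_of_real (\<phi> x) - W x $ i $ j * complex_of_real (\<phi> x)))"
      by (rule integral_bounded_linear[OF l(1)]) (intro Bochner_Integration.integrable_diff int loc meas)
    finally show "(LINT x|lborel. l (V x $ i $ j - W x $ i $ j) * \<phi> x) = 0" unfolding z zero .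
  qed
  have "AE x in lborel. \<forall>i\<in>UNIV. \<forall>j\<in>UNIV. V x $ i $ j = W x $ i $ j"
  proof (intro AE_finite_allI finite)
    fix i j
    show "AE x in lborel. V x $ i $ j = W x $ i $ j"
      using parts[OF bounded_linear_Re, of i j] parts[OF bounded_linear_Im, of i j]
      by (auto simp: complex_eq_iff)
  qed
  then show ?thesis by (auto simp: vec_eq_iff)
qed

section \<open>Gradients of elements of the completion\<close>

text \<open>The seminorm makes the gradients and the Jacobians L2-Cauchy. Weighted convergence to
  \<open>U\<close> yields a subsequence that converges almost everywhere to \<open>U\<close>, so
  \<open>U\<close> is the unweighted limit of the gradients as well. The limit \<open>V\<close> of
  the Jacobians is the weak Jacobian by passing to the limit in the integration by parts.\<close>

lemma X_gradient_limit:
  fixes \<phi> :: "nat \<Rightarrow> real^'n::finite \<Rightarrow> complex" and U :: "real^'n \<Rightarrow> complex^'n"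
  assumes \<phi>: "\<phi> \<in> X_cauchy" and U: "U \<in> borel_measurable lborel"
    and lim: "(\<lambda>n. \<integral>\<^sup>+ x. ennreal ((norm x)\<^sup>2 * (norm (grad (\<phi> n) x - U x))\<^sup>2) \<partial>lborel) \<longlonglongrightarrow> 0"
  shows "\<exists>V. sqi U \<and> sqi V \<and> sqi (\<lambda>x. norm x *\<^sub>R U x) \<and> is_weak_jacobian U V
    \<and> (\<lambda>n. n2 (\<lambda>x. grad (\<phi> n) x - U x)) \<longlonglongrightarrow> 0 \<and> (\<lambda>n. n2 (\<lambda>x. jac (\<phi> n) x - V x)) \<longlonglongrightarrow> 0
    \<and> (\<lambda>n. n2 (\<lambda>x. norm x *\<^sub>R grad (\<phi> n) x - norm x *\<^sub>R U x)) \<longlonglongrightarrow> 0"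
proof -
  have tt: "test_function (\<phi> n)" for n using \<phi> by (simp add: X_cauchy_def)
  note t = test_function_cschwartz[OF tt]
  have sc: "\<exists>M. \<forall>m\<ge>M. \<forall>n\<ge>M. (X_seminorm (\<lambda>x. \<phi> m x - \<phi> n x))\<^sup>2 < e" if e: "e > 0" for e
  proof -
    obtain M where M: "\<And>m n. m \<ge> M \<Longrightarrow> n \<ge> M \<Longrightarrow> X_seminorm (\<lambda>x. \<phi> m x - \<phi> n x) < sqrt e"
      using \<phi> real_sqrt_gt_zero[OF e] unfolding X_cauchy_def by blast
    have "(X_seminorm (\<lambda>x. \<phi> m x - \<phi> n x))\<^sup>2 < e" if "m \<ge> M" "n \<ge> M" for m n
    proof -
      have "(X_seminorm (\<lambda>x. \<phi> m x - \<phi> n x))\<^sup>2 < (sqrt e)\<^sup>2"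
        by (intro power_strict_mono M that X_seminorm_sq(2) cschwartz_diff t) simp
      then show ?thesis using e by simp
    qed
    then show ?thesis by blast
  qed
  have gc: "\<exists>M. \<forall>m\<ge>M. \<forall>n\<ge>M. n2 (\<lambda>x. grad (\<phi> m) x - grad (\<phi> n) x) < e" if "e > 0" for e
    using sc[OF that] grad_le_X_seminorm[OF cschwartz_diff[OF t t]]
    unfolding grad_diff[OF t t] by (meson le_less_trans)
  have jc: "\<exists>M. \<forall>m\<ge>M. \<forall>n\<ge>M. n2 (\<lambda>x. jac (\<phi> m) x - jac (\<phi> n) x) < e" if "e > 0" for e
  proof -
    have "n2 (\<lambda>x. jac (\<phi> m) x - jac (\<phi> n) x) \<le> (X_seminorm (\<lambda>x. \<phi> m x - \<phi> n x))\<^sup>2" for m n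
      unfolding X_seminorm_sq(1)[OF cschwartz_diff[OF t t]] jac_diff[OF t t, symmetric] using n2_nonneg by (simp add: ext)
    then show ?thesis using sc[OF that] by (meson le_less_trans)
  qed
  let ?F = "\<lambda>n x. norm x *\<^sub>R grad (\<phi> n) x" and ?G = "\<lambda>x. norm x *\<^sub>R U x"
  note [measurable] = U
  have sF: "sqi (?F n)" for n by (rule cschwartz_weighted_grad(1)[OF t])
  have [measurable]: "?F n \<in> borel_measurable lborel" for n using sF[of n] by (simp add: sqi_def)
  have [measurable]: "?G \<in> borel_measurable lborel" by simp
  have e: "(norm x)\<^sup>2 * (norm (grad (\<phi> n) x - U x))\<^sup>2 = (norm (?F n x - ?G x))\<^sup>2" for n x
    by (simp add: scaleR_diff_right[symmetric] power_mult_distrib)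
  note lim' = lim[unfolded e]
  have "\<forall>\<^sub>F n in sequentially. (\<integral>\<^sup>+ x. ennreal ((norm (?F n x - ?G x))\<^sup>2) \<partial>lborel) < 1"
    using order_tendstoD(2)[OF lim'] by simp
  then obtain M where "(\<integral>\<^sup>+ x. ennreal ((norm (?F M x - ?G x))\<^sup>2) \<partial>lborel) < 1" using eventually_happens'[OF sequentially_bot] by blast
  then have "sqi (\<lambda>x. ?F M x - ?G x)" unfolding sqi_def
    by (intro conjI integrableI_bounded) (auto intro: less_trans)
  from sqi_diff[OF sF[of M] this] have sG: "sqi ?G" by simp
  note sFG = sqi_diff[OF sF sG]
  have "(\<lambda>n. ennreal (n2 (\<lambda>x. ?F n x - ?G x))) \<longlonglongrightarrow> 0"
    using lim' unfolding n2_def using sFG by (subst nn_integral_eq_integral[symmetric]) (auto simp: sqi_def)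
  then have wl: "(\<lambda>n. n2 (\<lambda>x. ?F n x - ?G x)) \<longlonglongrightarrow> 0"
    using tendsto_ennreal_iff[of "\<lambda>n. n2 (\<lambda>x. ?F n x - ?G x)" sequentially 0] by (simp add: n2_nonneg)
  have "\<exists>r::nat \<Rightarrow> nat. strict_mono r \<and> (AE x in lborel. (\<lambda>n. (norm (?F (r n) x - ?G x))\<^sup>2) \<longlonglongrightarrow> 0)"
    by (rule tendsto_L1_AE_subseq) (use sFG wl in \<open>auto simp: sqi_def n2_def\<close>)
  then obtain r :: "nat \<Rightarrow> nat" where r: "strict_mono r" "AE x in lborel. (\<lambda>n. (norm (?F (r n) x - ?G x))\<^sup>2) \<longlonglongrightarrow> 0" by blast
  \<comment> \<open>The weight is divided out off the origin, which is a null set.\<close>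
  have ae: "AE x in lborel. (\<lambda>n. grad (\<phi> (r n)) x) \<longlonglongrightarrow> U x"
    using r(2) AE_lborel_singleton[of "0::real^'n"]
  proof eventually_elim
    case (elim x)
    from tendsto_real_sqrt[OF elim(1)] have "(\<lambda>n. norm (?F (r n) x - ?G x)) \<longlonglongrightarrow> 0" by simp
    then have "(\<lambda>n. ?F (r n) x) \<longlonglongrightarrow> ?G x" by (simp add: tendsto_norm_zero_iff LIM_zero_iff)
    from tendsto_scaleR[OF tendsto_const[of "inverse (norm x)"] this] show ?case using elim(2) by simp
  qed
  note UU = l2_cauchy_limit[OF cschwartz_grad(1)[OF t] gc r(1) U ae]
  obtain s V where s: "strict_mono (s :: nat \<Rightarrow> nat)" "V \<in> borel_measurable lborel" "AE x in lborel. (\<lambda>n. jac (\<phi> (s n)) x) \<longlonglongrightarrow> V x"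
    using l2_cauchy_subsequence[OF cschwartz_jac(1)[OF t] jc] by blast
  note VV = l2_cauchy_limit[OF cschwartz_jac(1)[OF t] jc s]
  have "(LINT x|lborel. U x $ i * partial j \<psi> x) = - (LINT x|lborel. V x $ i $ j * \<psi> x)" if \<psi>: "test_function \<psi>" for \<psi> i j
  proof -
    have ti: "test_function (partial i (\<phi> n))" for n by (rule test_function_partial[OF tt])
    have 1: "(\<lambda>n. LINT x|lborel. partial i (\<phi> n) x * partial j \<psi> x) \<longlonglongrightarrow> (LINT x|lborel. U x $ i * partial j \<psi> x)"
    proof (rule l2_product_tendsto)
      have "n2 (\<lambda>x. partial i (\<phi> n) x - U x $ i) \<le> n2 (\<lambda>x. grad (\<phi> n) x - U x)" for n
        using sqi_vec_nth(2)[OF sqi_diff[OF cschwartz_grad(1)[OF t] UU(1)], of n i] by (simp add: grad_def)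
      then show "(\<lambda>n. n2 (\<lambda>x. partial i (\<phi> n) x - U x $ i)) \<longlonglongrightarrow> 0"
        by (intro tendsto_sandwich[OF _ _ tendsto_const UU(2)]) (auto simp: n2_nonneg)
    qed (auto intro: cschwartz_sqi[OF test_function_cschwartz] ti test_function_partial[OF \<psi>] sqi_vec_nth UU(1))
    have 2: "(\<lambda>n. LINT x|lborel. partial j (partial i (\<phi> n)) x * \<psi> x) \<longlonglongrightarrow> (LINT x|lborel. V x $ i $ j * \<psi> x)"
    proof (rule l2_product_tendsto)
      have sd: "sqi (\<lambda>x. jac (\<phi> n) x - V x)" for n by (rule sqi_diff[OF cschwartz_jac(1)[OF t] VV(1)])
      have "n2 (\<lambda>x. (jac (\<phi> n) x - V x) $ i $ j) \<le> n2 (\<lambda>x. jac (\<phi> n) x - V x)" for n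
        using sqi_vec_nth(2)[OF sqi_vec_nth(1)[OF sd[of n], of i], of j] sqi_vec_nth(2)[OF sd[of n], of i] by simp
      then have "n2 (\<lambda>x. partial j (partial i (\<phi> n)) x - V x $ i $ j) \<le> n2 (\<lambda>x. jac (\<phi> n) x - V x)" for n by (simp add: jac_def)
      then show "(\<lambda>n. n2 (\<lambda>x. partial j (partial i (\<phi> n)) x - V x $ i $ j)) \<longlonglongrightarrow> 0"
        by (intro tendsto_sandwich[OF _ _ tendsto_const VV(2)]) (auto simp: n2_nonneg)
    qed (auto intro: cschwartz_sqi[OF test_function_cschwartz] ti test_function_partial \<psi> sqi_vec_nth(1)[OF sqi_vec_nth(1)[OF VV(1)]])
    have "(\<lambda>n. LINT x|lborel. partial i (\<phi> n) x * partial j \<psi> x) \<longlonglongrightarrow> - (LINT x|lborel. V x $ i $ j * \<psi> x)"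
      unfolding test_function_by_parts[OF ti \<psi>] by (rule tendsto_minus[OF 2])
    then show ?thesis using 1 LIMSEQ_unique by blast
  qed
  then have "is_weak_jacobian U V"
    unfolding is_weak_jacobian_def using U s(2) sqi_locally_integrable[OF UU(1)] sqi_locally_integrable[OF VV(1)] by blast
  then show ?thesis using UU VV sG wl by blast
qed

lemma delta_CF_eq:
  fixes U :: "real^'n::finite \<Rightarrow> complex^'n"
  assumes "is_weak_jacobian U V"
  shows "delta_CF U = sqrt (n2 V) * sqrt (n2 (\<lambda>x. norm x *\<^sub>R U x)) - (real CARD('n) + 2) / 2 * n2 U"
proof -
  have w: "is_weak_jacobian U (weak_jacobian U)" unfolding weak_jacobian_def by (rule someI[of "is_weak_jacobian U", OF assms])
  have "(LINT x|lborel. (norm (weak_jacobian U x))\<^sup>2) = n2 V" unfolding n2_def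
    using weak_jacobian_unique[OF w assms] w assms by (intro integral_cong_AE) (auto simp: is_weak_jacobian_def)
  then show ?thesis by (simp add: delta_CF_def n2_def power_mult_distrib)
qed

section \<open>The comparison functions with complex parameters\<close>

definition lin :: "real^'n::finite \<Rightarrow> real^'n \<Rightarrow> real" where
  "lin a x = (\<Sum>i\<in>UNIV. a $ i * x $ i)"

definition quad :: "(real^'n::finite \<Rightarrow> real^'m::finite) \<Rightarrow> real^'m \<Rightarrow> real^'n \<Rightarrow> real" where
  "quad \<Phi> b x = (norm x)\<^sup>2 * (\<Sum>i\<in>UNIV. b $ i * \<Phi> (x /\<^sub>R norm x) $ i)"

lemma solid_harmonic_sum: "finite I \<Longrightarrow> (\<And>i. i \<in> I \<Longrightarrow> solid_harmonic k (h i)) \<Longrightarrow> solid_harmonic k (\<lambda>x. \<Sum>i\<in>I. h i x)"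
  by (induction I rule: finite_induct) (auto intro: solid_harmonic_zero solid_harmonic_add)

lemma solid_harmonic_component: "solid_harmonic 1 (\<lambda>x::real^'a::finite. x $ i)"
proof -
  have "partial k (partial k (\<lambda>x. x $ i)) = (\<lambda>x. 0)" for k :: 'a by (cases "k = i") simp_all
  then show ?thesis unfolding solid_harmonic_def by (simp add: polynomial_component laplacian_def)
qed

lemma solid_harmonic_lin: "solid_harmonic 1 (lin a)"
  unfolding lin_def[abs_def] by (intro solid_harmonic_sum solid_harmonic_cmult solid_harmonic_component) simp

text \<open>Homogeneity of degree 1 makes h(sx) linear in \<open>s\<close>, so \<open>h\<close>
  coincides with its derivative at the origin.\<close>

lemma lin_surj:
  assumes h: "solid_harmonic 1 h" shows "\<exists>a. h = lin a"
proof -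
  have t: "h (t *\<^sub>R x) = t * h x" for t x using h by (simp add: solid_harmonic_def)
  have h0: "h 0 = 0" using t[of 0 0] by simp
  have d: "(h has_derivative (\<lambda>y. \<Sum>i\<in>UNIV. y $ i *\<^sub>R partial i h 0)) (at 0)"
    by (rule has_derivative_partial[OF differentiable_at_real_polynomial_function[OF solid_harmonic_poly[OF h]]])
  have "h x = (\<Sum>i\<in>UNIV. x $ i *\<^sub>R partial i h 0)" for x
  proof -
    have "((\<lambda>s::real. s *\<^sub>R x) has_derivative (\<lambda>s. s *\<^sub>R x)) (at 0)" by (auto intro!: derivative_eq_intros)
    moreover have "(h has_derivative (\<lambda>y. \<Sum>i\<in>UNIV. y $ i *\<^sub>R partial i h 0)) (at (0 *\<^sub>R x))" using d by simp
    ultimately have "((\<lambda>s. h (s *\<^sub>R x)) has_derivative (\<lambda>s. \<Sum>i\<in>UNIV. (s *\<^sub>R x) $ i *\<^sub>R partial i h 0)) (at 0)"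
      by (rule has_derivative_compose)
    moreover have "((\<lambda>s. h (s *\<^sub>R x)) has_derivative (\<lambda>s. s * h x)) (at 0)" unfolding t by (auto intro!: derivative_eq_intros)
    ultimately have "(\<lambda>s. \<Sum>i\<in>UNIV. (s *\<^sub>R x) $ i *\<^sub>R partial i h 0) = (\<lambda>s. s * h x)" by (rule has_derivative_unique)
    from fun_cong[OF this, of 1] show ?thesis by simp
  qed
  then have "h = lin (\<chi> i. partial i h 0)" by (auto simp: lin_def mult.commute)
  then show ?thesis by blast
qed

lemma solid_harmonic_sphere:
  assumes "solid_harmonic 2 p" shows "(norm x)\<^sup>2 * p (x /\<^sub>R norm x) = p x"
proof -
  have t: "p (norm x *\<^sub>R (x /\<^sub>R norm x)) = (norm x)\<^sup>2 * p (x /\<^sub>R norm x)" using assms by (simp only: solid_harmonic_def)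
  show ?thesis
  proof (cases "x = 0")
    case True
    have "p (0 *\<^sub>R 0) = 0\<^sup>2 * p 0" using assms by (simp only: solid_harmonic_def)
    then show ?thesis using True by simp
  next
    case False then show ?thesis using t by simp
  qed
qed

lemma sphere_normalized: "x \<noteq> 0 \<Longrightarrow> x /\<^sub>R norm x \<in> sphere 0 1"
  by simp

text \<open>The components of the basis agree with solid harmonics on the sphere only; the radial
  extension by |x|^2 agrees with them everywhere by homogeneity, at the origin because both sides
  vanish.\<close>

lemma solid_harmonic_quad:
  fixes \<Phi> :: "real^'n::finite \<Rightarrow> real^'m::finite"
  assumes B: "spherical_harmonic_basis 2 \<Phi>" shows "solid_harmonic 2 (quad \<Phi> b)"
proof -
  obtain p where p: "\<And>i. solid_harmonic 2 (p i)" "\<And>i x. x \<in> sphere 0 1 \<Longrightarrow> \<Phi> x $ i = p i x"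
    using B unfolding spherical_harmonic_basis_def spherical_harmonic_def by metis
  have "(norm x)\<^sup>2 * \<Phi> (x /\<^sub>R norm x) $ i = p i x" for i x
  proof (cases "x = 0")
    case True then show ?thesis using solid_harmonic_sphere[OF p(1), of x i] by simp
  next
    case False
    then show ?thesis using solid_harmonic_sphere[OF p(1), of x i] p(2)[OF sphere_normalized] by simp
  qed
  then have "quad \<Phi> b = (\<lambda>x. \<Sum>i\<in>UNIV. b $ i * p i x)"
    by (auto simp: quad_def fun_eq_iff sum_distrib_left mult.left_commute[of _ "b $ _"])
  then show ?thesis using p(1) by (auto intro!: solid_harmonic_sum solid_harmonic_cmult)
qed

lemma quad_surj:
  fixes \<Phi> :: "real^'n::finite \<Rightarrow> real^'m::finite"
  assumes B: "spherical_harmonic_basis 2 \<Phi>" and h: "solid_harmonic 2 h" shows "\<exists>b. h = quad \<Phi> b"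
proof -
  have "spherical_harmonic 2 h" using h unfolding spherical_harmonic_def by blast
  then obtain b :: "real^'m" where b: "\<And>x. x \<in> sphere 0 1 \<Longrightarrow> h x = (\<Sum>i\<in>UNIV. b $ i * \<Phi> x $ i)"
    using B unfolding spherical_harmonic_basis_def by metis
  have "h x = quad \<Phi> b x" for x
  proof (cases "x = 0")
    case True then show ?thesis using solid_harmonic_sphere[OF h, of x] by (simp add: quad_def)
  next
    case False
    then show ?thesis using solid_harmonic_sphere[OF h, of x] b[OF sphere_normalized] by (simp add: quad_def)
  qed
  then show ?thesis by blast
qed

text \<open>The indexing by \<open>j\<close> matches \<open>rw\<close>, so that the four cases are
  treated at once.\<close>

definition wj :: "nat \<Rightarrow> (real^'n::finite \<Rightarrow> real^'m::finite) \<Rightarrow> ('n, 'm) params \<Rightarrow> real^'n \<Rightarrow> complex" where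
  "wj j \<Phi> P = (if j = 0 then w0 P else if j = 1 then w1 P else if j = 2 then w2 \<Phi> P else w3 \<Phi> P)"

definition Rev :: "complex^'k::finite \<Rightarrow> real^'k" where "Rev a = (\<chi> i. Re (a $ i))"
definition Imv :: "complex^'k::finite \<Rightarrow> real^'k" where "Imv a = (\<chi> i. Im (a $ i))"

lemma wj_parts:
  "(\<lambda>x. Re (wj j \<Phi> (\<alpha>, \<tau>, a, b, \<beta>) x)) = rw j \<beta> (Re \<alpha>) (Re \<tau>) (lin (Rev a)) (quad \<Phi> (Rev b))"
  "(\<lambda>x. Im (wj j \<Phi> (\<alpha>, \<tau>, a, b, \<beta>) x)) = rw j \<beta> (Im \<alpha>) (Im \<tau>) (lin (Imv a)) (quad \<Phi> (Imv b))"
  by (auto simp: wj_def rw_def fun_eq_iff gauss_def bilinear_dot_def lin_def quad_def Rev_def Imv_def)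

lemma n2_complex_vec:
  fixes G :: "real^'n::finite \<Rightarrow> complex^'k::finite"
  assumes G: "sqi G"
  shows "sqi (\<lambda>x. Rev (G x))" "sqi (\<lambda>x. Imv (G x))" "n2 G = n2 (\<lambda>x. Rev (G x)) + n2 (\<lambda>x. Imv (G x))"
proof -
  note c = sqi_vec_nth(1)[OF G]
  have s: "sqi (\<lambda>x. Rev (G x) $ i)" "sqi (\<lambda>x. Imv (G x) $ i)" for i
    using sqi_complex_parts[OF c, of i] by (simp_all add: Rev_def Imv_def)
  then show "sqi (\<lambda>x. Rev (G x))" "sqi (\<lambda>x. Imv (G x))" by (auto intro: n2_vec)
  show "n2 G = n2 (\<lambda>x. Rev (G x)) + n2 (\<lambda>x. Imv (G x))"
    unfolding n2_vec(2)[OF c] n2_vec(2)[OF s(1)] n2_vec(2)[OF s(2)] n2_complex(2)[OF sqi_complex_parts[OF c]]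
    by (simp add: sum.distrib Rev_def Imv_def)
qed

lemma sqi_complex_vecI:
  fixes G :: "real^'n::finite \<Rightarrow> complex^'k::finite"
  assumes "sqi (\<lambda>x. Rev (G x))" "sqi (\<lambda>x. Imv (G x))" shows "sqi G"
proof (rule n2_vec(1))
  fix i
  show "sqi (\<lambda>x. G x $ i)"
    by (rule n2_complex(1)) (use sqi_vec_nth(1)[OF assms(1), of i] sqi_vec_nth(1)[OF assms(2), of i] in \<open>simp_all add: Rev_def Imv_def\<close>)
qed

section \<open>The stability inequality for complex fields\<close>

context
  fixes \<Phi> :: "real^'n::finite \<Rightarrow> real^'m::finite"
  assumes N: "CARD('n) \<ge> 2" and B: "spherical_harmonic_basis 2 \<Phi>"
begin

lemma grad_wj:
  assumes b: "\<beta> > 0"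
  shows "Rev (grad (wj j \<Phi> (\<alpha>, \<tau>, a, b, \<beta>)) x) = rgrad (rw j \<beta> (Re \<alpha>) (Re \<tau>) (lin (Rev a)) (quad \<Phi> (Rev b))) x"
    "Imv (grad (wj j \<Phi> (\<alpha>, \<tau>, a, b, \<beta>)) x) = rgrad (rw j \<beta> (Im \<alpha>) (Im \<tau>) (lin (Imv a)) (quad \<Phi> (Imv b))) x"
    "sqi (grad (wj j \<Phi> (\<alpha>, \<tau>, a, b, \<beta>)))"
proof -
  let ?f = "wj j \<Phi> (\<alpha>, \<tau>, a, b, \<beta>)"
  have d: "(\<lambda>x. Re (?f x)) differentiable (at x)" "(\<lambda>x. Im (?f x)) differentiable (at x)" for x
    unfolding wj_parts by (intro rw_rgrad(1) N b solid_harmonic_lin solid_harmonic_quad B)+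
  show r: "Rev (grad ?f x) = rgrad (rw j \<beta> (Re \<alpha>) (Re \<tau>) (lin (Rev a)) (quad \<Phi> (Rev b))) x"
    "Imv (grad ?f x) = rgrad (rw j \<beta> (Im \<alpha>) (Im \<tau>) (lin (Imv a)) (quad \<Phi> (Imv b))) x" for x
    by (simp_all add: vec_eq_iff Rev_def Imv_def grad_def rgrad_def partial_complex[OF d] wj_parts)
  show "sqi (grad ?f)"
    by (rule sqi_complex_vecI) (unfold r, (intro rw_rgrad(3) N b solid_harmonic_lin solid_harmonic_quad B)+)
qed

lemma remainder_eq:
  "2 * remainder \<Phi> U P = wsum CARD('n) (n2 (\<lambda>x. U x - grad (wj 0 \<Phi> P) x)) (n2 (\<lambda>x. U x - grad (wj 1 \<Phi> P) x))
     (n2 (\<lambda>x. U x - grad (wj 2 \<Phi> P) x)) (n2 (\<lambda>x. U x - grad (wj 3 \<Phi> P) x))"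
proof -
  have "(L2_norm F)\<^sup>2 = n2 F" for F :: "real^'n \<Rightarrow> complex^'n" by (simp add: L2_norm_def n2_def)
  then show ?thesis by (simp add: remainder_def wsum_def wj_def Let_def)
qed

lemma wsum_nonneg: "r0 \<ge> 0 \<Longrightarrow> r1 \<ge> 0 \<Longrightarrow> r2 \<ge> 0 \<Longrightarrow> r3 \<ge> 0 \<Longrightarrow> wsum CARD('n) r0 r1 r2 r3 \<ge> 0"
  using D_facts[OF N] unfolding wsum_def by (intro add_nonneg_nonneg mult_nonneg_nonneg) auto

lemma remainder_nonneg: "remainder \<Phi> U P \<ge> 0"
proof -
  have "2 * remainder \<Phi> U P \<ge> 0" unfolding remainder_eq by (intro wsum_nonneg n2_nonneg)
  then show ?thesis by simp
qed

text \<open>For fixed \<beta> the comparison functions depend linearly on the other parameters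
  through real functions, so real and imaginary parts of the field decouple.\<close>

lemma remainder_split:
  assumes U: "sqi U" and b: "\<beta> > 0"
  shows "2 * remainder \<Phi> U (\<alpha>, \<tau>, a, b, \<beta>) =
    rrem \<beta> (Re \<alpha>) (Re \<tau>) (lin (Rev a)) (quad \<Phi> (Rev b)) (\<lambda>x. Rev (U x)) + rrem \<beta> (Im \<alpha>) (Im \<tau>) (lin (Imv a)) (quad \<Phi> (Imv b)) (\<lambda>x. Imv (U x))"
proof -
  have diff: "Rev (z - z') = Rev z - Rev z'" "Imv (z - z') = Imv z - Imv z'" for z z' :: "complex^'n"
    by (simp_all add: Rev_def Imv_def vec_eq_iff)
  have "n2 (\<lambda>x. U x - grad (wj j \<Phi> (\<alpha>, \<tau>, a, b, \<beta>)) x) =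
      n2 (\<lambda>x. Rev (U x) - rgrad (rw j \<beta> (Re \<alpha>) (Re \<tau>) (lin (Rev a)) (quad \<Phi> (Rev b))) x)
    + n2 (\<lambda>x. Imv (U x) - rgrad (rw j \<beta> (Im \<alpha>) (Im \<tau>) (lin (Imv a)) (quad \<Phi> (Imv b))) x)" for j
    by (subst n2_complex_vec(3)[OF sqi_diff[OF U grad_wj(3)[OF b]]]) (simp only: diff grad_wj[OF b])
  then show ?thesis unfolding remainder_eq by (simp add: rrem_def Let_def wsum_def algebra_simps)
qed

lemma remainder_perturb:
  assumes U: "sqi U" and F: "sqi F" and P: "P \<in> complex_params" and e: "\<eta> > 0"
  shows "2 * remainder \<Phi> U P \<le> (1 + \<eta>) * (2 * remainder \<Phi> F P) + D_const CARD('n) 3 * ((1 + 1 / \<eta>) * n2 (\<lambda>x. F x - U x))"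
proof -
  obtain \<alpha> \<tau> a b \<beta> where P': "P = (\<alpha>, \<tau>, a, b, \<beta>)" "\<beta> > 0" using P by (auto simp: complex_params_def)
  have "n2 (\<lambda>x. U x - grad (wj j \<Phi> P) x) \<le> (1 + \<eta>) * n2 (\<lambda>x. F x - grad (wj j \<Phi> P) x) + (1 + 1 / \<eta>) * n2 (\<lambda>x. F x - U x)" for j
  proof -
    have "n2 (\<lambda>x. U x - grad (wj j \<Phi> P) x) = n2 (\<lambda>x. (F x - grad (wj j \<Phi> P) x) + (U x - F x))" by simp
    also have "\<dots> \<le> (1 + \<eta>) * n2 (\<lambda>x. F x - grad (wj j \<Phi> P) x) + (1 + 1 / \<eta>) * n2 (\<lambda>x. U x - F x)"
      unfolding P'(1) by (intro n2_add_le e sqi_diff U F grad_wj(3) P'(2))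
    finally show ?thesis unfolding n2_minus_commute[of U F] .
  qed
  then show ?thesis unfolding remainder_eq wsum_affine[symmetric] by (intro wsum_mono N)
qed

text \<open>The width \<beta> is fixed before anything else, so the parameters found separately for
  the real and the imaginary part share it and combine into one complex parameter.\<close>

lemma core_complex:
  assumes b: "\<beta> > 0" and p: "real_polynomial_function p1" "real_polynomial_function p2" and e: "\<epsilon> > 0"
  defines "f \<equiv> \<lambda>x. Complex (p1 x * gauss \<beta> x) (p2 x * gauss \<beta> x)"
  shows "\<exists>P\<in>complex_params. 4 * \<beta> * remainder \<Phi> (grad f) P
    \<le> n2 (jac f) + (2 * \<beta>)\<^sup>2 * n2 (\<lambda>x. norm x *\<^sub>R grad f x) - (real CARD('n) + 2) * (2 * \<beta>) * n2 (grad f) + \<epsilon>"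
proof -
  let ?f1 = "\<lambda>x. p1 x * gauss \<beta> x" and ?f2 = "\<lambda>x. p2 x * gauss \<beta> x"
  have f: "cschwartz f" using schwartz_polynomial[OF p(1) gauss_schwartz[OF b]] schwartz_polynomial[OF p(2) gauss_schwartz[OF b]]
    by (simp add: f_def cschwartz_def)
  have R: "(\<lambda>x. Re (f x)) = ?f1" "(\<lambda>x. Im (f x)) = ?f2" by (simp_all add: f_def)
  have g: "(\<lambda>x. Rev (grad f x)) = rgrad ?f1" "(\<lambda>x. Imv (grad f x)) = rgrad ?f2"
    using fun_cong[OF parts_partial(1)[OF f]] fun_cong[OF parts_partial(2)[OF f]] unfolding R
    by (auto simp: fun_eq_iff vec_eq_iff Rev_def Imv_def grad_def rgrad_def)
  have e2: "\<epsilon> / 2 > 0" using e by simp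
  obtain \<alpha> \<tau> h1 h2 where 1: "solid_harmonic 1 h1" "solid_harmonic 2 h2" "2 * \<beta> * rrem \<beta> \<alpha> \<tau> h1 h2 (rgrad ?f1) \<le> qform (2 * \<beta>) ?f1 ?f1 + \<epsilon> / 2"
    using core[OF N b p(1) e2] by blast
  obtain \<alpha>' \<tau>' h1' h2' where 2: "solid_harmonic 1 h1'" "solid_harmonic 2 h2'" "2 * \<beta> * rrem \<beta> \<alpha>' \<tau>' h1' h2' (rgrad ?f2) \<le> qform (2 * \<beta>) ?f2 ?f2 + \<epsilon> / 2"
    using core[OF N b p(2) e2] by blast
  obtain a a' where a: "h1 = lin a" "h1' = lin a'" using lin_surj 1(1) 2(1) by metis
  obtain c c' where c: "h2 = quad \<Phi> c" "h2' = quad \<Phi> c'" using quad_surj[OF B] 1(2) 2(2) by metis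
  define A :: "complex^'n" where "A = (\<chi> i. Complex (a $ i) (a' $ i))"
  define C :: "complex^'m" where "C = (\<chi> i. Complex (c $ i) (c' $ i))"
  have AC: "Rev A = a" "Imv A = a'" "Rev C = c" "Imv C = c'" by (simp_all add: A_def C_def Rev_def Imv_def vec_eq_iff)
  let ?P = "(Complex \<alpha> \<alpha>', Complex \<tau> \<tau>', A, C, \<beta>)"
  have "4 * \<beta> * remainder \<Phi> (grad f) ?P = 2 * \<beta> * (2 * remainder \<Phi> (grad f) ?P)" by simp
  also have "\<dots> = 2 * \<beta> * rrem \<beta> \<alpha> \<tau> h1 h2 (rgrad ?f1) + 2 * \<beta> * rrem \<beta> \<alpha>' \<tau>' h1' h2' (rgrad ?f2)"
    unfolding remainder_split[OF cschwartz_grad(1)[OF f] b] g AC a c by (simp add: distrib_left)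
  also have "\<dots> \<le> qform (2 * \<beta>) ?f1 ?f1 + qform (2 * \<beta>) ?f2 ?f2 + \<epsilon>" using 1(3) 2(3) by simp
  also have "\<dots> = n2 (jac f) + (2 * \<beta>)\<^sup>2 * n2 (\<lambda>x. norm x *\<^sub>R grad f x) - (real CARD('n) + 2) * (2 * \<beta>) * n2 (grad f) + \<epsilon>"
    unfolding cschwartz_jac(2)[OF f] cschwartz_weighted_grad(2)[OF f] cschwartz_grad(2)[OF f] R qform_def
    by (simp add: algebra_simps)
  finally show ?thesis using b by (intro bexI[of _ ?P]) (auto simp: complex_params_def)
qed

lemma test_function_approx:
  assumes b: "\<beta> > 0" and \<phi>: "test_function \<phi>" and e: "\<epsilon> > 0"
  shows "\<exists>p1 p2. real_polynomial_function p1 \<and> real_polynomial_function p2 \<and>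
    (let f = \<lambda>x. Complex (p1 x * gauss \<beta> x) (p2 x * gauss \<beta> x) in
      cschwartz f \<and> n2 (\<lambda>x. grad f x - grad \<phi> x) \<le> \<epsilon> \<and> n2 (\<lambda>x. jac f x - jac \<phi> x) \<le> \<epsilon>
      \<and> n2 (\<lambda>x. norm x *\<^sub>R grad f x - norm x *\<^sub>R grad \<phi> x) \<le> \<epsilon>)"
proof -
  let ?u = "\<lambda>x. Re (\<phi> x)" and ?v = "\<lambda>x. Im (\<phi> x)"
  obtain R where R: "\<And>x. norm x > R \<Longrightarrow> \<phi> x = 0" using test_function_parts(3)[OF \<phi>] by blast
  have e2: "\<epsilon> / 2 > 0" using e by simp
  obtain p1 where p1: "real_polynomial_function p1" "energy (\<lambda>x. ?u x - p1 x * gauss \<beta> x) \<le> \<epsilon> / 2"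
    using polynomial_gauss_dense[OF b test_function_parts(1)[OF \<phi>] _ e2, of R] R by auto
  obtain p2 where p2: "real_polynomial_function p2" "energy (\<lambda>x. ?v x - p2 x * gauss \<beta> x) \<le> \<epsilon> / 2"
    using polynomial_gauss_dense[OF b test_function_parts(2)[OF \<phi>] _ e2, of R] R by auto
  define f where "f x = Complex (p1 x * gauss \<beta> x) (p2 x * gauss \<beta> x)" for x
  have f: "cschwartz f" using schwartz_polynomial[OF p1(1) gauss_schwartz[OF b]] schwartz_polynomial[OF p2(1) gauss_schwartz[OF b]]
    by (simp add: f_def cschwartz_def)
  note c\<phi> = test_function_cschwartz[OF \<phi>]
  note d = cschwartz_diff[OF c\<phi> f]
  have parts: "(\<lambda>x. Re (\<phi> x - f x)) = (\<lambda>x. ?u x - p1 x * gauss \<beta> x)" "(\<lambda>x. Im (\<phi> x - f x)) = (\<lambda>x. ?v x - p2 x * gauss \<beta> x)"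
    by (simp_all add: f_def)
  let ?a = "\<lambda>x. ?u x - p1 x * gauss \<beta> x" and ?b = "\<lambda>x. ?v x - p2 x * gauss \<beta> x"
  note nn = xip_nonneg[of ?a] xip_nonneg[of ?b] gip_nonneg[of ?a] gip_nonneg[of ?b] ip_nonneg[of "laplacian ?a"] ip_nonneg[of "laplacian ?b"]
  have E: "energy (\<lambda>x. ?u x - p1 x * gauss \<beta> x) + energy (\<lambda>x. ?v x - p2 x * gauss \<beta> x) \<le> \<epsilon>" using p1(2) p2(2) by simp
  have "n2 (\<lambda>x. grad \<phi> x - grad f x) \<le> \<epsilon>"
    unfolding grad_diff[OF c\<phi> f, symmetric] cschwartz_grad(2)[OF d, folded grad_def, unfolded parts]
    using E nn unfolding energy_def by linarith
  moreover have "n2 (\<lambda>x. jac \<phi> x - jac f x) \<le> \<epsilon>"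
    unfolding jac_diff[OF c\<phi> f, symmetric] cschwartz_jac(2)[OF d, unfolded parts]
    using E nn unfolding energy_def by linarith
  moreover have "n2 (\<lambda>x. norm x *\<^sub>R grad \<phi> x - norm x *\<^sub>R grad f x) \<le> \<epsilon>"
    unfolding scaleR_diff_right[symmetric] grad_diff[OF c\<phi> f, symmetric] cschwartz_weighted_grad(2)[OF d, unfolded parts]
    using E nn unfolding energy_def by linarith
  ultimately show ?thesis
    using p1(1) p2(1) f n2_minus_commute[of "grad \<phi>" "grad f"] n2_minus_commute[of "jac \<phi>" "jac f"]
      n2_minus_commute[of "\<lambda>x. norm x *\<^sub>R grad \<phi> x" "\<lambda>x. norm x *\<^sub>R grad f x"]
    by - (rule exI[of _ p1], rule exI[of _ p2], simp add: f_def[abs_def, symmetric] Let_def)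
qed

text \<open>The parameters \<open>P n\<close> belonging to the approximations \<open>f n\<close>
  need not converge. It is enough that each of them bounds the infimum for \<open>U\<close> from
  above, up to a factor 1 + \<eta> and a multiple of the distance between \<open>U\<close> and the
  gradient of \<open>f n\<close>.\<close>

lemma scale_inequality:
  fixes U :: "real^'n \<Rightarrow> complex^'n"
  assumes b: "\<beta> > 0" and t: "\<And>n. test_function (\<phi> n)" and U: "sqi U" "sqi V" "sqi (\<lambda>x. norm x *\<^sub>R U x)"
    and lim: "(\<lambda>n. n2 (\<lambda>x. grad (\<phi> n) x - U x)) \<longlonglongrightarrow> 0" "(\<lambda>n. n2 (\<lambda>x. jac (\<phi> n) x - V x)) \<longlonglongrightarrow> 0"
      "(\<lambda>n. n2 (\<lambda>x. norm x *\<^sub>R grad (\<phi> n) x - norm x *\<^sub>R U x)) \<longlonglongrightarrow> 0"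
  shows "4 * \<beta> * (INF P\<in>complex_params. remainder \<Phi> U P)
    \<le> n2 V + (2 * \<beta>)\<^sup>2 * n2 (\<lambda>x. norm x *\<^sub>R U x) - (real CARD('n) + 2) * (2 * \<beta>) * n2 U"
proof -
  define Q where "Q A W C = A + (2 * \<beta>)\<^sup>2 * W - (real CARD('n) + 2) * (2 * \<beta>) * C" for A W C :: real
  define G where "G p1 p2 x = Complex (p1 x * gauss \<beta> x) (p2 x * gauss \<beta> x)" for p1 p2 :: "real^'n \<Rightarrow> real" and x
  have "\<forall>n. \<exists>p. real_polynomial_function (fst p) \<and> real_polynomial_function (snd p) \<and>
      cschwartz (G (fst p) (snd p)) \<and> n2 (\<lambda>x. grad (G (fst p) (snd p)) x - grad (\<phi> n) x) \<le> inverse (real (Suc n)) \<and>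
      n2 (\<lambda>x. jac (G (fst p) (snd p)) x - jac (\<phi> n) x) \<le> inverse (real (Suc n))
      \<and> n2 (\<lambda>x. norm x *\<^sub>R grad (G (fst p) (snd p)) x - norm x *\<^sub>R grad (\<phi> n) x) \<le> inverse (real (Suc n))"
    using test_function_approx[OF b t, of "inverse (real (Suc _))"] unfolding Let_def G_def[abs_def] by simp
  from choice[OF this] obtain p where p: "\<forall>n. real_polynomial_function (fst (p n)) \<and> real_polynomial_function (snd (p n)) \<and>
      cschwartz (G (fst (p n)) (snd (p n))) \<and> n2 (\<lambda>x. grad (G (fst (p n)) (snd (p n))) x - grad (\<phi> n) x) \<le> inverse (real (Suc n)) \<and>
      n2 (\<lambda>x. jac (G (fst (p n)) (snd (p n))) x - jac (\<phi> n) x) \<le> inverse (real (Suc n))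
      \<and> n2 (\<lambda>x. norm x *\<^sub>R grad (G (fst (p n)) (snd (p n))) x - norm x *\<^sub>R grad (\<phi> n) x) \<le> inverse (real (Suc n))" ..
  define f where "f n = G (fst (p n)) (snd (p n))" for n
  have p: "real_polynomial_function (fst (p n))" "real_polynomial_function (snd (p n))" "cschwartz (f n)"
      "n2 (\<lambda>x. grad (f n) x - grad (\<phi> n) x) \<le> inverse (real (Suc n))" "n2 (\<lambda>x. jac (f n) x - jac (\<phi> n) x) \<le> inverse (real (Suc n))"
      "n2 (\<lambda>x. norm x *\<^sub>R grad (f n) x - norm x *\<^sub>R grad (\<phi> n) x) \<le> inverse (real (Suc n))" for n
    using p[rule_format, of n] unfolding f_def by blast+
  note ct = test_function_cschwartz[OF t]
  have z: "(\<lambda>n. n2 (h n)) \<longlonglongrightarrow> 0" if "\<And>n. n2 (h n) \<le> inverse (real (Suc n))" for h :: "nat \<Rightarrow> real^'n \<Rightarrow> 'b::euclidean_space"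
    by (rule tendsto_sandwich[OF _ _ tendsto_const LIMSEQ_inverse_real_of_nat]) (auto simp: n2_nonneg that simp del: of_nat_Suc)
  have comb: "(\<lambda>n. n2 (\<lambda>x. h n x - H x)) \<longlonglongrightarrow> 0 \<and> (\<lambda>n. n2 (h n)) \<longlonglongrightarrow> n2 H"
    if "\<And>n. sqi (h n)" "\<And>n. sqi (k n)" "sqi H" "(\<lambda>n. n2 (\<lambda>x. h n x - k n x)) \<longlonglongrightarrow> 0" "(\<lambda>n. n2 (\<lambda>x. k n x - H x)) \<longlonglongrightarrow> 0"
    for h k :: "nat \<Rightarrow> real^'n \<Rightarrow> 'b::euclidean_space" and H
  proof -
    have "(\<lambda>n. n2 (\<lambda>x. (h n x - k n x) + (k n x - H x))) \<longlonglongrightarrow> 0"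
      by (intro n2_tendsto_add sqi_diff that)
    then have 1: "(\<lambda>n. n2 (\<lambda>x. h n x - H x)) \<longlonglongrightarrow> 0" by simp
    with n2_tendsto[OF that(1) that(3) 1 tendsto_const] show ?thesis by blast
  qed
  have gU: "(\<lambda>n. n2 (\<lambda>x. grad (f n) x - U x)) \<longlonglongrightarrow> 0 \<and> (\<lambda>n. n2 (grad (f n))) \<longlonglongrightarrow> n2 U"
    by (rule comb[OF cschwartz_grad(1)[OF p(3)] cschwartz_grad(1)[OF ct] U(1) z[OF p(4)] lim(1)])
  have jV: "(\<lambda>n. n2 (\<lambda>x. jac (f n) x - V x)) \<longlonglongrightarrow> 0 \<and> (\<lambda>n. n2 (jac (f n))) \<longlonglongrightarrow> n2 V"
    by (rule comb[OF cschwartz_jac(1)[OF p(3)] cschwartz_jac(1)[OF ct] U(2) z[OF p(5)] lim(2)])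
  have xU: "(\<lambda>n. n2 (\<lambda>x. norm x *\<^sub>R grad (f n) x - norm x *\<^sub>R U x)) \<longlonglongrightarrow> 0 \<and> (\<lambda>n. n2 (\<lambda>x. norm x *\<^sub>R grad (f n) x)) \<longlonglongrightarrow> n2 (\<lambda>x. norm x *\<^sub>R U x)"
    by (rule comb[OF cschwartz_weighted_grad(1)[OF p(3)] cschwartz_weighted_grad(1)[OF ct] U(3) z[OF p(6)] lim(3)])
  define q where "q n = Q (n2 (jac (f n))) (n2 (\<lambda>x. norm x *\<^sub>R grad (f n) x)) (n2 (grad (f n))) + inverse (real (Suc n))" for n
  define qL where "qL = Q (n2 V) (n2 (\<lambda>x. norm x *\<^sub>R U x)) (n2 U)"
  have qlim: "q \<longlonglongrightarrow> qL"
  proof -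
    have "q \<longlonglongrightarrow> qL + 0" unfolding q_def qL_def Q_def
      using gU jV xU by (intro tendsto_intros LIMSEQ_inverse_real_of_nat) auto
    then show ?thesis by simp
  qed
  have "\<exists>P\<in>complex_params. 4 * \<beta> * remainder \<Phi> (grad (f n)) P \<le> q n" for n
    using core_complex[OF b p(1,2), of "inverse (real (Suc n))" n n] unfolding q_def Q_def f_def G_def[abs_def] by simp
  then obtain P where P: "\<And>n. P n \<in> complex_params" "\<And>n. 4 * \<beta> * remainder \<Phi> (grad (f n)) (P n) \<le> q n" by metis
  let ?I = "INF P\<in>complex_params. remainder \<Phi> U P"
  have inf: "?I \<le> remainder \<Phi> U (P n)" for n
    by (rule cINF_lower[OF _ P(1)]) (auto intro!: bdd_belowI2[of _ 0] remainder_nonneg)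
  have bound: "4 * \<beta> * ?I \<le> (1 + \<eta>) * qL" if e: "\<eta> > 0" for \<eta>
  proof -
    let ?K = "2 * \<beta> * D_const CARD('n) 3 * (1 + 1 / \<eta>)"
    have "4 * \<beta> * ?I \<le> (1 + \<eta>) * q n + ?K * n2 (\<lambda>x. grad (f n) x - U x)" for n
    proof -
      have "4 * \<beta> * ?I \<le> 4 * \<beta> * remainder \<Phi> U (P n)" using inf[of n] b by simp
      also have "\<dots> = 2 * \<beta> * (2 * remainder \<Phi> U (P n))" by simp
      also have "\<dots> \<le> 2 * \<beta> * ((1 + \<eta>) * (2 * remainder \<Phi> (grad (f n)) (P n)) + D_const CARD('n) 3 * ((1 + 1 / \<eta>) * n2 (\<lambda>x. grad (f n) x - U x)))"
        using b by (intro mult_left_mono remainder_perturb U cschwartz_grad(1) p P e) auto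
      also have "\<dots> = (1 + \<eta>) * (4 * \<beta> * remainder \<Phi> (grad (f n)) (P n)) + ?K * n2 (\<lambda>x. grad (f n) x - U x)"
        by (simp add: algebra_simps)
      also have "\<dots> \<le> (1 + \<eta>) * q n + ?K * n2 (\<lambda>x. grad (f n) x - U x)"
        using P(2)[of n] e by (intro add_right_mono mult_left_mono) auto
      finally show ?thesis .
    qed
    moreover have "(\<lambda>n. (1 + \<eta>) * q n + ?K * n2 (\<lambda>x. grad (f n) x - U x)) \<longlonglongrightarrow> (1 + \<eta>) * qL + ?K * 0"
      using gU by (intro tendsto_intros qlim) auto
    ultimately show ?thesis using LIMSEQ_le_const by fastforce
  qed
  have "(\<lambda>n. (1 + inverse (real (Suc n))) * qL) \<longlonglongrightarrow> (1 + 0) * qL"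
    by (intro tendsto_intros LIMSEQ_inverse_real_of_nat)
  then have "4 * \<beta> * ?I \<le> (1 + 0) * qL"
    by (rule LIMSEQ_le_const) (auto intro!: bound simp del: of_nat_Suc)
  then show ?thesis by (simp add: qL_def Q_def)
qed

text \<open>Optimizing over the scale: the arithmetic mean of \<open>A\<^sup>2/\<lambda>\<close> and \<open>\<lambda>B\<^sup>2\<close> is minimal when both are equal, and the
  degenerate cases are limits \<open>\<lambda> \<rightarrow> 0\<close> and \<open>\<lambda> \<rightarrow> \<infinity>\<close>.\<close>

lemma product_bound:
  fixes A B K :: real
  assumes A: "A \<ge> 0" and B: "B \<ge> 0" and le: "\<And>l. l > 0 \<Longrightarrow> 2 * l * K \<le> A + l\<^sup>2 * B"
  shows "K \<le> sqrt A * sqrt B"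
proof (rule ccontr)
  assume "\<not> K \<le> sqrt A * sqrt B"
  then have K: "K > sqrt A * sqrt B" by simp
  then have K0: "K > 0" using A B by (meson le_less_trans mult_nonneg_nonneg real_sqrt_ge_zero)
  show False
  proof (cases "B = 0")
    case True
    have "2 * ((A + 1) / K) * K \<le> A" using le[of "(A + 1) / K"] A K0 True by simp
    then show False using K0 A by simp
  next
    case False
    then have B0: "B > 0" using B by simp
    have "2 * (K / B) * K \<le> A + (K / B)\<^sup>2 * B" using K0 B0 by (intro le) simp
    then have "K\<^sup>2 / B \<le> A" using B0 by (simp add: power2_eq_square field_simps)
    then have "K\<^sup>2 \<le> A * B" using B0 by (simp add: divide_le_eq)
    then have "sqrt (K\<^sup>2) \<le> sqrt (A * B)" by (rule real_sqrt_le_mono)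
    then show False using K K0 by (simp add: real_sqrt_mult)
  qed
qed

lemma deficit_inequality:
  fixes U :: "real^'n \<Rightarrow> complex^'n"
  assumes u: "u \<in> X_space" and U: "X_gradient u U"
  shows "(INF P\<in>complex_params. remainder \<Phi> U P) \<le> delta_CF U" "sqi U"
proof -
  obtain \<phi> where \<phi>: "\<phi> \<in> u" "U \<in> borel_measurable lborel"
    "(\<lambda>n. \<integral>\<^sup>+ x. ennreal ((norm x)\<^sup>2 * (norm (grad (\<phi> n) x - U x))\<^sup>2) \<partial>lborel) \<longlonglongrightarrow> 0"
    using U unfolding X_gradient_def by blast
  have c: "\<phi> \<in> X_cauchy" using u \<phi>(1) unfolding X_space_def quotient_def X_equiv_def by auto
  then have t: "\<And>n. test_function (\<phi> n)" by (simp add: X_cauchy_def)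
  obtain V where V: "sqi U" "sqi V" "sqi (\<lambda>x. norm x *\<^sub>R U x)" "is_weak_jacobian U V"
    "(\<lambda>n. n2 (\<lambda>x. grad (\<phi> n) x - U x)) \<longlonglongrightarrow> 0" "(\<lambda>n. n2 (\<lambda>x. jac (\<phi> n) x - V x)) \<longlonglongrightarrow> 0"
    "(\<lambda>n. n2 (\<lambda>x. norm x *\<^sub>R grad (\<phi> n) x - norm x *\<^sub>R U x)) \<longlonglongrightarrow> 0"
    using X_gradient_limit[OF c \<phi>(2,3)] by blast
  show "sqi U" by (rule V(1))
  let ?I = "INF P\<in>complex_params. remainder \<Phi> U P"
  \<comment> \<open>With the mass term moved to the left, the bounds for all scales l = 2\<beta>
    have the form required by \<open>product_bound\<close>; the infimum \<open>?I\<close> does not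
    depend on the scale.\<close>
  have "?I + (real CARD('n) + 2) / 2 * n2 U \<le> sqrt (n2 V) * sqrt (n2 (\<lambda>x. norm x *\<^sub>R U x))"
  proof (rule product_bound[OF n2_nonneg n2_nonneg])
    fix l :: real assume l: "l > 0"
    have "4 * (l / 2) * ?I \<le> n2 V + (2 * (l / 2))\<^sup>2 * n2 (\<lambda>x. norm x *\<^sub>R U x) - (real CARD('n) + 2) * (2 * (l / 2)) * n2 U"
      using l by (intro scale_inequality[OF _ t V(1-3) V(5-7)]) simp
    then show "2 * l * (?I + (real CARD('n) + 2) / 2 * n2 U) \<le> n2 V + l\<^sup>2 * n2 (\<lambda>x. norm x *\<^sub>R U x)"
      by (simp add: algebra_simps add_divide_distrib)
  qed
  then show "?I \<le> delta_CF U" unfolding delta_CF_eq[OF V(4)] by simp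
qed

section \<open>Real fields and real parameters\<close>

lemma real_params_subset: "real_params \<subseteq> complex_params"
  by (auto simp: real_params_def complex_params_def)

lemma real_params_nonempty: "real_params \<noteq> {}"
proof -
  have "(0, 0, 0, 0, 1) \<in> real_params" by (simp add: real_params_def)
  then show ?thesis by blast
qed

text \<open>Taking real parts of the parameters leaves the contribution of the real part of
  \<open>U\<close> unchanged and reduces that of the vanishing imaginary part to 0; the width is
  real already.\<close>

lemma INF_real_params:
  fixes U :: "real^'n \<Rightarrow> complex^'n"
  assumes U: "sqi U" and real: "real_valued U"
  shows "(INF P\<in>complex_params. remainder \<Phi> U P) = (INF P\<in>real_params. remainder \<Phi> U P)"
proof (rule antisym)
  have bdd: "bdd_below ((\<lambda>P. remainder \<Phi> U P) ` S)" for S by (auto intro!: bdd_belowI2[of _ 0] remainder_nonneg)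
  show "(INF P\<in>complex_params. remainder \<Phi> U P) \<le> (INF P\<in>real_params. remainder \<Phi> U P)"
    by (rule cINF_superset_mono[OF real_params_nonempty bdd real_params_subset]) simp
  show "(INF P\<in>real_params. remainder \<Phi> U P) \<le> (INF P\<in>complex_params. remainder \<Phi> U P)"
  proof (rule cINF_greatest)
    show "complex_params \<noteq> ({} :: ('n, 'm) params set)" using real_params_nonempty real_params_subset by blast
    fix P :: "('n, 'm) params" assume "P \<in> complex_params"
    then obtain \<alpha> \<tau> a b \<beta> where P: "P = (\<alpha>, \<tau>, a, b, \<beta>)" and b: "\<beta> > 0" by (auto simp: complex_params_def)
    let ?P = "(complex_of_real (Re \<alpha>), complex_of_real (Re \<tau>), \<chi> i. complex_of_real (Re (a $ i)), \<chi> i. complex_of_real (Re (b $ i)), \<beta>)"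
    have P': "?P \<in> real_params" using b by (simp add: real_params_def)
    have parts: "Rev (\<chi> i. complex_of_real (Re (a $ i))) = Rev a" "Imv (\<chi> i. complex_of_real (Re (a $ i))) = 0"
      "Rev (\<chi> i. complex_of_real (Re (b $ i))) = Rev b" "Imv (\<chi> i. complex_of_real (Re (b $ i))) = 0"
      by (simp_all add: Rev_def Imv_def vec_eq_iff)
    have "AE x in lborel. Imv (U x) = 0"
      using real unfolding real_valued_def by eventually_elim (simp add: Imv_def vec_eq_iff complex_is_Real_iff)
    then have "n2 (\<lambda>x. Imv (U x)) = integral\<^sup>L (lborel :: (real^'n) measure) (\<lambda>x. 0::real)"
      unfolding n2_def using n2_complex_vec(2)[OF U] by (intro integral_cong_AE) (auto simp: sqi_def)
    then have z: "n2 (\<lambda>x. Imv (U x)) = 0" by simp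
    have zr: "rgrad (rw j \<beta> 0 0 (lin 0) (quad \<Phi> 0)) x = 0" for j x
    proof -
      have "rw j \<beta> 0 0 (lin 0) (quad \<Phi> 0) = (\<lambda>x. 0)" by (auto simp: rw_def lin_def quad_def)
      then show ?thesis by (simp add: rgrad_def vec_eq_iff)
    qed
    have "2 * remainder \<Phi> U ?P = rrem \<beta> (Re \<alpha>) (Re \<tau>) (lin (Rev a)) (quad \<Phi> (Rev b)) (\<lambda>x. Rev (U x)) + rrem \<beta> 0 0 (lin 0) (quad \<Phi> 0) (\<lambda>x. Imv (U x))"
      unfolding remainder_split[OF U b] parts by simp
    also have "rrem \<beta> 0 0 (lin 0) (quad \<Phi> 0) (\<lambda>x. Imv (U x)) = 0" by (simp add: rrem_def zr z wsum_def)
    also have "0 \<le> rrem \<beta> (Im \<alpha>) (Im \<tau>) (lin (Imv a)) (quad \<Phi> (Imv b)) (\<lambda>x. Imv (U x))"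
      unfolding rrem_def Let_def by (intro wsum_nonneg n2_nonneg)
    finally have "2 * remainder \<Phi> U ?P \<le> 2 * remainder \<Phi> U P" unfolding P remainder_split[OF U b] by simp
    then have "remainder \<Phi> U ?P \<le> remainder \<Phi> U P" by simp
    then show "(INF P\<in>real_params. remainder \<Phi> U P) \<le> remainder \<Phi> U P" by (rule cINF_lower2[OF bdd P'])
  qed
qed

lemma grad_w0_E_CF:
  fixes P :: "('n, 'm) params"
  assumes "P \<in> real_params" shows "grad (w0 P) \<in> E_CF"
proof -
  obtain \<alpha> \<tau> a b \<beta> where P: "P = (\<alpha>, \<tau>, a, b, \<beta>)" "\<alpha> \<in> \<real>" and b: "\<beta> > 0" using assms by (auto simp: real_params_def)
  have w: "w0 P = (\<lambda>x. complex_of_real (Re \<alpha> * gauss \<beta> x))" using P by (auto simp: fun_eq_iff gauss_def)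
  have d: "(\<lambda>x::real^'n. Re \<alpha> * gauss \<beta> x) differentiable (at x)" for x
    by (intro differentiable_mult differentiable_const gauss_differentiable)
  have "grad (w0 P) x $ i = complex_of_real ((- 2 * \<beta> * Re \<alpha>) * exp (- \<beta> * (norm x)\<^sup>2) * x $ i)" for x i
  proof -
    have "grad (w0 P) x $ i = complex_of_real (partial i (\<lambda>x. Re \<alpha> * gauss \<beta> x) x)"
      unfolding grad_def vec_lambda_beta w by (rule partial_bounded_linear_compose(2)[OF bounded_linear_of_real d])
    also have "partial i (\<lambda>x. Re \<alpha> * gauss \<beta> x) x = (- 2 * \<beta> * Re \<alpha>) * exp (- \<beta> * (norm x)\<^sup>2) * x $ i"
      unfolding partial_cmult[OF gauss_differentiable] partial_gauss by (simp add: gauss_def)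
    finally show ?thesis .
  qed
  then have "grad (w0 P) = (\<lambda>x. \<chi> i. complex_of_real ((- 2 * \<beta> * Re \<alpha>) * exp (- \<beta> * (norm x)\<^sup>2) * x $ i))"
    by (simp add: fun_eq_iff vec_eq_iff)
  then show ?thesis unfolding E_CF_def using b by blast
qed

lemma E_CF_inequality:
  fixes U :: "real^'n \<Rightarrow> complex^'n"
  shows "D_const CARD('n) 1 / 2 * (INF V\<in>E_CF. (L2_norm (\<lambda>x. U x - V x))\<^sup>2) \<le> (INF P\<in>real_params. remainder \<Phi> U P)"
proof (rule cINF_greatest[OF real_params_nonempty])
  fix P :: "('n, 'm) params" assume P: "P \<in> real_params"
  let ?D = "D_const CARD('n)"
  have "(INF V\<in>E_CF. (L2_norm (\<lambda>x. U x - V x))\<^sup>2) \<le> (L2_norm (\<lambda>x. U x - grad (w0 P) x))\<^sup>2"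
    by (rule cINF_lower[OF _ grad_w0_E_CF[OF P]]) (auto intro!: bdd_belowI2[of _ 0])
  then have "?D 1 / 2 * (INF V\<in>E_CF. (L2_norm (\<lambda>x. U x - V x))\<^sup>2) \<le> ?D 1 / 2 * (L2_norm (\<lambda>x. U x - grad (w0 P) x))\<^sup>2"
    using D_facts(1)[OF N] by (intro mult_left_mono) auto
  also have "\<dots> \<le> remainder \<Phi> U P"
    unfolding remainder_def Let_def using D_facts[OF N] by (simp add: add_nonneg_nonneg)
  finally show "?D 1 / 2 * (INF V\<in>E_CF. (L2_norm (\<lambda>x. U x - V x))\<^sup>2) \<le> remainder \<Phi> U P" .
qed

end

section \<open>Sharpness of the constant\<close>

lemma lborel_reflect: "distr lborel borel (\<lambda>x. - x) = (lborel :: (real^'n::finite) measure)"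
  by (subst lborel_affine[of "- 1" 0]) (auto simp: density_1 one_ennreal_def[symmetric])

lemma n2_reflect:
  fixes F :: "real^'n::finite \<Rightarrow> 'b::euclidean_space"
  assumes [measurable]: "F \<in> borel_measurable borel" shows "n2 (\<lambda>x. F (- x)) = n2 F"
proof -
  have "n2 F = (LINT x|distr lborel borel (\<lambda>x. - x). (norm (F x))\<^sup>2)" by (simp add: n2_def lborel_reflect)
  also have "\<dots> = n2 (\<lambda>x. F (- x))" unfolding n2_def by (rule integral_distr) auto
  finally show ?thesis by simp
qed

text \<open>Reflection exchanges U - V and U + V, so both have the same norm, and 2U is their
  sum.\<close>

lemma n2_even_odd:
  assumes U: "sqi U" "\<And>x. U (- x) = U x" and V: "sqi V" "\<And>x. V (- x) = - V x"
  shows "n2 U \<le> n2 (\<lambda>x. U x - V x)"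
proof -
  have s: "sqi (\<lambda>x. U x - V x)" "sqi (\<lambda>x. U x + V x)" using U V by (auto intro: sqi_diff sqi_add)
  have "n2 (\<lambda>x. U x + V x) = n2 (\<lambda>x. U x - V x)"
    using n2_reflect[of "\<lambda>x. U x - V x"] s(1) by (simp add: U V sqi_def)
  then have "sqrt (n2 (\<lambda>x. 2 *\<^sub>R U x)) \<le> 2 * sqrt (n2 (\<lambda>x. U x - V x))"
    using n2_triangle[OF s] by (simp add: scaleR_2)
  then show ?thesis by (simp add: n2_scaleR real_sqrt_mult)
qed

lemma E_CF_sqi_odd:
  fixes V :: "real^'n::finite \<Rightarrow> complex^'n"
  assumes "V \<in> E_CF" shows "sqi V" "V (- x) = - V x"
proof -
  obtain \<alpha> \<beta> where V: "V = (\<lambda>x. \<chi> i. complex_of_real (\<alpha> * exp (- \<beta> * (norm x)\<^sup>2) * x $ i))" "\<beta> > 0"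
    using assms unfolding E_CF_def by blast
  show "V (- x) = - V x" by (simp add: V(1) vec_eq_iff)
  have "schwartz (\<lambda>x::real^'n. \<alpha> * exp (- \<beta> * (norm x)\<^sup>2) * x $ i)" for i
    using schwartz_cmult[OF schwartz_component[OF gauss_schwartz[OF V(2)]], of \<alpha> i] by (simp add: gauss_def mult_ac)
  then have "cschwartz (\<lambda>x. V x $ i)" for i by (simp add: V(1) cschwartz_def schwartz_zero)
  then show "sqi V" by (intro n2_vec(1) cschwartz_sqi(1))
qed

definition sharp_bound :: "'n::finite itself \<Rightarrow> real \<Rightarrow> bool" where
  "sharp_bound _ c \<longleftrightarrow> (\<forall>u\<in>X_space. \<forall>U :: real^'n \<Rightarrow> complex^'n. X_gradient u U \<and> real_valued U \<longrightarrow>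
     delta_CF U \<ge> c * (INF V\<in>E_CF. (L2_norm (\<lambda>x. U x - V x))\<^sup>2))"

text \<open>The gradient of an odd function is even, hence its distance to the odd fields of
  \<open>E_CF\<close> is at least its own norm. On the other side 2l times the deficit is at most
  the quadratic form, by the arithmetic-geometric mean inequality. The constant sequence represents
  the element of the completion.\<close>

lemma sharp_bound_test_function:
  fixes f :: "real^'n::finite \<Rightarrow> real"
  assumes c: "sharp_bound TYPE('n) c" "c \<ge> 0" and l: "l > 0"
    and f: "schwartz f" and supp: "\<And>x. norm x > R \<Longrightarrow> f x = 0" and odd: "\<And>x. f (- x) = - f x"
  shows "2 * l * c * gip f f \<le> qform l f f"
proof -
  define \<phi> where "\<phi> x = complex_of_real (f x)" for x
  have t: "test_function \<phi>" unfolding \<phi>_def[abs_def] by (rule test_function_of_real[OF f supp])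
  note ct = test_function_cschwartz[OF t]
  have parts: "(\<lambda>x. Re (\<phi> x)) = f" "(\<lambda>x. Im (\<phi> x)) = (\<lambda>x. 0)" by (simp_all add: \<phi>_def)
  have zero: "gip (\<lambda>x::real^'n. 0) (\<lambda>x. 0) = 0" "xip (\<lambda>x::real^'n. 0) (\<lambda>x. 0) = 0" by (simp_all add: gip_def xip_def)
  have "laplacian (\<lambda>x::real^'n. 0::complex) = (\<lambda>x. 0)" "grad (\<lambda>x::real^'n. 0) = (\<lambda>x. 0)"
    by (simp_all add: laplacian_def grad_def fun_eq_iff vec_eq_iff)
  then have s0: "X_seminorm (\<lambda>x. \<phi> x - \<phi> x) = 0" by (simp add: X_seminorm_def)
  have cauchy: "(\<lambda>n::nat. \<phi>) \<in> X_cauchy" using t s0 by (simp add: X_cauchy_def)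
  define u where "u = X_equiv `` {\<lambda>n::nat. \<phi>}"
  have u: "u \<in> X_space" unfolding u_def X_space_def by (rule quotientI[OF cauchy])
  have mem: "(\<lambda>n::nat. \<phi>) \<in> u" unfolding u_def X_equiv_def using cauchy s0 by simp
  let ?U = "grad \<phi>"
  have m: "?U \<in> borel_measurable lborel" using cschwartz_grad(1)[OF ct] by (simp add: sqi_def)
  have lim: "(\<lambda>n::nat. \<integral>\<^sup>+ x. ennreal ((norm x)\<^sup>2 * (norm (grad \<phi> x - ?U x))\<^sup>2) \<partial>lborel) \<longlonglongrightarrow> 0" by simp
  have X: "X_gradient u ?U" unfolding X_gradient_def by (rule conjI[OF m], rule bexI[OF _ mem], rule lim)
  obtain V where V: "is_weak_jacobian ?U V" "sqi V" "(\<lambda>n::nat. n2 (\<lambda>x. jac \<phi> x - V x)) \<longlonglongrightarrow> 0"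
    using X_gradient_limit[OF cauchy m lim] by blast
  \<comment> \<open>\<open>V\<close> is the L2 limit of a constant sequence, so its norm is that of
    the classical Jacobian.\<close>
  have "n2 V = n2 (jac \<phi>)"
    using n2_tendsto[OF cschwartz_jac(1)[OF ct] V(2) V(3) tendsto_const] by (simp add: LIMSEQ_const_iff)
  then have delta: "delta_CF ?U = sqrt (isq (laplacian f)) * sqrt (xip f f) - (real CARD('n) + 2) / 2 * gip f f"
    unfolding delta_CF_eq[OF V(1)] cschwartz_jac(2)[OF ct] cschwartz_weighted_grad(2)[OF ct] cschwartz_grad(2)[OF ct] parts
    by (simp add: zero)
  have pe: "partial i f (- x) = partial i f x" for i x
  proof -
    have "partial i (\<lambda>y. f ((- 1) *\<^sub>R y)) x = (- 1) *\<^sub>R partial i f ((- 1) *\<^sub>R x)"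
      by (rule partial_scale[OF schwartz_differentiable[OF f]])
    moreover have "partial i (\<lambda>y. (- 1) * f y) x = (- 1) * partial i f x" by (rule partial_cmult[OF schwartz_differentiable[OF f]])
    ultimately show ?thesis by (simp add: odd)
  qed
  have g: "?U x $ i = complex_of_real (partial i f x)" for x i
    using fun_cong[OF parts_partial(1)[OF ct, of i], of x] fun_cong[OF parts_partial(2)[OF ct, of i], of x]
    unfolding parts by (simp add: grad_def complex_eq_iff)
  have rv: "real_valued ?U" by (simp add: real_valued_def g)
  have "gip f f \<le> (INF V\<in>E_CF. (L2_norm (\<lambda>x. ?U x - V x))\<^sup>2)"
  proof (rule cINF_greatest)
    show "(E_CF :: (real^'n \<Rightarrow> complex^'n) set) \<noteq> {}" unfolding E_CF_def by (auto intro: exI[of _ 1])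
    fix V :: "real^'n \<Rightarrow> complex^'n" assume V: "V \<in> E_CF"
    have "n2 ?U \<le> n2 (\<lambda>x. ?U x - V x)"
      by (rule n2_even_odd[OF cschwartz_grad(1)[OF ct] _ E_CF_sqi_odd[OF V]]) (simp add: vec_eq_iff g pe)
    then show "gip f f \<le> (L2_norm (\<lambda>x. ?U x - V x))\<^sup>2"
      unfolding cschwartz_grad(2)[OF ct] parts by (simp add: zero L2_norm_def n2_def)
  qed
  then have "c * gip f f \<le> c * (INF V\<in>E_CF. (L2_norm (\<lambda>x. ?U x - V x))\<^sup>2)" using c(2) by (rule mult_left_mono)
  also have "\<dots> \<le> delta_CF ?U" using c(1) u X rv unfolding sharp_bound_def by blast
  finally have "2 * l * (c * gip f f) \<le> 2 * l * delta_CF ?U" using l by simp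
  also have "\<dots> \<le> qform l f f"
  proof -
    define A B where "A = sqrt (isq (laplacian f))" and "B = sqrt (xip f f)"
    have AB: "isq (laplacian f) = A\<^sup>2" "xip f f = B\<^sup>2" by (simp_all add: A_def B_def ip_nonneg xip_nonneg)
    have "0 \<le> (A - l * B)\<^sup>2" by simp
    then have "2 * l * (A * B) \<le> A\<^sup>2 + l\<^sup>2 * B\<^sup>2" by (simp add: power2_eq_square algebra_simps)
    moreover have "2 * l * delta_CF ?U = 2 * l * (A * B) - (real CARD('n) + 2) * l * gip f f"
      unfolding delta A_def B_def by (simp add: algebra_simps add_divide_distrib)
    ultimately show ?thesis unfolding qform_def AB by linarith
  qed
  finally show ?thesis by simp
qed

section \<open>Removal of the compact support by a cutoff\<close>

definition l2lim :: "(nat \<Rightarrow> real^'n::finite \<Rightarrow> real) \<Rightarrow> (real^'n \<Rightarrow> real) \<Rightarrow> bool" where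
  "l2lim h H \<longleftrightarrow> (\<forall>n. sqi (h n)) \<and> sqi H \<and> (\<lambda>n. n2 (\<lambda>x. h n x - H x)) \<longlonglongrightarrow> 0"

lemma l2lim_add: "l2lim h H \<Longrightarrow> l2lim k K \<Longrightarrow> l2lim (\<lambda>n x. h n x + k n x) (\<lambda>x. H x + K x)"
  unfolding l2lim_def
  using n2_tendsto_add[of "\<lambda>n x. h n x - H x" "\<lambda>n x. k n x - K x"] by (auto intro: sqi_add sqi_diff simp: algebra_simps)

lemma l2lim_zero: "l2lim (\<lambda>n x. 0) (\<lambda>x. 0)" by (simp add: l2lim_def sqi_def n2_def)

lemma l2lim_sum: "finite I \<Longrightarrow> (\<And>i. i \<in> I \<Longrightarrow> l2lim (h i) (H i)) \<Longrightarrow> l2lim (\<lambda>n x. \<Sum>i\<in>I. h i n x) (\<lambda>x. \<Sum>i\<in>I. H i x)"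
  by (induction I rule: finite_induct) (auto intro: l2lim_zero l2lim_add)

lemma l2lim_n2: "l2lim h H \<Longrightarrow> (\<lambda>n. n2 (h n)) \<longlonglongrightarrow> n2 H"
  unfolding l2lim_def by (auto intro: n2_tendsto[of h "\<lambda>n. H"])

lemma l2lim_null: assumes h: "l2lim h H" and s: "s \<longlonglongrightarrow> 0" shows "l2lim (\<lambda>n x. s n * h n x) (\<lambda>x. 0)"
proof -
  have "(\<lambda>n. (s n)\<^sup>2 * n2 (h n)) \<longlonglongrightarrow> 0\<^sup>2 * n2 H" by (intro tendsto_intros s l2lim_n2 h)
  then show ?thesis using h n2_scaleR[of "s _" "h _"] sqi_scaleR[of "h _" "s _"] unfolding l2lim_def
    by (auto simp: sqi_def)
qed

lemma l2lim_cutoff: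
  fixes \<zeta> g :: "real^'n::finite \<Rightarrow> real"
  assumes z: "schwartz \<zeta>" and g: "sqi g" and s: "s \<longlonglongrightarrow> 0"
  shows "l2lim (\<lambda>n x. \<zeta> (s n *\<^sub>R x) * g x) (\<lambda>x. \<zeta> 0 * g x)"
proof -
  obtain C where C: "\<And>x. \<bar>\<zeta> x\<bar> \<le> C" using decays_bounded[OF schwartz_decays[OF z]] by blast
  have c: "continuous_on UNIV \<zeta>" by (rule schwartz_continuous[OF z])
  have [measurable]: "g \<in> borel_measurable lborel" using g by (simp add: sqi_def)
  have [measurable]: "(\<lambda>x. \<zeta> (s n *\<^sub>R x)) \<in> borel_measurable lborel" for n
    by (simp, intro borel_measurable_continuous_onI continuous_on_compose2[OF c] continuous_intros) auto
  have bound: "\<bar>a * g x\<bar>\<^sup>2 \<le> (2 * C)\<^sup>2 * (g x)\<^sup>2" if "\<bar>a\<bar> \<le> 2 * C" for a x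
  proof -
    have "a\<^sup>2 \<le> (2 * C)\<^sup>2" using power_mono[OF that, of 2] by simp
    then show ?thesis by (simp add: power_mult_distrib mult_right_mono)
  qed
  have ig: "integrable lborel (\<lambda>x. (2 * C)\<^sup>2 * (g x)\<^sup>2)" using g by (simp add: sqi_def)
  have C0: "C \<ge> 0" using C[of 0] by simp
  have sh: "sqi (\<lambda>x. \<zeta> (s n *\<^sub>R x) * g x)" for n
  proof -
    have "integrable lborel (\<lambda>x. (norm (\<zeta> (s n *\<^sub>R x) * g x))\<^sup>2)"
    proof (rule Bochner_Integration.integrable_bound[OF ig])
      show "AE x in lborel. norm ((norm (\<zeta> (s n *\<^sub>R x) * g x))\<^sup>2) \<le> norm ((2 * C)\<^sup>2 * (g x)\<^sup>2)"
        using bound[of "\<zeta> (s n *\<^sub>R _)"] C C0 by (intro AE_I2) (simp add: order_trans[OF C])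
    qed measurable
    then show ?thesis by (simp add: sqi_def)
  qed
  have sH: "sqi (\<lambda>x. \<zeta> 0 * g x)" using sqi_scaleR[OF g, of "\<zeta> 0"] by simp
  have "(\<lambda>n. LINT x|lborel. (norm (\<zeta> (s n *\<^sub>R x) * g x - \<zeta> 0 * g x))\<^sup>2) \<longlonglongrightarrow> integral\<^sup>L (lborel :: (real^'n) measure) (\<lambda>x. 0::real)"
  proof (rule integral_dominated_convergence[OF _ _ ig])
    show "AE x in lborel. (\<lambda>n. (norm (\<zeta> (s n *\<^sub>R x) * g x - \<zeta> 0 * g x))\<^sup>2) \<longlonglongrightarrow> 0"
    proof (rule AE_I2)
      fix x :: "real^'n"
      have "(\<lambda>n. s n *\<^sub>R x) \<longlonglongrightarrow> 0 *\<^sub>R x" by (rule tendsto_scaleR[OF s tendsto_const])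
      then have "(\<lambda>n. \<zeta> (s n *\<^sub>R x)) \<longlonglongrightarrow> \<zeta> 0"
        using continuous_on_tendsto_compose[OF c, of "\<lambda>n. s n *\<^sub>R x" 0] by simp
      then have "(\<lambda>n. (norm (\<zeta> (s n *\<^sub>R x) * g x - \<zeta> 0 * g x))\<^sup>2) \<longlonglongrightarrow> (norm (\<zeta> 0 * g x - \<zeta> 0 * g x))\<^sup>2"
        by (intro tendsto_intros)
      then show "(\<lambda>n. (norm (\<zeta> (s n *\<^sub>R x) * g x - \<zeta> 0 * g x))\<^sup>2) \<longlonglongrightarrow> 0" by simp
    qed
    show "AE x in lborel. norm ((norm (\<zeta> (s n *\<^sub>R x) * g x - \<zeta> 0 * g x))\<^sup>2) \<le> (2 * C)\<^sup>2 * (g x)\<^sup>2" for n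
    proof (rule AE_I2)
      fix x
      have "\<bar>\<zeta> (s n *\<^sub>R x) - \<zeta> 0\<bar> \<le> 2 * C" using C[of "s n *\<^sub>R x"] C[of 0] by linarith
      from bound[OF this, of x] show "norm ((norm (\<zeta> (s n *\<^sub>R x) * g x - \<zeta> 0 * g x))\<^sup>2) \<le> (2 * C)\<^sup>2 * (g x)\<^sup>2"
        by (simp add: left_diff_distrib)
    qed
  qed measurable
  then show ?thesis unfolding l2lim_def using sh sH by (simp add: n2_def)
qed

text \<open>The cutoff is \<eta>(s_n x) with s_n tending to 0. Each derivative falling on it
  produces a factor s_n, so all three forms converge to those of \<open>f\<close>. The cutoff is
  radial and preserves oddness.\<close>

lemma sharp_bound_schwartz:
  fixes f :: "real^'n::finite \<Rightarrow> real"
  assumes c: "sharp_bound TYPE('n) c" "c \<ge> 0" and l: "l > 0" and f: "schwartz f" and odd: "\<And>x. f (- x) = - f x"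
  shows "2 * l * c * gip f f \<le> qform l f f"
proof -
  \<comment> \<open>The factor \<open>exp 1\<close> normalises the cutoff to the value 1 at the
    origin, since \<open>flat 0 1\<close> is exp (-1).\<close>
  define \<eta> where "\<eta> x = exp 1 * flat 0 (1 - (norm x)\<^sup>2)" for x :: "real^'n"
  define s where "s n = inverse (real (Suc n))" for n
  have s: "s \<longlonglongrightarrow> 0" unfolding s_def[abs_def] by (rule LIMSEQ_inverse_real_of_nat)
  have s2: "(\<lambda>n. (s n)\<^sup>2) \<longlonglongrightarrow> 0" using tendsto_power[OF s, of 2] by simp
  have sp: "s n > 0" for n by (simp add: s_def)
  have eta0: "\<eta> 0 = 1" by (simp add: \<eta>_def flat_def exp_minus)
  have zero: "\<eta> (s n *\<^sub>R x) = 0" if "norm x > real (Suc n)" for n x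
  proof -
    have "1 < s n * norm x" using that by (simp add: s_def field_simps)
    then have "1 < (norm (s n *\<^sub>R x))\<^sup>2" using sp[of n] by (simp add: one_less_power)
    then show ?thesis by (simp add: \<eta>_def flat_def)
  qed
  have es: "schwartz (\<lambda>x. \<eta> (s n *\<^sub>R x))" for n
  proof (rule schwartz_bounded_support[of _ "real (Suc n)"])
    have "real_polynomial_function (\<lambda>x::real^'n. 1 - (s n)\<^sup>2 * (norm x)\<^sup>2)"
      by (intro real_polynomial_function_diff real_polynomial_function.intros(4) real_polynomial_function.intros(2) polynomial_norm_sq)
    then show "C_k k (\<lambda>x. \<eta> (s n *\<^sub>R x))" for k
      unfolding \<eta>_def norm_scaleR power_mult_distrib power2_abs by (intro C_k_mult C_k_const C_k_flat C_k_polynomial)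
  qed (rule zero)
  have e: "schwartz \<eta>" using es[of 0] by (simp add: s_def)
  define F where "F n x = \<eta> (s n *\<^sub>R x) * f x" for n x
  have Fs: "schwartz (F n)" for n unfolding F_def[abs_def] by (rule schwartz_mult[OF es f])
  have sc: "partial i (\<lambda>x. g (s n *\<^sub>R x)) = (\<lambda>x. s n * partial i g (s n *\<^sub>R x))" if "schwartz g" for g i n
    using partial_scale[of g "s n"] schwartz_differentiable[OF that] by auto
  have pm: "partial i (\<lambda>x. g (s n *\<^sub>R x) * h x) = (\<lambda>x. g (s n *\<^sub>R x) * partial i h x + s n * (partial i g (s n *\<^sub>R x) * h x))"
    if "schwartz g" "schwartz h" "\<And>x. (\<lambda>x. g (s n *\<^sub>R x)) differentiable (at x)" for g h i n
    using that by (auto simp: fun_eq_iff partial_mult[OF that(3) schwartz_differentiable[OF that(2)]] sc[OF that(1)])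
  have ds: "(\<lambda>x. g (s n *\<^sub>R x)) differentiable (at x)" if "schwartz g" for g :: "real^'n \<Rightarrow> real" and n x
    by (rule differentiable_compose[of g "\<lambda>x. s n *\<^sub>R x"]) (auto intro: schwartz_differentiable[OF that])
  have dF: "partial i (F n) = (\<lambda>x. \<eta> (s n *\<^sub>R x) * partial i f x + s n * (partial i \<eta> (s n *\<^sub>R x) * f x))" for i n
    unfolding F_def[abs_def] by (rule pm[OF e f ds[OF e]])
  have pe: "schwartz (partial i \<eta>)" and pf: "schwartz (partial i f)" for i by (intro schwartz_partial e f)+
  have lim1: "l2lim (\<lambda>n. partial i (F n)) (partial i f)" for i
    using l2lim_add[OF l2lim_cutoff[OF e sqi_schwartz[OF pf] s] l2lim_null[OF l2lim_cutoff[OF pe sqi_schwartz[OF f] s] s]]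
    unfolding dF by (simp add: eta0)
  have lim2: "l2lim (\<lambda>n x. norm x * partial i (F n) x) (\<lambda>x. norm x * partial i f x)" for i
    using l2lim_add[OF l2lim_cutoff[OF e schwartz_weighted(1)[OF pf[of i]] s] l2lim_null[OF l2lim_cutoff[OF pe[of i] schwartz_weighted(1)[OF f] s] s]]
    unfolding dF by (simp add: eta0 algebra_simps)
  have ddF: "partial i (partial i (F n)) = (\<lambda>x. (\<eta> (s n *\<^sub>R x) * partial i (partial i f) x + s n * (partial i \<eta> (s n *\<^sub>R x) * partial i f x))
      + (s n * (partial i \<eta> (s n *\<^sub>R x) * partial i f x) + (s n)\<^sup>2 * (partial i (partial i \<eta>) (s n *\<^sub>R x) * f x)))" for i n
  proof -
    have d1: "(\<lambda>x. \<eta> (s n *\<^sub>R x) * partial i f x) differentiable (at x)" for x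
      by (intro differentiable_mult ds e schwartz_differentiable pf)
    have d2: "(\<lambda>x. partial i \<eta> (s n *\<^sub>R x) * f x) differentiable (at x)" for x
      by (intro differentiable_mult ds pe schwartz_differentiable f)
    have d3: "(\<lambda>x. s n * (partial i \<eta> (s n *\<^sub>R x) * f x)) differentiable (at x)" for x
      by (intro differentiable_mult differentiable_const ds pe schwartz_differentiable f)
    show ?thesis unfolding dF
      by (rule ext) (simp only: partial_add[OF d1 d3] partial_cmult[OF d2] pm[OF e pf ds[OF e]] pm[OF pe f ds[OF pe]] distrib_left power2_eq_square mult.assoc)
  qed
  have "l2lim (\<lambda>n. partial i (partial i (F n))) (partial i (partial i f))" for i
    using l2lim_add[OF l2lim_add[OF l2lim_cutoff[OF e sqi_schwartz[OF schwartz_partial[OF pf[of i], of i]] s] l2lim_null[OF l2lim_cutoff[OF pe[of i] sqi_schwartz[OF pf[of i]] s] s]]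
      l2lim_add[OF l2lim_null[OF l2lim_cutoff[OF pe[of i] sqi_schwartz[OF pf[of i]] s] s] l2lim_null[OF l2lim_cutoff[OF schwartz_partial[OF pe[of i], of i] sqi_schwartz[OF f] s] s2]]]
    unfolding ddF by (simp add: eta0)
  then have lim3: "l2lim (\<lambda>n. laplacian (F n)) (laplacian f)"
    unfolding laplacian_def[abs_def] by (intro l2lim_sum) auto
  have g: "(\<lambda>n. gsq (F n)) \<longlonglongrightarrow> gip f f"
    unfolding gip_def n2_schwartz[symmetric] by (intro tendsto_sum l2lim_n2 lim1)
  have x: "(\<lambda>n. xip (F n) (F n)) \<longlonglongrightarrow> xip f f"
    unfolding xip_def schwartz_weighted(2)[OF schwartz_partial[OF Fs], symmetric] schwartz_weighted(2)[OF pf, symmetric]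
    by (intro tendsto_sum l2lim_n2 lim2)
  have L: "(\<lambda>n. isq (laplacian (F n))) \<longlonglongrightarrow> isq (laplacian f)"
    unfolding n2_schwartz[symmetric] by (rule l2lim_n2[OF lim3])
  have le: "2 * l * c * gsq (F n) \<le> qform l (F n) (F n)" for n
    by (rule sharp_bound_test_function[OF c l Fs, of "real (Suc n)"]) (simp add: F_def zero del: of_nat_Suc, simp add: F_def odd \<eta>_def)
  show ?thesis
  proof (rule LIMSEQ_le)
    show "(\<lambda>n. 2 * l * c * gsq (F n)) \<longlonglongrightarrow> 2 * l * c * gip f f" by (intro tendsto_intros g)
    show "(\<lambda>n. qform l (F n) (F n)) \<longlonglongrightarrow> qform l f f" unfolding qform_def by (intro tendsto_intros g x L)
    show "\<exists>N. \<forall>n\<ge>N. 2 * l * c * gsq (F n) \<le> qform l (F n) (F n)" using le by blast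
  qed
qed

text \<open>The truncated ground states of degree 1 nearly attain equality in the factorisation: A
  applied to them tends to 0, while their gradients converge to a nonzero limit. A coordinate
  function serves as the harmonic, so the truncations are odd.\<close>

lemma sharpness:
  assumes N: "CARD('n::finite) \<ge> 2" and c: "sharp_bound TYPE('n) c"
  shows "c \<le> D_const CARD('n) 1 / 2"
proof (cases "c \<ge> 0")
  case False then show ?thesis using D_facts(1)[OF N] by simp
next
  case True
  \<comment> \<open>With \<beta> = 1/2 the scale l = 2\<beta> is 1; any other width would do as
    well.\<close>
  have b: "(1/2::real) > 0" by simp
  let ?D = "D_const CARD('n) 1"
  interpret S: kummer_sector "(real 1 + (real CARD('n) + ?D / 2)) / 2" "real 1 + real CARD('n) / 2" "1/2" 1
    "real CARD('n) + ?D / 2" ?D "TYPE('n)"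
    by (rule kummer_sector_D[OF N b]) simp
  obtain i :: 'n where True by blast
  let ?h = "\<lambda>x::real^'n. x $ i"
  note h = solid_harmonic_component[of i]
  let ?c = "real CARD('n) + ?D / 2"
  have VK: "VK (1/2) 1 (S.thn n ?h)" for n by (rule S.thn_VK[OF h])
  have s: "schwartz (S.thn n ?h)" for n by (rule VK_schwartz[OF VK b])
  have G: "(\<lambda>n. gsq (S.thn n ?h)) \<longlonglongrightarrow> n2 (rgrad (S.Th ?h))"
    unfolding schwartz_sqi_rgrad(2)[OF s, symmetric]
    by (rule n2_tendsto[OF schwartz_sqi_rgrad(1)[OF s] S.Th_sqi[OF h] S.thn_Th_tendsto[OF h] tendsto_const])
  have le: "2 * c * gsq (S.thn n ?h) \<le> ?D * gsq (S.thn n ?h) + isq (op (2 * (1/2)) ?c (S.thn n ?h))" for n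
  proof -
    have "2 * 1 * c * gsq (S.thn n ?h) \<le> qform 1 (S.thn n ?h) (S.thn n ?h)"
      by (rule sharp_bound_schwartz[OF c True _ s]) (unfold S.thn_def, simp_all)
    also have "\<dots> = 2 * (?c - real CARD('n)) * 1 * gsq (S.thn n ?h) + isq (op 1 ?c (S.thn n ?h))"
      by (rule qform_sector[OF VK_sector[OF VK b]]) (use D_quadratic[OF N, of 1] in simp)
    finally show ?thesis by simp
  qed
  have "2 * c * n2 (rgrad (S.Th ?h)) \<le> ?D * n2 (rgrad (S.Th ?h)) + 0"
  proof (rule LIMSEQ_le)
    show "(\<lambda>n. 2 * c * gsq (S.thn n ?h)) \<longlonglongrightarrow> 2 * c * n2 (rgrad (S.Th ?h))" by (intro tendsto_intros G)
    show "(\<lambda>n. ?D * gsq (S.thn n ?h) + isq (op (2 * (1/2)) ?c (S.thn n ?h)))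
        \<longlonglongrightarrow> ?D * n2 (rgrad (S.Th ?h)) + 0"
      by (intro tendsto_intros G S.op_thn_tendsto[OF h])
  qed (use le in blast)
  moreover have "n2 (rgrad (S.Th ?h)) > 0" by (rule S.Th_gradient_nonzero[OF h, of "axis i 1"]) simp
  ultimately show ?thesis by simp
qed

theorem corollary1p8:
  fixes \<Phi> :: "real^'n::finite \<Rightarrow> real^'m::finite"
  assumes "CARD('n) \<ge> 2"
    and "spherical_harmonic_basis 2 \<Phi>"
  shows "(\<forall>u\<in>X_space. \<forall>U :: real^'n \<Rightarrow> complex^'n. X_gradient u U \<longrightarrow>
            delta_CF U \<ge> (INF P\<in>complex_params. remainder \<Phi> U P) \<and>
            (real_valued U \<longrightarrow>
               (INF P\<in>complex_params. remainder \<Phi> U P) = (INF P\<in>real_params. remainder \<Phi> U P) \<and>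
               delta_CF U \<ge> D_const CARD('n) 1 / 2 *
                 (INF V\<in>E_CF. (L2_norm (\<lambda>x. U x - V x))\<^sup>2))) \<and>
         (\<forall>c::real.
            (\<forall>u\<in>X_space. \<forall>U :: real^'n \<Rightarrow> complex^'n. X_gradient u U \<and> real_valued U \<longrightarrow>
               delta_CF U \<ge> c * (INF V\<in>E_CF. (L2_norm (\<lambda>x. U x - V x))\<^sup>2))
            \<longrightarrow> c \<le> D_const CARD('n) 1 / 2)"
proof (intro conjI ballI allI impI)
  fix u and U :: "real^'n \<Rightarrow> complex^'n"
  assume u: "u \<in> X_space" and U: "X_gradient u U"
  note d = deficit_inequality[OF assms u U]
  show "delta_CF U \<ge> (INF P\<in>complex_params. remainder \<Phi> U P)" by (rule d(1))
  assume "real_valued U"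
  note e = INF_real_params[OF assms d(2) this]
  show "(INF P\<in>complex_params. remainder \<Phi> U P) = (INF P\<in>real_params. remainder \<Phi> U P)" by (rule e)
  show "delta_CF U \<ge> D_const CARD('n) 1 / 2 * (INF V\<in>E_CF. (L2_norm (\<lambda>x. U x - V x))\<^sup>2)"
    using E_CF_inequality[OF assms, of U] d(1) unfolding e by simp
next
  fix c :: real
  assume "\<forall>u\<in>X_space. \<forall>U :: real^'n \<Rightarrow> complex^'n. X_gradient u U \<and> real_valued U \<longrightarrow>
      delta_CF U \<ge> c * (INF V\<in>E_CF. (L2_norm (\<lambda>x. U x - V x))\<^sup>2)"
  then show "c \<le> D_const CARD('n) 1 / 2"
    by (intro sharpness[OF assms(1)]) (simp add: sharp_bound_def)
qed

end
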